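(* Let $W$ be a finite Coxeter group and let $w \in W$. Let $V$ be the smallest parabolic subgroup of $W$ that contains $w$. Then the following hold. (i) The centralizer $C_V(w) = C_W(w) \cap V$ is a normal subgroup of the centralizer $C_W(w)$, and the quotient $C_W(w)/C_V(w)$ is isomorphic to $N_W(V)/V$. (ii) The centralizer $C_W(w)$ splits over $C_V(w)$ with complement isomorphic to $N_W(V)/V$, unless $w$ lies in a non-compliant conjugacy class of elements of $W$.
   Context: $W$ is a finite Coxeter group with set of simple reflections $S$. For $M \subseteq S$ the standard parabolic subgroup is $W_M = \langle M \rangle$; a parabolic subgroup of $W$ is a conjugate of a standard parabolic subgroup. Intersections of parabolic subgroups are parabolic, so $V$ is well defined as the intersection of all parabolic subgroups of $W$ containing $w$. $C_W$ and $N_W$ denote centralizer and normalizer in $W$. A group $G$ splits over a normal subgroup $H$ with complement $K$ if $K \le G$, $G = HK$ and $H \cap K = 1$. Type $D_n$ and cycle types: the Coxeter group $W(D_n)$ is identified with the group of permutations $w$ of $\{-n,\dots,-1,0,1,\dots,n\}$ satisfying $w(-i) = -w(i)$ and having an even number of $i>0$ with $w(i)<0$; its Coxeter generators are $u=(1,-2)$ and $s_i=(i,i+1)$ for $1\le i\le n-1$ (regarded as signed permutations, i.e. $w(1)=-2$, $w(2)=-1$ for $u$, etc.). On nonzero points, the cycles of such $w$ are of two kinds: pairs $(i_1,\dots,i_k)(-i_1,\dots,-i_k)$ of disjoint cycles, each pair being called a positive cycle of length $k$, and cycles $(i_1,\dots,i_k,-i_1,\dots,-i_k)$, called negative cycles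 of length $k$. The cycle type of $w$ is the double partition $\lambda=(\lambda^+,\lambda^-)$ of $n$ (i.e. $|\lambda^+|+|\lambda^-|=n$), where $\lambda^+$ has a part $l$ for each positive cycle of length $l$ and $\lambda^-$ has a part $l$ for each negative cycle of length $l$. A partition is even if all its parts are even. Non-compliant: A double partition $\lambda = (\lambda^+,\lambda^-)$ is non-compliant if $\lambda^+$ consists of a single odd part and $\lambda^-$ is a nonempty even partition with an even number of parts. A conjugacy class $C$ of a finite Coxeter group $W$ is non-compliant if, for some odd $n>4$, there are a non-compliant double partition $\lambda$ of $n$ and a (standard) parabolic subgroup $W_M$ of $W$ having an irreducible component $W_K$ of type $D_n$, such that $C$ contains an element of $W_M$ whose projection onto the direct factor $W_K \cong W(D_n)$ has cycle type $\lambda$. *)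

theory Defs
  imports "HOL-Algebra.Algebra" "HOL-Combinatorics.Combinatorics" "HOL-Library.Multiset"
begin

section \<open>Coxeter systems\<close>

text \<open>One application of a defining relation: two words over \<open>S\<close> are related if the second
  arises from the first by deleting a factor \<open>(st)^m\<close>, where \<open>m\<close> is the order of \<open>st\<close> in \<open>W\<close>.
  The case \<open>s = t\<close> deletes a factor \<open>ss\<close>, so that formal inverses of generators are not needed.
  An element of infinite order has \<open>ord = 0\<close> and imposes no relation.\<close>

definition coxeter_step :: "('a, 'b) monoid_scheme \<Rightarrow> 'a set \<Rightarrow> ('a list \<times> 'a list) set" where
  "coxeter_step W S =
    {(xs @ concat (replicate (group.ord W (s \<otimes>\<^bsub>W\<^esub> t)) [s, t]) @ ys, xs @ ys) | xs ys s t.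
      xs \<in> lists S \<and> ys \<in> lists S \<and> s \<in> S \<and> t \<in> S}"

text \<open>\<open>W\<close> is generated by the set \<open>S\<close> of elements of order 2 and has the presentation with
  generators \<open>S\<close> and relations \<open>(st)^m = 1\<close>: each word over \<open>S\<close> with value \<open>1\<close> in \<open>W\<close> can be
  transformed into the empty word by means of the defining relations.\<close>

definition coxeter_system :: "('a, 'b) monoid_scheme \<Rightarrow> 'a set \<Rightarrow> bool" where
  "coxeter_system W S \<longleftrightarrow>
    group W \<and> S \<subseteq> carrier W \<and> generate W S = carrier W \<and>
    (\<forall>s\<in>S. group.ord W s = 2) \<and>
    (\<forall>xs\<in>lists S. foldr (\<otimes>\<^bsub>W\<^esub>) xs \<one>\<^bsub>W\<^esub> = \<one>\<^bsub>W\<^esub> \<longrightarrow>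
       (xs, []) \<in> (coxeter_step W S \<union> (coxeter_step W S)\<inverse>)\<^sup>*)"

definition parabolic :: "('a, 'b) monoid_scheme \<Rightarrow> 'a set \<Rightarrow> 'a set \<Rightarrow> bool" where
  "parabolic W S P \<longleftrightarrow>
    (\<exists>M g. M \<subseteq> S \<and> g \<in> carrier W \<and>
      P = g <#\<^bsub>W\<^esub> generate W M #>\<^bsub>W\<^esub> inv\<^bsub>W\<^esub> g)"

definition parabolic_closure :: "('a, 'b) monoid_scheme \<Rightarrow> 'a set \<Rightarrow> 'a \<Rightarrow> 'a set" where
  "parabolic_closure W S w = \<Inter>{P. parabolic W S P \<and> w \<in> P}"

text \<open>The edges of the Coxeter graph on \<open>M\<close>.\<close>

definition coxeter_edges :: "('a, 'b) monoid_scheme \<Rightarrow> 'a set \<Rightarrow> ('a \<times> 'a) set" where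
  "coxeter_edges W M = {(s, t). s \<in> M \<and> t \<in> M \<and> s \<noteq> t \<and> group.ord W (s \<otimes>\<^bsub>W\<^esub> t) \<noteq> 2}"

text \<open>\<open>generate W K\<close> is an irreducible component of \<open>generate W M\<close>, that is, \<open>K\<close> is (the vertex
  set of) a connected component of the Coxeter graph on \<open>M\<close>.\<close>

definition irreducible_component ::
    "('a, 'b) monoid_scheme \<Rightarrow> 'a set \<Rightarrow> 'a set \<Rightarrow> bool" where
  "irreducible_component W M K \<longleftrightarrow> (\<exists>s\<in>M. K = (coxeter_edges W M)\<^sup>* `` {s})"


section \<open>Centralizers, conjugacy classes and complements\<close>

definition centralizer :: "('a, 'b) monoid_scheme \<Rightarrow> 'a \<Rightarrow> 'a set" where
  "centralizer G x = {g \<in> carrier G. g \<otimes>\<^bsub>G\<^esub> x = x \<otimes>\<^bsub>G\<^esub> g}"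

definition conjugacy_class :: "('a, 'b) monoid_scheme \<Rightarrow> 'a \<Rightarrow> 'a set" where
  "conjugacy_class G x = {g \<otimes>\<^bsub>G\<^esub> x \<otimes>\<^bsub>G\<^esub> inv\<^bsub>G\<^esub> g | g. g \<in> carrier G}"

definition splits_over_with_complement ::
    "('a, 'b) monoid_scheme \<Rightarrow> 'a set \<Rightarrow> 'a set \<Rightarrow> bool" where
  "splits_over_with_complement G H K \<longleftrightarrow>
    H \<lhd> G \<and> subgroup K G \<and> carrier G = H <#>\<^bsub>G\<^esub> K \<and> H \<inter> K = {\<one>\<^bsub>G\<^esub>}"


section \<open>The Coxeter group of type \<open>D\<close> as a group of signed permutations\<close>

definition D_group :: "nat \<Rightarrow> (int \<Rightarrow> int) monoid" where
  "D_group n =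
    \<lparr>carrier = {w. w permutes {- int n..int n} \<and> (\<forall>i\<in>{- int n..int n}. w (- i) = - w i) \<and>
                   even (card {i \<in> {1..int n}. w i < 0})},
     monoid.mult = (\<circ>), one = id\<rparr>"

text \<open>The generators \<open>u = (1, -2)(-1, 2)\<close> and \<open>s\<^sub>i = (i, i + 1)(-i, -(i + 1))\<close>.\<close>

definition D_generators :: "nat \<Rightarrow> (int \<Rightarrow> int) set" where
  "D_generators n =
    insert (transpose 1 (- 2) \<circ> transpose (- 1) 2)
      {transpose i (i + 1) \<circ> transpose (- i) (- (i + 1)) | i. 1 \<le> i \<and> i \<le> int n - 1}"

text \<open>Isomorphisms of Coxeter systems from \<open>(generate W K, K)\<close> to \<open>W(D_n)\<close>. They exist if and only
  if \<open>K\<close> is of type \<open>D_n\<close>.\<close>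

definition type_D_isos ::
    "('a, 'b) monoid_scheme \<Rightarrow> 'a set \<Rightarrow> nat \<Rightarrow> ('a \<Rightarrow> int \<Rightarrow> int) set" where
  "type_D_isos W K n =
    {\<phi> \<in> iso (W\<lparr>carrier := generate W K\<rparr>) (D_group n). \<phi> ` K = D_generators n}"

text \<open>Cycles of a signed permutation are represented by their supports, i.e. orbits on the nonzero
  points. A positive cycle is an unordered pair \<open>{C, -C}\<close> with \<open>C \<noteq> -C\<close> (hence disjoint), and a
  negative cycle is an orbit \<open>C = -C\<close>; in both cases the length is half the size of
  \<open>C \<union> -C\<close>. Fixed points give positive cycles of length 1.\<close>

definition signed_orbits :: "nat \<Rightarrow> (int \<Rightarrow> int) \<Rightarrow> int set set" where
  "signed_orbits n w = Orbits.orbit w ` ({- int n..int n} - {0})"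

definition positive_cycles :: "nat \<Rightarrow> (int \<Rightarrow> int) \<Rightarrow> int set set set" where
  "positive_cycles n w = {{C, uminus ` C} | C. C \<in> signed_orbits n w \<and> uminus ` C \<noteq> C}"

definition negative_cycles :: "nat \<Rightarrow> (int \<Rightarrow> int) \<Rightarrow> int set set" where
  "negative_cycles n w = {C \<in> signed_orbits n w. uminus ` C = C}"

definition cycle_type :: "nat \<Rightarrow> (int \<Rightarrow> int) \<Rightarrow> nat multiset \<times> nat multiset" where
  "cycle_type n w =
    (image_mset (\<lambda>P. card (\<Union>P) div 2) (mset_set (positive_cycles n w)),
     image_mset (\<lambda>C. card C div 2) (mset_set (negative_cycles n w)))"


section \<open>Non-compliant classes\<close>

definition double_partition :: "nat \<Rightarrow> nat multiset \<times> nat multiset \<Rightarrow> bool" where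
  "double_partition n \<mu> \<longleftrightarrow>
    0 \<notin># fst \<mu> \<and> 0 \<notin># snd \<mu> \<and> sum_mset (fst \<mu>) + sum_mset (snd \<mu>) = n"

definition noncompliant_double_partition :: "nat multiset \<times> nat multiset \<Rightarrow> bool" where
  "noncompliant_double_partition \<mu> \<longleftrightarrow>
    (\<exists>l. odd l \<and> fst \<mu> = {#l#}) \<and>
    snd \<mu> \<noteq> {#} \<and> (\<forall>l\<in>#snd \<mu>. even l) \<and> even (size (snd \<mu>))"

text \<open>Since \<open>generate W M\<close> is the direct product of \<open>generate W K\<close> and \<open>generate W (M - K)\<close>, the
  element \<open>a\<close> is the projection of \<open>x = ab\<close> onto the component \<open>generate W K\<close>. The cycle type
  does not depend on the choice of \<open>\<phi>\<close>: for \<open>n > 4\<close> two choices differ at most by the interchange of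
  \<open>u\<close> and \<open>s\<^sub>1\<close>, which is conjugation by the sign change \<open>(1, -1)\<close>.\<close>

definition noncompliant_class ::
    "('a, 'b) monoid_scheme \<Rightarrow> 'a set \<Rightarrow> 'a set \<Rightarrow> bool" where
  "noncompliant_class W S C \<longleftrightarrow>
    (\<exists>z\<in>carrier W. C = conjugacy_class W z) \<and>
    (\<exists>n \<mu> M K \<phi> x a b.
      odd n \<and> n > 4 \<and> double_partition n \<mu> \<and> noncompliant_double_partition \<mu> \<and>
      M \<subseteq> S \<and> irreducible_component W M K \<and> \<phi> \<in> type_D_isos W K n \<and>
      x \<in> C \<and> x \<in> generate W M \<and>
      a \<in> generate W K \<and> b \<in> generate W (M - K) \<and> x = a \<otimes>\<^bsub>W\<^esub> b \<and>
      cycle_type n (\<phi> a) = \<mu>)"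

end

theory Submission
  imports Defs "HOL-Library.Function_Algebras" Complex_Main
begin

text \<open>
  Up to conjugation, \<open>V\<close> is a standard parabolic subgroup \<open>W\<^sub>J\<close>, and \<open>w\<close> is cuspidal in it, i.e. has no
  nonzero fixed vector in the span of the simple roots in \<open>J\<close>. Minimality of \<open>V\<close> gives
  \<open>C\<^sub>W(w) \<le> N\<^sub>W(V)\<close>, and \<open>N\<^sub>W(W\<^sub>J)\<close> is the semidirect product of \<open>W\<^sub>J\<close> and the group \<open>N\<^sub>J\<close> of elements
  that permute the simple roots in \<open>J\<close>. So (i) says that every \<open>x \<in> N\<^sub>J\<close> can be multiplied by an
  element of \<open>W\<^sub>J\<close> so as to commute with \<open>w\<close>, and (ii) that these corrections can be chosen
  multiplicatively. Both questions reduce to the components \<open>K\<close> of \<open>J\<close>, which \<open>N\<^sub>J\<close> permutes.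

  On components of type A, \<open>w\<close> is conjugate to a Coxeter element; all other components are stable under
  \<open>N\<^sub>J\<close>. An element that stabilizes \<open>K\<close> acts on it trivially or like the longest element of \<open>W\<^sub>K\<close>,
  except possibly for \<open>K\<close> of type \<open>D\<^sub>n\<close> with \<open>n\<close> even. There, a decomposition of \<open>x\<close> into elementary moves
  \<open>w\<^sub>0(M) w\<^sub>0(J)\<close> with \<open>M = J \<union> {s}\<close> shows that a nontrivial action arises only if the component of \<open>M\<close>
  that contains \<open>K\<close> has type \<open>D\<close> of odd rank, and that it is then a sign change in the model by signed
  permutations. It is corrected by the restriction of \<open>w\<close> to a negative cycle. If \<open>w\<close> has a negative
  cycle of odd length on \<open>K\<close>, then \<open>-1\<close> on that cycle is an involutory correction, which gives (ii)
  (with a separate argument for \<open>D\<^sub>4\<close>, where the automorphism group is larger); otherwise the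
  elementary move exhibits the class of \<open>w\<close> as non-compliant.
\<close>

text \<open>Finiteness enters through an averaged inner product: it makes the canonical form
  positive definite, so the null vectors of affine diagrams become obstructions. They show that a
  connected diagram has at most one branch point or edge of order at least 4. Conjugate simple
  reflections are joined by edges of odd order, so a component of \<open>J\<close> and its image
  under \<open>ncomp J\<close> lie in one component of the whole diagram; outside type A they must
  then meet, hence coincide.

  The obstacle is type D of even rank: there \<open>w0\<close> acts as -1 and induces no diagram
  symmetry, while an element outside may act as the sign change at 1, which is in W(B_n) but not in
  W(D_n). A correction has to commute with the given signed permutation and to contain an odd number
  of sign changes. For (ii) it should also be an involution that the outside elements centralize,
  and a cycle restricted to its support has too large an order for that.

  Where components are permuted, corrections chosen on the stabilizer of one component per orbit are
  spread over the orbit as in an induced representation.\<close>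

instantiation "fun" :: (type, real_vector) real_vector
begin

definition scaleR_fun_def: "r *\<^sub>R f = (\<lambda>x. r *\<^sub>R f x)"

instance
  by standard (auto simp: scaleR_fun_def plus_fun_def fun_eq_iff algebra_simps)

end

lemma scaleR_fun_apply: "(r *\<^sub>R f) x = r *\<^sub>R f x"
  by (simp add: scaleR_fun_def)

text \<open>Induction eta-expands function-valued terms; the pointwise rules would then break up vectors.\<close>

lemmas vec_apply = plus_fun_apply zero_fun_apply minus_apply uminus_apply scaleR_fun_apply

declare plus_fun_apply [simp del] zero_fun_apply [simp del] minus_apply [simp del] uminus_apply [simp del]

lemma sum_fun_apply: "(\<Sum>i\<in>A. f i) x = (\<Sum>i\<in>A. f i x)"
  by (induction A rule: infinite_finite_induct) (auto simp: vec_apply)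

definition unit_vec :: "'a \<Rightarrow> 'a \<Rightarrow> real" ("\<alpha>") where
  "\<alpha> s = (\<lambda>t. if t = s then 1 else 0)"

lemma unit_vec_same [simp]: "\<alpha> s s = 1"
  and unit_vec_other [simp]: "t \<noteq> s \<Longrightarrow> \<alpha> s t = 0"
  by (auto simp: unit_vec_def)

lemma unit_vec_inj [simp]: "\<alpha> s = \<alpha> t \<longleftrightarrow> s = t"
  by (metis unit_vec_same unit_vec_other zero_neq_one)

lemma unit_vec_nonneg: "\<alpha> s t \<ge> 0"
  by (simp add: unit_vec_def)

lemma unit_vec_neq_0 [simp]: "\<alpha> s \<noteq> 0"
  by (metis unit_vec_same zero_fun_apply zero_neq_one)

abbreviation (in group) (input) cj :: "'a \<Rightarrow> 'a \<Rightarrow> 'a" where "cj x u \<equiv> x \<otimes> u \<otimes> inv x"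

section \<open>The geometric representation of a finite Coxeter group\<close>

locale finite_coxeter = group W for W :: "('a, 'b) monoid_scheme" (structure) +
  fixes S :: "'a set"
  assumes coxeter_system: "coxeter_system W S"
    and finite_carrier: "finite (carrier W)"
begin

definition m :: "'a \<Rightarrow> 'a \<Rightarrow> nat" where "m s t = ord (s \<otimes> t)"

definition bform :: "('a \<Rightarrow> real) \<Rightarrow> ('a \<Rightarrow> real) \<Rightarrow> real" where
  "bform x y = (\<Sum>s\<in>S. \<Sum>t\<in>S. x s * y t * (- cos (pi / real (m s t))))"

definition reflect :: "'a \<Rightarrow> ('a \<Rightarrow> real) \<Rightarrow> 'a \<Rightarrow> real" where
  "reflect s x = x - (2 * bform x (\<alpha> s)) *\<^sub>R \<alpha> s"

definition word :: "'a list \<Rightarrow> 'a" where "word xs = foldr (\<otimes>) xs \<one>"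

definition reflects :: "'a list \<Rightarrow> ('a \<Rightarrow> real) \<Rightarrow> 'a \<Rightarrow> real" where "reflects xs = foldr reflect xs"

text \<open>The word is an arbitrary choice; \<open>reflects_cong\<close> shows that the product of
  reflections depends on the value of the word only.\<close>

definition act :: "'a \<Rightarrow> ('a \<Rightarrow> real) \<Rightarrow> 'a \<Rightarrow> real" where
  "act w = reflects (SOME xs. xs \<in> lists S \<and> word xs = w)"

definition len :: "'a \<Rightarrow> nat" where
  "len w = (LEAST n. \<exists>xs\<in>lists S. word xs = w \<and> length xs = n)"

lemma S_carrier [simp]: "s \<in> S \<Longrightarrow> s \<in> carrier W"
  and S_subset: "S \<subseteq> carrier W"
  and generate_S: "generate W S = carrier W"
  and ord_S: "s \<in> S \<Longrightarrow> ord s = 2"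
  and coxeter_relations: "xs \<in> lists S \<Longrightarrow> word xs = \<one> \<Longrightarrow>
    (xs, []) \<in> (coxeter_step W S \<union> (coxeter_step W S)\<inverse>)\<^sup>*"
  using coxeter_system by (auto simp: coxeter_system_def word_def)

lemma finite_S [simp]: "finite S"
  using finite_carrier S_subset finite_subset by blast

lemma finite_sub_S: "J \<subseteq> S \<Longrightarrow> finite J"
  using finite_S finite_subset by blast

lemma S_square [simp]: "s \<in> S \<Longrightarrow> s \<otimes> s = \<one>"
  using pow_ord_eq_1[of s] ord_S[of s] by (simp add: numeral_2_eq_2)

lemma S_square' [simp]: "s \<in> S \<Longrightarrow> x \<in> carrier W \<Longrightarrow> s \<otimes> (s \<otimes> x) = x"
  by (metis S_carrier S_square m_assoc l_one)

lemma S_inv [simp]: "s \<in> S \<Longrightarrow> inv s = s"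
  by (simp add: inv_equality)

lemma m_sym: "s \<in> S \<Longrightarrow> t \<in> S \<Longrightarrow> m s t = m t s"
proof -
  assume s: "s \<in> S" and t: "t \<in> S"
  have "t \<otimes> s = inv (s \<otimes> t)" using s t by (simp add: inv_mult_group)
  then show ?thesis using s t by (simp add: m_def ord_inv)
qed

lemma m_same [simp]: "s \<in> S \<Longrightarrow> m s s = 1"
  by (simp add: m_def)

lemma m_pos: "s \<in> S \<Longrightarrow> t \<in> S \<Longrightarrow> m s t > 0"
  unfolding m_def using ord_ge_1[OF finite_carrier, of "s \<otimes> t"] by simp

lemma m_eq_1: "s \<in> S \<Longrightarrow> t \<in> S \<Longrightarrow> m s t = 1 \<longleftrightarrow> s = t"
proof -
  assume s: "s \<in> S" and t: "t \<in> S"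
  have "m s t = 1 \<longleftrightarrow> s \<otimes> t = \<one>" using s t ord_eq_1[of "s \<otimes> t"] by (auto simp: m_def)
  also have "\<dots> \<longleftrightarrow> s = t" using s t by (metis S_carrier S_inv inv_equality S_square)
  finally show ?thesis .
qed

lemma m_ge_2: "s \<in> S \<Longrightarrow> t \<in> S \<Longrightarrow> s \<noteq> t \<Longrightarrow> m s t \<ge> 2"
  using m_pos[of s t] m_eq_1[of s t] by linarith

lemma word_simps [simp]: "word [] = \<one>" "word (x # xs) = x \<otimes> word xs"
  by (auto simp: word_def)

lemma word_carrier [simp]: "xs \<in> lists S \<Longrightarrow> word xs \<in> carrier W"
  by (induction xs) auto

lemma word_append: "xs \<in> lists S \<Longrightarrow> ys \<in> lists S \<Longrightarrow> word (xs @ ys) = word xs \<otimes> word ys"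
  by (induction xs) (auto simp: m_assoc)

lemma word_rev: "xs \<in> lists S \<Longrightarrow> word (rev xs) = inv (word xs)"
  by (induction xs) (auto simp: word_append inv_mult_group in_lists_conv_set)

declare in_lists_conv_set [simp del]

lemma generate_iff_word:
  assumes "J \<subseteq> S"
  shows "w \<in> generate W J \<longleftrightarrow> (\<exists>xs\<in>lists J. word xs = w)"
proof
  assume "w \<in> generate W J"
  then show "\<exists>xs\<in>lists J. word xs = w"
  proof induction
    case one then show ?case by (intro bexI[of _ "[]"]) auto
  next
    case (incl h) then show ?case using assms by (intro bexI[of _ "[h]"]) auto
  next
    case (inv h) then show ?case using assms by (intro bexI[of _ "[h]"]) auto
  next
    case (eng h1 h2)
    then obtain xs ys where "xs \<in> lists J" "word xs = h1" "ys \<in> lists J" "word ys = h2" by blast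
    then show ?case using assms lists_mono[OF assms]
      by (intro bexI[of _ "xs @ ys"]) (auto simp: word_append subset_iff)
  qed
next
  assume "\<exists>xs\<in>lists J. word xs = w"
  then obtain xs where "xs \<in> lists J" "word xs = w" by blast
  then show "w \<in> generate W J"
  proof (induction xs arbitrary: w)
    case Nil then show ?case by (auto intro: generate.one)
  next
    case (Cons x xs) then show ?case by (auto intro: generate.eng generate.incl)
  qed
qed

lemma carrier_word: "w \<in> carrier W \<Longrightarrow> \<exists>xs\<in>lists S. word xs = w"
  using generate_iff_word[of S] generate_S by auto

subsection \<open>The form and the reflections\<close>

lemma bform_add_left: "bform (x + y) z = bform x z + bform y z"
  and bform_scale_left: "bform (c *\<^sub>R x) z = c * bform x z"
proof -
  show "bform (x + y) z = bform x z + bform y z"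
    unfolding bform_def sum.distrib[symmetric] by (intro sum.cong refl) (simp add: vec_apply algebra_simps)
  show "bform (c *\<^sub>R x) z = c * bform x z"
    unfolding bform_def sum_distrib_left by (intro sum.cong refl) (simp add: vec_apply)
qed

lemma bform_sym: "bform x y = bform y x"
proof -
  have "bform x y = (\<Sum>t\<in>S. \<Sum>s\<in>S. x s * y t * (- cos (pi / real (m s t))))"
    unfolding bform_def by (rule sum.swap)
  also have "\<dots> = bform y x"
    unfolding bform_def by (intro sum.cong refl) (simp add: m_sym mult_ac)
  finally show ?thesis .
qed

lemma bform_add_right: "bform z (x + y) = bform z x + bform z y"
  and bform_scale_right: "bform z (c *\<^sub>R x) = c * bform z x"
  using bform_sym bform_add_left bform_scale_left by metis+

lemma bform_zero [simp]: "bform 0 x = 0" "bform x 0 = 0"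
  using bform_scale_left[of 0 0 x] bform_scale_right[of x 0 0] by simp_all

lemma bform_minus_left: "bform (- x) z = - bform x z"
  and bform_minus_right: "bform z (- x) = - bform z x"
  using bform_scale_left[of "-1" x z] bform_scale_right[of z "-1" x] by simp_all

lemma bform_diff_left: "bform (x - y) z = bform x z - bform y z"
  and bform_diff_right: "bform z (x - y) = bform z x - bform z y"
  using bform_add_left[of x "-y" z] bform_add_right[of z x "-y"]
  by (simp_all add: bform_minus_left bform_minus_right)

lemmas bform_simps = bform_add_left bform_add_right bform_scale_left bform_scale_right
  bform_minus_left bform_minus_right bform_diff_left bform_diff_right

lemma bform_sum_left: "bform (\<Sum>i\<in>A. f i) z = (\<Sum>i\<in>A. bform (f i) z)"
  using linear_sum[OF linearI[of "\<lambda>x. bform x z"], OF bform_add_left] by (simp add: bform_scale_left)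

lemma bform_sum_right: "bform z (\<Sum>i\<in>A. f i) = (\<Sum>i\<in>A. bform z (f i))"
  using bform_sum_left bform_sym by (metis (no_types, lifting) sum.cong)

lemma bform_unit_right: "t \<in> S \<Longrightarrow> bform x (\<alpha> t) = (\<Sum>s\<in>S. x s * (- cos (pi / real (m s t))))"
proof -
  assume "t \<in> S"
  moreover have "(\<Sum>u\<in>S. x s * \<alpha> t u * (- cos (pi / real (m s u)))) =
      (\<Sum>u\<in>S. if u = t then x s * (- cos (pi / real (m s t))) else 0)" for s
    by (intro sum.cong) (auto simp: unit_vec_def)
  ultimately show ?thesis by (simp add: bform_def)
qed

lemma bform_unit: "s \<in> S \<Longrightarrow> t \<in> S \<Longrightarrow> bform (\<alpha> s) (\<alpha> t) = - cos (pi / real (m s t))"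
proof -
  assume "s \<in> S" "t \<in> S"
  moreover have "(\<Sum>u\<in>S. \<alpha> s u * (- cos (pi / real (m u t)))) =
      (\<Sum>u\<in>S. if u = s then - cos (pi / real (m s t)) else 0)"
    by (intro sum.cong) (auto simp: unit_vec_def)
  ultimately show ?thesis by (simp add: bform_unit_right)
qed

lemma bform_unit_same [simp]: "s \<in> S \<Longrightarrow> bform (\<alpha> s) (\<alpha> s) = 1"
  by (simp add: bform_unit)

lemma reflect_add: "reflect s (x + y) = reflect s x + reflect s y"
  and reflect_scale: "reflect s (c *\<^sub>R x) = c *\<^sub>R reflect s x"
  by (simp_all add: reflect_def bform_simps algebra_simps)

lemma reflect_reflect [simp]: "s \<in> S \<Longrightarrow> reflect s (reflect s x) = x"
  by (simp add: reflect_def bform_simps fun_eq_iff vec_apply)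

lemma bform_reflect: "s \<in> S \<Longrightarrow> bform (reflect s x) (reflect s y) = bform x y"
  using bform_sym[of "\<alpha> s" y] by (simp add: reflect_def bform_simps algebra_simps)

lemma reflects_simps [simp]: "reflects [] x = x" "reflects (s # xs) x = reflect s (reflects xs x)"
  by (auto simp: reflects_def)

lemma reflects_append [simp]: "reflects (xs @ ys) x = reflects xs (reflects ys x)"
  by (simp add: reflects_def)

lemma reflects_linear: "reflects xs (x + y) = reflects xs x + reflects xs y" "reflects xs (c *\<^sub>R x) = c *\<^sub>R reflects xs x"
  by (induction xs) (auto simp: reflect_add reflect_scale)

text \<open>The plane spanned by \<open>\<alpha> s\<close> and \<open>\<alpha> t\<close> is rotated by \<open>reflect s \<circ> reflect t\<close>; \<open>\<phi>\<close> plays the role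
  of an angle.\<close>

lemma reflect_dihedral:
  assumes "s \<in> S" "t \<in> S" "s \<noteq> t"
  defines "\<theta> \<equiv> pi / real (m s t)"
  shows "reflect t (sin (\<phi> + \<theta>) *\<^sub>R \<alpha> s + sin \<phi> *\<^sub>R \<alpha> t)
         = sin (\<phi> + \<theta>) *\<^sub>R \<alpha> s + sin (\<phi> + 2 * \<theta>) *\<^sub>R \<alpha> t"
proof -
  have c: "bform (\<alpha> s) (\<alpha> t) = - cos \<theta>" using assms by (simp add: bform_unit)
  have "sin (\<phi> + 2 * \<theta>) + sin \<phi> = 2 * cos \<theta> * sin (\<phi> + \<theta>)"
    using sin_plus_sin[of "\<phi> + 2 * \<theta>" \<phi>] by (simp add: algebra_simps add_divide_distrib)
  then have e: "sin (\<phi> + 2 * \<theta>) = 2 * cos \<theta> * sin (\<phi> + \<theta>) - sin \<phi>" by simp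
  show ?thesis
    unfolding reflect_def e using assms(2) c
    by (simp add: bform_simps fun_eq_iff vec_apply algebra_simps)
qed

lemma reflects_dihedral_power:
  assumes "s \<in> S" "t \<in> S" "s \<noteq> t"
  defines "\<theta> \<equiv> pi / real (m s t)"
  shows "reflects (concat (replicate k [s, t])) (sin (\<phi> + \<theta>) *\<^sub>R \<alpha> s + sin \<phi> *\<^sub>R \<alpha> t)
         = sin (\<phi> + \<theta> + 2 * k * \<theta>) *\<^sub>R \<alpha> s + sin (\<phi> + 2 * k * \<theta>) *\<^sub>R \<alpha> t"
proof (induction k)
  case (Suc k)
  have th: "pi / real (m t s) = \<theta>" using m_sym assms by simp
  let ?\<psi> = "\<phi> + 2 * k * \<theta>"
  have "reflects (concat (replicate (Suc k) [s, t])) (sin (\<phi> + \<theta>) *\<^sub>R \<alpha> s + sin \<phi> *\<^sub>R \<alpha> t)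
     = reflect s (reflect t (sin (?\<psi> + \<theta>) *\<^sub>R \<alpha> s + sin ?\<psi> *\<^sub>R \<alpha> t))"
    using Suc by (simp add: add_ac)
  also have "\<dots> = reflect s (sin (?\<psi> + 2 * \<theta>) *\<^sub>R \<alpha> t + sin (?\<psi> + \<theta>) *\<^sub>R \<alpha> s)"
    using reflect_dihedral[OF assms(1-3), of ?\<psi>] by (simp add: \<theta>_def add_ac)
  also have "\<dots> = sin (?\<psi> + 2 * \<theta>) *\<^sub>R \<alpha> t + sin (?\<psi> + 3 * \<theta>) *\<^sub>R \<alpha> s"
    using reflect_dihedral[OF assms(2,1), of "?\<psi> + \<theta>"] assms(3) th by (simp add: algebra_simps)
  finally show ?case by (simp add: algebra_simps)
qed auto

lemma sin_m_pos:
  assumes "s \<in> S" "t \<in> S" "s \<noteq> t" "0 < k" "k < m s t"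
  shows "sin (real k * (pi / real (m s t))) > 0"
proof (rule sin_gt_zero)
  show "0 < real k * (pi / real (m s t))" using assms m_pos by simp
  have "real k * pi < real (m s t) * pi" using assms by simp
  then show "real k * (pi / real (m s t)) < pi" using m_pos[OF assms(1,2)] by (simp add: field_simps)
qed

text \<open>The form is nondegenerate on the plane of \<open>\<alpha> s\<close> and
  \<open>\<alpha> t\<close>: with \<open>c = - cos (pi / m)\<close> its Gram determinant is
  \<open>1 - c^2 = sin^2 (pi / m)\<close>, which is positive because \<open>m\<close> is at least 2.
  The witnesses come from Cramer's rule.\<close>

lemma orthogonal_decomposition:
  assumes "s \<in> S" "t \<in> S" "s \<noteq> t"
  shows "\<exists>a b. bform (x - a *\<^sub>R \<alpha> s - b *\<^sub>R \<alpha> t) (\<alpha> s) = 0 \<and> bform (x - a *\<^sub>R \<alpha> s - b *\<^sub>R \<alpha> t) (\<alpha> t) = 0"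
proof -
  define c where "c = bform (\<alpha> s) (\<alpha> t)"
  define p q where "p = bform x (\<alpha> s)" and "q = bform x (\<alpha> t)"
  have "sin (1 * (pi / real (m s t))) > 0"
    using sin_m_pos[of s t 1] assms m_ge_2[of s t] by simp
  then have "c\<^sup>2 < 1"
    using assms sin_squared_eq[of "pi / real (m s t)"] by (simp add: c_def bform_unit)
      (smt (verit) zero_less_power)
  then have d: "1 - c\<^sup>2 \<noteq> 0" by simp
  have c': "bform (\<alpha> t) (\<alpha> s) = c" using c_def bform_sym by simp
  have "p - (p - c * q) / (1 - c\<^sup>2) - (q - c * p) / (1 - c\<^sup>2) * c = 0"
       "q - (p - c * q) / (1 - c\<^sup>2) * c - (q - c * p) / (1 - c\<^sup>2) = 0"
    using d by (simp_all add: divide_simps) (simp_all add: algebra_simps power2_eq_square)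
  then show ?thesis
    using assms c' by (intro exI[of _ "(p - c * q) / (1 - c\<^sup>2)"] exI[of _ "(q - c * p) / (1 - c\<^sup>2)"])
      (simp add: bform_simps flip: c_def p_def q_def)
qed

text \<open>On the plane of \<open>\<alpha> s\<close> and \<open>\<alpha> t\<close> the word is a
  rotation by the full angle 2 pi, and on the orthogonal complement both reflections are
  trivial.\<close>

lemma reflects_relation:
  assumes "s \<in> S" "t \<in> S"
  shows "reflects (concat (replicate (m s t) [s, t])) x = x"
proof (cases "s = t")
  case False
  define \<theta> where "\<theta> = pi / real (m s t)"
  define R where "R = reflects (concat (replicate (m s t) [s, t]))"
  have s0: "sin \<theta> > 0"
    using sin_m_pos[of s t 1] assms m_ge_2[of s t] False by (simp add: \<theta>_def)
  have full: "2 * real (m s t) * \<theta> = 2 * pi" using m_pos assms by (simp add: \<theta>_def)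
  have *: "R (sin (\<phi> + \<theta>) *\<^sub>R \<alpha> s + sin \<phi> *\<^sub>R \<alpha> t) = sin (\<phi> + \<theta>) *\<^sub>R \<alpha> s + sin \<phi> *\<^sub>R \<alpha> t" for \<phi>
    using reflects_dihedral_power[OF assms False, of "m s t" \<phi>, folded \<theta>_def]
    unfolding R_def full by simp
  have lin: "R (x + y) = R x + R y" "R (c *\<^sub>R x) = c *\<^sub>R R x" for x y c
    by (simp_all add: R_def reflects_linear)
  \<comment> \<open>The angles \<open>0\<close> and \<open>- \<theta>\<close> each make one of the
    two coefficients vanish and so isolate \<open>\<alpha> s\<close> and
    \<open>\<alpha> t\<close>.\<close>
  have "sin \<theta> *\<^sub>R R (\<alpha> s) = sin \<theta> *\<^sub>R \<alpha> s" using *[of 0] by (simp flip: lin)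
  then have Rs: "R (\<alpha> s) = \<alpha> s" using s0 by simp
  have "(- sin \<theta>) *\<^sub>R R (\<alpha> t) = (- sin \<theta>) *\<^sub>R \<alpha> t" using *[of "- \<theta>"] by (simp del: scaleR_minus_left flip: lin)
  then have Rt: "R (\<alpha> t) = \<alpha> t" using s0 by simp
  obtain a b where ab: "bform (x - a *\<^sub>R \<alpha> s - b *\<^sub>R \<alpha> t) (\<alpha> s) = 0" "bform (x - a *\<^sub>R \<alpha> s - b *\<^sub>R \<alpha> t) (\<alpha> t) = 0"
    using orthogonal_decomposition[OF assms False] by blast
  define y where "y = x - a *\<^sub>R \<alpha> s - b *\<^sub>R \<alpha> t"
  have "reflect s y = y" "reflect t y = y" using ab by (simp_all add: reflect_def y_def)
  then have "reflects (concat (replicate k [s, t])) y = y" for k by (induction k) auto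
  then have Ry: "R y = y" by (simp add: R_def)
  have x: "x = y + (a *\<^sub>R \<alpha> s + b *\<^sub>R \<alpha> t)" by (simp add: y_def)
  have "R x = x" by (subst (2) x, subst x) (simp only: lin Rs Rt Ry)
  then show ?thesis by (simp add: R_def)
next
  case True then show ?thesis using assms by simp
qed

text \<open>The presentation is used here: inserting or deleting a relator does not change the
  product of reflections, so the geometric representation is well defined.\<close>

lemma reflects_one:
  assumes "xs \<in> lists S" "word xs = \<one>"
  shows "reflects xs x = x"
proof -
  have step: "reflects xs x = reflects ys x" if "(xs, ys) \<in> coxeter_step W S" for xs ys x
    using that reflects_relation by (auto simp: coxeter_step_def m_def)
  have "reflects xs x = reflects ys x" if "(xs, ys) \<in> (coxeter_step W S \<union> (coxeter_step W S)\<inverse>)\<^sup>*" for xs ys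
    using that by (induction rule: rtrancl_induct) (auto simp: step dest: step[symmetric])
  from this[OF coxeter_relations[OF assms]] show ?thesis by simp
qed

lemma reflects_rev: "xs \<in> lists S \<Longrightarrow> reflects xs (reflects (rev xs) x) = x"
  by (induction xs arbitrary: x) auto

lemma reflects_cong:
  assumes "xs \<in> lists S" "ys \<in> lists S" "word xs = word ys"
  shows "reflects xs x = reflects ys x"
proof -
  have "word (rev ys @ xs) = \<one>" using assms by (subst word_append) (auto simp: word_rev)
  then have "reflects (rev ys @ xs) x = x" using assms by (intro reflects_one) auto
  then have "reflects (rev ys) (reflects xs x) = x" by simp
  then show ?thesis using reflects_rev[of ys] assms by metis
qed

lemma act_word: "xs \<in> lists S \<Longrightarrow> act (word xs) x = reflects xs x"
  unfolding act_def using someI[of "\<lambda>ys. ys \<in> lists S \<and> word ys = word xs" xs] by (auto intro: reflects_cong)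

lemma act_mult [simp]:
  assumes "v \<in> carrier W" "w \<in> carrier W"
  shows "act (v \<otimes> w) x = act v (act w x)"
proof -
  obtain xs ys where "xs \<in> lists S" "word xs = v" "ys \<in> lists S" "word ys = w"
    using assms carrier_word by metis
  then show ?thesis using act_word[of "xs @ ys" x] act_word[of ys x] act_word[of xs]
    by (metis append_in_lists_conv word_append reflects_append)
qed

lemma act_one [simp]: "act \<one> x = x"
  using act_word[of "[]"] by simp

lemma act_gen: "s \<in> S \<Longrightarrow> act s x = x - (2 * bform x (\<alpha> s)) *\<^sub>R \<alpha> s"
  using act_word[of "[s]"] by (simp add: reflect_def)

lemma act_inv [simp]: "w \<in> carrier W \<Longrightarrow> act (inv w) (act w x) = x"
  and act_inv' [simp]: "w \<in> carrier W \<Longrightarrow> act w (act (inv w) x) = x"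
  by (simp_all flip: act_mult)

lemma act_add: "act w (x + y) = act w x + act w y"
  and act_scale: "act w (c *\<^sub>R x) = c *\<^sub>R act w x"
  by (simp_all add: act_def reflects_linear)

lemma act_linear: "linear (act w)"
  by (rule linearI) (auto simp: act_add act_scale)

lemma act_diff: "act w (x - y) = act w x - act w y"
  and act_minus: "act w (- x) = - act w x"
  and act_zero [simp]: "act w 0 = 0"
  and act_sum: "act w (\<Sum>i\<in>A. f i) = (\<Sum>i\<in>A. act w (f i))"
  using act_linear linear_diff linear_neg linear_0 linear_sum by blast+

lemmas act_simps = act_add act_scale act_diff act_minus act_sum

lemma bform_act:
  assumes "w \<in> carrier W" shows "bform (act w x) (act w y) = bform x y"
proof -
  have "bform (reflects xs x) (reflects xs y) = bform x y" if "xs \<in> lists S" for xs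
    using that by (induction xs) (auto simp: bform_reflect)
  then show ?thesis using assms carrier_word act_word by metis
qed

lemma act_inj: "w \<in> carrier W \<Longrightarrow> act w x = act w y \<longleftrightarrow> x = y"
  by (metis act_inv)

lemma act_gen_self [simp]: "s \<in> S \<Longrightarrow> act s (\<alpha> s) = - \<alpha> s"
  by (simp add: act_gen fun_eq_iff vec_apply)

subsection \<open>Length and positivity\<close>

lemma len_le: "xs \<in> lists S \<Longrightarrow> len (word xs) \<le> length xs"
  unfolding len_def by (rule Least_le) auto

lemma len_word: "w \<in> carrier W \<Longrightarrow> \<exists>xs\<in>lists S. word xs = w \<and> length xs = len w"
  unfolding len_def by (rule LeastI_ex) (use carrier_word in blast)

lemma len_one [simp]: "len \<one> = 0"
  using len_le[of "[]"] by simp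

lemma len_mult: "v \<in> carrier W \<Longrightarrow> w \<in> carrier W \<Longrightarrow> len (v \<otimes> w) \<le> len v + len w"
proof -
  assume "v \<in> carrier W" "w \<in> carrier W"
  then obtain xs ys where "xs \<in> lists S" "word xs = v" "length xs = len v" "ys \<in> lists S" "word ys = w" "length ys = len w"
    using len_word[of v] len_word[of w] by blast
  then show ?thesis using len_le[of "xs @ ys"] by (simp add: word_append)
qed

lemma exists_shorter:
  assumes "w \<in> carrier W" "w \<noteq> \<one>"
  shows "\<exists>s\<in>S. len (w \<otimes> s) < len w"
proof -
  obtain xs where xs: "xs \<in> lists S" "word xs = w" "length xs = len w" using len_word assms by blast
  then have "xs \<noteq> []" using assms by auto
  then obtain ys s where ys: "xs = ys @ [s]" using rev_exhaust by blast
  then have "ys \<in> lists S" "s \<in> S" using xs by simp_all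
  then have "w \<otimes> s = word ys" using xs ys by (simp add: word_append m_assoc flip: xs(2))
  then have "len (w \<otimes> s) < len w" using xs ys \<open>ys \<in> lists S\<close> len_le[of ys] by simp
  then show ?thesis using \<open>s \<in> S\<close> by blast
qed

end

section \<open>Positive cones and coordinate subspaces\<close>

definition nonneg :: "('a \<Rightarrow> real) \<Rightarrow> bool" where "nonneg x \<longleftrightarrow> (\<forall>t. 0 \<le> x t)"

definition coord :: "'a set \<Rightarrow> ('a \<Rightarrow> real) set" where "coord J = {x. \<forall>t. t \<notin> J \<longrightarrow> x t = 0}"

lemma nonneg_add: "nonneg x \<Longrightarrow> nonneg y \<Longrightarrow> nonneg (x + y)"
  and nonneg_scale: "c \<ge> 0 \<Longrightarrow> nonneg x \<Longrightarrow> nonneg (c *\<^sub>R x)"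
  and nonneg_unit [simp]: "nonneg (\<alpha> s)"
  by (auto simp: nonneg_def vec_apply unit_vec_nonneg)

lemma nonneg_sum: "(\<And>i. i \<in> A \<Longrightarrow> nonneg (f i)) \<Longrightarrow> nonneg (\<Sum>i\<in>A. f i)"
  by (auto simp: nonneg_def sum_fun_apply intro: sum_nonneg)

lemma nonneg_antisym: "nonneg x \<Longrightarrow> nonneg (- x) \<Longrightarrow> x = 0"
  by (auto simp: nonneg_def vec_apply fun_eq_iff intro: order_antisym)

lemma coord_add: "x \<in> coord J \<Longrightarrow> y \<in> coord J \<Longrightarrow> x + y \<in> coord J"
  and coord_scale: "x \<in> coord J \<Longrightarrow> c *\<^sub>R x \<in> coord J"
  and coord_diff: "x \<in> coord J \<Longrightarrow> y \<in> coord J \<Longrightarrow> x - y \<in> coord J"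
  and coord_minus: "x \<in> coord J \<Longrightarrow> - x \<in> coord J"
  and coord_zero [simp]: "0 \<in> coord J"
  and coord_unit [simp]: "\<alpha> s \<in> coord J \<longleftrightarrow> s \<in> J"
  by (auto simp: coord_def vec_apply unit_vec_def)

lemma coord_sum: "(\<And>i. i \<in> A \<Longrightarrow> f i \<in> coord J) \<Longrightarrow> (\<Sum>i\<in>A. f i) \<in> coord J"
  by (auto simp: coord_def sum_fun_apply intro: sum.neutral)

lemma coord_mono: "J \<subseteq> K \<Longrightarrow> x \<in> coord J \<Longrightarrow> x \<in> coord K"
  by (auto simp: coord_def)

lemma lincomb_apply: "finite J \<Longrightarrow> (\<Sum>r\<in>J. c r *\<^sub>R \<alpha> r) s = (if s \<in> J then c s else 0)"
proof -
  assume "finite J"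
  moreover have "(\<Sum>r\<in>J. c r *\<^sub>R \<alpha> r) s = (\<Sum>r\<in>J. if r = s then c s else 0)"
    unfolding sum_fun_apply by (intro sum.cong) (auto simp: vec_apply unit_vec_def)
  ultimately show ?thesis by simp
qed

lemma coord_expand: "finite J \<Longrightarrow> x \<in> coord J \<Longrightarrow> x = (\<Sum>s\<in>J. x s *\<^sub>R \<alpha> s)"
  by (rule ext) (simp add: lincomb_apply coord_def)

section \<open>Dihedral words, signs of roots and positivity of the form\<close>

context finite_coxeter
begin

text \<open>Anchored at the right: every nonempty word ends in \<open>t\<close>, and
  \<open>Suc k\<close> adds a letter in front. Acting on a vector, such a word begins with the
  reflection in \<open>t\<close>.\<close>

definition alternating :: "'a \<Rightarrow> 'a \<Rightarrow> nat \<Rightarrow> 'a list" where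
  "alternating s t k = (if odd k then [t] else []) @ concat (replicate (k div 2) [s, t])"

lemma alternating_simps [simp]: "alternating s t 0 = []"
  "alternating s t (Suc k) = (if odd k then s else t) # alternating s t k"
proof -
  show "alternating s t 0 = []" by (simp add: alternating_def)
  show "alternating s t (Suc k) = (if odd k then s else t) # alternating s t k"
    by (cases "odd k") (auto simp: alternating_def odd_iff_mod_2_eq_one elim!: oddE)
qed

lemma length_alternating [simp]: "length (alternating s t k) = k"
  by (induction k) auto

lemma alternating_in_lists: "s \<in> A \<Longrightarrow> t \<in> A \<Longrightarrow> alternating s t k \<in> lists A"
  by (induction k) auto

lemma alternating_snoc: "alternating s t (Suc k) = alternating t s k @ [t]"
  by (induction k) auto

lemma alternating_append: "\<exists>F. set F \<subseteq> {s, t} \<and> length F = i \<and> alternating s t (i + k) = F @ alternating s t k"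
proof (induction i)
  case (Suc i)
  then obtain F where "set F \<subseteq> {s, t} \<and> length F = i \<and> alternating s t (i + k) = F @ alternating s t k" by blast
  then show ?case by (intro exI[of _ "(if odd (i + k) then s else t) # F"]) simp
qed auto

lemma dihedral_word:
  assumes "s \<in> S" "t \<in> S" "xs \<in> lists {s, t}"
  shows "\<exists>k \<le> length xs. word xs = word (alternating s t k) \<or> word xs = word (alternating t s k)"
  using assms(3)
proof (induction xs)
  case (Cons x xs)
  have *: "\<exists>k \<le> Suc (length xs). word (x # xs) = word (alternating a b k) \<or> word (x # xs) = word (alternating b a k)"
    if "k \<le> length xs" "word xs = word (alternating a b k)" "{a, b} = {s, t}" for k a b
  proof -
    have ab: "a \<in> S" "b \<in> S" "x = a \<or> x = b" using that assms Cons by (auto simp: doubleton_eq_iff)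
    show ?thesis
    proof (cases "x = (if odd k then a else b)")
      case True
      then show ?thesis using that by (intro exI[of _ "Suc k"]) simp
    next
      case False
      show ?thesis
      proof (cases k)
        case 0
        then show ?thesis using ab that False by (intro exI[of _ 1]) auto
      next
        case (Suc j)
        then have "x = (if odd j then a else b)" using ab False by auto
        then have "word (x # xs) = word (alternating a b j)"
          using that Suc ab alternating_in_lists[of a S b j] by simp
        then show ?thesis using that Suc by (intro exI[of _ j]) simp
      qed
    qed
  qed
  obtain k where "k \<le> length xs" "word xs = word (alternating s t k) \<or> word xs = word (alternating t s k)"
    using Cons by auto
  then show ?case using *[of k s t] *[of k t s] by (metis (no_types, lifting) insert_commute length_Cons)
qed auto

lemma word_alternating_even:
  assumes "s \<in> S" "t \<in> S"
  shows "word (alternating s t (2 * j)) = (s \<otimes> t) [^] j"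
proof (induction j)
  case (Suc j)
  have "(s \<otimes> t) [^] Suc j = (s \<otimes> t) \<otimes> (s \<otimes> t) [^] j" using assms by (simp add: nat_pow_comm flip: nat_pow_Suc2)
  then show ?case using Suc assms by (simp add: m_assoc)
qed simp

lemma word_alternating_m:
  assumes "s \<in> S" "t \<in> S"
  shows "word (alternating s t (m s t)) = word (alternating t s (m s t))"
proof -
  let ?r = "s \<otimes> t" and ?m = "m s t"
  have r: "?r \<in> carrier W" and i: "inv ?r = t \<otimes> s" using assms by (auto simp: inv_mult_group)
  have 1: "?r [^] ?m = \<one>" using r by (simp add: m_def)
  show ?thesis
  proof (cases "even ?m")
    case True
    then obtain j where j: "?m = 2 * j" by (elim evenE)
    have "?r [^] j \<otimes> ?r [^] j = \<one>" using 1 r by (simp add: j nat_pow_mult mult_2)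
    then have "?r [^] j = inv (?r [^] j)" using r by (metis inv_equality nat_pow_closed)
    also have "\<dots> = (t \<otimes> s) [^] j" using r i nat_pow_inv by metis
    finally show ?thesis using word_alternating_even assms j by metis
  next
    case False
    then obtain j where j: "?m = 2 * j + 1" by (elim oddE)
    have "word (alternating s t ?m) = t \<otimes> ?r [^] j" using assms j by (simp add: word_alternating_even)
    moreover have "word (alternating t s ?m) = s \<otimes> (t \<otimes> s) [^] j" using assms j by (simp add: word_alternating_even)
    moreover have "t \<otimes> ?r [^] j = s \<otimes> (t \<otimes> s) [^] j"
    proof -
      have "?r [^] j \<otimes> (?r \<otimes> ?r [^] j) = ?r [^] (j + Suc j)"
        using r by (simp only: nat_pow_Suc2[symmetric] nat_pow_mult)
      then have "?r [^] j \<otimes> (?r \<otimes> ?r [^] j) = \<one>" using 1 j by (simp add: mult_2)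
      then have "?r \<otimes> ?r [^] j = inv (?r [^] j)" using r by (metis inv_equality inv_inv m_closed nat_pow_closed)
      also have "\<dots> = (t \<otimes> s) [^] j" using r i nat_pow_inv by metis
      finally have "s \<otimes> (?r \<otimes> ?r [^] j) = s \<otimes> (t \<otimes> s) [^] j" by simp
      then show ?thesis using assms r by (simp add: m_assoc)
    qed
    ultimately show ?thesis by simp
  qed
qed

text \<open>The rank 2 case of \<open>ascent_imp_nonneg\<close>. A shortest word that
  \<open>s\<close> does not shorten from the right is alternating with \<open>t\<close> at its right
  end, and it has fewer than \<open>m s t\<close> letters. The coefficients of the image of
  \<open>\<alpha> s\<close> are then quotients \<open>sin (i * \<theta>) / sin \<theta>\<close> with
  \<open>i\<close> at most \<open>m s t\<close>.\<close>

lemma dihedral_nonneg: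
  assumes st: "s \<in> S" "t \<in> S" "s \<noteq> t" and xs: "xs \<in> lists {s, t}"
    and min: "\<And>ys. ys \<in> lists {s, t} \<Longrightarrow> word ys = word xs \<Longrightarrow> length xs \<le> length ys"
    and asc: "\<And>ys. ys \<in> lists {s, t} \<Longrightarrow> word ys = word xs \<otimes> s \<Longrightarrow> length xs \<le> length ys"
  shows "\<exists>a b. a \<ge> 0 \<and> b \<ge> 0 \<and> act (word xs) (\<alpha> s) = a *\<^sub>R \<alpha> s + b *\<^sub>R \<alpha> t"
proof -
  have L: "zs \<in> lists S" if "zs \<in> lists {s, t}" for zs
    using that st lists_mono[of "{s,t}" S] by auto
  have alt: "alternating a b j \<in> lists {s, t}" if "{a, b} = {s, t}" for a b j
    using that by (intro alternating_in_lists) auto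
  have no_s: False if "word xs = word (ys @ [s])" "ys \<in> lists {s, t}" "length ys < length xs" for ys
    using asc[of ys] that st L[of ys] by (simp add: word_append m_assoc)
  obtain k where k: "k \<le> length xs" "word xs = word (alternating s t k) \<or> word xs = word (alternating t s k)"
    using dihedral_word st xs by blast
  have kl: "k = length xs" using k min[of "alternating s t k"] min[of "alternating t s k"] alt[of s t k] alt[of t s k] by force
  have e: "word xs = word (alternating s t k)"
  proof (rule ccontr)
    assume "word xs \<noteq> word (alternating s t k)"
    then have w: "word xs = word (alternating t s k)" "k \<noteq> 0" using k by (auto intro: ccontr)
    then obtain j where j: "k = Suc j" using not0_implies_Suc by blast
    show False using no_s[of "alternating s t j"] w j kl alt[of s t j] by (simp only: alternating_snoc) simp
  qed
  \<comment> \<open>The last \<open>m s t\<close> letters could be traded for the other alternating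
    word of that length, which ends in \<open>s\<close>; dropping this \<open>s\<close> would
    contradict the ascent assumption.\<close>
  have km: "k < m s t"
  proof (rule ccontr)
    assume "\<not> k < m s t"
    then obtain i where i: "k = i + m s t" by (metis add.commute le_Suc_ex not_less)
    obtain F where F: "set F \<subseteq> {s, t}" "length F = i" "alternating s t k = F @ alternating s t (m s t)"
      using alternating_append[of s t i "m s t"] i by auto
    obtain j where j: "m s t = Suc j" using m_pos[of s t] st not0_implies_Suc by blast
    have Fl: "F \<in> lists {s, t}" using F by (auto simp: in_lists_conv_set)
    have "word xs = word F \<otimes> word (alternating t s (m s t))"
      using e F L[OF Fl] L[OF alt, of s t] word_alternating_m[of s t] st by (simp add: word_append)
    also have "\<dots> = word (F @ alternating s t j @ [s])"
      using L[OF Fl] L[OF alt, of s t j] st by (simp add: word_append j alternating_snoc del: alternating_simps)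
    finally show False using no_s[of "F @ alternating s t j"] Fl alt[of s t j] F i j kl by simp
  qed
  define \<theta> where "\<theta> = pi / real (m s t)"
  have s0: "sin \<theta> > 0" using sin_m_pos[of s t 1] m_ge_2[of s t] st by (simp add: \<theta>_def)
  have nn: "sin (real i * \<theta>) \<ge> 0" if "i \<le> m s t" for i
    using sin_m_pos[of s t i] st that m_pos[of s t] by (cases "i = 0 \<or> i = m s t") (auto simp: \<theta>_def less_imp_le)
  have ev: "reflects (concat (replicate j [s, t])) (sin \<theta> *\<^sub>R \<alpha> s)
      = sin (real (2 * j + 1) * \<theta>) *\<^sub>R \<alpha> s + sin (real (2 * j) * \<theta>) *\<^sub>R \<alpha> t" for j
    using reflects_dihedral_power[OF st, of j 0] by (simp add: \<theta>_def algebra_simps)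
  have ac: "act (word xs) z = reflects (alternating s t k) z" for z
    using e act_word[OF L[OF alt]] by simp
  have "\<exists>a b. a \<ge> 0 \<and> b \<ge> 0 \<and> act (word xs) (sin \<theta> *\<^sub>R \<alpha> s) = a *\<^sub>R \<alpha> s + b *\<^sub>R \<alpha> t"
  proof (cases "even k")
    case True
    then obtain j where j: "k = 2 * j" by (elim evenE)
    then have "act (word xs) (sin \<theta> *\<^sub>R \<alpha> s) = reflects (concat (replicate j [s, t])) (sin \<theta> *\<^sub>R \<alpha> s)"
      using ac by (simp add: alternating_def)
    then show ?thesis unfolding ev using nn[of "2 * j + 1"] nn[of "2 * j"] km j
      by (intro exI[of _ "sin (real (2 * j + 1) * \<theta>)"] exI[of _ "sin (real (2 * j) * \<theta>)"]) auto
  next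
    case False
    then obtain j where j: "k = 2 * j + 1" by (elim oddE)
    then have "act (word xs) (sin \<theta> *\<^sub>R \<alpha> s) = reflect t (reflects (concat (replicate j [s, t])) (sin \<theta> *\<^sub>R \<alpha> s))"
      using ac by (simp add: alternating_def)
    also have "\<dots> = sin (real (2 * j + 1) * \<theta>) *\<^sub>R \<alpha> s + sin (real (2 * j + 2) * \<theta>) *\<^sub>R \<alpha> t"
      unfolding ev using reflect_dihedral[OF st, of "real (2 * j) * \<theta>"] by (simp add: \<theta>_def algebra_simps)
    finally show ?thesis using nn[of "2 * j + 1"] nn[of "2 * j + 2"] km j
      by (intro exI[of _ "sin (real (2 * j + 1) * \<theta>)"] exI[of _ "sin (real (2 * j + 2) * \<theta>)"]) auto
  qed
  then obtain a b where ab: "a \<ge> 0" "b \<ge> 0" "sin \<theta> *\<^sub>R act (word xs) (\<alpha> s) = a *\<^sub>R \<alpha> s + b *\<^sub>R \<alpha> t"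
    by (auto simp: act_simps)
  have "act (word xs) (\<alpha> s) = (1 / sin \<theta>) *\<^sub>R (sin \<theta> *\<^sub>R act (word xs) (\<alpha> s))" using s0 by simp
  also have "\<dots> = (a / sin \<theta>) *\<^sub>R \<alpha> s + (b / sin \<theta>) *\<^sub>R \<alpha> t" unfolding ab by (simp add: scaleR_add_right)
  finally show ?thesis using ab s0
    by (intro exI[of _ "a / sin \<theta>"] exI[of _ "b / sin \<theta>"]) auto
qed

text \<open>With \<open>t\<close> a right descent of \<open>w\<close>, write \<open>w = v x\<close>
  with \<open>x\<close> in the dihedral group of \<open>s\<close> and \<open>t\<close>, lengths
  adding up and \<open>v\<close> as short as possible. Then neither \<open>s\<close> nor
  \<open>t\<close> shortens \<open>v\<close>, so the induction hypothesis applies to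
  \<open>v\<close> and \<open>dihedral_nonneg\<close> to \<open>x\<close>.\<close>

theorem ascent_imp_nonneg:
  assumes "w \<in> carrier W" "s \<in> S" "len w \<le> len (w \<otimes> s)"
  shows "nonneg (act w (\<alpha> s))"
  using assms
proof (induction "len w" arbitrary: w s rule: less_induct)
  case less
  note w = less.prems(1) and s = less.prems(2) and asc = less.prems(3)
  show ?case
  proof (cases "w = \<one>")
    case False
    then obtain t where t: "t \<in> S" "len (w \<otimes> t) < len w" using exists_shorter w by blast
    then have "s \<noteq> t" using asc by auto
    define A where "A = {v \<in> carrier W. \<exists>xs\<in>lists {s, t}. w = v \<otimes> word xs \<and> len v + length xs = len w}"
    have Lst: "xs \<in> lists S" if "xs \<in> lists {s, t}" for xs
      using that s t lists_mono[of "{s,t}" S] by auto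
    have lower: "len w \<le> len v + length xs" if "w = v \<otimes> word xs" "v \<in> carrier W" "xs \<in> lists {s, t}" for v xs
      using len_mult[OF that(2) word_carrier[OF Lst[OF that(3)]]] len_le[OF Lst[OF that(3)]] that(1) by simp
    have wt: "w \<otimes> t \<in> A"
      unfolding A_def using w t lower[of "w \<otimes> t" "[t]"]
      by (auto intro!: bexI[of _ "[t]"] simp: m_assoc)
    define v where "v = arg_min len (\<lambda>v. v \<in> A)"
    have v: "v \<in> A" "\<And>u. u \<in> A \<Longrightarrow> len v \<le> len u"
      unfolding v_def by (rule arg_min_natI[of "\<lambda>v. v \<in> A", OF wt], rule arg_min_nat_le)
    then obtain xs where vc: "v \<in> carrier W" and xs: "xs \<in> lists {s, t}" "w = v \<otimes> word xs" "len v + length xs = len w"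
      unfolding A_def by blast
    have "len v < len w" using v(2)[OF wt] t by simp
    have nn: "nonneg (act v (\<alpha> r))" if "r \<in> {s, t}" for r
    proof (rule less.hyps[OF \<open>len v < len w\<close> vc])
      show r: "r \<in> S" using that s t by auto
      show "len v \<le> len (v \<otimes> r)"
      proof (rule ccontr)
        assume l: "\<not> len v \<le> len (v \<otimes> r)"
        have "w = (v \<otimes> r) \<otimes> word (r # xs)" using xs vc r Lst[OF xs(1)] by (simp add: m_assoc)
        moreover have "len w \<le> len (v \<otimes> r) + length (r # xs)"
          using lower[of "v \<otimes> r" "r # xs"] calculation vc r that xs by auto
        ultimately have "v \<otimes> r \<in> A" unfolding A_def using vc r that xs l by (auto intro!: bexI[of _ "r # xs"])
        then show False using v(2) l by blast
      qed
    qed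
    have "\<exists>a b. a \<ge> 0 \<and> b \<ge> 0 \<and> act (word xs) (\<alpha> s) = a *\<^sub>R \<alpha> s + b *\<^sub>R \<alpha> t"
    proof (rule dihedral_nonneg[OF s t(1) \<open>s \<noteq> t\<close> xs(1)])
      fix ys assume "ys \<in> lists {s, t}" "word ys = word xs"
      then show "length xs \<le> length ys" using lower[of v ys] vc xs by simp
    next
      fix ys assume ys: "ys \<in> lists {s, t}" "word ys = word xs \<otimes> s"
      then have "w \<otimes> s = v \<otimes> word ys" using vc s xs Lst by (simp add: m_assoc)
      then have "len (w \<otimes> s) \<le> len v + length ys"
        using len_mult[of v "word ys"] len_le[of ys] vc Lst[OF ys(1)] by simp
      then show "length xs \<le> length ys" using asc xs by simp
    qed
    then obtain a b where ab: "a \<ge> 0" "b \<ge> 0" "act (word xs) (\<alpha> s) = a *\<^sub>R \<alpha> s + b *\<^sub>R \<alpha> t" by blast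
    have "act w (\<alpha> s) = a *\<^sub>R act v (\<alpha> s) + b *\<^sub>R act v (\<alpha> t)"
      using xs(2) vc Lst[OF xs(1)] ab by (simp add: act_simps)
    then show ?thesis using ab nn by (simp add: nonneg_add nonneg_scale)
  qed simp
qed

lemma descent_imp_nonpos:
  assumes "w \<in> carrier W" "s \<in> S" "len (w \<otimes> s) \<le> len w"
  shows "nonneg (- act w (\<alpha> s))"
proof -
  have "nonneg (act (w \<otimes> s) (\<alpha> s))"
    using assms by (intro ascent_imp_nonneg) (auto simp: m_assoc)
  then show ?thesis using assms by (simp add: act_simps)
qed

lemma act_unit_neq_0: "w \<in> carrier W \<Longrightarrow> act w (\<alpha> s) \<noteq> 0"
  using act_inj[of w "\<alpha> s" 0] by simp

lemma act_unit_cases: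
  assumes "w \<in> carrier W" "s \<in> S"
  shows "nonneg (act w (\<alpha> s)) \<or> nonneg (- act w (\<alpha> s))"
  using ascent_imp_nonneg descent_imp_nonpos assms linorder_le_cases by blast

text \<open>A nontrivial element has a right descent, and it sends the corresponding simple root to
  a negative one.\<close>

lemma nonneg_all_imp_one:
  assumes "w \<in> carrier W" "\<And>s. s \<in> S \<Longrightarrow> nonneg (act w (\<alpha> s))"
  shows "w = \<one>"
  using exists_shorter[OF assms(1)] descent_imp_nonpos[OF assms(1)] assms act_unit_neq_0 nonneg_antisym
  by (metis less_imp_le)

lemma act_eqI:
  assumes "v \<in> carrier W" "w \<in> carrier W" "\<And>s. s \<in> S \<Longrightarrow> act v (\<alpha> s) = act w (\<alpha> s)"
  shows "v = w"
proof -
  have "inv w \<otimes> v = \<one>" using assms by (intro nonneg_all_imp_one) auto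
  then show ?thesis using assms by (metis inv_equality inv_inv inv_closed)
qed

lemma act_outside: "w \<in> carrier W \<Longrightarrow> J \<subseteq> S \<Longrightarrow> w \<in> generate W J \<Longrightarrow> t \<notin> J \<Longrightarrow> act w x t = x t"
proof -
  assume J: "J \<subseteq> S" and t: "t \<notin> J" and w: "w \<in> generate W J"
  have "reflects xs x t = x t" if "xs \<in> lists J" for xs
    using that t by (induction xs) (auto simp: reflect_def vec_apply unit_vec_def)
  then show ?thesis using w J act_word generate_iff_word lists_mono[OF J] by (metis subsetD)
qed

lemma par_in_W: "J \<subseteq> S \<Longrightarrow> w \<in> generate W J \<Longrightarrow> w \<in> carrier W"
  using generate_in_carrier S_subset by blast

lemma act_diff_coord:
  "J \<subseteq> S \<Longrightarrow> w \<in> generate W J \<Longrightarrow> act w x - x \<in> coord J"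
  using act_outside par_in_W by (auto simp: coord_def vec_apply)

lemma act_coord:
  assumes "J \<subseteq> S" "w \<in> generate W J" "J \<subseteq> K" "x \<in> coord K"
  shows "act w x \<in> coord K"
proof -
  have "act w x = (act w x - x) + x" by simp
  then show ?thesis using act_diff_coord assms coord_add coord_mono by metis
qed

lemma act_coord_S: "w \<in> carrier W \<Longrightarrow> x \<in> coord S \<Longrightarrow> act w x \<in> coord S"
  using act_coord[of S w S x] generate_S by simp

subsection \<open>The form is positive definite\<close>

text \<open>The standard inner product in the coordinates, summed over the group to become
  invariant.\<close>

definition average_form :: "('a \<Rightarrow> real) \<Rightarrow> ('a \<Rightarrow> real) \<Rightarrow> real" where
  "average_form x y = (\<Sum>w\<in>carrier W. \<Sum>t\<in>S. act w x t * act w y t)"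

lemma average_form_add: "average_form (x + y) z = average_form x z + average_form y z"
  and average_form_scale: "average_form (c *\<^sub>R x) z = c * average_form x z"
  and average_form_sym: "average_form x y = average_form y x"
  unfolding average_form_def sum.distrib[symmetric] sum_distrib_left
  by (auto intro!: sum.cong simp: act_simps vec_apply algebra_simps)

lemma average_form_act:
  assumes "g \<in> carrier W"
  shows "average_form (act g x) (act g y) = average_form x y"
proof -
  have "bij_betw (\<lambda>w. w \<otimes> g) (carrier W) (carrier W)"
    by (rule bij_betwI[where g = "\<lambda>w. w \<otimes> inv g"]) (auto simp: assms m_assoc)
  then show ?thesis unfolding average_form_def
    using sum.reindex_bij_betw[of "\<lambda>w. w \<otimes> g" "carrier W" "carrier W" "\<lambda>w. \<Sum>t\<in>S. act w x t * act w y t"] assms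
    by simp
qed

lemma average_form_pos:
  assumes "x \<in> coord S" "x \<noteq> 0"
  shows "average_form x x > 0"
proof -
  obtain t where t: "x t \<noteq> 0" using assms(2) by (auto simp: fun_eq_iff vec_apply)
  then have "t \<in> S" using assms(1) by (auto simp: coord_def)
  have "0 < (\<Sum>t\<in>S. act \<one> x t * act \<one> x t)"
    by (rule sum_pos2[OF _ \<open>t \<in> S\<close>]) (use t in \<open>auto simp: not_square_less_zero zero_less_mult_iff\<close>)
  then show ?thesis unfolding average_form_def
    by (intro sum_pos2[OF finite_carrier one_closed]) (auto intro: sum_nonneg)
qed

text \<open>The reflection \<open>s\<close> preserves \<open>average_form\<close> and negates
  \<open>\<alpha> s\<close>; expanding the form at the reflected vectors forces proportionality to
  \<open>bform x (\<alpha> s)\<close>.\<close>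

lemma average_form_unit:
  assumes "s \<in> S"
  shows "average_form x (\<alpha> s) = bform x (\<alpha> s) * average_form (\<alpha> s) (\<alpha> s)"
proof -
  have "average_form (act s x) (act s (\<alpha> s)) = average_form x (\<alpha> s)"
    using average_form_act[of s x "\<alpha> s"] assms by (simp del: act_gen_self)
  moreover have "average_form (act s x) (act s (\<alpha> s)) =
      - average_form x (\<alpha> s) + 2 * bform x (\<alpha> s) * average_form (\<alpha> s) (\<alpha> s)"
  proof -
    have m: "average_form y (- z) = - average_form y z" for y z
      using average_form_sym average_form_scale[of "-1" z y] by (metis mult_minus1 scaleR_minus1_left)
    have "act s x = x + (- (2 * bform x (\<alpha> s))) *\<^sub>R \<alpha> s" using assms by (simp add: act_gen)
    then show ?thesis using assms by (simp add: m average_form_add average_form_scale del: scaleR_minus_left)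
  qed
  ultimately show ?thesis by simp
qed

text \<open>By \<open>average_form_unit\<close> the positive definite \<open>average_form\<close>
  differs from \<open>bform\<close> only in the lengths \<open>c s\<close> of the simple roots, and
  these agree for non-orthogonal roots because both forms are symmetric. So \<open>bform x x\<close>
  is the averaged norm of the vector \<open>y\<close> with rescaled coordinates.\<close>

theorem bform_pos:
  assumes "x \<in> coord S" "x \<noteq> 0"
  shows "bform x x > 0"
proof -
  define c where "c s = sqrt (average_form (\<alpha> s) (\<alpha> s))" for s
  have c: "c s > 0" "c s * c s = average_form (\<alpha> s) (\<alpha> s)" if "s \<in> S" for s
    using average_form_pos[of "\<alpha> s"] that by (auto simp: c_def)
  have sq: "average_form (\<alpha> s) (\<alpha> t) = c s * c t * bform (\<alpha> s) (\<alpha> t)" if "s \<in> S" "t \<in> S" for s t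
  proof (cases "bform (\<alpha> s) (\<alpha> t) = 0")
    case False
    have "c t * c t * bform (\<alpha> s) (\<alpha> t) = c s * c s * bform (\<alpha> s) (\<alpha> t)"
      using average_form_unit[of t "\<alpha> s"] average_form_unit[of s "\<alpha> t"] c that
      by (metis average_form_sym bform_sym mult.commute)
    then have "c t = c s" using False c[OF that(1)] c[OF that(2)] by (simp add: c_def)
    have "average_form (\<alpha> s) (\<alpha> t) = bform (\<alpha> s) (\<alpha> t) * (c t * c t)"
      using average_form_unit[of t "\<alpha> s"] c(2)[OF that(2)] that by metis
    then show ?thesis unfolding \<open>c t = c s\<close> by (simp only: mult_ac)
  qed (use average_form_unit[of t "\<alpha> s"] that in simp)
  define y where "y = (\<Sum>s\<in>S. (x s / c s) *\<^sub>R \<alpha> s)"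
  have "y s = x s / c s" if "s \<in> S" for s
    using that by (simp add: y_def lincomb_apply)
  moreover obtain t where "x t \<noteq> 0" "t \<in> S" using assms by (force simp: fun_eq_iff vec_apply coord_def)
  ultimately have "y \<noteq> 0" using c(1)[of t] by (auto simp: fun_eq_iff vec_apply intro!: exI[of _ t])
  moreover have "y \<in> coord S" unfolding y_def by (intro coord_sum coord_scale) simp
  ultimately have "0 < average_form y y" by (rule average_form_pos[rotated])
  also have "average_form y y = bform x x"
  proof -
    have l: "average_form (\<Sum>s\<in>S. f s) z = (\<Sum>s\<in>S. average_form (f s) z)" for f z
      using linear_sum[OF linearI[of "\<lambda>x. average_form x z"], OF average_form_add] by (simp add: average_form_scale)
    have sr: "average_form z (k *\<^sub>R x) = k * average_form z x" for z k x
      using average_form_scale average_form_sym by metis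
    have lr: "average_form z (\<Sum>s\<in>S. f s) = (\<Sum>s\<in>S. average_form z (f s))" for f z
      unfolding average_form_sym[of z] by (rule l)
    have "average_form y y = (\<Sum>s\<in>S. \<Sum>t\<in>S. x s / c s * (x t / c t * average_form (\<alpha> s) (\<alpha> t)))"
      unfolding y_def l lr
      by (intro sum.cong refl) (simp add: average_form_scale sr average_form_sym mult_ac)
    also have "\<dots> = (\<Sum>s\<in>S. \<Sum>t\<in>S. x s * (x t * bform (\<alpha> s) (\<alpha> t)))"
      using c(1) by (intro sum.cong refl) (simp add: sq less_imp_neq[symmetric])
    also have "\<dots> = bform (\<Sum>s\<in>S. x s *\<^sub>R \<alpha> s) (\<Sum>s\<in>S. x s *\<^sub>R \<alpha> s)"
      unfolding bform_sum_left bform_sum_right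
      by (intro sum.cong refl) (simp add: bform_simps bform_sym)
    also have "\<dots> = bform x x" using coord_expand[OF finite_S assms(1)] by simp
    finally show ?thesis .
  qed
  finally show ?thesis .
qed

end

section \<open>Standard parabolic subgroups\<close>

context finite_coxeter
begin

abbreviation par :: "'a set \<Rightarrow> 'a set" where "par J \<equiv> generate W J"

lemma par_subgroup: "J \<subseteq> S \<Longrightarrow> subgroup (par J) W"
  using generate_is_subgroup S_subset by blast

lemma par_one [simp]: "\<one> \<in> par J"
  and par_gen: "s \<in> J \<Longrightarrow> s \<in> par J"
  and par_mult: "u \<in> par J \<Longrightarrow> v \<in> par J \<Longrightarrow> u \<otimes> v \<in> par J"
  by (auto intro: generate.intros)

lemma par_inv: "J \<subseteq> S \<Longrightarrow> u \<in> par J \<Longrightarrow> inv u \<in> par J"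
  using subgroup.m_inv_closed[OF par_subgroup] by blast

lemma par_mono: "J \<subseteq> K \<Longrightarrow> u \<in> par J \<Longrightarrow> u \<in> par K"
  using mono_generate by blast

lemma par_S [simp]: "par S = carrier W"
  by (rule generate_S)

lemma len_inv: "w \<in> carrier W \<Longrightarrow> len (inv w) = len w"
proof -
  have *: "len (inv w) \<le> len w" if w: "w \<in> carrier W" for w
  proof -
    obtain xs where xs: "xs \<in> lists S" "word xs = w" "length xs = len w" using len_word[OF w] by blast
    then have "rev xs \<in> lists S" by (simp add: in_lists_conv_set)
    from len_le[OF this] show ?thesis using xs by (simp only: word_rev length_rev)
  qed
  assume "w \<in> carrier W"
  then show ?thesis using *[of w] *[of "inv w"] by simp
qed

lemma act_eqI': "v \<in> carrier W \<Longrightarrow> w \<in> carrier W \<Longrightarrow> (\<And>x. act v x = act w x) \<Longrightarrow> v = w"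
  by (rule act_eqI) auto

subsection \<open>Roots and reflections\<close>

lemma act_conj_gen:
  assumes "w \<in> carrier W" "s \<in> S"
  shows "act (cj w s) x = x - (2 * bform x (act w (\<alpha> s))) *\<^sub>R act w (\<alpha> s)"
proof -
  have "bform (act (inv w) x) (\<alpha> s) = bform x (act w (\<alpha> s))"
    using bform_act[of w "act (inv w) x" "\<alpha> s"] assms by simp
  then show ?thesis using assms by (simp add: act_gen act_simps)
qed

lemma conj_gen_eq:
  assumes "v \<in> carrier W" "w \<in> carrier W" "s \<in> S" "t \<in> S"
    and "act v (\<alpha> s) = act w (\<alpha> t) \<or> act v (\<alpha> s) = - act w (\<alpha> t)"
  shows "cj v s = cj w t"
proof (rule act_eqI')
  show "act (cj v s) x = act (cj w t) x" for x
    unfolding act_conj_gen[OF assms(1,3)] act_conj_gen[OF assms(2,4)] using assms(5) by (auto simp: bform_simps)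
qed (use assms in auto)

lemma conj_gen_eq_gen:
  assumes "w \<in> carrier W" "s \<in> S" "t \<in> S" "act w (\<alpha> s) = \<alpha> t \<or> act w (\<alpha> s) = - \<alpha> t"
  shows "cj w s = t"
  using conj_gen_eq[of w \<one> s t] assms by simp

lemma bform_act_unit: "w \<in> carrier W \<Longrightarrow> s \<in> S \<Longrightarrow> bform (act w (\<alpha> s)) (act w (\<alpha> s)) = 1"
  by (simp add: bform_act)

lemma root_multiple:
  assumes "w \<in> carrier W" "s \<in> S" "t \<in> S" "act w (\<alpha> s) = c *\<^sub>R \<alpha> t"
  shows "c = 1 \<or> c = -1"
proof -
  have "c * c = 1" using bform_act_unit[of w s] assms by (simp add: bform_simps)
  then show ?thesis by (simp add: square_eq_1_iff)
qed

text \<open>The reflection \<open>t\<close> negates the root \<open>act w (\<alpha> s)\<close>, and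
  the only vectors negated by \<open>t\<close> are the multiples of
  \<open>\<alpha> t\<close>.\<close>

lemma conj_gen_eq_gen_iff:
  assumes "w \<in> carrier W" "s \<in> S" "t \<in> S" "cj w s = t"
  shows "act w (\<alpha> s) = \<alpha> t \<or> act w (\<alpha> s) = - \<alpha> t"
proof -
  let ?b = "act w (\<alpha> s)"
  have "act t ?b = ?b - (2 * bform ?b ?b) *\<^sub>R ?b" using act_conj_gen[OF assms(1,2), of ?b] assms(4) by simp
  then have "act t ?b = - ?b" using assms by (simp add: bform_act_unit fun_eq_iff vec_apply)
  then have "?b = bform ?b (\<alpha> t) *\<^sub>R \<alpha> t" using assms(3) by (simp add: act_gen fun_eq_iff vec_apply)
  then show ?thesis using root_multiple[OF assms(1-3)] by (metis scaleR_minus1_left scaleR_one)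
qed

lemma act_unit_nonnegI:
  assumes "w \<in> carrier W" "s \<in> S" "act w (\<alpha> s) t > 0"
  shows "nonneg (act w (\<alpha> s))"
proof (rule ccontr)
  assume "\<not> ?thesis"
  then have "nonneg (- act w (\<alpha> s))" using act_unit_cases assms by blast
  then show False using assms(3) by (auto simp: nonneg_def vec_apply dest: spec[of _ t])
qed

lemma act_unit_nonposI:
  assumes "w \<in> carrier W" "s \<in> S" "act w (\<alpha> s) t < 0"
  shows "nonneg (- act w (\<alpha> s))"
proof (rule ccontr)
  assume "\<not> ?thesis"
  then have "nonneg (act w (\<alpha> s))" using act_unit_cases assms by blast
  then show False using assms(3) by (auto simp: nonneg_def not_le[symmetric])
qed

lemma nonneg_act:
  assumes "L \<subseteq> S" "\<And>s. s \<in> L \<Longrightarrow> nonneg (act w (\<alpha> s))" "x \<in> coord L" "nonneg x"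
  shows "nonneg (act w x)"
proof -
  have "act w x = (\<Sum>s\<in>L. x s *\<^sub>R act w (\<alpha> s))"
    by (subst coord_expand[OF finite_sub_S[OF assms(1)] assms(3)]) (simp add: act_simps)
  then show ?thesis using assms by (auto intro!: nonneg_sum nonneg_scale simp: nonneg_def[of x])
qed

text \<open>A root is positive or negative, and \<open>x\<close> keeps nonnegative combinations of
  \<open>L\<close> nonnegative. So the sign of a root in the span of \<open>L\<close> can be read
  off after applying \<open>x\<close>.\<close>

lemma nonneg_root_reflect:
  assumes "L \<subseteq> S" "x \<in> carrier W" "\<And>s. s \<in> L \<Longrightarrow> nonneg (act x (\<alpha> s))"
    and "g \<in> carrier W" "t \<in> S" "act g (\<alpha> t) \<in> coord L" "nonneg (act x (act g (\<alpha> t)))"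
  shows "nonneg (act g (\<alpha> t))"
proof (rule ccontr)
  assume "\<not> ?thesis"
  then have "nonneg (- act g (\<alpha> t))" using act_unit_cases assms by blast
  then have "nonneg (act x (- act g (\<alpha> t)))"
    using nonneg_act[OF assms(1,3), where x = "- act g (\<alpha> t)"] coord_minus[OF assms(6)] by blast
  then have "nonneg (- act x (act g (\<alpha> t)))" by (simp add: act_simps)
  then show False using assms nonneg_antisym act_unit_neq_0[of "x \<otimes> g" t] by auto
qed

subsection \<open>Minimal coset representatives and longest elements\<close>

lemma min_coset_rep:
  assumes "J \<subseteq> S" "x \<in> carrier W"
  obtains y u where "y \<in> carrier W" "u \<in> par J" "x = y \<otimes> u"
    "\<And>s. s \<in> J \<Longrightarrow> nonneg (act y (\<alpha> s))" "\<And>v. v \<in> par J \<Longrightarrow> len y \<le> len (x \<otimes> v)"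
proof -
  define y where "y = arg_min len (\<lambda>y. \<exists>v\<in>par J. y = x \<otimes> v)"
  have "\<exists>v\<in>par J. x = x \<otimes> v" using assms by (intro bexI[of _ \<one>]) auto
  then have y: "\<exists>v\<in>par J. y = x \<otimes> v"
    unfolding y_def by (rule arg_min_natI)
  have min: "\<And>z. \<exists>v\<in>par J. z = x \<otimes> v \<Longrightarrow> len y \<le> len z"
    unfolding y_def by (rule arg_min_nat_le)
  obtain v where v: "v \<in> par J" "y = x \<otimes> v" using y by blast
  have vc: "v \<in> carrier W" using par_in_W assms v by blast
  show thesis
  proof
    show "y \<in> carrier W" using v vc assms by simp
    show "inv v \<in> par J" using par_inv assms v by blast
    show "x = y \<otimes> inv v" using v vc assms by (simp add: m_assoc)
    show "len y \<le> len (x \<otimes> v')" if "v' \<in> par J" for v' using min that by blast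
    show "nonneg (act y (\<alpha> s))" if "s \<in> J" for s
    proof (rule ascent_imp_nonneg)
      show "len y \<le> len (y \<otimes> s)"
        using v vc assms that par_gen par_mult by (intro min bexI[of _ "v \<otimes> s"]) (auto simp: m_assoc)
    qed (use v vc assms that in auto)
  qed
qed

text \<open>The coordinate at \<open>s\<close> stays equal to 1, and one positive coordinate makes a
  root positive.\<close>

lemma par_nonneg_outside:
  assumes "J \<subseteq> S" "u \<in> par J" "s \<in> S" "s \<notin> J"
  shows "nonneg (act u (\<alpha> s))"
  using act_unit_nonnegI[of u s s] act_outside[of u J s "\<alpha> s"] par_in_W assms by auto

lemma par_nonneg_imp_one:
  assumes "J \<subseteq> S" "u \<in> par J" "\<And>s. s \<in> J \<Longrightarrow> nonneg (act u (\<alpha> s))"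
  shows "u = \<one>"
  using assms par_nonneg_outside by (intro nonneg_all_imp_one par_in_W) blast+

text \<open>A linear bijection between the cones spanned by the simple roots of \<open>J\<close> and
  of \<open>K\<close> maps extreme rays to extreme rays. The sign \<open>\<sigma>\<close> covers
  both the elements that keep simple roots positive and the longest element.\<close>

lemma simple_map:
  assumes J: "J \<subseteq> S" and K: "K \<subseteq> S" and w: "w \<in> carrier W" and \<sigma>: "\<sigma> = 1 \<or> \<sigma> = -1"
    and 1: "\<And>s. s \<in> J \<Longrightarrow> nonneg (\<sigma> *\<^sub>R act w (\<alpha> s)) \<and> act w (\<alpha> s) \<in> coord K"
    and 2: "\<And>t. t \<in> K \<Longrightarrow> nonneg (\<sigma> *\<^sub>R act (inv w) (\<alpha> t)) \<and> act (inv w) (\<alpha> t) \<in> coord J"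
    and s: "s \<in> J"
  shows "\<exists>t\<in>K. act w (\<alpha> s) = \<sigma> *\<^sub>R \<alpha> t"
proof -
  define b where "b = \<sigma> *\<^sub>R act w (\<alpha> s)"
  have ss: "\<sigma> * \<sigma> = 1" using \<sigma> by auto
  have b: "nonneg b" "b \<in> coord K" using 1 s by (auto simp: b_def coord_scale)
  have b0: "b \<noteq> 0" using act_unit_neq_0[OF w] \<sigma> by (auto simp: b_def)
  then obtain t where t: "b t \<noteq> 0" by (auto simp: fun_eq_iff vec_apply)
  then have tK: "t \<in> K" "b t > 0" using b by (auto simp: coord_def nonneg_def less_le)
  define f where "f r = \<sigma> *\<^sub>R act (inv w) (\<alpha> r)" for r
  have "\<alpha> s = \<sigma> *\<^sub>R act (inv w) b" using w ss by (simp add: b_def act_simps)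
  also have "\<dots> = (\<Sum>r\<in>K. b r *\<^sub>R f r)"
    by (subst coord_expand[OF finite_sub_S[OF K] b(2)]) (simp add: act_simps scaleR_sum_right f_def mult_ac)
  finally have e: "\<alpha> s = (\<Sum>r\<in>K. b r *\<^sub>R f r)" .
  \<comment> \<open>All summands are nonnegative and their sum at \<open>q\<close> is 0, while the
    coefficient \<open>b t\<close> is positive.\<close>
  have "f t q = 0" if "q \<noteq> s" for q
  proof -
    have "(\<Sum>r\<in>K. b r * f r q) = 0" using fun_cong[OF e, of q] that by (simp add: sum_fun_apply vec_apply)
    moreover have "b r * f r q \<ge> 0" if "r \<in> K" for r
      using b(1) 2[OF that] by (auto simp: nonneg_def f_def)
    ultimately have "b t * f t q = 0"
      using sum_nonneg_eq_0_iff[OF finite_sub_S[OF K], of "\<lambda>r. b r * f r q"] tK(1) by blast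
    then show ?thesis using tK by simp
  qed
  then have "f t = f t s *\<^sub>R \<alpha> s" by (auto simp: fun_eq_iff vec_apply unit_vec_def)
  moreover have ac: "act (inv w) (\<alpha> t) = \<sigma> *\<^sub>R f t" using ss by (simp add: f_def)
  ultimately have k: "act (inv w) (\<alpha> t) = (\<sigma> * f t s) *\<^sub>R \<alpha> s" by (metis scaleR_scaleR)
  have "\<sigma> * f t s = 1 \<or> \<sigma> * f t s = - 1"
    using root_multiple[OF _ _ _ k] w tK s J K by auto
  moreover have "f t s \<ge> 0" using 2[OF tK(1)] by (auto simp: nonneg_def f_def)
  ultimately have "f t s = 1" using \<sigma> by auto
  then have "act (inv w) (\<alpha> t) = \<sigma> *\<^sub>R \<alpha> s" using k by simp
  then have "\<alpha> t = \<sigma> *\<^sub>R act w (\<alpha> s)" using w by (metis act_inv' act_scale)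
  then have "act w (\<alpha> s) = \<sigma> *\<^sub>R \<alpha> t" using ss by simp
  then show ?thesis using tK by blast
qed

text \<open>The condition on \<open>inv u\<close> lets \<open>simple_map\<close> apply before
  \<open>w0 J\<close> is known to be an involution.\<close>

definition w0 :: "'a set \<Rightarrow> 'a" where
  "w0 J = (SOME u. u \<in> par J \<and> (\<forall>s\<in>J. nonneg (- act u (\<alpha> s)) \<and> nonneg (- act (inv u) (\<alpha> s))))"

text \<open>Any element of greatest length in \<open>par J\<close> works; its inverse has the same
  length, which gives the second half.\<close>

lemma w0_exists:
  assumes "J \<subseteq> S"
  shows "\<exists>u. u \<in> par J \<and> (\<forall>s\<in>J. nonneg (- act u (\<alpha> s)) \<and> nonneg (- act (inv u) (\<alpha> s)))"
proof -
  have fin: "finite (par J)" using finite_carrier generate_incl S_subset assms by (meson finite_subset subset_trans)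
  have "Max (len ` par J) \<in> len ` par J" using fin par_one[of J] by (intro Max_in) (auto simp del: par_one)
  then obtain u where u: "u \<in> par J" "len u = Max (len ` par J)" by auto
  then have max: "\<And>v. v \<in> par J \<Longrightarrow> len v \<le> len u" using fin by simp
  have uc: "u \<in> carrier W" using par_in_W assms u by blast
  have "nonneg (- act u (\<alpha> s)) \<and> nonneg (- act (inv u) (\<alpha> s))" if s: "s \<in> J" for s
  proof
    show "nonneg (- act u (\<alpha> s))"
      using max[of "u \<otimes> s"] u s assms uc par_gen par_mult by (intro descent_imp_nonpos) auto
    show "nonneg (- act (inv u) (\<alpha> s))"
      using max[of "inv u \<otimes> s"] u s assms uc par_gen par_mult par_inv
      by (intro descent_imp_nonpos) (auto simp: len_inv)
  qed
  then show ?thesis using u by blast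
qed

lemma w0_props:
  assumes "J \<subseteq> S"
  shows w0_par: "w0 J \<in> par J" and w0_carrier [simp]: "w0 J \<in> carrier W"
    and w0_neg: "s \<in> J \<Longrightarrow> nonneg (- act (w0 J) (\<alpha> s))"
    and w0_inv_neg: "s \<in> J \<Longrightarrow> nonneg (- act (inv (w0 J)) (\<alpha> s))"
  using someI_ex[OF w0_exists[OF assms]] par_in_W[OF assms] unfolding w0_def by blast+

lemma act_w0_ex:
  assumes J: "J \<subseteq> S" and s: "s \<in> J"
  shows "\<exists>t\<in>J. act (w0 J) (\<alpha> s) = - \<alpha> t"
proof -
  have "\<exists>t\<in>J. act (w0 J) (\<alpha> s) = (-1) *\<^sub>R \<alpha> t"
    using J s w0_neg[OF J] w0_inv_neg[OF J] w0_par[OF J] par_inv[OF J w0_par[OF J]]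
    by (intro simple_map[of J J "w0 J" "-1"]) (auto intro!: act_coord[OF J])
  then show ?thesis by simp
qed

definition opp :: "'a set \<Rightarrow> 'a \<Rightarrow> 'a" where "opp J s = (THE t. act (w0 J) (\<alpha> s) = - \<alpha> t)"

lemma opp:
  assumes "J \<subseteq> S" "s \<in> J"
  shows act_w0: "act (w0 J) (\<alpha> s) = - \<alpha> (opp J s)" and opp_in: "opp J s \<in> J"
proof -
  obtain t where t: "t \<in> J" "act (w0 J) (\<alpha> s) = - \<alpha> t" using act_w0_ex[OF assms] by blast
  then have "opp J s = t" unfolding opp_def by auto
  then show "act (w0 J) (\<alpha> s) = - \<alpha> (opp J s)" "opp J s \<in> J" using t by auto
qed

lemma w0_square [simp]:
  assumes "J \<subseteq> S" shows "w0 J \<otimes> w0 J = \<one>"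
  using assms by (intro par_nonneg_imp_one[OF assms])
    (auto simp: par_mult w0_par act_w0 act_simps opp_in)

lemma w0_inv [simp]: "J \<subseteq> S \<Longrightarrow> inv (w0 J) = w0 J"
  by (simp add: inv_equality)

lemma act_w0_w0 [simp]: "J \<subseteq> S \<Longrightarrow> act (w0 J) (act (w0 J) x) = x"
  by (simp flip: act_mult)

lemma opp_opp: "J \<subseteq> S \<Longrightarrow> s \<in> J \<Longrightarrow> opp J (opp J s) = s"
  using act_w0_w0[of J "\<alpha> s"] by (simp add: act_w0 opp_in act_simps)

lemma w0_unique:
  assumes J: "J \<subseteq> S" and u: "u \<in> par J" "\<And>s. s \<in> J \<Longrightarrow> nonneg (- act u (\<alpha> s))"
  shows "u = w0 J"
proof -
  have c: "u \<in> carrier W" using par_in_W J u by blast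
  have "u \<otimes> w0 J = \<one>"
    using J u c by (intro par_nonneg_imp_one[OF J]) (auto simp: par_mult w0_par act_w0 act_simps opp_in)
  then show ?thesis using J c by (metis inv_equality w0_carrier w0_inv inv_inv)
qed

subsection \<open>Elements that map simple roots to simple roots\<close>

definition simple_in :: "'a set \<Rightarrow> 'a \<Rightarrow> bool" where
  "simple_in J x \<longleftrightarrow> x \<in> carrier W \<and> (\<forall>s\<in>J. \<exists>t\<in>S. act x (\<alpha> s) = \<alpha> t)"

text \<open>Taking the conjugate makes composition and orders of products immediate; whenever
  \<open>x\<close> maps \<open>\<alpha> s\<close> to a simple root, that root is
  \<open>\<alpha> (img x s)\<close>.\<close>

definition img :: "'a \<Rightarrow> 'a \<Rightarrow> 'a" where "img x s = cj x s"

lemma simple_in_img: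
  assumes "J \<subseteq> S" "simple_in J x" "s \<in> J"
  shows act_img: "act x (\<alpha> s) = \<alpha> (img x s)" and img_in_S: "img x s \<in> S"
proof -
  obtain t where "t \<in> S" "act x (\<alpha> s) = \<alpha> t" using assms by (auto simp: simple_in_def)
  then have "img x s = t" using conj_gen_eq_gen[of x s t] assms by (auto simp: img_def simple_in_def)
  then show "act x (\<alpha> s) = \<alpha> (img x s)" "img x s \<in> S"
    using \<open>t \<in> S\<close> \<open>act x (\<alpha> s) = \<alpha> t\<close> by auto
qed

lemma simple_in_carrier: "simple_in J x \<Longrightarrow> x \<in> carrier W"
  by (simp add: simple_in_def)

lemma img_inj: "J \<subseteq> S \<Longrightarrow> x \<in> carrier W \<Longrightarrow> inj_on (img x) J"
  by (auto simp: inj_on_def img_def subset_iff)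

lemma simple_in_mono: "simple_in J x \<Longrightarrow> K \<subseteq> J \<Longrightarrow> simple_in K x"
  by (auto simp: simple_in_def)

lemma inv_cancel [simp]:
  assumes "g \<in> carrier W" "h \<in> carrier W"
  shows "inv g \<otimes> (g \<otimes> h) = h" "g \<otimes> (inv g \<otimes> h) = h"
  using assms by (simp_all flip: m_assoc)

lemma m_img:
  assumes x: "x \<in> carrier W" and s: "s \<in> S" and t: "t \<in> S"
  shows "m (img x s) (img x t) = m s t"
proof -
  have "img x s \<otimes> img x t = cj x (s \<otimes> t)"
    using x s t by (simp add: img_def m_assoc)
  moreover have "ord (cj x (s \<otimes> t)) = ord (s \<otimes> t)"
  proof -
    have p: "(cj x g) [^] (n::nat) = cj x (g [^] n)" if "g \<in> carrier W" for g n
      using x that by (induction n) (auto simp: m_assoc)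
    have "cj x g = \<one> \<longleftrightarrow> g = \<one>" if "g \<in> carrier W" for g
      using x that by (auto simp: inv_solve_right')
    then show ?thesis using x s t by (auto simp: ord_unique pow_eq_id p)
  qed
  ultimately show ?thesis by (simp add: m_def)
qed

lemma img_m: "J \<subseteq> S \<Longrightarrow> simple_in J x \<Longrightarrow> s \<in> J \<Longrightarrow> t \<in> J \<Longrightarrow> m (img x s) (img x t) = m s t"
  using m_img simple_in_carrier by blast

text \<open>For a right descent \<open>s\<close> of \<open>x\<close> and
  \<open>L = insert s J\<close>, split \<open>x = y u\<close> with \<open>y\<close> shortest in its
  coset of \<open>par L\<close>. Then \<open>u = w0 L \<otimes> w0 J\<close>, because
  \<open>z = u \<otimes> w0 J \<otimes> w0 L\<close> maps every simple root of \<open>L\<close> to a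
  positive one. As \<open>y\<close> is no longer than \<open>x \<otimes> s\<close>, repeated moves
  terminate.\<close>

theorem elementary_move:
  assumes J: "J \<subseteq> S" and x: "simple_in J x" and x1: "x \<noteq> \<one>"
  obtains s y v where "s \<in> S" "s \<notin> J" "v = w0 (insert s J) \<otimes> w0 J" "y \<in> carrier W" "x = y \<otimes> v" "len y < len x"
    "\<And>r. r \<in> J \<Longrightarrow> act v (\<alpha> r) = \<alpha> (opp (insert s J) (opp J r))"
    "simple_in (img v ` J) y" "simple_in J v"
proof -
  have xc: "x \<in> carrier W" using x by (simp add: simple_in_def)
  obtain s where s: "s \<in> S" "len (x \<otimes> s) < len x" using exists_shorter xc x1 by blast
  then have neg: "nonneg (- act x (\<alpha> s))" using descent_imp_nonpos xc by simp
  have sJ: "s \<notin> J"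
  proof
    assume "s \<in> J"
    then have "nonneg (act x (\<alpha> s))" using x by (auto simp: simple_in_def)
    then show False using neg nonneg_antisym act_unit_neq_0[OF xc] by blast
  qed
  define L where "L = insert s J"
  have L: "L \<subseteq> S" and JL: "J \<subseteq> L" using s J by (auto simp: L_def)
  obtain y u where y: "y \<in> carrier W" and u: "u \<in> par L" and xyu: "x = y \<otimes> u"
    and ynn: "\<And>s. s \<in> L \<Longrightarrow> nonneg (act y (\<alpha> s))" and ymin: "\<And>v. v \<in> par L \<Longrightarrow> len y \<le> len (x \<otimes> v)"
    using min_coset_rep[OF L xc] by blast
  have uc: "u \<in> carrier W" using par_in_W L u by blast
  have wJ: "w0 J \<in> par L" using w0_par[OF J] par_mono[OF JL] by blast
  define v where "v = w0 L \<otimes> w0 J"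
  have v: "v \<in> carrier W" using L J by (simp add: v_def)
  define z where "z = u \<otimes> w0 J \<otimes> w0 L"
  have zL: "z \<in> par L" unfolding z_def using u wJ w0_par[OF L] by (intro par_mult)
  have "nonneg (act z (\<alpha> t))" if t: "t \<in> L" for t
  proof -
    define t' where "t' = opp L t"
    have t': "t' \<in> L" "act z (\<alpha> t) = - act u (act (w0 J) (\<alpha> t'))"
      using t L J uc by (simp_all add: t'_def opp_in z_def act_w0 act_simps)
    show ?thesis
    proof (cases "t' \<in> J")
      \<comment> \<open>The two longest elements together send \<open>\<alpha> t\<close> to
        \<open>\<alpha> r\<close> with \<open>r\<close> in \<open>J\<close>. Since
        \<open>x = y u\<close> maps \<open>\<alpha> r\<close> to a simple root, \<open>y\<close>
        detects that \<open>act u (\<alpha> r)\<close> is positive.\<close>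
      case True
      define r where "r = opp J t'"
      have r: "r \<in> J" "act z (\<alpha> t) = act u (\<alpha> r)" using True t' J by (simp_all add: r_def opp_in act_w0 act_simps)
      have "nonneg (act y (act u (\<alpha> r)))" using x r xyu y uc by (auto simp: simple_in_def)
      then have "nonneg (act u (\<alpha> r))"
        using nonneg_root_reflect[OF L y ynn uc, of r] act_coord[OF L u, of L "\<alpha> r"] r JL L J by auto
      then show ?thesis using r by simp
    next
      case False
      then have ts: "t' = s" using t' by (simp add: L_def)
      define g where "g = u \<otimes> w0 J"
      have g: "g \<in> par L" "g \<in> carrier W" using u wJ uc J by (auto simp: g_def par_mult)
      have gs: "act g (\<alpha> s) = act u (act (w0 J) (\<alpha> s))" using uc J by (simp add: g_def)
      have d: "act (w0 J) (\<alpha> s) - \<alpha> s \<in> coord J" using act_diff_coord J w0_par by blast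
      define J' where "J' = img x ` J"
      have J': "act x e \<in> coord J'" if "e \<in> coord J" for e
      proof -
        have "act x e = (\<Sum>r\<in>J. e r *\<^sub>R \<alpha> (img x r))"
          by (subst coord_expand[OF finite_sub_S[OF J] that]) (simp add: act_simps act_img[OF J x])
        also have "\<dots> \<in> coord J'" by (intro coord_sum coord_scale) (simp add: J'_def)
        finally show ?thesis .
      qed
      \<comment> \<open>As \<open>s\<close> is outside \<open>J\<close>, the negative root
        \<open>act x (\<alpha> s)\<close> has a nonzero, hence negative, coordinate outside
        \<open>J'\<close>. Applying \<open>w0 J\<close> to \<open>\<alpha> s\<close> beforehand only
        changes coordinates inside \<open>J'\<close>, so the result is negative as well.\<close>
      have "act x (\<alpha> s) \<notin> coord J'"
      proof
        assume a: "act x (\<alpha> s) \<in> coord J'"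
        have fJ': "finite J'" using finite_sub_S[OF J] by (simp add: J'_def)
        have "act (inv x) (\<alpha> q) \<in> coord J" if q: "q \<in> J'" for q
        proof -
          obtain r where r: "r \<in> J" "q = img x r" using q by (auto simp: J'_def)
          then have "act (inv x) (\<alpha> q) = \<alpha> r" using act_img[OF J x r(1)] xc by (metis act_inv)
          then show ?thesis using r by simp
        qed
        then have "act (inv x) (act x (\<alpha> s)) \<in> coord J"
          by (subst coord_expand[OF fJ' a]) (auto simp: act_simps intro!: coord_sum coord_scale)
        then show False using xc sJ by simp
      qed
      then obtain q where q: "q \<notin> J'" "act x (\<alpha> s) q \<noteq> 0" by (auto simp: coord_def)
      then have "act x (\<alpha> s) q < 0" using neg by (auto simp: nonneg_def vec_apply less_le)
      moreover have "act x (act (w0 J) (\<alpha> s)) q = act x (\<alpha> s) q"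
        using J'[OF d] q(1) by (auto simp: coord_def act_simps vec_apply)
      ultimately have "act (x \<otimes> w0 J) (\<alpha> s) q < 0" using xc J by simp
      then have n: "nonneg (- act (x \<otimes> w0 J) (\<alpha> s))" using act_unit_nonposI[of "x \<otimes> w0 J" s q] xc J s by simp
      have "\<not> nonneg (act g (\<alpha> s))"
      proof
        assume "nonneg (act g (\<alpha> s))"
        moreover have "act g (\<alpha> s) \<in> coord L" using act_coord[OF L g(1), of L] by (simp add: L_def)
        ultimately have "nonneg (act y (act g (\<alpha> s)))" using nonneg_act[OF L ynn] by blast
        moreover have "act y (act g (\<alpha> s)) = act (x \<otimes> w0 J) (\<alpha> s)" using xyu y uc J xc by (simp add: gs)
        ultimately show False using n nonneg_antisym act_unit_neq_0[of "x \<otimes> w0 J" s] xc J by auto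
      qed
      then have "nonneg (- act g (\<alpha> s))" using act_unit_cases g s by blast
      then show ?thesis using t' ts gs by simp
    qed
  qed
  then have "z = \<one>" by (rule par_nonneg_imp_one[OF L zL])
  then have "u \<otimes> (w0 J \<otimes> w0 L) = \<one>" using uc J L by (simp add: z_def m_assoc)
  then have "inv (w0 J \<otimes> w0 L) = u" using uc J L by (intro inv_equality) auto
  then have "u = v" using J L by (simp add: v_def inv_mult_group)
  have av: "act v (\<alpha> r) = \<alpha> (opp L (opp J r))" if "r \<in> J" for r
    using that J L JL by (simp add: v_def act_w0 act_simps opp_in subset_iff)
  have sv: "simple_in J v" using v av opp_in[OF L] opp_in[OF J] JL L
    by (auto simp: simple_in_def subset_iff)
  have "simple_in (img v ` J) y"
    unfolding simple_in_def
  proof (intro conjI ballI y)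
    fix q assume "q \<in> img v ` J"
    then obtain r where r: "r \<in> J" "q = img v r" by blast
    then have "act y (\<alpha> q) = act x (\<alpha> r)" using act_img[OF J sv r(1)] xyu \<open>u = v\<close> y v by simp
    then show "\<exists>t\<in>S. act y (\<alpha> q) = \<alpha> t" using x r by (auto simp: simple_in_def)
  qed
  moreover have "len y < len x" using ymin[of s] s par_gen[of s L] by (simp add: L_def)
  ultimately show thesis using that[of s v y] s sJ xyu y av sv \<open>u = v\<close> by (simp add: v_def L_def)
qed

end

context finite_coxeter
begin

subsection \<open>Parabolic subgroups as stabilizers\<close>

text \<open>With \<open>parabolic_iff_stab\<close>, intersections and conjugates of parabolic
  subgroups become statements about vectors.\<close>

definition stab :: "('a \<Rightarrow> real) \<Rightarrow> 'a set" where
  "stab x = {w \<in> carrier W. act w x = x}"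

lemma stab_subgroup: "subgroup (stab x) W"
proof (rule subgroupI)
  show "stab x \<noteq> {}" by (auto simp: stab_def intro: exI[of _ \<one>])
  show "inv a \<in> stab x" if "a \<in> stab x" for a
    using that act_inv[of a x] by (simp add: stab_def)
qed (auto simp: stab_def)

lemma stab_act: "g \<in> carrier W \<Longrightarrow> w \<in> carrier W \<Longrightarrow> w \<in> stab (act g x) \<longleftrightarrow> inv g \<otimes> w \<otimes> g \<in> stab x"
  using act_inj[of "inv g" "act w (act g x)" "act g x"] by (simp add: stab_def)

text \<open>If \<open>s\<close> is a right descent of \<open>w\<close>, then
  \<open>act w (\<alpha> s)\<close> is negative, so its product with the dominant \<open>x\<close>
  is at most 0. As \<open>w\<close> fixes \<open>x\<close>, this product equals
  \<open>bform x (\<alpha> s)\<close>, which therefore vanishes, and \<open>s\<close> can be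
  stripped from \<open>w\<close>.\<close>

lemma stab_dominant:
  assumes dom: "\<And>s. s \<in> S \<Longrightarrow> bform x (\<alpha> s) \<ge> 0" and w: "w \<in> stab x"
  shows "w \<in> par {s \<in> S. bform x (\<alpha> s) = 0}"
  using w
proof (induction "len w" arbitrary: w rule: less_induct)
  case less
  let ?J = "{s \<in> S. bform x (\<alpha> s) = 0}"
  have w: "w \<in> carrier W" "act w x = x" using less.prems by (auto simp: stab_def)
  show ?case
  proof (cases "w = \<one>")
    case False
    obtain s where s: "s \<in> S" "len (w \<otimes> s) < len w" using exists_shorter[OF w(1) False] by blast
    have n: "nonneg (- act w (\<alpha> s))" using descent_imp_nonpos w s by simp
    have c: "act w (\<alpha> s) \<in> coord S" using act_coord_S w s by simp
    have "bform x (\<alpha> s) = bform x (act w (\<alpha> s))" using bform_act[OF w(1), of x "\<alpha> s"] w by simp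
    also have "\<dots> = (\<Sum>t\<in>S. act w (\<alpha> s) t * bform x (\<alpha> t))"
      by (subst coord_expand[OF finite_S c]) (simp add: bform_sum_right bform_simps)
    also have "\<dots> \<le> 0"
      by (intro sum_nonpos mult_nonpos_nonneg dom) (use n in \<open>auto simp: nonneg_def vec_apply\<close>)
    finally have z: "bform x (\<alpha> s) = 0" using dom[OF s(1)] by simp
    then have "w \<otimes> s \<in> stab x" using w s by (simp add: stab_def act_gen)
    then have "w \<otimes> s \<in> par ?J" using less.hyps s by blast
    then have "w \<otimes> s \<otimes> s \<in> par ?J" using par_mult par_gen z s by simp
    then show ?thesis using w s by (simp add: m_assoc)
  qed simp
qed

text \<open>A vector of maximal coordinate sum in the orbit is dominant, because \<open>s\<close>
  lowers the sum by twice the product with \<open>\<alpha> s\<close>.\<close>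

lemma dominant_representative:
  assumes "x \<in> coord S"
  obtains w where "w \<in> carrier W" "\<And>s. s \<in> S \<Longrightarrow> bform (act w x) (\<alpha> s) \<ge> 0"
proof -
  define h where "h w = (\<Sum>t\<in>S. act w x t)" for w
  have "Max (h ` carrier W) \<in> h ` carrier W" using finite_carrier one_closed by (intro Max_in) blast+
  then obtain w where w: "w \<in> carrier W" "h w = Max (h ` carrier W)" by force
  have "bform (act w x) (\<alpha> s) \<ge> 0" if s: "s \<in> S" for s
  proof -
    have "h (s \<otimes> w) \<le> h w" using w s finite_carrier by simp
    moreover have "h (s \<otimes> w) = h w - 2 * bform (act w x) (\<alpha> s) * (\<Sum>t\<in>S. \<alpha> s t)"
      using w s by (simp add: h_def act_gen vec_apply sum_subtractf sum_distrib_left)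
    moreover have "(\<Sum>t\<in>S. \<alpha> s t) = 1" using s by (simp add: unit_vec_def)
    ultimately show ?thesis by simp
  qed
  then show thesis using that w by blast
qed

lemma par_subset_stab: "J \<subseteq> S \<Longrightarrow> (\<And>s. s \<in> J \<Longrightarrow> bform x (\<alpha> s) = 0) \<Longrightarrow> par J \<subseteq> stab x"
  using generate_subgroup_incl[OF _ stab_subgroup[of x], of J] by (auto simp: stab_def act_gen subset_iff)

lemma stab_par: "J \<subseteq> S \<Longrightarrow> (\<And>s. s \<in> S \<Longrightarrow> bform x (\<alpha> s) \<ge> 0) \<Longrightarrow> (\<And>s. s \<in> S \<Longrightarrow> bform x (\<alpha> s) = 0 \<longleftrightarrow> s \<in> J)
   \<Longrightarrow> stab x = par J"
proof -
  assume a: "J \<subseteq> S" "\<And>s. s \<in> S \<Longrightarrow> bform x (\<alpha> s) \<ge> 0" "\<And>s. s \<in> S \<Longrightarrow> bform x (\<alpha> s) = 0 \<longleftrightarrow> s \<in> J"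
  then have "{s \<in> S. bform x (\<alpha> s) = 0} = J" by auto
  then show ?thesis using stab_dominant[of x] par_subset_stab[of J x] a by auto
qed

lemma conj_set_eq:
  assumes "g \<in> carrier W" "H \<subseteq> carrier W"
  shows "g <# H #> inv g = {w \<in> carrier W. inv g \<otimes> w \<otimes> g \<in> H}"
proof (intro equalityI subsetI)
  fix w assume "w \<in> g <# H #> inv g"
  then obtain h where "h \<in> H" "w = cj g h" by (auto simp: l_coset_def r_coset_def)
  then show "w \<in> {w \<in> carrier W. inv g \<otimes> w \<otimes> g \<in> H}" using assms
    by (auto simp: m_assoc subset_iff)
next
  fix w assume w: "w \<in> {w \<in> carrier W. inv g \<otimes> w \<otimes> g \<in> H}"
  then have "w = cj g (inv g \<otimes> w \<otimes> g)" using assms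
    by (simp add: m_assoc)
  then show "w \<in> g <# H #> inv g" using w unfolding l_coset_def r_coset_def by blast
qed

lemma stab_conj: "g \<in> carrier W \<Longrightarrow> g <# stab x #> inv g = stab (act g x)"
  using conj_set_eq[of g "stab x"] stab_act[of g _ x] by (auto simp: stab_def)

text \<open>The sum of the images of \<open>\<alpha> t\<close> under \<open>par (S - {t})\<close> is
  fixed by that group, hence orthogonal to its simple roots. Its coordinate at \<open>t\<close> is
  the group order, so \<open>bform x x > 0\<close> determines the sign of the remaining
  product.\<close>

lemma fundamental_weight:
  assumes t: "t \<in> S"
  shows "\<exists>x\<in>coord S. bform x (\<alpha> t) > 0 \<and> (\<forall>s\<in>S - {t}. bform x (\<alpha> s) = 0)"
proof -
  let ?J = "S - {t}"
  have J: "?J \<subseteq> S" by blast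
  define x where "x = (\<Sum>u\<in>par ?J. act u (\<alpha> t))"
  have fin: "finite (par ?J)" using finite_carrier par_in_W[OF J] by (meson finite_subset subsetI)
  have z: "bform x (\<alpha> s) = 0" if s: "s \<in> ?J" for s
  proof -
    have "bij_betw ((\<otimes>) s) (par ?J) (par ?J)"
      by (rule bij_betwI[where g = "(\<otimes>) s"]) (use s J par_in_W[OF J] par_gen par_mult in \<open>auto simp: subset_iff\<close>)
    then have "(\<Sum>u\<in>par ?J. act (s \<otimes> u) (\<alpha> t)) = x"
      unfolding x_def by (rule sum.reindex_bij_betw[of "(\<otimes>) s" _ _ "\<lambda>u. act u (\<alpha> t)"])
    moreover have "(\<Sum>u\<in>par ?J. act (s \<otimes> u) (\<alpha> t)) = act s x"
      unfolding x_def act_sum using s J par_in_W[OF J] by (intro sum.cong) auto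
    ultimately have "act s x s = x s" by simp
    then show ?thesis using s J by (auto simp: act_gen vec_apply subset_iff)
  qed
  have xS: "x \<in> coord S" unfolding x_def using t by (intro coord_sum act_coord_S par_in_W[OF J]) auto
  have "x t = (\<Sum>u\<in>par ?J. 1)" unfolding x_def sum_fun_apply
    by (intro sum.cong refl) (use act_outside[OF par_in_W[OF J] J, of _ t "\<alpha> t"] in simp)
  moreover have "card (par ?J) > 0" using fin par_one unfolding card_gt_0_iff by blast
  ultimately have xt: "x t > 0" by simp
  have "bform x x = (\<Sum>s\<in>S. x s * bform x (\<alpha> s))"
    by (subst (2) coord_expand[OF finite_S xS]) (simp add: bform_sum_right bform_simps)
  also have "\<dots> = (\<Sum>s\<in>{t}. x s * bform x (\<alpha> s))" using t z by (intro sum.mono_neutral_right) auto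
  finally have "bform x x = x t * bform x (\<alpha> t)" by simp
  moreover have "bform x x > 0" using xt by (intro bform_pos xS) (auto simp: vec_apply)
  ultimately show ?thesis using z xS xt zero_less_mult_pos by metis
qed

text \<open>The sum of the fundamental weights outside \<open>J\<close> is dominant and orthogonal
  to exactly the simple roots in \<open>J\<close>.\<close>

lemma exists_stab_par:
  assumes J: "J \<subseteq> S" shows "\<exists>x\<in>coord S. stab x = par J"
proof -
  obtain f where f: "\<And>t. t \<in> S \<Longrightarrow> f t \<in> coord S" "\<And>t. t \<in> S \<Longrightarrow> bform (f t) (\<alpha> t) > 0"
    "\<And>s t. t \<in> S \<Longrightarrow> s \<in> S - {t} \<Longrightarrow> bform (f t) (\<alpha> s) = 0"
    using fundamental_weight by metis
  define x where "x = (\<Sum>t\<in>S - J. f t)"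
  have b: "bform x (\<alpha> s) = (if s \<in> J then 0 else bform (f s) (\<alpha> s))" if s: "s \<in> S" for s
  proof -
    have "bform x (\<alpha> s) = (\<Sum>t\<in>S - J. if t = s then bform (f s) (\<alpha> s) else 0)"
      unfolding x_def bform_sum_left using f(3) s by (intro sum.cong) auto
    then show ?thesis using s by simp
  qed
  have "stab x = par J" using b f(2) by (intro stab_par[OF J]) (auto simp: less_imp_le, metis less_irrefl)
  moreover have "x \<in> coord S" unfolding x_def using f(1) by (intro coord_sum) auto
  ultimately show ?thesis by blast
qed

lemma parabolic_iff_stab: "parabolic W S P \<longleftrightarrow> (\<exists>x\<in>coord S. P = stab x)"
proof
  assume "parabolic W S P"
  then obtain M g where "M \<subseteq> S" "g \<in> carrier W" "P = g <# par M #> inv g" by (auto simp: parabolic_def)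
  then show "\<exists>x\<in>coord S. P = stab x"
    using exists_stab_par[of M] stab_conj act_coord_S by metis
next
  assume "\<exists>x\<in>coord S. P = stab x"
  then obtain x where x: "x \<in> coord S" "P = stab x" by blast
  obtain w where w: "w \<in> carrier W" "\<And>s. s \<in> S \<Longrightarrow> bform (act w x) (\<alpha> s) \<ge> 0" using dominant_representative[OF x(1)] by blast
  have "stab (act w x) = par {s \<in> S. bform (act w x) (\<alpha> s) = 0}" using w by (intro stab_par) auto
  then have "P = inv w <# par {s \<in> S. bform (act w x) (\<alpha> s) = 0} #> inv (inv w)"
    using stab_conj[of "inv w" "act w x"] w x by simp
  moreover have "{s \<in> S. bform (act w x) (\<alpha> s) = 0} \<subseteq> S" by auto
  ultimately show "parabolic W S P" using w(1) inv_closed unfolding parabolic_def by metis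
qed

text \<open>For generic \<open>e\<close>, an element fixing \<open>x + e y\<close> fixes both
  vectors: each \<open>w\<close> that moves \<open>x\<close> rules out at most one value of
  \<open>e\<close>, and \<open>e = 0\<close> is ruled out as well.\<close>

lemma parabolic_Int:
  assumes "parabolic W S P" "parabolic W S Q" shows "parabolic W S (P \<inter> Q)"
proof -
  obtain x y where x: "x \<in> coord S" "P = stab x" and y: "y \<in> coord S" "Q = stab y"
    using assms by (auto simp: parabolic_iff_stab)
  define bad where "bad w = {e::real. act w x \<noteq> x \<and> act w (x + e *\<^sub>R y) = x + e *\<^sub>R y}" for w
  have "finite (bad w)" for w
  proof -
    have "a = b" if a: "a \<in> bad w" and b: "b \<in> bad w" for a b
    proof -
      have e: "act w x - x = a *\<^sub>R (y - act w y)" "act w x - x = b *\<^sub>R (y - act w y)" "act w x - x \<noteq> 0"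
        using a b by (auto simp: bad_def act_simps algebra_simps)
      then have "(a - b) *\<^sub>R (y - act w y) = 0" by (metis eq_iff_diff_eq_0 scaleR_left.diff)
      then show "a = b" using e by auto
    qed
    then have "bad w \<subseteq> {SOME e. e \<in> bad w}" by (metis singletonI someI_ex subsetI)
    then show ?thesis using finite_subset by blast
  qed
  then have "finite (insert 0 (\<Union>w\<in>carrier W. bad w))" using finite_carrier by simp
  then obtain e where e: "e \<notin> insert 0 (\<Union>w\<in>carrier W. bad w)" using ex_new_if_finite infinite_UNIV_char_0 by blast
  have "stab (x + e *\<^sub>R y) = P \<inter> Q"
    using e unfolding x y stab_def bad_def by (auto simp: act_simps)
  moreover have "x + e *\<^sub>R y \<in> coord S" using x y by (intro coord_add coord_scale)
  ultimately show ?thesis using parabolic_iff_stab by blast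
qed

text \<open>A parabolic subgroup of least order containing \<open>w\<close> lies in every other one,
  since its intersection with that one is again parabolic.\<close>

lemma parabolic_closure_props:
  assumes "w \<in> carrier W"
  defines "V \<equiv> parabolic_closure W S w"
  shows parabolic_parabolic_closure: "parabolic W S V" and mem_parabolic_closure: "w \<in> V"
    and parabolic_closure_least: "parabolic W S P \<Longrightarrow> w \<in> P \<Longrightarrow> V \<subseteq> P"
proof -
  show "w \<in> V" unfolding V_def parabolic_closure_def by blast
  show "V \<subseteq> P" if "parabolic W S P" "w \<in> P" for P
    using that unfolding V_def parabolic_closure_def by blast
  define Q where "Q = arg_min card (\<lambda>P. parabolic W S P \<and> w \<in> P)"
  have "parabolic W S (carrier W) \<and> w \<in> carrier W"
    using assms parabolic_iff_stab[of "carrier W"] by (auto simp: stab_def intro!: bexI[of _ 0])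
  then have Q: "parabolic W S Q \<and> w \<in> Q"
    unfolding Q_def by (rule arg_min_natI)
  have min: "\<And>P. parabolic W S P \<and> w \<in> P \<Longrightarrow> card Q \<le> card P"
    unfolding Q_def by (rule arg_min_nat_le)
  have finQ: "finite Q" using Q parabolic_iff_stab finite_carrier by (auto simp: stab_def)
  have "Q \<subseteq> P" if P: "parabolic W S P" "w \<in> P" for P
  proof -
    have "card Q \<le> card (P \<inter> Q)" using min parabolic_Int P Q by blast
    then show ?thesis using finQ card_seteq[of Q "P \<inter> Q"] by blast
  qed
  then have "V = Q" unfolding V_def parabolic_closure_def using Q by blast
  then show "parabolic W S V" using Q by simp
qed

text \<open>For \<open>J \<subseteq> S\<close> this amounts to \<open>w\<close> lying in no proper
  parabolic subgroup of \<open>par J\<close>; \<open>cuspidal_not_proper\<close> is the direction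
  used in type A, while the fixed vector condition serves in type D.\<close>

definition cuspidal :: "'a set \<Rightarrow> 'a \<Rightarrow> bool" where
  "cuspidal J w \<longleftrightarrow> w \<in> par J \<and> (\<forall>x\<in>coord J. act w x = x \<longrightarrow> x = 0)"

lemma cuspidal_par: "cuspidal J w \<Longrightarrow> w \<in> par J"
  by (simp add: cuspidal_def)

lemma bform_zero_imp_zero:
  assumes "J \<subseteq> S" "x \<in> coord J" "\<And>s. s \<in> J \<Longrightarrow> bform x (\<alpha> s) = 0"
  shows "x = 0"
proof -
  have "bform x x = (\<Sum>s\<in>J. x s * bform x (\<alpha> s))"
    by (subst (2) coord_expand[OF finite_sub_S[OF assms(1)] assms(2)]) (simp add: bform_sum_right bform_simps)
  also have "\<dots> = 0" using assms by simp
  finally show ?thesis using bform_pos[of x] coord_mono assms by fastforce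
qed

text \<open>If the conjugate of \<open>w\<close> fixes \<open>x\<close> in \<open>coord J\<close>,
  the stabilizer of \<open>act g x\<close> is a parabolic subgroup containing \<open>w\<close>,
  hence contains the closure. So the reflections in \<open>J\<close> fix \<open>x\<close>, which
  makes \<open>x\<close> orthogonal to all simple roots of \<open>J\<close> and thus zero.\<close>

lemma parabolic_closure_standard:
  assumes "w \<in> carrier W"
  obtains J g where "J \<subseteq> S" "g \<in> carrier W" "parabolic_closure W S w = g <# par J #> inv g"
    "cuspidal J (inv g \<otimes> w \<otimes> g)"
proof -
  let ?V = "parabolic_closure W S w"
  obtain J g where J: "J \<subseteq> S" and g: "g \<in> carrier W" and V: "?V = g <# par J #> inv g"
    using parabolic_parabolic_closure[OF assms] by (auto simp: parabolic_def)
  have Vc: "?V = {v \<in> carrier W. inv g \<otimes> v \<otimes> g \<in> par J}"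
    unfolding V using conj_set_eq[OF g, of "par J"] par_in_W[OF J] by blast
  have "x = 0" if x: "x \<in> coord J" "act (inv g \<otimes> w \<otimes> g) x = x" for x
  proof -
    have "w \<in> stab (act g x)" using stab_act[of g w x] g assms x by (auto simp: stab_def)
    moreover have "act g x \<in> coord S" using x(1) coord_mono[OF J] act_coord_S g by blast
    ultimately have sub: "?V \<subseteq> stab (act g x)" using parabolic_closure_least[OF assms] parabolic_iff_stab by blast
    have "bform x (\<alpha> s) = 0" if s: "s \<in> J" for s
    proof -
      have sS: "s \<in> S" using s J by blast
      have "inv g \<otimes> (cj g s) \<otimes> g = s" using g sS by (simp add: m_assoc)
      then have "cj g s \<in> ?V" using s sS g par_gen unfolding Vc by simp
      then have "s \<in> stab x" using sub stab_act[of g "cj g s" x] g sS \<open>inv g \<otimes> (cj g s) \<otimes> g = s\<close> by auto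
      then have "act s x s = x s" by (simp add: stab_def)
      then show ?thesis using sS by (simp add: act_gen vec_apply)
    qed
    then show ?thesis using bform_zero_imp_zero[OF J] x by blast
  qed
  moreover have "inv g \<otimes> w \<otimes> g \<in> par J" using mem_parabolic_closure[OF assms] Vc by blast
  ultimately show thesis using that[OF J g V] by (simp add: cuspidal_def)
qed

subsection \<open>The normalizer of a standard parabolic subgroup\<close>

definition ncomp :: "'a set \<Rightarrow> 'a set" where
  "ncomp J = {x \<in> carrier W. \<forall>s\<in>J. \<exists>t\<in>J. act x (\<alpha> s) = \<alpha> t}"

lemma ncomp_simple_in: "J \<subseteq> S \<Longrightarrow> x \<in> ncomp J \<Longrightarrow> simple_in J x"
  unfolding ncomp_def simple_in_def by blast

lemma ncomp_carrier: "x \<in> ncomp J \<Longrightarrow> x \<in> carrier W"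
  by (auto simp: ncomp_def)

lemma ncomp_img:
  assumes "J \<subseteq> S" "x \<in> ncomp J"
  shows "img x ` J = J"
proof (rule endo_inj_surj[OF finite_sub_S[OF assms(1)]])
  show "img x ` J \<subseteq> J"
  proof (rule image_subsetI)
    fix s assume s: "s \<in> J"
    then obtain t where "t \<in> J" "act x (\<alpha> s) = \<alpha> t" using assms by (auto simp: ncomp_def)
    then show "img x s \<in> J" using act_img[OF assms(1) ncomp_simple_in[OF assms] s] by simp
  qed
  show "inj_on (img x) J" using img_inj assms ncomp_carrier by blast
qed

lemma ncomp_subgroup:
  assumes J: "J \<subseteq> S" shows "subgroup (ncomp J) W"
proof (rule subgroupI)
  show "ncomp J \<subseteq> carrier W" by (auto simp: ncomp_def)
  show "ncomp J \<noteq> {}" by (auto simp: ncomp_def intro!: exI[of _ \<one>])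
  show "a \<otimes> b \<in> ncomp J" if "a \<in> ncomp J" "b \<in> ncomp J" for a b
    using that by (fastforce simp: ncomp_def)
  show "inv a \<in> ncomp J" if a: "a \<in> ncomp J" for a
    unfolding ncomp_def
  proof (intro CollectI conjI ballI)
    show "inv a \<in> carrier W" using a ncomp_carrier by simp
    fix t assume "t \<in> J"
    then obtain s where s: "s \<in> J" "t = img a s" using ncomp_img[OF J a] by blast
    then have "act (inv a) (\<alpha> t) = \<alpha> s" using act_img[OF J ncomp_simple_in[OF J a] s(1)] ncomp_carrier[OF a] by (metis act_inv)
    then show "\<exists>s\<in>J. act (inv a) (\<alpha> t) = \<alpha> s" using s by blast
  qed
qed

lemma conj_word: "x \<in> carrier W \<Longrightarrow> u \<in> carrier W \<Longrightarrow> v \<in> carrier W \<Longrightarrow>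
   x \<otimes> (u \<otimes> v) \<otimes> inv x = (cj x u) \<otimes> (cj x v)"
  by (simp add: m_assoc)

lemma simple_in_conj_par:
  assumes J: "J \<subseteq> S" and K: "K \<subseteq> J" and x: "simple_in J x" and u: "u \<in> par K"
  shows "cj x u \<in> par (img x ` K)"
proof -
  have xc: "x \<in> carrier W" using x by (simp add: simple_in_def)
  have KS: "K \<subseteq> S" using J K by simp
  from u show ?thesis
  proof induction
    case (eng h1 h2)
    then show ?case using conj_word[OF xc] par_in_W[OF KS] generate.eng by (metis (no_types, lifting))
  next
    case (inv h)
    then show ?case using KS par_gen[of "img x h" "img x ` K"] by (auto simp: img_def subset_iff)
  qed (use xc par_gen in \<open>auto simp: img_def\<close>)
qed

lemma ncomp_par_Int: "J \<subseteq> S \<Longrightarrow> x \<in> ncomp J \<Longrightarrow> x \<in> par J \<Longrightarrow> x = \<one>"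
  by (rule par_nonneg_imp_one) (auto simp: ncomp_def)

text \<open>The shortest element \<open>y\<close> of the coset of \<open>x\<close> still normalizes
  \<open>par J\<close> and sends \<open>J\<close> to positive roots. It and its inverse keep these
  roots inside \<open>coord J\<close>, so \<open>simple_map\<close> shows that it permutes the
  simple ones.\<close>

lemma normalizes_imp_ncomp:
  assumes J: "J \<subseteq> S" and x: "x \<in> carrier W"
    and nrm: "\<And>v. v \<in> par J \<Longrightarrow> cj x v \<in> par J" "\<And>v. v \<in> par J \<Longrightarrow> inv x \<otimes> v \<otimes> x \<in> par J"
  obtains v n where "v \<in> par J" "n \<in> ncomp J" "x = v \<otimes> n"
proof -
  obtain y u where y: "y \<in> carrier W" and u: "u \<in> par J" and xy: "x = y \<otimes> u" and ynn: "\<And>s. s \<in> J \<Longrightarrow> nonneg (act y (\<alpha> s))"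
    using min_coset_rep[OF J x] by metis
  have uc: "u \<in> carrier W" using par_in_W J u by blast
  have y': "y = x \<otimes> inv u" using xy y uc by (simp add: m_assoc)
  have iu: "inv u \<in> par J" using par_inv J u by blast
  have ny: "cj y v \<in> par J" if v: "v \<in> par J" for v
  proof -
    have vc: "v \<in> carrier W" using par_in_W J v by blast
    have "cj y v = cj x (inv u \<otimes> v \<otimes> u)"
      using y' x uc vc by (simp add: inv_mult_group m_assoc)
    then show ?thesis using nrm(1) v u iu par_mult by simp
  qed
  have ny': "inv y \<otimes> v \<otimes> y \<in> par J" if v: "v \<in> par J" for v
  proof -
    have vc: "v \<in> carrier W" using par_in_W J v by blast
    have "inv y \<otimes> v \<otimes> y = cj u (inv x \<otimes> v \<otimes> x)"
      using y' x uc vc by (simp add: inv_mult_group m_assoc)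
    then show ?thesis using nrm(2) v u iu par_mult by simp
  qed
  \<comment> \<open>The reflection in the root \<open>act z (\<alpha> s)\<close> lies in
    \<open>par J\<close> and negates it, while elements of \<open>par J\<close> change vectors only
    by elements of \<open>coord J\<close>.\<close>
  have coord: "act z (\<alpha> s) \<in> coord J" if z: "z \<in> carrier W" "cj z s \<in> par J" and s: "s \<in> J" for z s
  proof -
    have sS: "s \<in> S" using s J by blast
    let ?b = "act z (\<alpha> s)"
    have "act (cj z s) ?b = - ?b" using z(1) sS by (simp add: m_assoc act_simps)
    then have "- ?b - ?b \<in> coord J" using act_diff_coord[OF J z(2), of ?b] by simp
    then have "(- 1 / 2) *\<^sub>R (- ?b - ?b) \<in> coord J" by (rule coord_scale)
    moreover have "(- 1 / 2) *\<^sub>R (- ?b - ?b) = ?b" by (simp add: fun_eq_iff vec_apply)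
    ultimately show ?thesis by simp
  qed
  have c1: "act y (\<alpha> s) \<in> coord J" if "s \<in> J" for s
    using coord[OF y ny[OF par_gen[OF that]] that] .
  have c2: "act (inv y) (\<alpha> s) \<in> coord J" if "s \<in> J" for s
    using coord[of "inv y" s] ny'[OF par_gen[OF that]] that y by simp
  have p2: "nonneg (act (inv y) (\<alpha> s))" if "s \<in> J" for s
    using nonneg_root_reflect[OF J y ynn, of "inv y" s] c2[OF that] that y J by auto
  have yN: "y \<in> ncomp J"
    using simple_map[OF J J y, of 1] c1 c2 p2 ynn y by (auto simp: ncomp_def)
  have "cj y u \<in> par J" using ny u by blast
  moreover have "x = (cj y u) \<otimes> y" using xy y uc by (simp add: m_assoc)
  ultimately show thesis using that yN by blast
qed

end

context finite_coxeter
begin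

subsection \<open>Connected components\<close>

definition adj :: "'a \<Rightarrow> 'a \<Rightarrow> bool" where "adj s t \<longleftrightarrow> s \<noteq> t \<and> m s t \<noteq> 2"

lemma adj_sym: "s \<in> S \<Longrightarrow> t \<in> S \<Longrightarrow> adj s t \<longleftrightarrow> adj t s"
  by (auto simp: adj_def m_sym)

lemma adj_irrefl [simp]: "\<not> adj s s"
  by (simp add: adj_def)

lemma coxeter_edges_iff: "(s, t) \<in> coxeter_edges W M \<longleftrightarrow> s \<in> M \<and> t \<in> M \<and> adj s t"
  by (auto simp: coxeter_edges_def adj_def m_def)

lemma adj_m_ge_3: "s \<in> S \<Longrightarrow> t \<in> S \<Longrightarrow> adj s t \<Longrightarrow> m s t \<ge> 3"
  using m_ge_2[of s t] by (auto simp: adj_def)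

lemma bform_adj_le:
  assumes "s \<in> S" "t \<in> S" "k \<ge> 2" "m s t \<ge> k"
  shows "bform (\<alpha> s) (\<alpha> t) \<le> - cos (pi / real k)"
proof -
  have "cos (pi / real k) \<le> cos (pi / real (m s t))"
    using assms by (intro cos_monotone_0_pi_le) (auto simp: frac_le field_simps)
  then show ?thesis using assms by (simp add: bform_unit)
qed

lemma bform_adj: "s \<in> S \<Longrightarrow> t \<in> S \<Longrightarrow> adj s t \<Longrightarrow> bform (\<alpha> s) (\<alpha> t) \<le> - 1 / 2"
  using bform_adj_le[of s t 3] adj_m_ge_3[of s t] by (simp add: cos_60)

lemma bform_unit_nonpos: "s \<in> S \<Longrightarrow> t \<in> S \<Longrightarrow> s \<noteq> t \<Longrightarrow> bform (\<alpha> s) (\<alpha> t) \<le> 0"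
  using bform_adj_le[of s t 2] m_ge_2[of s t] by simp

definition conn :: "'a set \<Rightarrow> bool" where
  "conn K \<longleftrightarrow> K \<noteq> {} \<and> (\<forall>s\<in>K. \<forall>t\<in>K. (s, t) \<in> (coxeter_edges W K)\<^sup>*)"

definition comp :: "'a set \<Rightarrow> 'a set \<Rightarrow> bool" where
  "comp J K \<longleftrightarrow> K \<subseteq> J \<and> conn K \<and> (\<forall>s\<in>K. \<forall>t\<in>J - K. \<not> adj s t)"

lemma conn_closed:
  assumes "conn K" "s \<in> A" "s \<in> K" "\<And>a b. a \<in> A \<Longrightarrow> a \<in> K \<Longrightarrow> b \<in> K \<Longrightarrow> adj a b \<Longrightarrow> b \<in> A"
  shows "K \<subseteq> A"
proof
  fix t assume "t \<in> K"
  then have "(s, t) \<in> (coxeter_edges W K)\<^sup>*" using assms by (auto simp: conn_def)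
  then have "t \<in> A \<and> t \<in> K"
    by (induction rule: rtrancl_induct) (use assms in \<open>auto simp: coxeter_edges_iff\<close>)
  then show "t \<in> A" by blast
qed

lemma connI:
  assumes "K \<subseteq> S" "s \<in> K"
    and "\<And>A. s \<in> A \<Longrightarrow> A \<subseteq> K \<Longrightarrow> (\<And>a b. a \<in> A \<Longrightarrow> b \<in> K \<Longrightarrow> adj a b \<Longrightarrow> b \<in> A) \<Longrightarrow> A = K"
  shows "conn K"
proof -
  let ?E = "coxeter_edges W K"
  have sym: "sym (?E\<^sup>*)" using adj_sym assms(1) by (intro sym_rtrancl) (auto simp: sym_def coxeter_edges_iff)
  have "{t \<in> K. (s, t) \<in> ?E\<^sup>*} = K"
  proof (rule assms(3))
    show "b \<in> {t \<in> K. (s, t) \<in> ?E\<^sup>*}" if "a \<in> {t \<in> K. (s, t) \<in> ?E\<^sup>*}" "b \<in> K" "adj a b" for a b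
      using that rtrancl_into_rtrancl[of s a ?E b] by (auto simp: coxeter_edges_iff)
  qed (use assms in auto)
  then have st: "(s, t) \<in> ?E\<^sup>*" if "t \<in> K" for t using that by blast
  have "(a, b) \<in> ?E\<^sup>*" if "a \<in> K" "b \<in> K" for a b
    using st[OF that(1)] st[OF that(2)] sym by (meson rtrancl_trans symD)
  then show ?thesis using assms(2) by (auto simp: conn_def)
qed

lemma comp_iff: "J \<subseteq> S \<Longrightarrow> irreducible_component W J K \<longleftrightarrow> comp J K"
proof
  assume J: "J \<subseteq> S" and "irreducible_component W J K"
  then obtain s where s: "s \<in> J" "K = (coxeter_edges W J)\<^sup>* `` {s}" by (auto simp: irreducible_component_def)
  have KJ: "K \<subseteq> J"
  proof
    fix t assume "t \<in> K"
    then have "(s, t) \<in> (coxeter_edges W J)\<^sup>*" using s by simp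
    then show "t \<in> J" using s(1) by (induction rule: rtrancl_induct) (auto simp: coxeter_edges_iff)
  qed
  have cl: "t \<in> K" if "r \<in> K" "t \<in> J" "adj r t" for r t
  proof -
    have "(s, r) \<in> (coxeter_edges W J)\<^sup>*" "(r, t) \<in> coxeter_edges W J" using that s KJ by (auto simp: coxeter_edges_iff)
    then show ?thesis using s by (auto intro: rtrancl_into_rtrancl)
  qed
  have sK: "s \<in> K" using s by simp
  have "conn K"
  proof (rule connI[OF _ sK])
    fix A assume A: "s \<in> A" "A \<subseteq> K" "\<And>a b. a \<in> A \<Longrightarrow> b \<in> K \<Longrightarrow> adj a b \<Longrightarrow> b \<in> A"
    have "t \<in> A" if "(s, t) \<in> (coxeter_edges W J)\<^sup>*" for t
      using that by (induction rule: rtrancl_induct) (use A cl in \<open>auto simp: coxeter_edges_iff\<close>)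
    then show "A = K" using s A by blast
  qed (use KJ J in blast)
  then show "comp J K" using KJ cl by (auto simp: comp_def)
next
  assume J: "J \<subseteq> S" and c: "comp J K"
  then obtain s where s: "s \<in> K" by (auto simp: comp_def conn_def)
  have mono: "(coxeter_edges W K)\<^sup>* \<subseteq> (coxeter_edges W J)\<^sup>*" using c by (intro rtrancl_mono) (auto simp: coxeter_edges_iff comp_def)
  have "K = (coxeter_edges W J)\<^sup>* `` {s}"
  proof (intro equalityI subsetI)
    fix t assume "t \<in> K"
    then show "t \<in> (coxeter_edges W J)\<^sup>* `` {s}" using c s mono by (auto simp: comp_def conn_def)
  next
    fix t assume "t \<in> (coxeter_edges W J)\<^sup>* `` {s}"
    then have "(s, t) \<in> (coxeter_edges W J)\<^sup>*" by simp
    then show "t \<in> K" by (induction rule: rtrancl_induct) (use s c in \<open>auto simp: comp_def coxeter_edges_iff\<close>)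
  qed
  then show "irreducible_component W J K" using s c unfolding irreducible_component_def comp_def by blast
qed

lemma comp_ex: "J \<subseteq> S \<Longrightarrow> s \<in> J \<Longrightarrow> \<exists>K. comp J K \<and> s \<in> K"
proof -
  assume J: "J \<subseteq> S" and s: "s \<in> J"
  have "irreducible_component W J ((coxeter_edges W J)\<^sup>* `` {s})" using s by (auto simp: irreducible_component_def)
  then show ?thesis using comp_iff[OF J] by blast
qed

lemma comp_sub: "comp J K \<Longrightarrow> K \<subseteq> J"
  and comp_conn: "comp J K \<Longrightarrow> conn K"
  and comp_nonadj: "comp J K \<Longrightarrow> s \<in> K \<Longrightarrow> t \<in> J \<Longrightarrow> t \<notin> K \<Longrightarrow> \<not> adj s t"
  and comp_adj: "comp J K \<Longrightarrow> s \<in> K \<Longrightarrow> t \<in> J \<Longrightarrow> adj s t \<Longrightarrow> t \<in> K"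
  by (auto simp: comp_def)

lemma conn_sub_comp: "conn A \<Longrightarrow> A \<subseteq> J \<Longrightarrow> comp J K \<Longrightarrow> s \<in> A \<Longrightarrow> s \<in> K \<Longrightarrow> A \<subseteq> K"
  using conn_closed[of A s K] comp_adj[of J K] by (meson subsetD)

lemma comp_eq: "comp J K \<Longrightarrow> comp J L \<Longrightarrow> s \<in> K \<Longrightarrow> s \<in> L \<Longrightarrow> K = L"
  using conn_sub_comp comp_conn comp_sub by (metis subset_antisym)

lemma comp_m:
  assumes "J \<subseteq> S" "comp J K" "s \<in> K" "t \<in> J - K" shows "m s t = 2"
  using assms comp_nonadj[OF assms(2,3), of t] by (auto simp: adj_def)

subsection \<open>Projections onto components\<close>

lemma commute_gen:
  assumes "s \<in> S" "t \<in> S" "m s t = 2" shows "s \<otimes> t = t \<otimes> s"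
proof -
  have "(s \<otimes> t) [^] (2::nat) = \<one>" using assms by (metis m_closed m_def S_carrier pow_ord_eq_1)
  then have "(s \<otimes> t) \<otimes> (s \<otimes> t) = \<one>" using assms by (simp add: numeral_2_eq_2)
  then have "inv (s \<otimes> t) = s \<otimes> t" using assms by (intro inv_equality) auto
  then show ?thesis using assms by (simp add: inv_mult_group)
qed

lemma commute_par:
  assumes K: "K \<subseteq> S" and L: "L \<subseteq> S" and kl: "\<And>s t. s \<in> K \<Longrightarrow> t \<in> L \<Longrightarrow> m s t = 2"
    and u: "u \<in> par K" and v: "v \<in> par L"
  shows "u \<otimes> v = v \<otimes> u"
proof -
  have 1: "s \<otimes> v = v \<otimes> s" if s: "s \<in> K" for s
  proof -
    have sc: "s \<in> carrier W" using s K by auto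
    from v show ?thesis
    proof induction
      case (eng h1 h2)
      then have "h1 \<in> carrier W" "h2 \<in> carrier W" using par_in_W[OF L] by auto
      then show ?case using eng.IH sc by (metis m_assoc)
    qed (use s K L kl in \<open>auto simp: subset_iff intro!: commute_gen\<close>)
  qed
  have vc: "v \<in> carrier W" using par_in_W[OF L v] .
  from u show ?thesis
  proof induction
    case (eng h1 h2)
    then have "h1 \<in> carrier W" "h2 \<in> carrier W" using par_in_W[OF K] by auto
    then show ?case using eng.IH vc by (metis m_assoc)
  qed (use K vc 1 in \<open>auto simp: subset_iff\<close>)
qed

lemma act_orthogonal:
  assumes K: "K \<subseteq> S" and L: "L \<subseteq> S" and kl: "\<And>s t. s \<in> K \<Longrightarrow> t \<in> L \<Longrightarrow> m s t = 2"
    and v: "v \<in> par L" and x: "x \<in> coord K"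
  shows "act v x = x"
proof -
  have "bform x (\<alpha> t) = 0" if t: "t \<in> L" for t
  proof -
    have "bform x (\<alpha> t) = (\<Sum>s\<in>K. x s * bform (\<alpha> s) (\<alpha> t))"
      by (subst coord_expand[OF finite_sub_S[OF K] x]) (simp add: bform_sum_left bform_simps)
    also have "\<dots> = 0" using t K L kl by (intro sum.neutral) (auto simp: bform_unit subset_iff)
    finally show ?thesis .
  qed
  then have "v \<in> stab x" using par_subset_stab[OF L] v by blast
  then show ?thesis by (simp add: stab_def)
qed

lemma comp_decompose:
  assumes J: "J \<subseteq> S" and c: "comp J K" and w: "w \<in> par J"
  shows "\<exists>u\<in>par K. \<exists>v\<in>par (J - K). w = u \<otimes> v"
proof -
  have K: "K \<subseteq> S" and JK: "J - K \<subseteq> S" using comp_sub[OF c] J by auto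
  have com: "u \<otimes> v = v \<otimes> u" if "u \<in> par K" "v \<in> par (J - K)" for u v
    using commute_par[OF K JK comp_m[OF J c]] that by blast
  note gc = par_in_W[OF K] par_in_W[OF JK]
  have gen: "\<exists>u\<in>par K. \<exists>v\<in>par (J - K). h = u \<otimes> v" if h: "h \<in> J" for h
  proof (cases "h \<in> K")
    case True
    then have "h = h \<otimes> \<one>" using K by auto
    then show ?thesis using True par_gen par_one by blast
  next
    case False
    then have "h = \<one> \<otimes> h" "h \<in> J - K" using h J by auto
    then show ?thesis using par_gen par_one by blast
  qed
  from w show ?thesis
  proof induction
    case one
    have "\<one> = \<one> \<otimes> \<one>" by simp
    then show ?case using par_one by blast
  next
    case (incl h)
    then show ?case by (rule gen)
  next
    case (inv h)
    then show ?case using gen J by auto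
  next
    case (eng h1 h2)
    then obtain u1 v1 u2 v2 where *: "u1 \<in> par K" "v1 \<in> par (J - K)" "h1 = u1 \<otimes> v1" "u2 \<in> par K" "v2 \<in> par (J - K)" "h2 = u2 \<otimes> v2"
      by blast
    have "h1 \<otimes> h2 = u1 \<otimes> (v1 \<otimes> u2) \<otimes> v2" using * gc by (simp add: m_assoc)
    also have "\<dots> = u1 \<otimes> (u2 \<otimes> v1) \<otimes> v2" using com[of u2 v1] * by simp
    also have "\<dots> = (u1 \<otimes> u2) \<otimes> (v1 \<otimes> v2)" using * gc by (simp add: m_assoc)
    finally show ?case using * par_mult by blast
  qed
qed

text \<open>Described by its action on the simple roots of \<open>K\<close>, so that identities
  between projections can be checked there.\<close>

definition proj :: "'a set \<Rightarrow> 'a \<Rightarrow> 'a" where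
  "proj K w = (THE u. u \<in> par K \<and> (\<forall>s\<in>K. act u (\<alpha> s) = act w (\<alpha> s)))"

lemma par_eqI:
  assumes K: "K \<subseteq> S" and u: "u \<in> par K" and v: "v \<in> par K" and e: "\<And>s. s \<in> K \<Longrightarrow> act u (\<alpha> s) = act v (\<alpha> s)"
  shows "u = v"
proof -
  have c: "u \<in> carrier W" "v \<in> carrier W" using par_in_W[OF K] u v by auto
  have "inv v \<otimes> u = \<one>"
    using u v K c e par_inv par_mult by (intro par_nonneg_imp_one[OF K]) auto
  then show ?thesis using c by (metis inv_equality inv_inv inv_closed)
qed

lemma proj_unique:
  assumes K: "K \<subseteq> S" and u: "u \<in> par K" and e: "\<And>s. s \<in> K \<Longrightarrow> act u (\<alpha> s) = act w (\<alpha> s)"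
  shows "proj K w = u"
  unfolding proj_def using u e par_eqI[OF K] by (intro the_equality) auto

lemma proj:
  assumes J: "J \<subseteq> S" and c: "comp J K" and w: "w \<in> par J"
  shows proj_par: "proj K w \<in> par K"
    and act_proj: "x \<in> coord K \<Longrightarrow> act (proj K w) x = act w x"
    and proj_rest: "\<exists>v\<in>par (J - K). w = proj K w \<otimes> v"
proof -
  have K: "K \<subseteq> S" and JK: "J - K \<subseteq> S" using comp_sub[OF c] J by auto
  obtain u v where uv: "u \<in> par K" "v \<in> par (J - K)" "w = u \<otimes> v" using comp_decompose[OF assms] by blast
  have cc: "u \<in> carrier W" "v \<in> carrier W" using par_in_W uv K JK by auto
  have a: "act u x = act w x" if "x \<in> coord K" for x
    using uv cc act_orthogonal[OF K JK comp_m[OF J c] uv(2) that] by simp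
  have "proj K w = u" using proj_unique[OF K uv(1)] a by simp
  then show "proj K w \<in> par K" "x \<in> coord K \<Longrightarrow> act (proj K w) x = act w x"
     "\<exists>v\<in>par (J - K). w = proj K w \<otimes> v" using uv a by auto
qed

lemma act_comp_coord:
  assumes J: "J \<subseteq> S" and c: "comp J K" and w: "w \<in> par J" and x: "x \<in> coord K"
  shows "act w x \<in> coord K"
  using act_proj[OF J c w x] act_coord[OF _ proj_par[OF J c w] order_refl x] comp_sub[OF c] J
  by (metis subset_trans)

lemma par_eq_projI:
  assumes J: "J \<subseteq> S" and v: "v \<in> par J" and w: "w \<in> par J" and e: "\<And>K. comp J K \<Longrightarrow> proj K v = proj K w"
  shows "v = w"
proof (rule par_eqI[OF J v w])
  fix s assume "s \<in> J"
  then obtain K where "comp J K" "s \<in> K" using comp_ex[OF J] by blast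
  then show "act v (\<alpha> s) = act w (\<alpha> s)"
    using act_proj[OF J _ v, of K "\<alpha> s"] act_proj[OF J _ w, of K "\<alpha> s"] e by simp
qed

text \<open>Factors from different components act on orthogonal subspaces, so their product acts on
  each \<open>coord K\<close> as \<open>u K\<close> alone.\<close>

lemma glue:
  assumes J: "J \<subseteq> S" and u: "\<And>K. comp J K \<Longrightarrow> u K \<in> par K"
  obtains w where "w \<in> par J" "\<And>K. comp J K \<Longrightarrow> proj K w = u K"
proof -
  have fin: "finite {K. comp J K}"
    by (rule finite_subset[of _ "Pow J"]) (use comp_sub finite_sub_S[OF J] in auto)
  have "\<exists>w\<in>par J. \<forall>K. comp J K \<longrightarrow> (\<forall>x\<in>coord K. act w x = (if K \<in> C then act (u K) x else x))"
    if "finite C" "C \<subseteq> {K. comp J K}" for C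
    using that
  proof (induction C)
    case empty
    show ?case by (intro bexI[of _ \<one>]) auto
  next
    case (insert L C)
    then obtain w where w: "w \<in> par J"
      "\<And>K x. comp J K \<Longrightarrow> x \<in> coord K \<Longrightarrow> act w x = (if K \<in> C then act (u K) x else x)" by auto
    have L: "comp J L" "L \<notin> C" using insert by auto
    have LS: "L \<subseteq> S" using comp_sub[OF L(1)] J by simp
    have cc: "w \<in> carrier W" "u L \<in> carrier W" using par_in_W[OF J w(1)] par_in_W[OF LS u[OF L(1)]] by auto
    have "act (u L \<otimes> w) x = (if K \<in> insert L C then act (u K) x else x)"
      if K: "comp J K" and x: "x \<in> coord K" for K x
    proof (cases "K = L")
      case True
      then show ?thesis using w(2)[OF K x] L cc by simp
    next
      case False
      have KS: "K \<subseteq> S" using comp_sub[OF K] J by simp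
      have "m s t = 2" if "s \<in> K" "t \<in> L" for s t
        using comp_m[OF J K, of s t] that comp_sub[OF L(1)] comp_eq[OF K L(1), of t] False by blast
      then have "act (u L) y = y" if "y \<in> coord K" for y
        using act_orthogonal[OF KS LS _ u[OF L(1)] that] by blast
      moreover have "act w x \<in> coord K" using act_comp_coord[OF J K w(1) x] .
      ultimately show ?thesis using w(2)[OF K x] False cc by simp
    qed
    moreover have "u L \<otimes> w \<in> par J" using par_mult[OF par_mono[OF comp_sub[OF L(1)] u[OF L(1)]] w(1)] .
    ultimately show ?case by blast
  qed
  from this[OF fin order_refl] obtain w where w: "w \<in> par J"
    "\<And>K x. comp J K \<Longrightarrow> x \<in> coord K \<Longrightarrow> act w x = act (u K) x" by auto
  have "proj K w = u K" if K: "comp J K" for K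
    using proj_unique[OF _ u[OF K]] w(2)[OF K] comp_sub[OF K] J by simp
  then show thesis using that w by blast
qed

lemma proj_mult:
  assumes J: "J \<subseteq> S" and c: "comp J K" and v: "v \<in> par J" and w: "w \<in> par J"
  shows "proj K (v \<otimes> w) = proj K v \<otimes> proj K w"
proof -
  have K: "K \<subseteq> S" using comp_sub[OF c] J by auto
  have cc: "v \<in> carrier W" "w \<in> carrier W" "proj K v \<in> carrier W" "proj K w \<in> carrier W"
    using par_in_W[OF J] par_in_W[OF K] v w proj_par[OF J c] by auto
  show ?thesis
  proof (rule proj_unique[OF K])
    show "proj K v \<otimes> proj K w \<in> par K" using proj_par[OF J c] v w by (intro par_mult)
    show "act (proj K v \<otimes> proj K w) (\<alpha> s) = act (v \<otimes> w) (\<alpha> s)" if "s \<in> K" for s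
      using that cc act_proj[OF J c v] act_proj[OF J c w] act_comp_coord[OF J c w] by simp
  qed
qed

lemma proj_par_self:
  assumes J: "J \<subseteq> S" and c: "comp J K" and u: "u \<in> par K" and v: "v \<in> par (J - K)"
  shows "proj K (u \<otimes> v) = u"
proof -
  have K: "K \<subseteq> S" and JK: "J - K \<subseteq> S" using comp_sub[OF c] J by auto
  have cc: "u \<in> carrier W" "v \<in> carrier W" using par_in_W u v K JK by auto
  show ?thesis using act_orthogonal[OF K JK comp_m[OF J c] v] cc by (intro proj_unique[OF K u]) auto
qed

lemma proj_w0:
  assumes J: "J \<subseteq> S" and c: "comp J K"
  shows "proj K (w0 J) = w0 K"
proof -
  have K: "K \<subseteq> S" using comp_sub[OF c] J by auto
  show ?thesis
    using act_proj[OF J c w0_par[OF J]] w0_neg[OF J] comp_sub[OF c]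
    by (intro w0_unique[OF K] proj_par[OF J c w0_par[OF J]]) auto
qed

lemma opp_comp:
  assumes J: "J \<subseteq> S" and c: "comp J K" and s: "s \<in> K"
  shows "opp J s = opp K s"
proof -
  have K: "K \<subseteq> S" and sJ: "s \<in> J" using comp_sub[OF c] J s by auto
  have "- \<alpha> (opp J s) = - \<alpha> (opp K s)"
    using act_proj[OF J c w0_par[OF J], of "\<alpha> s"] s proj_w0[OF J c] act_w0[OF J sJ] act_w0[OF K s] by simp
  then show ?thesis by simp
qed

subsection \<open>Transport by elements mapping simple roots to simple roots\<close>

lemma img_adj:
  "J \<subseteq> S \<Longrightarrow> simple_in J x \<Longrightarrow> s \<in> J \<Longrightarrow> t \<in> J \<Longrightarrow> adj (img x s) (img x t) \<longleftrightarrow> adj s t"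
  using img_m[of J x s t] inj_onD[OF img_inj[of J x], of s t] by (auto simp: adj_def simple_in_carrier)

lemma img_subset: "J \<subseteq> S \<Longrightarrow> simple_in J x \<Longrightarrow> img x ` J \<subseteq> S"
  using img_in_S by blast

lemma img_conn:
  assumes J: "J \<subseteq> S" and x: "simple_in J x" and K: "K \<subseteq> J" and c: "conn K"
  shows "conn (img x ` K)"
proof -
  obtain s where s: "s \<in> K" using c by (auto simp: conn_def)
  show ?thesis
  proof (rule connI[of _ "img x s"])
    show "img x ` K \<subseteq> S" using img_subset[OF J x] K by blast
    fix A assume A: "img x s \<in> A" "A \<subseteq> img x ` K" "\<And>a b. a \<in> A \<Longrightarrow> b \<in> img x ` K \<Longrightarrow> adj a b \<Longrightarrow> b \<in> A"
    have "K \<subseteq> img x -` A"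
    proof (rule conn_closed[OF c _ s])
      show "b \<in> img x -` A" if "a \<in> img x -` A" "a \<in> K" "b \<in> K" "adj a b" for a b
        using A(3)[of "img x a" "img x b"] that K img_adj[OF J x, of a b] by blast
    qed (use A in simp)
    then show "A = img x ` K" using A by blast
  qed (use s in simp)
qed

lemma img_comp:
  assumes J: "J \<subseteq> S" and x: "simple_in J x" and c: "comp J K"
  shows "comp (img x ` J) (img x ` K)"
  unfolding comp_def
proof (intro conjI ballI)
  show "img x ` K \<subseteq> img x ` J" using comp_sub[OF c] by blast
  show "conn (img x ` K)" using img_conn[OF J x comp_sub[OF c] comp_conn[OF c]] .
  fix a b assume "a \<in> img x ` K" "b \<in> img x ` J - img x ` K"
  then obtain s t where "s \<in> K" "a = img x s" "t \<in> J" "t \<notin> K" "b = img x t" by blast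
  then show "\<not> adj a b" using comp_nonadj[OF c] img_adj[OF J x, of s t] comp_sub[OF c] by blast
qed

lemma act_conj: "x \<in> carrier W \<Longrightarrow> u \<in> carrier W \<Longrightarrow> act (cj x u) (act x y) = act x (act u y)"
  by (simp add: m_assoc)

lemma coord_img:
  assumes J: "J \<subseteq> S" and x: "simple_in J x" and K: "K \<subseteq> J" and y: "y \<in> coord (img x ` K)"
  obtains z where "z \<in> coord K" "y = act x z"
proof
  define z where "z = (\<Sum>s\<in>K. y (img x s) *\<^sub>R \<alpha> s)"
  show "z \<in> coord K" unfolding z_def by (intro coord_sum coord_scale) simp
  have KS: "K \<subseteq> S" using J K by simp
  have inj: "inj_on (img x) K" using img_inj[OF KS simple_in_carrier[OF x]] .
  have "y = (\<Sum>t\<in>img x ` K. y t *\<^sub>R \<alpha> t)"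
    using coord_expand[OF _ y] finite_sub_S[OF KS] by simp
  also have "\<dots> = (\<Sum>s\<in>K. y (img x s) *\<^sub>R act x (\<alpha> s))"
    using K by (simp add: sum.reindex[OF inj] act_img[OF J x] subset_iff)
  also have "\<dots> = act x z" by (simp add: z_def act_simps)
  finally show "y = act x z" .
qed

lemma img_proj:
  assumes J: "J \<subseteq> S" and x: "simple_in J x" and c: "comp J K" and w: "w \<in> par J"
  shows "proj (img x ` K) (cj x w) = cj x (proj K w)"
proof (rule proj_unique)
  have K: "K \<subseteq> S" using comp_sub[OF c] J by auto
  have xc: "x \<in> carrier W" using simple_in_carrier[OF x] .
  show "img x ` K \<subseteq> S" using img_subset[OF J x] comp_sub[OF c] by blast
  show "cj x (proj K w) \<in> par (img x ` K)"
    using simple_in_conj_par[OF J comp_sub[OF c] x proj_par[OF J c w]] .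
  have pc: "proj K w \<in> carrier W" "w \<in> carrier W" using par_in_W[OF K proj_par[OF J c w]] par_in_W[OF J w] by auto
  fix t assume "t \<in> img x ` K"
  then obtain s where s: "s \<in> K" "t = img x s" by blast
  then have "\<alpha> t = act x (\<alpha> s)" using act_img[OF J x] comp_sub[OF c] by auto
  then show "act (cj x (proj K w)) (\<alpha> t) = act (cj x w) (\<alpha> t)"
    using act_conj[OF xc] pc act_proj[OF J c w, of "\<alpha> s"] s by simp
qed

lemma cuspidal_proj:
  assumes J: "J \<subseteq> S" and c: "comp J K" and w: "cuspidal J w"
  shows "cuspidal K (proj K w)"
proof -
  have wJ: "w \<in> par J" using w by (rule cuspidal_par)
  show ?thesis unfolding cuspidal_def
  proof (intro conjI ballI impI)
    show "proj K w \<in> par K" by (rule proj_par[OF J c wJ])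
    fix x assume x: "x \<in> coord K" "act (proj K w) x = x"
    then have "act w x = x" using act_proj[OF J c wJ] by simp
    moreover have "x \<in> coord J" using x(1) coord_mono[OF comp_sub[OF c]] by blast
    ultimately show "x = 0" using w by (auto simp: cuspidal_def)
  qed
qed

lemma cuspidal_img:
  assumes J: "J \<subseteq> S" and x: "simple_in J x" and w: "cuspidal J w"
  shows "cuspidal (img x ` J) (cj x w)"
  unfolding cuspidal_def
proof (intro conjI ballI impI)
  have xc: "x \<in> carrier W" using simple_in_carrier[OF x] .
  have wJ: "w \<in> par J" "w \<in> carrier W" using cuspidal_par[OF w] par_in_W[OF J] by auto
  show "cj x w \<in> par (img x ` J)" using simple_in_conj_par[OF J order_refl x wJ(1)] .
  fix y assume y: "y \<in> coord (img x ` J)" "act (cj x w) y = y"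
  obtain z where z: "z \<in> coord J" "y = act x z" using coord_img[OF J x order_refl y(1)] .
  then have "act w z = z" using y(2) act_conj[OF xc wJ(2)] act_inj[OF xc] by simp
  then have "z = 0" using z(1) w unfolding cuspidal_def by blast
  then show "y = 0" using z by simp
qed

lemma cuspidal_conj:
  assumes J: "J \<subseteq> S" and v: "v \<in> par J" and w: "cuspidal J w"
  shows "cuspidal J (cj v w)"
  unfolding cuspidal_def
proof (intro conjI ballI impI)
  have wJ: "w \<in> par J" using w by (rule cuspidal_par)
  have c: "v \<in> carrier W" "w \<in> carrier W" using par_in_W[OF J] v wJ by auto
  show "cj v w \<in> par J" using v wJ par_inv[OF J] par_mult by blast
  fix x assume x: "x \<in> coord J" "act (cj v w) x = x"
  define y where "y = act (inv v) x"
  have y: "y \<in> coord J" "x = act v y"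
    using act_coord[OF J par_inv[OF J v] order_refl x(1)] c by (simp_all add: y_def)
  then have "act w y = y" using x(2) act_conj[OF c] act_inj[OF c(1)] by simp
  then have "y = 0" using y(1) w unfolding cuspidal_def by blast
  then show "x = 0" using y by simp
qed

text \<open>An element of \<open>par (K - {s})\<close> fixes the sum of the images of
  \<open>\<alpha> s\<close> under that group, a vector whose coordinate at \<open>s\<close> is the
  group order.\<close>

lemma cuspidal_not_proper:
  assumes K: "K \<subseteq> S" and w: "cuspidal K w" and s: "s \<in> K" and v: "v \<in> par K"
  shows "cj v w \<notin> par (K - {s})"
proof
  assume y: "cj v w \<in> par (K - {s})"
  define y where "y = cj v w"
  have cy: "cuspidal K y" unfolding y_def by (rule cuspidal_conj[OF K v w])
  let ?H = "par (K - {s})"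
  have KS: "K - {s} \<subseteq> S" using K by blast
  have gc: "u \<in> carrier W" if "u \<in> ?H" for u using par_in_W[OF KS that] .
  have fin: "finite ?H" using finite_carrier gc by (meson finite_subset subsetI)
  define x where "x = (\<Sum>u\<in>?H. act u (\<alpha> s))"
  have yH: "y \<in> ?H" using y by (simp add: y_def)
  have "bij_betw ((\<otimes>) y) ?H ?H"
    by (rule bij_betwI[where g = "(\<otimes>) (inv y)"]) (use yH gc par_mult par_inv[OF KS] in auto)
  then have "(\<Sum>u\<in>?H. act (y \<otimes> u) (\<alpha> s)) = x"
    unfolding x_def by (rule sum.reindex_bij_betw[of "(\<otimes>) y" _ _ "\<lambda>u. act u (\<alpha> s)"])
  moreover have "(\<Sum>u\<in>?H. act (y \<otimes> u) (\<alpha> s)) = act y x"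
    unfolding x_def act_sum using yH gc by (intro sum.cong) auto
  ultimately have "act y x = x" by simp
  moreover have "x \<in> coord K"
    unfolding x_def using s by (intro coord_sum act_coord[OF KS]) auto
  moreover have "x s = real (card ?H)"
    unfolding x_def sum_fun_apply using act_outside[OF gc KS, of _ s "\<alpha> s"] by simp
  moreover have "card ?H > 0" using fin par_one[of "K - {s}"] card_gt_0_iff[of ?H] by blast
  ultimately have "x \<in> coord K" "act y x = x" "x s \<noteq> 0" by auto
  then show False using cy unfolding cuspidal_def by (metis zero_fun_apply)
qed

subsection \<open>Cuspidal elements of type A\<close>

definition path_A :: "'a list \<Rightarrow> bool" where
  "path_A ps \<longleftrightarrow> ps \<noteq> [] \<and> set ps \<subseteq> S \<and> distinct ps \<and>
    (\<forall>i<length ps. \<forall>j<length ps. i \<noteq> j \<longrightarrow> m (ps ! i) (ps ! j) = (if j = Suc i \<or> i = Suc j then 3 else 2))"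

lemma braid3:
  assumes "s \<in> S" "t \<in> S" "m s t = 3" shows "s \<otimes> (t \<otimes> s) = t \<otimes> (s \<otimes> t)"
  using word_alternating_m[OF assms(1,2)] assms by (simp add: eval_nat_numeral)

text \<open>It suffices that the union \<open>D\<close> of the two double cosets is closed under
  left multiplication by generators, and only the product of the new letter with an element of the
  larger double coset takes an argument.\<close>

lemma path_A_double_coset:
  assumes p: "path_A ps" and k: "k < length ps" and u: "u \<in> par (set (take (Suc k) ps))"
  shows "u \<in> par (set (take k ps)) \<or>
    (\<exists>a\<in>par (set (take k ps)). \<exists>b\<in>par (set (take k ps)). u = a \<otimes> ps ! k \<otimes> b)"
  using k u
proof (induction k arbitrary: u)
  have Sps: "set ps \<subseteq> S" using p by (simp add: path_A_def)
  define P where "P j = par (set (take j ps))" for j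
  have tS: "set (take j ps) \<subseteq> S" for j using Sps set_take_subset by fastforce
  have Pc: "x \<in> carrier W" if "x \<in> P j" for x j using par_in_W[OF tS] that by (auto simp: P_def)
  have Pm: "x \<otimes> y \<in> P j" if "x \<in> P j" "y \<in> P j" for x y j using that par_mult by (auto simp: P_def)
  have nS: "ps ! j \<in> S" if "j < length ps" for j using that Sps by auto
  have mono: "x \<in> P i" if "x \<in> P j" "j \<le> i" for x i j
    using that par_mono set_take_subset_set_take by (metis P_def)
  {
    case 0
    have "v = \<one> \<or> v = ps ! 0" if "v \<in> par {ps ! 0}" for v
      using that 0(1) nS[of 0] by (induction rule: generate.induct) auto
    moreover have "u \<in> par {ps ! 0}" using 0 by (simp add: take_Suc_conv_app_nth)
    ultimately have "u = \<one> \<or> u = ps ! 0" by blast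
    then show ?case using 0 nS[of 0] by (auto intro!: bexI[of _ \<one>])
  next
    case (Suc k)
    let ?s = "ps ! Suc k" and ?r = "ps ! k"
    have sr: "?s \<in> S" "?r \<in> S" "m ?s ?r = 3" "?r \<in> P (Suc k)" "k < length ps"
      using Suc.prems nS p by (auto simp: path_A_def P_def take_Suc_conv_app_nth intro!: par_gen)
    have com: "?s \<otimes> a = a \<otimes> ?s" if "a \<in> P k" for a
    proof (rule commute_par[of "{?s}" "set (take k ps)"])
      show "m s t = 2" if "s \<in> {?s}" "t \<in> set (take k ps)" for s t
        using that Suc.prems p by (auto simp: path_A_def in_set_conv_nth)
    qed (use sr tS that par_gen in \<open>auto simp: P_def\<close>)
    define D where "D = P (Suc k) \<union> {a \<otimes> ?s \<otimes> b | a b. a \<in> P (Suc k) \<and> b \<in> P (Suc k)}"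
    have Dc: "d \<in> carrier W" if "d \<in> D" for d using that Pc sr by (auto simp: D_def)
    have DI: "a \<otimes> ?s \<otimes> b \<in> D" "a \<in> D" if "a \<in> P (Suc k)" "b \<in> P (Suc k)" for a b using that by (auto simp: D_def)
    have one: "\<one> \<in> P (Suc k)" by (simp add: P_def)
    have left_s: "?s \<otimes> d \<in> D" if d: "d \<in> D" for d
    proof -
      consider "d \<in> P (Suc k)" | a b where "a \<in> P (Suc k)" "b \<in> P (Suc k)" "d = a \<otimes> ?s \<otimes> b" using d by (auto simp: D_def)
      then show ?thesis
      proof cases
        case 1
        then show ?thesis using DI(1)[OF one 1] sr by simp
      next
        case 2
        have "a \<in> P k \<or> (\<exists>c\<in>P k. \<exists>e\<in>P k. a = c \<otimes> ?r \<otimes> e)"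
          using Suc.IH[OF sr(5), of a] 2 by (simp add: P_def)
        then show ?thesis
        proof
          assume a: "a \<in> P k"
          have "?s \<otimes> d = a \<otimes> b" using 2 Pc sr com[OF a] by (simp add: m_assoc flip: m_assoc[of ?s a])
          then show ?thesis using Pm[OF 2(1,2)] DI one by simp
        next
          assume "\<exists>c\<in>P k. \<exists>e\<in>P k. a = c \<otimes> ?r \<otimes> e"
          then obtain c e where ce: "c \<in> P k" "e \<in> P k" "a = c \<otimes> ?r \<otimes> e" by blast
          have cc: "c \<in> carrier W" "e \<in> carrier W" "b \<in> carrier W" using Pc ce 2 by auto
          \<comment> \<open>By induction \<open>a = c r e\<close>, where \<open>c\<close> and
            \<open>e\<close> commute with the new letter \<open>s\<close>; the braid relation turns
            the middle \<open>s r s\<close> into \<open>r s r\<close>.\<close>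
          have "?s \<otimes> d = (?s \<otimes> c) \<otimes> ?r \<otimes> (e \<otimes> ?s) \<otimes> b" using 2 ce cc sr by (simp add: m_assoc)
          also have "\<dots> = c \<otimes> (?s \<otimes> (?r \<otimes> ?s)) \<otimes> e \<otimes> b" using com[OF ce(1)] com[OF ce(2), symmetric] cc sr by (simp add: m_assoc)
          also have "\<dots> = (c \<otimes> ?r) \<otimes> ?s \<otimes> (?r \<otimes> e \<otimes> b)" using braid3[OF sr(1-3)] cc sr by (simp add: m_assoc)
          finally show ?thesis using DI(1) Pm sr mono[OF ce(1)] mono[OF ce(2)] 2 by simp
        qed
      qed
    qed
    have left: "h \<otimes> d \<in> D" if h: "h \<in> set (take (Suc (Suc k)) ps)" and d: "d \<in> D" for h d
    proof (cases "h = ?s")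
      case False
      then have hP: "h \<in> P (Suc k)" using h Suc.prems by (auto simp: take_Suc_conv_app_nth P_def intro!: par_gen)
      consider "d \<in> P (Suc k)" | a b where "a \<in> P (Suc k)" "b \<in> P (Suc k)" "d = a \<otimes> ?s \<otimes> b" using d by (auto simp: D_def)
      then show ?thesis
      proof cases
        case 2
        then have "h \<otimes> d = (h \<otimes> a) \<otimes> ?s \<otimes> b" using Pc hP sr by (simp add: m_assoc)
        then show ?thesis using DI(1) Pm hP 2 by simp
      qed (use Pm hP DI one in blast)
    qed (use left_s d in simp)
    have "\<forall>d\<in>D. u \<otimes> d \<in> D"
      using Suc.prems(2)
    proof induction
      case one then show ?case using Dc by auto
    next
      case (incl h) then show ?case using left by blast
    next
      case (inv h)
      then have "h \<in> S" using tS by blast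
      then show ?case using left[OF inv] by simp
    next
      case (eng h1 h2)
      then show ?case using par_in_W[OF tS] Dc by (auto simp: m_assoc)
    qed
    then have "u \<otimes> \<one> \<in> D" using DI(2)[OF one one] by blast
    then show ?case using par_in_W[OF tS Suc.prems(2)] by (auto simp: D_def P_def)
  }
qed

text \<open>Letters are split off from the right end of the path. If the remaining factor
  \<open>u\<close> avoided the next letter \<open>s\<close>, a conjugate of \<open>w\<close> would
  lie in a proper parabolic subgroup. Otherwise \<open>u = a s b\<close>, and conjugation by
  \<open>b\<close>, which commutes with the letters already split off, puts \<open>s\<close> in its
  place.\<close>

theorem path_A_cuspidal:
  assumes p: "path_A ps" and w: "cuspidal (set ps) w"
  shows "\<exists>v\<in>par (set ps). cj v w = word ps"
proof -
  let ?K = "set ps"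
  have K: "?K \<subseteq> S" and dist: "distinct ps" using p by (auto simp: path_A_def)
  have lS: "drop j ps \<in> lists S" for j using K set_drop_subset by (fastforce simp: in_lists_conv_set)
  have tS: "set (take j ps) \<subseteq> S" for j using K set_take_subset by fastforce
  have gc: "v \<in> carrier W" if "v \<in> par ?K" for v using par_in_W[OF K that] .
  have tK: "v \<in> par ?K" if "v \<in> par (set (take j ps))" for v j using par_mono[OF set_take_subset] that .
  have wc: "w \<in> carrier W" using gc cuspidal_par[OF w] .
  have *: "\<exists>v\<in>par ?K. \<exists>u\<in>par (set (take j ps)). cj v w = u \<otimes> word (drop j ps)" if "j \<le> length ps" for j
    using that
  proof (induction rule: inc_induct)
    case base
    show ?case using cuspidal_par[OF w] wc by (intro bexI[of _ \<one>] bexI[of _ w]) auto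
  next
    case (step j)
    then obtain v u where v: "v \<in> par ?K" and u: "u \<in> par (set (take (Suc j) ps))"
      and e: "cj v w = u \<otimes> word (drop (Suc j) ps)" by blast
    let ?s = "ps ! j" and ?d = "word (drop (Suc j) ps)"
    have j: "j < length ps" using step by simp
    have sS: "?s \<in> S" using j K by auto
    have drop: "drop j ps = ?s # drop (Suc j) ps" using j by (simp add: Cons_nth_drop_Suc)
    have "u \<in> par (set (take j ps)) \<or> (\<exists>a\<in>par (set (take j ps)). \<exists>b\<in>par (set (take j ps)). u = a \<otimes> ?s \<otimes> b)"
      by (rule path_A_double_coset[OF p j u])
    then show ?case
    proof
      assume u': "u \<in> par (set (take j ps))"
      have s: "?s \<notin> set (take j ps)" "?s \<notin> set (drop (Suc j) ps)"
        using dist j by (auto simp: in_set_conv_nth nth_eq_iff_index_eq)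
      have "?d \<in> par (?K - {?s})"
        using generate_iff_word[of "?K - {?s}" ?d] K s(2) set_drop_subset[of "Suc j" ps]
        by (auto simp: in_lists_conv_set subset_iff intro!: bexI[of _ "drop (Suc j) ps"])
      moreover have "u \<in> par (?K - {?s})" using s set_take_subset[of j ps] by (intro par_mono[OF _ u']) auto
      ultimately have "cj v w \<in> par (?K - {?s})" unfolding e by (rule par_mult[rotated])
      then show ?thesis using cuspidal_not_proper[OF K w _ v, of ?s] j by simp
    next
      assume "\<exists>a\<in>par (set (take j ps)). \<exists>b\<in>par (set (take j ps)). u = a \<otimes> ?s \<otimes> b"
      then obtain a b where ab: "a \<in> par (set (take j ps))" "b \<in> par (set (take j ps))" "u = a \<otimes> ?s \<otimes> b" by blast
      have com: "b \<otimes> ?d = ?d \<otimes> b"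
      proof (rule commute_par[OF tS, of "set (drop (Suc j) ps)"])
        show "set (drop (Suc j) ps) \<subseteq> S" using K set_drop_subset by fastforce
        show "m s t = 2" if "s \<in> set (take j ps)" "t \<in> set (drop (Suc j) ps)" for s t
          using that p by (auto simp: path_A_def in_set_conv_nth)
        have "set (drop (Suc j) ps) \<subseteq> S" using K set_drop_subset by fastforce
        then show "?d \<in> par (set (drop (Suc j) ps))"
          using generate_iff_word by (auto intro!: bexI[of _ "drop (Suc j) ps"] simp: in_lists_conv_set)
      qed (use ab in auto)
      have cc: "a \<in> carrier W" "b \<in> carrier W" "v \<in> carrier W" "?d \<in> carrier W" using gc tK ab v word_carrier[OF lS] by auto
      have "cj (b \<otimes> v) w = cj b (cj v w)"
        using cc wc by (simp add: inv_mult_group m_assoc)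
      also have "\<dots> = (b \<otimes> a) \<otimes> ?s \<otimes> (b \<otimes> ?d) \<otimes> inv b" unfolding e ab(3) using cc sS by (simp add: m_assoc)
      also have "\<dots> = (b \<otimes> a) \<otimes> word (drop j ps)" unfolding com drop using cc sS by (simp add: m_assoc)
      finally show ?thesis using par_mult[OF tK[OF ab(2)] v] par_mult[OF ab(2,1)] by blast
    qed
  qed
  from *[of 0] obtain v u where "v \<in> par ?K" "u \<in> par {}" "cj v w = u \<otimes> word ps" by auto
  moreover have "u = \<one>" using \<open>u \<in> par {}\<close> by (simp add: generate_empty)
  ultimately show ?thesis using word_carrier[OF lS[of 0]] by auto
qed

end

lemma rtrancl_distinct_list:
  assumes "(s, t) \<in> R\<^sup>*"
  shows "\<exists>vs. vs \<noteq> [] \<and> hd vs = s \<and> last vs = t \<and> distinct vs \<and> (\<forall>i. Suc i < length vs \<longrightarrow> (vs ! i, vs ! Suc i) \<in> R)"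
  using assms
proof (induction rule: rtrancl_induct)
  case base
  show ?case by (intro exI[of _ "[s]"]) auto
next
  case (step y z)
  then obtain vs where vs: "vs \<noteq> []" "hd vs = s" "last vs = y" "distinct vs"
    "\<And>i. Suc i < length vs \<Longrightarrow> (vs ! i, vs ! Suc i) \<in> R" by blast
  show ?case
  proof (cases "z \<in> set vs")
    case True
    then obtain i where i: "i < length vs" "vs ! i = z" by (auto simp: in_set_conv_nth)
    have "last (take (Suc i) vs) = z" using i by (simp add: take_Suc_conv_app_nth)
    then show ?thesis using i vs by (intro exI[of _ "take (Suc i) vs"]) (auto simp: hd_conv_nth)
  next
    case False
    have "(( vs @ [z]) ! i, (vs @ [z]) ! Suc i) \<in> R" if "Suc i < length (vs @ [z])" for i
      using that vs step(2) by (cases "Suc i = length vs") (auto simp: nth_append last_conv_nth less_Suc_eq dest: sym)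
    then show ?thesis using vs False by (intro exI[of _ "vs @ [z]"]) auto
  qed
qed

context finite_coxeter
begin

subsection \<open>Forbidden subgraphs\<close>

text \<open>The vector with coordinates \<open>x\<close> would have nonpositive norm. Products of
  distinct simple roots are never positive, so it is enough to control a chosen set \<open>N\<close>
  of neighbours through lower bounds \<open>c\<close> for the edge weights. Hence one vector
  excludes every diagram that contains a given affine one.\<close>

lemma subharmonic_False:
  assumes Y: "Y \<subseteq> S" "Y \<noteq> {}" and pos: "\<And>s. s \<in> Y \<Longrightarrow> x s > 0"
    and sub: "\<And>s. s \<in> Y \<Longrightarrow> \<exists>N c. N \<subseteq> Y - {s} \<and> (\<forall>t\<in>N. bform (\<alpha> t) (\<alpha> s) \<le> - c t) \<and> x s \<le> (\<Sum>t\<in>N. c t * x t)"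
  shows False
proof -
  have fX: "finite Y" using finite_sub_S[OF Y(1)] .
  define y where "y = (\<Sum>s\<in>Y. x s *\<^sub>R \<alpha> s)"
  have yS: "y \<in> coord S" unfolding y_def using Y by (intro coord_sum coord_scale) auto
  have "y \<noteq> 0"
  proof
    assume "y = 0"
    obtain s where s: "s \<in> Y" using Y by blast
    then have "y s = x s" by (simp add: y_def lincomb_apply[OF fX])
    then show False using \<open>y = 0\<close> pos[OF s] by (simp add: vec_apply)
  qed
  then have "bform y y > 0" using bform_pos yS by blast
  moreover have "bform y (\<alpha> s) \<le> 0" if s: "s \<in> Y" for s
  proof -
    obtain N c where N: "N \<subseteq> Y - {s}" "\<And>t. t \<in> N \<Longrightarrow> bform (\<alpha> t) (\<alpha> s) \<le> - c t" "x s \<le> (\<Sum>t\<in>N. c t * x t)"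
      using sub[OF s] by blast
    have "bform y (\<alpha> s) = (\<Sum>t\<in>Y. x t * bform (\<alpha> t) (\<alpha> s))" by (simp add: y_def bform_sum_left bform_simps)
    also have "\<dots> = x s + (\<Sum>t\<in>Y - {s}. x t * bform (\<alpha> t) (\<alpha> s))"
      using s Y fX by (subst sum.remove[of Y s]) auto
    also have "(\<Sum>t\<in>Y - {s}. x t * bform (\<alpha> t) (\<alpha> s)) \<le> (\<Sum>t\<in>N. x t * bform (\<alpha> t) (\<alpha> s))"
    proof -
      have "(\<Sum>t\<in>Y - {s}. - (x t * bform (\<alpha> t) (\<alpha> s))) \<ge> (\<Sum>t\<in>N. - (x t * bform (\<alpha> t) (\<alpha> s)))"
        using N fX Y s pos by (intro sum_mono2) (auto simp: mult_nonneg_nonpos less_imp_le subset_iff intro!: mult_nonneg_nonpos bform_unit_nonpos)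
      then show ?thesis by (simp add: sum_negf)
    qed
    also have "(\<Sum>t\<in>N. x t * bform (\<alpha> t) (\<alpha> s)) \<le> (\<Sum>t\<in>N. - (c t * x t))"
    proof (rule sum_mono)
      fix t assume t: "t \<in> N"
      then have "x t * bform (\<alpha> t) (\<alpha> s) \<le> x t * (- c t)" using N(1) N(2)[OF t] pos by (intro mult_left_mono) (auto simp: less_imp_le)
      then show "x t * bform (\<alpha> t) (\<alpha> s) \<le> - (c t * x t)" by (simp add: mult_ac)
    qed
    finally show ?thesis using N(3) by (simp add: sum_negf)
  qed
  moreover have "bform y y = (\<Sum>s\<in>Y. x s * bform y (\<alpha> s))"
    by (subst (2) y_def) (simp add: bform_sum_right bform_simps)
  moreover have "(\<Sum>s\<in>Y. x s * bform y (\<alpha> s)) \<le> 0"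
    using calculation(2) pos by (intro sum_nonpos mult_nonneg_nonpos) (auto intro: less_imp_le)
  ultimately show False by linarith
qed

lemma subharmonic_adj:
  assumes Y: "Y \<subseteq> S" "s \<in> Y" and N: "N \<subseteq> {t \<in> Y. adj s t}" and le: "2 * x s \<le> (\<Sum>t\<in>N. x t)"
  shows "\<exists>N c. N \<subseteq> Y - {s} \<and> (\<forall>t\<in>N. bform (\<alpha> t) (\<alpha> s) \<le> - c t) \<and> x s \<le> (\<Sum>t\<in>N. c t * x t)"
proof (intro exI[of _ N] exI[of _ "\<lambda>_. 1 / 2 :: real"] conjI ballI)
  show "N \<subseteq> Y - {s}" using N by auto
  show "bform (\<alpha> t) (\<alpha> s) \<le> - (1 / 2)" if "t \<in> N" for t
    using bform_adj[of s t] bform_sym that N Y by (metis (mono_tags, lifting) divide_minus_left mem_Collect_eq subsetD)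
  show "x s \<le> (\<Sum>t\<in>N. 1 / 2 * x t)" using le by (simp add: sum_divide_distrib[symmetric])
qed

text \<open>The constant vector is the null vector of the affine diagram of type A.\<close>

lemma no_cycle:
  assumes Y: "Y \<subseteq> S" "Y \<noteq> {}" and two: "\<And>s. s \<in> Y \<Longrightarrow> \<exists>a\<in>Y. \<exists>b\<in>Y. a \<noteq> b \<and> adj s a \<and> adj s b"
  shows False
proof (rule subharmonic_False[OF Y, of "\<lambda>_. 1"])
  fix s assume s: "s \<in> Y"
  then obtain a b where "a \<in> Y" "b \<in> Y" "a \<noteq> b" "adj s a" "adj s b" using two by blast
  then show "\<exists>N c. N \<subseteq> Y - {s} \<and> (\<forall>t\<in>N. bform (\<alpha> t) (\<alpha> s) \<le> - c t) \<and> 1 \<le> (\<Sum>t\<in>N. c t * 1)"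
    by (intro subharmonic_adj[OF Y(1) s, of "{a, b}" "\<lambda>_. 1"]) auto
qed auto

text \<open>A gadget at \<open>p\<close> consists of further neighbours of \<open>p\<close> that act as one end of an affine diagram
  of type B, C or D; \<open>wt\<close> lists the coefficients of the isotropic vector of that diagram.\<close>

definition gadget :: "'a \<Rightarrow> 'a set \<Rightarrow> bool" where
  "gadget p G \<longleftrightarrow> (\<exists>a b. G = {a, b} \<and> a \<in> S \<and> b \<in> S \<and> a \<noteq> b \<and> adj p a \<and> adj p b) \<or>
    (\<exists>h. G = {h} \<and> h \<in> S \<and> m p h \<ge> 4)"

definition wt :: "'a set \<Rightarrow> 'a set \<Rightarrow> 'a \<Rightarrow> real" where
  "wt P H s = (if s \<in> P then 2 else if s \<in> H then sqrt 2 else 1)"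

lemma m_ge_4_adj: "s \<in> S \<Longrightarrow> m s t \<ge> 4 \<Longrightarrow> adj s t"
  by (auto simp: adj_def)

lemma bform_heavy: "s \<in> S \<Longrightarrow> t \<in> S \<Longrightarrow> m s t \<ge> 4 \<Longrightarrow> bform (\<alpha> t) (\<alpha> s) \<le> - (sqrt 2 / 2)"
  using bform_adj_le[of s t 4] bform_sym[of "\<alpha> t" "\<alpha> s"] by (simp add: cos_45)

lemma wt_ge_1: "wt P H s \<ge> 1"
  by (auto simp: wt_def)

text \<open>Leaves on edges of order at least 4 get weight \<open>sqrt 2\<close> because
  \<open>sqrt 2 * cos (pi / 4) = 1\<close>, which is what an end vertex of weight 2 has to receive
  from its gadget.\<close>

definition heavies :: "'a set \<Rightarrow> 'a set" where
  "heavies P = {h \<in> S. \<exists>p\<in>P. m p h \<ge> 4}"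

lemma gadget_contribution:
  assumes "gadget p G" "p \<in> P" "P \<subseteq> S"
  obtains c where "\<And>t. t \<in> G \<Longrightarrow> bform (\<alpha> t) (\<alpha> p) \<le> - c t" "1 \<le> (\<Sum>t\<in>G. c t * wt P (heavies P) t)"
  using assms(1) unfolding gadget_def
proof (elim disjE exE conjE)
  have pS: "p \<in> S" using assms by blast
  {
    fix a b assume "G = {a, b}" "a \<in> S" "b \<in> S" "a \<noteq> b" "adj p a" "adj p b"
    then show thesis
      using bform_adj[of p a] bform_adj[of p b] pS bform_sym wt_ge_1[of P "heavies P" a] wt_ge_1[of P "heavies P" b]
      by (intro that[of "\<lambda>_. 1 / 2"]) auto
  next
    fix h assume h: "G = {h}" "h \<in> S" "m p h \<ge> 4"
    then have "wt P (heavies P) h \<ge> sqrt 2" using assms(2) sqrt2_less_2 by (auto simp: wt_def heavies_def)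
    then have "sqrt 2 / 2 * sqrt 2 \<le> sqrt 2 / 2 * wt P (heavies P) h" by (intro mult_left_mono) auto
    then show thesis using h bform_heavy[OF pS] by (intro that[of "\<lambda>_. sqrt 2 / 2"]) auto
  }
qed

lemma gadget_props: "gadget p G \<Longrightarrow> p \<in> S \<Longrightarrow> G \<subseteq> S \<and> finite G \<and> p \<notin> G \<and> (\<forall>t\<in>G. adj p t)"
  using m_ge_4_adj by (auto simp: gadget_def)

lemma gadget_leaf:
  assumes g: "gadget p G" and p: "p \<in> P" "P \<subseteq> S" and P: "P \<subseteq> Y" "Y \<subseteq> S"
    and s: "s \<in> G" "s \<notin> P"
  shows "\<exists>N c. N \<subseteq> Y - {s} \<and> (\<forall>t\<in>N. bform (\<alpha> t) (\<alpha> s) \<le> - c t) \<and> wt P (heavies P) s \<le> (\<Sum>t\<in>N. c t * wt P (heavies P) t)"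
proof -
  have pS: "p \<in> S" using p by blast
  have sS: "s \<in> S" using gadget_props[OF g pS] s by blast
  show ?thesis
  proof (cases "s \<in> heavies P")
    case True
    then obtain q where q: "q \<in> P" "m q s \<ge> 4" by (auto simp: heavies_def)
    then have "bform (\<alpha> q) (\<alpha> s) \<le> - (sqrt 2 / 2)" using bform_heavy[of s q] m_sym[of q s] sS p by auto
    then show ?thesis using q s True P by (intro exI[of _ "{q}"] exI[of _ "\<lambda>_. sqrt 2 / 2"]) (auto simp: wt_def)
  next
    case False
    have "adj p s" using gadget_props[OF g pS] s by blast
    then have "bform (\<alpha> p) (\<alpha> s) \<le> - (1 / 2)" using bform_adj[OF pS sS] by simp
    then show ?thesis using False p P s by (intro exI[of _ "{p}"] exI[of _ "\<lambda>_. 1 / 2"]) (auto simp: wt_def)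
  qed
qed

text \<open>The degenerate affine diagrams whose two ends sit at one vertex; two pairs of neighbours
  give affine D4.\<close>

lemma two_gadgets_same:
  assumes p: "p \<in> S" and g: "gadget p G" "gadget p G'" "G \<inter> G' = {}"
  shows False
proof -
  let ?Y = "{p} \<union> G \<union> G'" and ?w = "wt {p} (heavies {p})"
  note gp = gadget_props[OF g(1) p] gadget_props[OF g(2) p]
  have Y: "?Y \<subseteq> S" using gp p by auto
  show False
  proof (rule subharmonic_False[OF Y, of ?w])
    show "?w s > 0" for s using wt_ge_1[of "{p}" "heavies {p}" s] by linarith
    fix s assume s: "s \<in> ?Y"
    show "\<exists>N c. N \<subseteq> ?Y - {s} \<and> (\<forall>t\<in>N. bform (\<alpha> t) (\<alpha> s) \<le> - c t) \<and> ?w s \<le> (\<Sum>t\<in>N. c t * ?w t)"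
    proof (cases "s = p")
      case True
      obtain c where c: "\<And>t. t \<in> G \<Longrightarrow> bform (\<alpha> t) (\<alpha> p) \<le> - c t" "1 \<le> (\<Sum>t\<in>G. c t * ?w t)"
        using gadget_contribution[OF g(1), of "{p}"] p by auto
      obtain d where d: "\<And>t. t \<in> G' \<Longrightarrow> bform (\<alpha> t) (\<alpha> p) \<le> - d t" "1 \<le> (\<Sum>t\<in>G'. d t * ?w t)"
        using gadget_contribution[OF g(2), of "{p}"] p by auto
      define e where "e t = (if t \<in> G then c t else d t)" for t
      have "(\<Sum>t\<in>G \<union> G'. e t * ?w t) = (\<Sum>t\<in>G. e t * ?w t) + (\<Sum>t\<in>G'. e t * ?w t)"
        using gp g(3) by (intro sum.union_disjoint) auto
      also have "(\<Sum>t\<in>G. e t * ?w t) = (\<Sum>t\<in>G. c t * ?w t)" by (intro sum.cong) (auto simp: e_def)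
      also have "(\<Sum>t\<in>G'. e t * ?w t) = (\<Sum>t\<in>G'. d t * ?w t)" using g(3) by (intro sum.cong) (auto simp: e_def)
      finally have "?w p \<le> (\<Sum>t\<in>G \<union> G'. e t * ?w t)" using c(2) d(2) by (simp add: wt_def)
      then show ?thesis using True gp c(1) d(1) by (intro exI[of _ "G \<union> G'"] exI[of _ e]) (auto simp: e_def)
    next
      case False
      then have "s \<in> G \<or> s \<in> G'" using s by auto
      then show ?thesis using gadget_leaf[OF g(1), of "{p}" ?Y s] gadget_leaf[OF g(2), of "{p}" ?Y s] False Y p by blast
    qed
  qed auto
qed

text \<open>The path carries weight 2, and the gadget at each end makes up for the missing
  neighbour. The gadgets may meet each other or the path, which the lower bounds for the weights
  absorb.\<close>

lemma two_gadgets_path: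
  assumes vs: "set vs \<subseteq> S" "distinct vs" "length vs \<ge> 2" "\<And>i. Suc i < length vs \<Longrightarrow> adj (vs ! i) (vs ! Suc i)"
    and g: "gadget (hd vs) G" "vs ! 1 \<notin> G" and g': "gadget (last vs) G'" "vs ! (length vs - 2) \<notin> G'"
  shows False
proof -
  let ?P = "set vs"
  let ?Y = "?P \<union> G \<union> G'" and ?w = "wt ?P (heavies ?P)"
  have ne: "vs \<noteq> []" using vs by auto
  have hl: "hd vs \<in> ?P" "last vs \<in> ?P" using ne by auto
  then have hlS: "hd vs \<in> S" "last vs \<in> S" using vs by auto
  note gp = gadget_props[OF g(1) hlS(1)] gadget_props[OF g'(1) hlS(2)]
  have Y: "?Y \<subseteq> S" using gp vs by auto
  have end_case: "\<exists>N c. N \<subseteq> ?Y - {s} \<and> (\<forall>t\<in>N. bform (\<alpha> t) (\<alpha> s) \<le> - c t) \<and> ?w s \<le> (\<Sum>t\<in>N. c t * ?w t)"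
    if h: "gadget s H" "H \<subseteq> ?Y" "s \<in> ?P" "v \<in> ?P" "v \<notin> H" "adj s v" for s H v
  proof -
    obtain c where c: "\<And>t. t \<in> H \<Longrightarrow> bform (\<alpha> t) (\<alpha> s) \<le> - c t" "1 \<le> (\<Sum>t\<in>H. c t * ?w t)"
      using gadget_contribution[OF h(1,3) vs(1)] by blast
    have sS: "s \<in> S" "v \<in> S" using h vs by auto
    note hp = gadget_props[OF h(1) sS(1)]
    define e where "e t = (if t = v then 1 / 2 else c t)" for t
    have "(\<Sum>t\<in>insert v H. e t * ?w t) = e v * ?w v + (\<Sum>t\<in>H. e t * ?w t)" using hp h by simp
    also have "(\<Sum>t\<in>H. e t * ?w t) = (\<Sum>t\<in>H. c t * ?w t)" using h by (intro sum.cong) (auto simp: e_def)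
    finally have "?w s \<le> (\<Sum>t\<in>insert v H. e t * ?w t)" using c(2) h by (simp add: wt_def e_def)
    moreover have "bform (\<alpha> v) (\<alpha> s) \<le> - (1 / 2)" using bform_adj[OF sS h(6)] bform_sym[of "\<alpha> v"] by simp
    moreover have "v \<noteq> s" using h(6) by auto
    ultimately show ?thesis using hp h c(1) by (intro exI[of _ "insert v H"] exI[of _ e]) (auto simp: e_def)
  qed
  show False
  proof (rule subharmonic_False[OF Y, of ?w])
    show "?Y \<noteq> {}" using ne by auto
    show "?w s > 0" for s using wt_ge_1[of ?P "heavies ?P" s] by linarith
    fix s assume s: "s \<in> ?Y"
    show "\<exists>N c. N \<subseteq> ?Y - {s} \<and> (\<forall>t\<in>N. bform (\<alpha> t) (\<alpha> s) \<le> - c t) \<and> ?w s \<le> (\<Sum>t\<in>N. c t * ?w t)"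
    proof (cases "s \<in> ?P")
      case True
      then obtain i where i: "i < length vs" "s = vs ! i" by (auto simp: in_set_conv_nth)
      consider "i = 0" | "i = length vs - 1" "i \<noteq> 0" | "i \<noteq> 0" "Suc i < length vs" using i by linarith
      then show ?thesis
      proof cases
        case 1
        then have "s = hd vs" using i ne by (simp add: hd_conv_nth)
        then show ?thesis using end_case[of s G "vs ! 1"] g vs(3) vs(4)[of 0] i 1 hl by auto
      next
        case 2
        then have s: "s = last vs" using i ne by (simp add: last_conv_nth)
        have a: "adj (vs ! (length vs - 2)) s" using vs(3) vs(4)[of "length vs - 2"] i 2 by (simp add: numeral_2_eq_2 Suc_diff_Suc)
        have P: "vs ! (length vs - 2) \<in> ?P" using vs(3) by simp
        then have "adj s (vs ! (length vs - 2))" using a adj_sym[of _ s] hlS s vs(1) by blast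
        then show ?thesis using end_case[of s G' "vs ! (length vs - 2)"] g' P hl s by auto
      next
        case 3
        have d: "vs ! (i - 1) \<noteq> vs ! Suc i" using vs(2) i 3 by (simp add: nth_eq_iff_index_eq)
        have "adj (vs ! (i - 1)) s" using vs(4)[of "i - 1"] i 3 by simp
        moreover have "vs ! (i - 1) \<in> ?P" "vs ! Suc i \<in> ?P" using i 3 by auto
        moreover have "adj s (vs ! Suc i)" using vs(4)[of i] i 3 by simp
        moreover have "s \<in> S" "vs ! (i - 1) \<in> S" using Y True \<open>vs ! (i - 1) \<in> ?P\<close> by auto
        ultimately have "{vs ! (i - 1), vs ! Suc i} \<subseteq> {t \<in> ?Y. adj s t}" using adj_sym by auto
        then show ?thesis using d True i 3 by (intro subharmonic_adj[OF Y s, of "{vs ! (i - 1), vs ! Suc i}"]) (auto simp: wt_def)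
      qed
    next
      case False
      then have "s \<in> G \<or> s \<in> G'" using s by auto
      then show ?thesis using gadget_leaf[OF g(1) hl(1) vs(1) _ Y, of s] gadget_leaf[OF g'(1) hl(2) vs(1) _ Y, of s] False by blast
    qed
  qed
qed

subsection \<open>Branch points and heavy edges\<close>

definition branch :: "'a set \<Rightarrow> 'a \<Rightarrow> bool" where
  "branch K p \<longleftrightarrow> p \<in> K \<and> (\<exists>a\<in>K. \<exists>b\<in>K. \<exists>c\<in>K. a \<noteq> b \<and> a \<noteq> c \<and> b \<noteq> c \<and> adj p a \<and> adj p b \<and> adj p c)"

definition heavy :: "'a set \<Rightarrow> 'a \<Rightarrow> 'a \<Rightarrow> bool" where
  "heavy K s t \<longleftrightarrow> s \<in> K \<and> t \<in> K \<and> s \<noteq> t \<and> m s t \<ge> 4"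

text \<open>The local features that separate a connected diagram from one of type A.\<close>

definition special :: "'a set \<Rightarrow> 'a set \<Rightarrow> bool" where
  "special K A \<longleftrightarrow> (\<exists>p. A = {p} \<and> branch K p) \<or> (\<exists>s t. A = {s, t} \<and> heavy K s t)"

lemma heavy_sym: "K \<subseteq> S \<Longrightarrow> heavy K s t \<Longrightarrow> heavy K t s"
  using m_sym[of s t] by (auto simp: heavy_def subset_iff)

text \<open>A branch point offers three pairs of neighbours, and \<open>v\<close> is missing from at
  least one of them.\<close>

lemma special_gadget:
  assumes K: "K \<subseteq> S" and A: "special K A" and p: "p \<in> A" and v: "v \<notin> A"
  obtains G where "gadget p G" "v \<notin> G"
  using A unfolding special_def
proof (elim disjE exE conjE)
  fix q assume q: "A = {q}" "branch K q"
  then obtain a b c where "a \<in> K" "b \<in> K" "c \<in> K" "a \<noteq> b" "a \<noteq> c" "b \<noteq> c" "adj q a" "adj q b" "adj q c"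
    by (auto simp: branch_def)
  then have "gadget q {a, b}" "gadget q {a, c}" "gadget q {b, c}" "v \<notin> {a, b} \<or> v \<notin> {a, c} \<or> v \<notin> {b, c}"
    using K by (auto simp: gadget_def)
  then show thesis using that p q by blast
next
  fix s t assume st: "A = {s, t}" "heavy K s t"
  then have "gadget s {t}" "gadget t {s}" using heavy_sym[OF K st(2)] K by (auto simp: gadget_def heavy_def)
  then show thesis using that p v st by blast
qed

text \<open>Two different features at a common vertex provide disjoint gadgets there, against
  \<open>two_gadgets_same\<close>.\<close>

lemma special_disjoint_gadgets:
  assumes K: "K \<subseteq> S" and A: "special K A" and B: "special K B" and ne: "A \<noteq> B" and p: "p \<in> A" "p \<in> B"
  shows False
proof -
  have pS: "p \<in> S" using A K p by (auto simp: special_def branch_def heavy_def)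
  have hb: False if h: "A = {p, t}" "heavy K p t" and b: "branch K p" for A t
  proof -
    obtain a b c where abc: "a \<in> K" "b \<in> K" "c \<in> K" "a \<noteq> b" "a \<noteq> c" "b \<noteq> c" "adj p a" "adj p b" "adj p c"
      using b by (auto simp: branch_def)
    then have "gadget p {a, b}" "gadget p {a, c}" "gadget p {b, c}" "t \<notin> {a, b} \<or> t \<notin> {a, c} \<or> t \<notin> {b, c}"
      using K by (auto simp: gadget_def)
    moreover have "gadget p {t}" using h K by (auto simp: gadget_def heavy_def)
    ultimately show False using two_gadgets_same[OF pS] by blast
  qed
  have pt: "\<exists>t. C = {p, t} \<and> heavy K p t" if "C = {s, t}" "heavy K s t" "p \<in> C" for C s t
    using that heavy_sym[OF K that(2)] by (cases "p = s") (auto simp: insert_commute)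
  consider "A = {p}" "branch K p" | t where "A = {p, t}" "heavy K p t"
    using A p(1) pt unfolding special_def by blast
  then show False
  proof cases
    case 1
    then obtain t where "B = {p, t}" "heavy K p t" using B p(2) pt ne unfolding special_def by blast
    then show False using hb 1 by blast
  next
    case 2
    have "branch K p \<or> (\<exists>t'. B = {p, t'} \<and> heavy K p t')" using B p(2) pt unfolding special_def by blast
    then show False
    proof
      assume "\<exists>t'. B = {p, t'} \<and> heavy K p t'"
      then obtain t' where t': "B = {p, t'}" "heavy K p t'" by blast
      then have "gadget p {t}" "gadget p {t'}" "t \<noteq> t'" using 2 ne K by (auto simp: gadget_def heavy_def)
      then show False using two_gadgets_same[OF pS, of "{t}" "{t'}"] by auto
    qed (use hb 2 in blast)
  qed
qed

text \<open>On a shortest path from \<open>A\<close> to \<open>B\<close> the second vertex is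
  outside \<open>A\<close> and the last but one is outside \<open>B\<close>. So each end carries a
  gadget that avoids its neighbour on the path, which \<open>two_gadgets_path\<close> forbids; a
  path of one vertex means that \<open>A\<close> and \<open>B\<close> overlap.\<close>

lemma special_unique:
  assumes K: "K \<subseteq> S" "conn K" and A: "special K A" and B: "special K B"
  shows "A = B"
proof (rule ccontr)
  assume ne: "A \<noteq> B"
  have AK: "A \<subseteq> K" "A \<noteq> {}" "B \<subseteq> K" "B \<noteq> {}" using A B by (auto simp: special_def branch_def heavy_def)
  define Q where "Q vs \<longleftrightarrow> vs \<noteq> [] \<and> hd vs \<in> A \<and> last vs \<in> B \<and> distinct vs \<and> set vs \<subseteq> K \<and>
     (\<forall>i. Suc i < length vs \<longrightarrow> adj (vs ! i) (vs ! Suc i))" for vs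
  have "\<exists>vs. Q vs"
  proof -
    obtain a b where ab: "a \<in> A" "b \<in> B" using AK by blast
    then have "(a, b) \<in> (coxeter_edges W K)\<^sup>*" using AK K unfolding conn_def by blast
    from rtrancl_distinct_list[OF this] obtain vs where vs: "vs \<noteq> []" "hd vs = a" "last vs = b" "distinct vs"
      "\<And>i. Suc i < length vs \<Longrightarrow> (vs ! i, vs ! Suc i) \<in> coxeter_edges W K" by blast
    have "vs ! i \<in> K" if "i < length vs" for i
    proof (cases i)
      case 0 then show ?thesis using vs ab AK by (simp add: hd_conv_nth[symmetric] subset_iff)
    next
      case (Suc j) then show ?thesis using vs(5)[of j] that by (auto simp: coxeter_edges_iff)
    qed
    then have "Q vs" using vs ab by (auto simp: Q_def coxeter_edges_iff in_set_conv_nth)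
    then show ?thesis by blast
  qed
  then obtain vs0 where "Q vs0" by blast
  define vs where "vs = arg_min length Q"
  have vs: "Q vs" unfolding vs_def using \<open>Q vs0\<close> by (rule arg_min_natI)
  have min: "length vs \<le> length us" if "Q us" for us unfolding vs_def using that by (rule arg_min_nat_le)
  have ne': "vs \<noteq> []" and hl: "hd vs \<in> A" "last vs \<in> B" using vs by (auto simp: Q_def)
  show False
  proof (cases "length vs = 1")
    case True
    then obtain p where "vs = [p]" by (metis One_nat_def Suc_length_conv length_0_conv)
    then show False using special_disjoint_gadgets[OF K(1) A B ne, of p] hl by auto
  next
    case False
    then have l2: "length vs \<ge> 2" using ne' by (cases vs) (auto simp: Suc_le_eq)
    then obtain p q ws where pq: "vs = p # q # ws" by (metis One_nat_def Suc_le_length_iff numeral_2_eq_2)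
    have "q \<notin> A"
    proof
      assume "q \<in> A"
      then have "Q (q # ws)" using vs pq unfolding Q_def by (auto split: if_splits)
      then show False using min pq by fastforce
    qed
    moreover have "vs ! (length vs - 2) \<notin> B"
    proof
      assume b: "vs ! (length vs - 2) \<in> B"
      have bn: "butlast vs \<noteq> []" "hd (butlast vs) = hd vs" using pq by auto
      moreover have "last (butlast vs) = vs ! (length vs - 2)"
        using last_conv_nth[OF bn(1)] nth_butlast[of "length vs - 2" vs] l2 by (simp add: numeral_2_eq_2)
      ultimately have "Q (butlast vs)" using vs b unfolding Q_def by (auto simp: distinct_butlast nth_butlast dest: in_set_butlastD)
      then show False using min[of "butlast vs"] l2 by simp
    qed
    moreover have "vs ! 1 = q" using pq by simp
    ultimately have n: "vs ! 1 \<notin> A" "vs ! (length vs - 2) \<notin> B" by simp_all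
    obtain G where G: "gadget (hd vs) G" "vs ! 1 \<notin> G" using special_gadget[OF K(1) A hl(1) n(1)] .
    obtain G' where G': "gadget (last vs) G'" "vs ! (length vs - 2) \<notin> G'" using special_gadget[OF K(1) B hl(2) n(2)] .
    have "set vs \<subseteq> S" "distinct vs" "\<And>i. Suc i < length vs \<Longrightarrow> adj (vs ! i) (vs ! Suc i)" using vs K unfolding Q_def by blast+
    then show False using two_gadgets_path[OF _ _ l2 _ G G'] by blast
  qed
qed

lemma branch_unique: "K \<subseteq> S \<Longrightarrow> conn K \<Longrightarrow> branch K p \<Longrightarrow> branch K q \<Longrightarrow> p = q"
  using special_unique[of K "{p}" "{q}"] by (auto simp: special_def)

lemma branch_heavy: "K \<subseteq> S \<Longrightarrow> conn K \<Longrightarrow> branch K p \<Longrightarrow> heavy K s t \<Longrightarrow> False"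
  using special_unique[of K "{p}" "{s, t}"] by (auto simp: special_def heavy_def)

lemma heavy_unique: "K \<subseteq> S \<Longrightarrow> conn K \<Longrightarrow> heavy K s t \<Longrightarrow> heavy K s' t' \<Longrightarrow> {s, t} = {s', t'}"
  using special_unique[of K "{s, t}" "{s', t'}"] by (auto simp: special_def)

lemma special_mono: "K \<subseteq> L \<Longrightarrow> special K A \<Longrightarrow> special L A"
  unfolding special_def branch_def heavy_def by blast

lemma special_subset: "special K A \<Longrightarrow> A \<subseteq> K \<and> A \<noteq> {}"
  by (auto simp: special_def branch_def heavy_def)

lemma degree_le_3:
  assumes "p \<in> S" "a \<in> S" "b \<in> S" "c \<in> S" "d \<in> S" "distinct [a, b, c, d]" "adj p a" "adj p b" "adj p c" "adj p d"
  shows False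
  using two_gadgets_same[of p "{a, b}" "{c, d}"] assms by (auto simp: gadget_def)

subsection \<open>Paths\<close>

definition path :: "'a list \<Rightarrow> bool" where
  "path ps \<longleftrightarrow> ps \<noteq> [] \<and> set ps \<subseteq> S \<and> distinct ps \<and>
    (\<forall>i<length ps. \<forall>j<length ps. adj (ps ! i) (ps ! j) \<longleftrightarrow> j = Suc i \<or> i = Suc j)"

text \<open>A chord would close a segment of the walk to a cycle.\<close>

lemma walk_chordless:
  assumes ps: "set ps \<subseteq> S" "distinct ps" "\<And>i. Suc i < length ps \<Longrightarrow> adj (ps ! i) (ps ! Suc i)"
    and ij: "i < j" "j < length ps" "adj (ps ! i) (ps ! j)"
  shows "j = Suc i"
proof (rule ccontr)
  assume n: "j \<noteq> Suc i"
  let ?Y = "(!) ps ` {i..j}"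
  have S: "ps ! k \<in> S" if "k < length ps" for k using ps that by auto
  have nd: "ps ! a \<noteq> ps ! b" if "a < length ps" "b < length ps" "a \<noteq> b" for a b
    using ps that by (simp add: nth_eq_iff_index_eq)
  show False
  proof (rule no_cycle[of ?Y])
    show "?Y \<subseteq> S" "?Y \<noteq> {}" using S ij by auto
    fix s assume "s \<in> ?Y"
    then obtain k where k: "k \<in> {i..j}" "s = ps ! k" by blast
    have bk: "adj (ps ! Suc l) (ps ! l)" if "Suc l < length ps" for l
      using ps(3)[OF that] adj_sym[of "ps ! l" "ps ! Suc l"] S[of l] S[of "Suc l"] that by simp
    consider "k = i" | "k = j" | "i < k" "k < j" using k by force
    then show "\<exists>a\<in>?Y. \<exists>b\<in>?Y. a \<noteq> b \<and> adj s a \<and> adj s b"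
    proof cases
      case 1
      then show ?thesis using k ij n ps(3)[of i] nd[of "Suc i" j]
        by (intro bexI[of _ "ps ! Suc i"] bexI[of _ "ps ! j"]) auto
    next
      case 2
      obtain l where l: "j = Suc l" using ij by (cases j) auto
      have "adj (ps ! j) (ps ! i)" using ij adj_sym[of "ps ! i" "ps ! j"] S[of i] S[of j] by simp
      then show ?thesis using 2 k l ij n bk[of l] nd[of l i]
        by (intro bexI[of _ "ps ! l"] bexI[of _ "ps ! i"]) auto
    next
      case 3
      then obtain l where l: "k = Suc l" by (cases k) auto
      then show ?thesis using 3 k ij bk[of l] ps(3)[of k] nd[of l "Suc k"]
        by (intro bexI[of _ "ps ! l"] bexI[of _ "ps ! Suc k"]) auto
    qed
  qed
qed

lemma walk_imp_path:
  assumes ps: "ps \<noteq> []" "set ps \<subseteq> S" "distinct ps" "\<And>i. Suc i < length ps \<Longrightarrow> adj (ps ! i) (ps ! Suc i)"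
  shows "path ps"
  unfolding path_def
proof (intro conjI ps allI impI)
  fix i j assume i: "i < length ps" and j: "j < length ps"
  have S: "ps ! i \<in> S" "ps ! j \<in> S" using ps i j by auto
  show "adj (ps ! i) (ps ! j) \<longleftrightarrow> j = Suc i \<or> i = Suc j"
    using walk_chordless[OF ps(2-4), of i j] walk_chordless[OF ps(2-4), of j i] ps(4)[of i] ps(4)[of j] i j adj_sym[OF S]
    by (metis adj_irrefl linorder_neqE_nat)
qed

text \<open>A longest walk fills \<open>K\<close>: a missing vertex adjacent to it would prolong it
  at an end or create a branch point in its interior.\<close>

lemma exists_path:
  assumes K: "K \<subseteq> S" "conn K" and nb: "\<And>p. \<not> branch K p"
  shows "\<exists>ps. path ps \<and> set ps = K"
proof -
  define Q where "Q vs \<longleftrightarrow> vs \<noteq> [] \<and> distinct vs \<and> set vs \<subseteq> K \<and> (\<forall>i. Suc i < length vs \<longrightarrow> adj (vs ! i) (vs ! Suc i))" for vs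
  have fK: "finite K" using finite_sub_S K by blast
  obtain s where s: "s \<in> K" using K by (auto simp: conn_def)
  have "Q [s]" using s by (simp add: Q_def)
  moreover have "\<forall>vs. Q vs \<longrightarrow> length vs \<le> card K"
    unfolding Q_def using fK by (metis card_mono distinct_card)
  then have "\<forall>vs. Q vs \<longrightarrow> length vs < Suc (card K)" by (simp add: less_Suc_eq_le)
  ultimately have "\<exists>ps. Q ps \<and> (\<forall>vs. Q vs \<longrightarrow> length vs \<le> length ps)" by (rule ex_has_greatest_nat)
  then obtain ps where ps: "Q ps" and max: "\<And>vs. Q vs \<Longrightarrow> length vs \<le> length ps" by blast
  have p: "ps \<noteq> []" "distinct ps" "set ps \<subseteq> K" "\<And>i. Suc i < length ps \<Longrightarrow> adj (ps ! i) (ps ! Suc i)"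
    using ps by (auto simp: Q_def)
  have "K \<subseteq> set ps"
  proof (rule conn_closed[OF K(2), of "hd ps"])
    show "hd ps \<in> set ps" "hd ps \<in> K" using p by auto
    fix a b assume ab: "a \<in> set ps" "b \<in> K" "adj a b"
    show "b \<in> set ps"
    proof (rule ccontr)
      assume b: "b \<notin> set ps"
      obtain i where i: "i < length ps" "a = ps ! i" using ab by (auto simp: in_set_conv_nth)
      have sym: "adj b a" "\<And>x y. x \<in> set ps \<Longrightarrow> y \<in> set ps \<Longrightarrow> adj x y \<Longrightarrow> adj y x" using ab adj_sym K p by blast+
      consider "i = 0" | "Suc i = length ps" | j where "i = Suc j" "Suc i < length ps"
        using i by (cases i) force+
      then show False
      proof cases
        case 1
        have "adj ((b # ps) ! k) ((b # ps) ! Suc k)" if "Suc k < length (b # ps)" for k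
          using that p(4) sym(1) i 1 by (cases k) auto
        then have "Q (b # ps)" using p b ab by (auto simp: Q_def)
        then show False using max by fastforce
      next
        case 2
        have "adj ((ps @ [b]) ! k) ((ps @ [b]) ! Suc k)" if "Suc k < length (ps @ [b])" for k
          using that p(4)[of k] ab(3) i 2 by (cases "k = i") (auto simp: nth_append less_Suc_eq)
        then have "Q (ps @ [b])" using p b ab by (auto simp: Q_def)
        then show False using max by fastforce
      next
        case 3
        have "adj a (ps ! j)" using sym(2)[of "ps ! j" a] p(4)[of j] i 3 by auto
        moreover have "adj a (ps ! Suc i)" using p(4)[of i] i 3 by simp
        moreover have "ps ! j \<noteq> ps ! Suc i" using p(2) i 3 by (simp add: nth_eq_iff_index_eq)
        moreover have "ps ! j \<in> set ps" "ps ! Suc i \<in> set ps" using i 3 by auto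
        ultimately have "branch K a"
          unfolding branch_def using ab p(3) b by (metis subsetD)
        then show False using nb by blast
      qed
    qed
  qed
  then show ?thesis using walk_imp_path[of ps] p K by blast
qed

definition nonA :: "'a set \<Rightarrow> bool" where "nonA K \<longleftrightarrow> (\<exists>A. special K A)"

text \<open>Special sets of \<open>K\<close> and of \<open>L\<close> are special in
  \<open>C\<close>, hence equal. This is the reason why components outside type A cannot be
  permuted.\<close>

lemma nonA_disjoint:
  assumes "C \<subseteq> S" "conn C" "K \<subseteq> C" "L \<subseteq> C" "nonA K" "nonA L"
  shows "K \<inter> L \<noteq> {}"
  using assms special_unique[of C] special_mono special_subset unfolding nonA_def by (metis (full_types) Int_greatest bot.extremum_uniqueI)

lemma typeA_or_nonA:
  assumes K: "K \<subseteq> S" "conn K" and n: "\<not> nonA K"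
  shows "\<exists>ps. path_A ps \<and> set ps = K"
proof -
  have "\<not> branch K p" for p using n by (auto simp: nonA_def special_def)
  then obtain ps where ps: "path ps" "set ps = K" using exists_path[OF K] by blast
  have h: "\<not> heavy K s t" for s t using n by (auto simp: nonA_def special_def)
  have "m (ps ! i) (ps ! j) = (if j = Suc i \<or> i = Suc j then 3 else 2)"
    if ij: "i < length ps" "j < length ps" "i \<noteq> j" for i j
  proof -
    have S: "ps ! i \<in> K" "ps ! j \<in> K" "ps ! i \<noteq> ps ! j" using ps ij by (auto simp: path_def nth_eq_iff_index_eq)
    then have "m (ps ! i) (ps ! j) < 4" using h[of "ps ! i" "ps ! j"] by (auto simp: heavy_def)
    moreover have "m (ps ! i) (ps ! j) \<ge> 2" using m_ge_2 S K by blast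
    moreover have "m (ps ! i) (ps ! j) \<noteq> 2 \<longleftrightarrow> j = Suc i \<or> i = Suc j" using ps ij S by (auto simp: path_def adj_def)
    ultimately show ?thesis by auto
  qed
  then show ?thesis using ps by (auto simp: path_A_def path_def)
qed

lemma path_unique_start:
  assumes p: "path ps" and q: "path qs" and e: "set qs = set ps" "qs ! 0 = ps ! 0"
  shows "qs = ps"
proof (rule nth_equalityI)
  have d: "distinct ps" "distinct qs" using p q by (auto simp: path_def)
  show l: "length qs = length ps" using d e(1) distinct_card by metis
  have "\<forall>j\<le>i. qs ! j = ps ! j" if "i < length qs" for i
    using that
  proof (induction i)
    case (Suc i)
    have IH: "\<forall>j\<le>i. qs ! j = ps ! j" using Suc by simp
    have "qs ! Suc i \<in> set ps" using Suc e nth_mem by blast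
    then obtain k where k: "k < length ps" "qs ! Suc i = ps ! k" by (metis in_set_conv_nth)
    have "adj (qs ! i) (qs ! Suc i)" using q Suc.prems unfolding path_def by (metis Suc_lessD)
    then have "k = Suc i \<or> i = Suc k" using p k IH Suc l by (auto simp: path_def)
    moreover have "i \<noteq> Suc k"
    proof
      assume "i = Suc k"
      then have "qs ! k = qs ! Suc i" using IH k by simp
      then show False using nth_eq_iff_index_eq[OF d(2), of k "Suc i"] Suc.prems \<open>i = Suc k\<close> by simp
    qed
    ultimately show ?case using IH k by (auto simp: le_Suc_eq)
  qed (use e in simp)
  then show "qs ! i = ps ! i" if "i < length qs" for i using that by blast
qed

lemma path_rev: "path ps \<Longrightarrow> path (rev ps)"
proof (rule walk_imp_path)
  assume p: "path ps"
  fix i assume "Suc i < length (rev ps)"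
  moreover have "length ps - Suc i = Suc (length ps - Suc (Suc i))" if "Suc i < length ps" using that by simp
  ultimately show "adj (rev ps ! i) (rev ps ! Suc i)" using p by (simp add: rev_nth path_def)
qed (auto simp: path_def)

text \<open>The first vertex of \<open>qs\<close> has at most one neighbour, so it is an end of
  \<open>ps\<close>, and \<open>path_unique_start\<close> determines the rest.\<close>

lemma path_unique:
  assumes p: "path ps" and q: "path qs" and e: "set qs = set ps"
  shows "qs = ps \<or> qs = rev ps"
proof (cases "length ps = 1")
  case True
  then have "length qs = 1" using p q e distinct_card unfolding path_def by metis
  then have "qs ! 0 = ps ! 0" using True e by (cases ps; cases qs) auto
  then show ?thesis using path_unique_start[OF p q e] by simp
next
  case False
  have l: "length qs = length ps" using p q e distinct_card unfolding path_def by metis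
  have ne: "length ps \<ge> 2" using p False by (cases ps) (auto simp: path_def Suc_le_eq)
  obtain k where k: "k < length ps" "qs ! 0 = ps ! k" using e l ne by (metis in_set_conv_nth nth_mem order_less_le_trans pos2)
  consider "k = 0" | "Suc k = length ps" | "0 < k" "Suc k < length ps" using k by linarith
  then show ?thesis
  proof cases
    case 1
    then show ?thesis using path_unique_start[OF p q e] k by simp
  next
    case 2
    then have "length ps - Suc 0 = k" by linarith
    then have "qs ! 0 = rev ps ! 0" using rev_nth[of 0 ps] k ne by (cases "ps = []") auto
    then show ?thesis using path_unique_start[OF path_rev[OF p] q] e by simp
  next
    case 3
    have "adj (qs ! 0) (ps ! (k - 1))" "adj (qs ! 0) (ps ! Suc k)" using p k 3 by (auto simp: path_def)
    moreover obtain a b where "a < length qs" "ps ! (k - 1) = qs ! a" "b < length qs" "ps ! Suc k = qs ! b"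
      using e 3 k by (metis in_set_conv_nth nth_mem less_imp_diff_less)
    moreover have "0 < length qs" using l ne by linarith
    then have "\<forall>j<length qs. adj (qs ! 0) (qs ! j) \<longleftrightarrow> j = Suc 0 \<or> 0 = Suc j" using q unfolding path_def by blast
    then have "\<And>j. j < length qs \<Longrightarrow> adj (qs ! 0) (qs ! j) \<Longrightarrow> j = 1" by simp
    ultimately have "a = 1" "b = 1" by metis+
    then have "ps ! (k - 1) = ps ! Suc k" using \<open>ps ! (k - 1) = qs ! a\<close> \<open>ps ! Suc k = qs ! b\<close> by simp
    moreover have "distinct ps" using p by (simp add: path_def)
    ultimately show ?thesis using nth_eq_iff_index_eq[of ps "k - 1" "Suc k"] 3 k by simp
  qed
qed

end

context finite_coxeter
begin

subsection \<open>Spiders\<close>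

definition walk :: "'a list \<Rightarrow> bool" where
  "walk ps \<longleftrightarrow> set ps \<subseteq> S \<and> distinct ps \<and> successively adj ps"

lemma walk_path: "walk ps \<Longrightarrow> ps \<noteq> [] \<Longrightarrow> path ps"
  by (rule walk_imp_path) (auto simp: walk_def successively_conv_nth)

lemma path_walk: "path ps \<Longrightarrow> walk ps"
  by (auto simp: walk_def path_def successively_conv_nth)

lemma walk_join:
  assumes "walk (b # p)" "walk (b # q)" "distinct (b # p @ q)"
  shows "path (rev p @ b # q)"
proof (rule walk_path)
  have "successively (\<lambda>x y. adj y x) p"
  proof -
    have "successively adj p" "set p \<subseteq> S" using assms by (auto simp: walk_def successively_Cons)
    then show ?thesis using adj_sym by (auto simp: successively_conv_nth subset_iff)
  qed
  moreover have "p \<noteq> [] \<Longrightarrow> adj (hd p) b"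
    using assms adj_sym[of b "hd p"] hd_in_set[of p] by (auto simp: walk_def successively_Cons subset_iff simp del: hd_in_set)
  ultimately show "walk (rev p @ b # q)"
    using assms by (auto simp: walk_def successively_append_iff successively_rev last_rev)
qed simp

text \<open>Only adjacencies along the arms are demanded; that there are no others follows because
  two arms joined at \<open>b\<close> form a walk, hence a path.\<close>

definition spider :: "'a \<Rightarrow> 'a list \<Rightarrow> 'a list \<Rightarrow> 'a list \<Rightarrow> bool" where
  "spider b p q r \<longleftrightarrow> p \<noteq> [] \<and> q \<noteq> [] \<and> r \<noteq> [] \<and> distinct (b # p @ q @ r) \<and>
     walk (b # p) \<and> walk (b # q) \<and> walk (b # r)"

abbreviation spider_set :: "'a \<Rightarrow> 'a list \<Rightarrow> 'a list \<Rightarrow> 'a list \<Rightarrow> 'a set" where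
  "spider_set b p q r \<equiv> insert b (set p \<union> set q \<union> set r)"

lemma spider_swap: "spider b p q r \<Longrightarrow> spider b q p r" "spider b p q r \<Longrightarrow> spider b p r q"
  by (auto simp: spider_def)

lemma spider_subset: "spider b p q r \<Longrightarrow> spider_set b p q r \<subseteq> S"
  by (auto simp: spider_def walk_def)

lemma spider_paths:
  assumes "spider b p q r" shows "path (rev p @ b # q)" "path (rev p @ b # r)"
  using assms by (auto simp: spider_def intro!: walk_join)

lemma path_adj:
  assumes "path xs" "i < length xs" "t \<in> set xs" "adj (xs ! i) t"
  shows "(0 < i \<and> t = xs ! (i - 1)) \<or> (Suc i < length xs \<and> t = xs ! Suc i)"
proof -
  obtain j where j: "j < length xs" "t = xs ! j" using assms(3) by (auto simp: in_set_conv_nth)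
  then have "j = Suc i \<or> i = Suc j" using assms by (auto simp: path_def)
  then show ?thesis using j by auto
qed

lemma spider_adj_center:
  assumes sp: "spider b p q r" and t: "t \<in> spider_set b p q r" "adj b t"
  shows "t \<in> {hd p, hd q, hd r}"
proof -
  have ne: "p \<noteq> []" "q \<noteq> []" "r \<noteq> []" using sp by (auto simp: spider_def)
  have *: "t \<in> {hd p, hd q'}" if q': "path (rev p @ b # q')" "q' \<noteq> []" "t \<in> set (rev p @ b # q')" for q'
  proof -
    let ?xs = "rev p @ b # q'"
    have i: "length p < length ?xs" "?xs ! length p = b" by (auto simp: nth_append)
    have "(0 < length p \<and> t = ?xs ! (length p - 1)) \<or> (Suc (length p) < length ?xs \<and> t = ?xs ! Suc (length p))"
      using path_adj[OF q'(1) i(1) q'(3)] i(2) t(2) by simp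
    moreover have "?xs ! (length p - 1) = hd p" using ne by (simp add: nth_append rev_nth hd_conv_nth)
    moreover have "?xs ! Suc (length p) = hd q'" using q' by (simp add: nth_append hd_conv_nth)
    ultimately show ?thesis by auto
  qed
  have "t \<in> set (rev p @ b # q) \<or> t \<in> set (rev p @ b # r)" using t by auto
  then show ?thesis using *[OF spider_paths(1)[OF sp] ne(2)] *[OF spider_paths(2)[OF sp] ne(3)] by auto
qed

lemma spider_adj_arm:
  assumes sp: "spider b p q r" and i: "i < length p" and t: "t \<in> spider_set b p q r" "adj (p ! i) t"
  shows "(i = 0 \<and> t = b) \<or> (0 < i \<and> t = p ! (i - 1)) \<or> (Suc i < length p \<and> t = p ! Suc i)"
proof -
  have *: ?thesis if q': "path (rev p @ b # q')" "t \<in> set (rev p @ b # q')" for q'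
  proof -
    let ?xs = "rev p @ b # q'" and ?j = "length p - Suc i"
    have j: "?j < length ?xs" "?xs ! ?j = p ! i" using i by (auto simp: nth_append rev_nth)
    have "(0 < ?j \<and> t = ?xs ! (?j - 1)) \<or> (Suc ?j < length ?xs \<and> t = ?xs ! Suc ?j)"
      using path_adj[OF q'(1) j(1) q'(2)] j(2) t(2) by simp
    then show ?thesis
    proof
      assume a: "0 < ?j \<and> t = ?xs ! (?j - 1)"
      then have "?xs ! (?j - 1) = p ! Suc i" using i by (auto simp: nth_append rev_nth)
      then show ?thesis using a by simp
    next
      assume a: "Suc ?j < length ?xs \<and> t = ?xs ! Suc ?j"
      show ?thesis
      proof (cases "i = 0")
        case True then show ?thesis using a i by (auto simp: nth_append)
      next
        case False
        then have "Suc ?j < length p" "length p - Suc (Suc ?j) = i - 1" using i by auto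
        then have "?xs ! Suc ?j = p ! (i - 1)" by (simp add: nth_append rev_nth)
        then show ?thesis using a False by simp
      qed
    qed
  qed
  have "t \<in> set (rev p @ b # q) \<or> t \<in> set (rev p @ b # r)" using t by auto
  then show ?thesis using *[OF spider_paths(1)[OF sp]] *[OF spider_paths(2)[OF sp]] by blast
qed

lemma spider_branch: "spider b p q r \<Longrightarrow> branch (spider_set b p q r) b"
  unfolding branch_def spider_def walk_def
  by (intro conjI bexI[of _ "hd p"] bexI[of _ "hd q"] bexI[of _ "hd r"])
    (auto simp: successively_Cons neq_Nil_conv)

text \<open>Choose arms of maximal total length. A further vertex adjacent to the centre would give
  it four neighbours, one adjacent to the tip of an arm would prolong that arm, and one adjacent
  elsewhere would create a second branch point.\<close>

lemma exists_spider:
  assumes K: "K \<subseteq> S" "conn K" and b: "branch K b"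
  shows "\<exists>p q r. spider b p q r \<and> spider_set b p q r = K"
proof -
  define Q where "Q = (\<lambda>(p, q, r). spider b p q r \<and> spider_set b p q r \<subseteq> K)"
  define f where "f = (\<lambda>(p::'a list, q::'a list, r::'a list). length p + length q + length r)"
  have fK: "finite K" using finite_sub_S K by blast
  obtain a c d where acd: "a \<in> K" "c \<in> K" "d \<in> K" "a \<noteq> c" "a \<noteq> d" "c \<noteq> d" "adj b a" "adj b c" "adj b d"
    and bK: "b \<in> K" using b by (auto simp: branch_def)
  have "b \<noteq> a" "b \<noteq> c" "b \<noteq> d" using acd by auto
  then have "Q ([a], [c], [d])" using acd bK K by (auto simp: Q_def spider_def walk_def)
  moreover have "f y < Suc (card K)" if "Q y" for y
  proof -
    obtain p q r where y: "y = (p, q, r)" by (cases y)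
    have "distinct (p @ q @ r)" "set (p @ q @ r) \<subseteq> K" using that by (auto simp: Q_def y spider_def)
    then have "length (p @ q @ r) \<le> card K" using fK by (metis card_mono distinct_card)
    then show ?thesis by (simp add: f_def y)
  qed
  ultimately have "\<exists>y. Q y \<and> (\<forall>z. Q z \<longrightarrow> f z \<le> f y)" by (intro ex_has_greatest_nat[of Q _ f "Suc (card K)"]) auto
  then obtain p q r where Q: "Q (p, q, r)" and max: "\<And>z. Q z \<Longrightarrow> f z \<le> f (p, q, r)" by auto
  have sp: "spider b p q r" "spider_set b p q r \<subseteq> K" using Q by (auto simp: Q_def)
  have arm: False if sp: "spider b p q r" "spider_set b p q r \<subseteq> K" and v: "v \<in> K" "v \<notin> spider_set b p q r"
      and max: "\<not> (spider b (p @ [v]) q r)" and a: "a \<in> set p" "adj a v" for p q r v a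
  proof -
    obtain i where i: "i < length p" "a = p ! i" using a by (auto simp: in_set_conv_nth)
    have w: "walk (b # p)" "distinct (b # p)" using sp by (auto simp: spider_def)
    have aK: "a \<in> S" "v \<in> S" "a \<in> K" using sp v K a by auto
    show False
    proof (cases "Suc i = length p")
      case True
      then have "length p - 1 = i" "p \<noteq> []" by auto
      then have "a = last p" using i last_conv_nth[of p] by simp
      then have "walk (b # p @ [v])" using w v aK a(2) i
        by (auto simp: walk_def successively_append_iff simp flip: append_Cons)
      then have "spider b (p @ [v]) q r" using sp v by (auto simp: spider_def)
      then show False using max by blast
    next
      case False
      define c where "c = (if i = 0 then b else p ! (i - 1))"
      have pth: "path (b # p)" using walk_path[OF w(1)] by simp
      have A: "j < Suc (length p) \<Longrightarrow> k < Suc (length p) \<Longrightarrow> adj ((b # p) ! j) ((b # p) ! k) \<longleftrightarrow> k = Suc j \<or> j = Suc k" for j k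
        using pth by (simp add: path_def)
      have "adj a ((b # p) ! i)" "adj a (p ! Suc i)"
        using A[of "Suc i" i] A[of "Suc i" "Suc (Suc i)"] i False by simp_all
      then have ad: "adj a c" "adj a (p ! Suc i)" by (auto simp: c_def nth_Cons')
      have "c \<in> set (b # p)" using i by (auto simp: c_def)
      moreover have "p ! Suc i \<in> set p" using i False by simp
      moreover have "(b # p) ! i = c" by (simp add: c_def nth_Cons')
      then have "c \<noteq> p ! Suc i" using nth_eq_iff_index_eq[OF w(2), of i "Suc (Suc i)"] i False by auto
      ultimately have "branch K a" unfolding branch_def using aK ad a(2) v sp(2)
        by (intro conjI bexI[of _ c] bexI[of _ "p ! Suc i"] bexI[of _ v]) auto
      then have "a = b" using branch_unique K b by blast
      then show False using a w by simp
    qed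
  qed
  have "K \<subseteq> spider_set b p q r"
  proof (rule conn_closed[OF K(2), of b])
    show "b \<in> spider_set b p q r" "b \<in> K" using bK by auto
    fix a v assume av: "a \<in> spider_set b p q r" "v \<in> K" "adj a v"
    show "v \<in> spider_set b p q r"
    proof (rule ccontr)
      assume v: "v \<notin> spider_set b p q r"
      have e: "\<not> spider b (p @ [v]) q r" "\<not> spider b (q @ [v]) p r" "\<not> spider b (r @ [v]) p q"
      proof -
        have "\<not> Q (p @ [v], q, r)" "\<not> Q (p, q @ [v], r)" "\<not> Q (p, q, r @ [v])"
          using max[of "(p @ [v], q, r)"] max[of "(p, q @ [v], r)"] max[of "(p, q, r @ [v])"] by (auto simp: f_def)
        moreover have "spider b (q @ [v]) p r \<Longrightarrow> spider b p (q @ [v]) r" by (rule spider_swap(1))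
        moreover have "spider b (r @ [v]) p q \<Longrightarrow> spider b p q (r @ [v])" by (rule spider_swap(2)[OF spider_swap(1)])
        ultimately show "\<not> spider b (p @ [v]) q r" "\<not> spider b (q @ [v]) p r" "\<not> spider b (r @ [v]) p q"
          using sp(2) av(2) by (auto simp: Q_def)
      qed
      consider "a = b" | "a \<in> set p" | "a \<in> set q" | "a \<in> set r" using av by auto
      then show False
      proof cases
        case 1
        have "hd p \<in> S" "hd q \<in> S" "hd r \<in> S" "distinct [hd p, hd q, hd r, v]" "adj b (hd p)" "adj b (hd q)" "adj b (hd r)"
          using sp(1) v by (auto simp: spider_def walk_def successively_Cons neq_Nil_conv)
        then show False using degree_le_3[of b "hd p" "hd q" "hd r" v] 1 av K bK by blast
      next
        case 2 then show False using arm[OF sp av(2) v e(1) _ av(3)] by blast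
      next
        case 3
        have "spider b q p r" by (rule spider_swap(1)[OF sp(1)])
        moreover have "spider_set b q p r \<subseteq> K" "v \<notin> spider_set b q p r" using sp(2) v by auto
        ultimately
        show False using arm[of q p r v a] 3 av e(2) by blast
      next
        case 4
        have "spider b r p q" by (rule spider_swap(1)[OF spider_swap(2)[OF sp(1)]])
        moreover have "spider_set b r p q \<subseteq> K" "v \<notin> spider_set b r p q" using sp(2) v by auto
        ultimately
        show False using arm[of r p q v a] 4 av e(3) by blast
      qed
    qed
  qed
  then show ?thesis using sp by blast
qed

text \<open>A walk that leaves the centre along an arm can neither turn off nor return. Applied to
  the images of arms under an automorphism, which are thus determined by their first vertex.\<close>

lemma spider_walk_prefix:
  assumes sp: "spider b p q r" and ws: "distinct (b # ws)" "successively adj (b # ws)" "set ws \<subseteq> spider_set b p q r"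
    "ws \<noteq> []" "hd ws = hd p"
  shows "ws = take (length ws) p"
proof -
  have ne: "p \<noteq> []" using sp by (simp add: spider_def)
  have "i < length p \<and> (\<forall>j\<le>i. ws ! j = p ! j)" if "i < length ws" for i
    using that
  proof (induction i)
    case 0
    then show ?case using ws ne by (simp add: hd_conv_nth)
  next
    case (Suc i)
    then have IH: "i < length p" "\<forall>j\<le>i. ws ! j = p ! j" by auto
    have a: "adj (p ! i) (ws ! Suc i)" using ws(2) Suc IH by (auto simp: successively_conv_nth)
    have "ws ! Suc i \<in> spider_set b p q r" using ws(3) Suc nth_mem by blast
    from spider_adj_arm[OF sp IH(1) this a]
    have "Suc i < length p \<and> ws ! Suc i = p ! Suc i"
    proof (elim disjE conjE)
      assume "ws ! Suc i = b"
      then show ?thesis using ws(1) Suc nth_mem by (metis distinct.simps(2))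
    next
      assume i0: "0 < i" "ws ! Suc i = p ! (i - 1)"
      then have "ws ! Suc i = ws ! (i - 1)" using IH by simp
      moreover have "distinct ws" using ws by simp
      then have "ws ! Suc i \<noteq> ws ! (i - 1)" using Suc.prems nth_eq_iff_index_eq[of ws "Suc i" "i - 1"] by simp
      ultimately show ?thesis by blast
    qed auto
    then show ?case using IH by (auto simp: le_Suc_eq)
  qed
  then have *: "i < length p" "ws ! i = p ! i" if "i < length ws" for i using that by blast+
  have "length ws \<le> length p" using *(1)[of "length ws - 1"] ws(4) by (cases ws) auto
  then show ?thesis using * by (intro nth_equalityI) auto
qed

definition automorph :: "'a set \<Rightarrow> ('a \<Rightarrow> 'a) \<Rightarrow> bool" where
  "automorph K f \<longleftrightarrow> f ` K = K \<and> inj_on f K \<and> (\<forall>s\<in>K. \<forall>t\<in>K. m (f s) (f t) = m s t)"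

lemma automorph_adj: "automorph K f \<Longrightarrow> s \<in> K \<Longrightarrow> t \<in> K \<Longrightarrow> adj (f s) (f t) \<longleftrightarrow> adj s t"
  by (auto simp: automorph_def adj_def inj_on_def)

lemma automorph_in: "automorph K f \<Longrightarrow> s \<in> K \<Longrightarrow> f s \<in> K"
  by (auto simp: automorph_def)

lemma automorph_walk:
  assumes "automorph K f" "walk ps" "set ps \<subseteq> K" "K \<subseteq> S"
  shows "walk (map f ps)"
proof -
  have "adj (f (ps ! i)) (f (ps ! Suc i))" if "Suc i < length ps" for i
  proof -
    have "ps ! i \<in> K" "ps ! Suc i \<in> K" using that assms(3) by (auto simp: subset_iff)
    then show ?thesis using automorph_adj[OF assms(1)] assms(2) that by (auto simp: walk_def successively_conv_nth)
  qed
  moreover have "set (map f ps) \<subseteq> S" using automorph_in[OF assms(1)] assms(3,4) by auto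
  moreover have "distinct (map f ps)"
    using assms(1-3) inj_on_subset by (auto simp: automorph_def walk_def distinct_map)
  ultimately show ?thesis by (auto simp: walk_def successively_conv_nth)
qed

lemma automorph_branch:
  assumes f: "automorph K f" and b: "branch K b"
  shows "branch K (f b)"
proof -
  obtain a c d where "a \<in> K" "c \<in> K" "d \<in> K" "a \<noteq> c" "a \<noteq> d" "c \<noteq> d" "adj b a" "adj b c" "adj b d" "b \<in> K"
    using b by (auto simp: branch_def)
  moreover from this have "f a \<noteq> f c" "f a \<noteq> f d" "f c \<noteq> f d" using f by (auto simp: automorph_def inj_on_def)
  ultimately show ?thesis unfolding branch_def using automorph_adj[OF f] automorph_in[OF f]
    by (intro conjI bexI[of _ "f a"] bexI[of _ "f c"] bexI[of _ "f d"]) auto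
qed

lemma spider_automorph:
  assumes sp: "spider b p q r" and K: "K = spider_set b p q r" "conn K" and f: "automorph K f"
  shows "f b = b" and "(map f p, map f q, map f r) \<in> {(p, q, r), (p, r, q), (q, p, r), (q, r, p), (r, p, q), (r, q, p)}"
proof -
  have KS: "K \<subseteq> S" using spider_subset[OF sp] K by simp
  have bb: "branch K b" using spider_branch[OF sp] K by simp
  show fb: "f b = b" using branch_unique[OF KS K(2) automorph_branch[OF f bb] bb] .
  have ne: "p \<noteq> []" "q \<noteq> []" "r \<noteq> []" and w: "walk (b # p)" "walk (b # q)" "walk (b # r)" using sp by (auto simp: spider_def)
  have hd_in: "hd p \<in> set p" "hd q \<in> set q" "hd r \<in> set r" using ne by auto
  have sps: "spider b q p r" "spider b r p q" "spider_set b q p r = K" "spider_set b r p q = K"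
    using spider_swap(1)[OF sp] spider_swap(1)[OF spider_swap(2)[OF sp]] K by auto
  have prefix: "length a \<le> length p' \<and> map f a = take (length a) p'"
    if a: "walk (b # a)" "a \<noteq> []" "set a \<subseteq> K" and p': "spider b p' q' r'" "spider_set b p' q' r' = K" "f (hd a) = hd p'" for a p' q' r'
  proof -
    have "walk (map f (b # a))" using automorph_walk[OF f a(1)] a bb KS by (auto simp: branch_def)
    then have "map f a = take (length (map f a)) p'"
      using a fb p' automorph_in[OF f] by (intro spider_walk_prefix[OF p'(1)]) (auto simp: walk_def hd_map)
    then show ?thesis by (metis length_map length_take min.absorb_iff1 min.commute)
  qed
  have arm: "f (hd a) \<in> {hd p, hd q, hd r}" if "walk (b # a)" "a \<noteq> []" "set a \<subseteq> K" for a
  proof -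
    have "hd a \<in> K" "adj b (hd a)" "b \<in> K" using that bb by (auto simp: walk_def successively_Cons branch_def)
    then have "adj b (f (hd a))" "f (hd a) \<in> K" using automorph_adj[OF f, of b "hd a"] fb automorph_in[OF f] by auto
    then show ?thesis using spider_adj_center[OF sp] K by blast
  qed
  have sub: "set p \<subseteq> K" "set q \<subseteq> K" "set r \<subseteq> K" using K by auto
  have inj: "f (hd p) \<noteq> f (hd q)" "f (hd p) \<noteq> f (hd r)" "f (hd q) \<noteq> f (hd r)"
  proof -
    have "set p \<inter> set q = {}" "set p \<inter> set r = {}" "set q \<inter> set r = {}" using sp by (auto simp: spider_def)
    then have "hd p \<noteq> hd q" "hd p \<noteq> hd r" "hd q \<noteq> hd r" using hd_in by (metis IntI empty_iff)+
    then show "f (hd p) \<noteq> f (hd q)" "f (hd p) \<noteq> f (hd r)" "f (hd q) \<noteq> f (hd r)"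
      using f hd_in sub unfolding automorph_def inj_on_def by blast+
  qed
  have P: "length a \<le> length p \<and> map f a = take (length a) p" if "walk (b # a)" "a \<noteq> []" "set a \<subseteq> K" "f (hd a) = hd p" for a
    using prefix[OF that(1-3) sp _ that(4)] K by simp
  have Q: "length a \<le> length q \<and> map f a = take (length a) q" if "walk (b # a)" "a \<noteq> []" "set a \<subseteq> K" "f (hd a) = hd q" for a
    using prefix[OF that(1-3) sps(1,3) that(4)] .
  have R: "length a \<le> length r \<and> map f a = take (length a) r" if "walk (b # a)" "a \<noteq> []" "set a \<subseteq> K" "f (hd a) = hd r" for a
    using prefix[OF that(1-3) sps(2,4) that(4)] .
  note Ps = P[OF w(1) ne(1) sub(1)] P[OF w(2) ne(2) sub(2)] P[OF w(3) ne(3) sub(3)]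
  note Qs = Q[OF w(1) ne(1) sub(1)] Q[OF w(2) ne(2) sub(2)] Q[OF w(3) ne(3) sub(3)]
  note Rs = R[OF w(1) ne(1) sub(1)] R[OF w(2) ne(2) sub(2)] R[OF w(3) ne(3) sub(3)]
  have a: "f (hd p) \<in> {hd p, hd q, hd r}" "f (hd q) \<in> {hd p, hd q, hd r}" "f (hd r) \<in> {hd p, hd q, hd r}"
    using arm w ne sub by blast+
  consider "f (hd p) = hd p" "f (hd q) = hd q" "f (hd r) = hd r" | "f (hd p) = hd p" "f (hd q) = hd r" "f (hd r) = hd q"
    | "f (hd p) = hd q" "f (hd q) = hd p" "f (hd r) = hd r" | "f (hd p) = hd q" "f (hd q) = hd r" "f (hd r) = hd p"
    | "f (hd p) = hd r" "f (hd q) = hd p" "f (hd r) = hd q" | "f (hd p) = hd r" "f (hd q) = hd q" "f (hd r) = hd p"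
    using a inj by (smt (verit) insertE singletonD)
  \<comment> \<open>In each case the lengths bound each other around the cycles of the permutation
    of arms, so the prefixes are whole arms.\<close>
  then show "(map f p, map f q, map f r) \<in> {(p, q, r), (p, r, q), (q, p, r), (q, r, p), (r, p, q), (r, q, p)}"
    using Ps Qs Rs by cases simp_all
qed

lemma spider_walkD:
  assumes "spider b p q r"
  shows "\<And>i. Suc i < length p \<Longrightarrow> adj (p ! i) (p ! Suc i) \<and> adj (p ! Suc i) (p ! i)" "adj b (p ! 0)" "adj (p ! 0) b"
proof -
  have pth: "path (b # p)" using assms walk_path[of "b # p"] by (auto simp: spider_def)
  have A: "\<And>i j. i < Suc (length p) \<Longrightarrow> j < Suc (length p) \<Longrightarrow> adj ((b # p) ! i) ((b # p) ! j) \<longleftrightarrow> j = Suc i \<or> i = Suc j"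
    using pth by (simp add: path_def)
  show "adj (p ! i) (p ! Suc i) \<and> adj (p ! Suc i) (p ! i)" if "Suc i < length p" for i
    using A[of "Suc i" "Suc (Suc i)"] A[of "Suc (Suc i)" "Suc i"] that by simp
  have "p \<noteq> []" using assms by (simp add: spider_def)
  then show "adj b (p ! 0)" "adj (p ! 0) b" using A[of 0 1] A[of 1 0] by auto
qed

lemma subharmonic_adj_False:
  fixes x :: "'a \<Rightarrow> real"
  assumes Y: "Y \<subseteq> S" "Y \<noteq> {}" and pos: "\<And>s. s \<in> Y \<Longrightarrow> x s > 0"
    and nb: "\<And>s. s \<in> Y \<Longrightarrow> nb s \<subseteq> {t \<in> Y. adj s t} \<and> 2 * x s \<le> (\<Sum>t\<in>nb s. x t)"
  shows False
proof (rule subharmonic_False[OF Y, of x])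
  fix s assume s: "s \<in> Y"
  show "\<exists>N c. N \<subseteq> Y - {s} \<and> (\<forall>t\<in>N. bform (\<alpha> t) (\<alpha> s) \<le> - c t) \<and> x s \<le> (\<Sum>t\<in>N. c t * x t)"
    using subharmonic_adj[OF Y(1) s, of "nb s" x] nb[OF s] by blast
qed (rule pos)

text \<open>The null vector of affine E6: 3 at the centre, then 2 and 1 along each arm.\<close>

lemma no_E6:
  assumes sp: "spider b p q r" and l: "length p \<ge> 2" "length q \<ge> 2" "length r \<ge> 2"
  shows False
proof -
  obtain p1 p2 ps where p: "p = p1 # p2 # ps" using l(1) by (metis Suc_le_length_iff numeral_2_eq_2)
  obtain q1 q2 qs where q: "q = q1 # q2 # qs" using l(2) by (metis Suc_le_length_iff numeral_2_eq_2)
  obtain r1 r2 rs where r: "r = r1 # r2 # rs" using l(3) by (metis Suc_le_length_iff numeral_2_eq_2)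
  have a: "adj b p1" "adj p1 b" "adj p1 p2" "adj p2 p1" using spider_walkD(2,3)[OF sp] spider_walkD(1)[OF sp, of 0] p by auto
  have b: "adj b q1" "adj q1 b" "adj q1 q2" "adj q2 q1"
    using spider_walkD(2,3)[OF spider_swap(1)[OF sp]] spider_walkD(1)[OF spider_swap(1)[OF sp], of 0] q by auto
  have c: "adj b r1" "adj r1 b" "adj r1 r2" "adj r2 r1"
    using spider_walkD(2,3)[OF spider_swap(1)[OF spider_swap(2)[OF sp]]] spider_walkD(1)[OF spider_swap(1)[OF spider_swap(2)[OF sp]], of 0] r by auto
  let ?Y = "{b, p1, p2, q1, q2, r1, r2}"
  define x where "x s = (if s = b then 3 else if s \<in> {p1, q1, r1} then 2 else 1 :: real)" for s
  have d: "distinct [b, p1, p2, q1, q2, r1, r2]" using sp p q r by (auto simp: spider_def)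
  then have d': "distinct (rev [b, p1, p2, q1, q2, r1, r2])" by (simp only: distinct_rev)
  have S: "?Y \<subseteq> S" using spider_subset[OF sp] p q r by auto
  define nb where "nb s = (if s = b then {p1, q1, r1} else if s = p1 then {b, p2} else if s = q1 then {b, q2} else if s = r1 then {b, r2} else if s = p2 then {p1} else if s = q2 then {q1} else {r1})" for s
  have nbs: "nb s \<subseteq> {t \<in> ?Y. adj s t} \<and> 2 * x s \<le> (\<Sum>t\<in>nb s. x t)" if "s \<in> ?Y" for s
    using that a b c d d' by (elim insertE emptyE; simp add: nb_def x_def)
  show False
    by (rule subharmonic_adj_False[OF S _ _ nbs]) (simp_all add: x_def)
qed

text \<open>The null vector of affine E7: 4 at the centre, then 3, 2, 1 along the two long arms and
  2 on the short one.\<close>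

lemma no_E7:
  assumes sp: "spider b p q r" and l: "length q \<ge> 3" "length r \<ge> 3"
  shows False
proof -
  obtain p1 ps where p: "p = p1 # ps" using sp by (auto simp: spider_def neq_Nil_conv)
  obtain q1 q2 q3 qs where q: "q = q1 # q2 # q3 # qs" using l(1) by (metis Suc_le_length_iff numeral_3_eq_3)
  obtain r1 r2 r3 rs where r: "r = r1 # r2 # r3 # rs" using l(2) by (metis Suc_le_length_iff numeral_3_eq_3)
  have a: "adj b p1" "adj p1 b" using spider_walkD(2,3)[OF sp] p by auto
  have b: "adj b q1" "adj q1 b" "adj q1 q2" "adj q2 q1" "adj q2 q3" "adj q3 q2"
    using spider_walkD(2,3)[OF spider_swap(1)[OF sp]] spider_walkD(1)[OF spider_swap(1)[OF sp], of 0]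
      spider_walkD(1)[OF spider_swap(1)[OF sp], of 1] q by auto
  have c: "adj b r1" "adj r1 b" "adj r1 r2" "adj r2 r1" "adj r2 r3" "adj r3 r2"
    using spider_walkD(2,3)[OF spider_swap(1)[OF spider_swap(2)[OF sp]]] spider_walkD(1)[OF spider_swap(1)[OF spider_swap(2)[OF sp]], of 0]
      spider_walkD(1)[OF spider_swap(1)[OF spider_swap(2)[OF sp]], of 1] r by auto
  let ?Y = "{b, p1, q1, q2, q3, r1, r2, r3}"
  define x where "x s = (if s = b then 4 else if s \<in> {q1, r1} then 3 else if s \<in> {p1, q2, r2} then 2 else 1 :: real)" for s
  have d: "distinct [b, p1, q1, q2, q3, r1, r2, r3]" using sp p q r by (auto simp: spider_def)
  then have d': "distinct (rev [b, p1, q1, q2, q3, r1, r2, r3])" by (simp only: distinct_rev)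
  have S: "?Y \<subseteq> S" using spider_subset[OF sp] p q r by auto
  define nb where "nb s = (if s = b then {p1, q1, r1} else if s = p1 then {b} else if s = q1 then {b, q2} else if s = r1 then {b, r2} else if s = q2 then {q1, q3} else if s = r2 then {r1, r3} else if s = q3 then {q2} else {r2})" for s
  have nbs: "nb s \<subseteq> {t \<in> ?Y. adj s t} \<and> 2 * x s \<le> (\<Sum>t\<in>nb s. x t)" if "s \<in> ?Y" for s
    using that a b c d d' by (elim insertE emptyE; simp add: nb_def x_def)
  show False
    by (rule subharmonic_adj_False[OF S _ _ nbs]) (simp_all add: x_def)
qed

text \<open>The exact value is the positive root of \<open>4 c^2 - 2 c - 1\<close>, which comes from
  comparing the cosines of 3 pi / 5 and 2 pi / 5. The bound 3/4 is what
  \<open>no_heavy_middle\<close> asks for: with weights 1, 2, 2, 1 an inner vertex receives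
  \<open>1/2 * 1 + 3/4 * 2 = 2\<close>.\<close>

lemma cos_pi_5: "cos (pi / 5) \<ge> 3 / 4"
proof (rule ccontr)
  define c where "c = cos (pi / 5)"
  assume "\<not> cos (pi / 5) \<ge> 3 / 4"
  then have c: "c < 3 / 4" by (simp add: c_def)
  have c0: "c > 0" unfolding c_def by (rule cos_gt_zero) auto
  have "3 * (pi / 5) = pi - 2 * (pi / 5)" by simp
  then have "cos (3 * (pi / 5)) = - cos (2 * (pi / 5))" by (simp only: cos_pi_minus)
  then have "4 * c ^ 3 - 3 * c = - (2 * c\<^sup>2 - 1)" unfolding c_def cos_treble_cos cos_double_cos .
  then have "(c + 1) * (4 * c\<^sup>2 - 2 * c - 1) = 0" by (simp add: algebra_simps power2_eq_square power3_eq_cube)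
  then have "4 * c\<^sup>2 - 2 * c - 1 = 0" using c0 by simp
  moreover have "c * (4 * c - 2) \<le> c * 1" using c c0 by (intro mult_left_mono) auto
  ultimately show False using c by (simp add: algebra_simps power2_eq_square)
qed

lemma no_heavy_middle:
  assumes S: "{a, s, t, c} \<subseteq> S" and d: "distinct [a, s, t, c]" and a: "adj s a" "adj t c" and st: "m s t \<ge> 5"
  shows False
proof -
  let ?Y = "{a, s, t, c}"
  define x where "x v = (if v \<in> {s, t} then 2 else 1 :: real)" for v
  have a': "adj a s" "adj c t" using a adj_sym S by auto
  have h: "bform (\<alpha> t) (\<alpha> s) \<le> - (3 / 4)" "bform (\<alpha> s) (\<alpha> t) \<le> - (3 / 4)"
    using bform_adj_le[of s t 5] bform_adj_le[of t s 5] cos_pi_5 st S m_sym[of s t] by auto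
  have e: "bform (\<alpha> a) (\<alpha> s) \<le> - (1 / 2)" "bform (\<alpha> c) (\<alpha> t) \<le> - (1 / 2)" using bform_adj a' S by auto
  show False
  proof (rule subharmonic_False[OF S, of x])
    fix v assume v: "v \<in> ?Y"
    consider "v = a" | "v = s" | "v = t" | "v = c" using v by auto
    then show "\<exists>N e. N \<subseteq> ?Y - {v} \<and> (\<forall>t\<in>N. bform (\<alpha> t) (\<alpha> v) \<le> - e t) \<and> x v \<le> (\<Sum>t\<in>N. e t * x t)"
    proof cases
      case 1 then show ?thesis using a' d by (intro subharmonic_adj[OF S v, of "{s}"]) (auto simp: x_def)
    next
      case 2
      then show ?thesis using d h e by (intro exI[of _ "{a, t}"] exI[of _ "\<lambda>v. if v = a then 1 / 2 else 3 / 4"]) (auto simp: x_def)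
    next
      case 3
      then show ?thesis using d h e by (intro exI[of _ "{c, s}"] exI[of _ "\<lambda>v. if v = c then 1 / 2 else 3 / 4"]) (auto simp: x_def)
    next
      case 4 then show ?thesis using a' d by (intro subharmonic_adj[OF S v, of "{t}"]) (auto simp: x_def)
    qed
  qed (auto simp: x_def)
qed

end

lemma map_eq_self: "map g xs = xs \<longleftrightarrow> (\<forall>s\<in>set xs. g s = s)"
  by (induction xs) auto

context finite_coxeter
begin

lemma path_adj_iff: "path xs \<Longrightarrow> i < length xs \<Longrightarrow> j < length xs \<Longrightarrow> adj (xs ! i) (xs ! j) \<longleftrightarrow> j = Suc i \<or> i = Suc j"
  by (simp add: path_def)

subsection \<open>Nontrivial opposition\<close>

lemma opp_img: "K \<subseteq> S \<Longrightarrow> s \<in> K \<Longrightarrow> opp K s = img (w0 K) s"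
proof -
  assume K: "K \<subseteq> S" "s \<in> K"
  then have "s \<in> S" "opp K s \<in> S" using opp_in[OF K] by auto
  then show ?thesis using conj_gen_eq_gen[of "w0 K" s "opp K s"] act_w0[OF K] K by (simp add: img_def)
qed

lemma opp_automorph:
  assumes K: "K \<subseteq> S" shows "automorph K (opp K)"
  unfolding automorph_def
proof (intro conjI ballI)
  show inj: "inj_on (opp K) K" using opp_opp[OF K] by (metis inj_onI)
  show "opp K ` K = K" using opp_in[OF K] by (intro endo_inj_surj finite_sub_S[OF K] inj) auto
  show "m (opp K s) (opp K t) = m s t" if "s \<in> K" "t \<in> K" for s t
  proof -
    have "s \<in> S" "t \<in> S" using K that by auto
    then show ?thesis using m_img[OF w0_carrier[OF K]] opp_img[OF K] that by simp
  qed
qed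

text \<open>If \<open>v\<close> is a weight and \<open>w0\<close> acts as \<open>-1\<close>, then \<open>2 v\<close> lies in the root lattice.\<close>

lemma integral_weight:
  assumes K: "K \<subseteq> S" and m: "\<And>s t. s \<in> K \<Longrightarrow> t \<in> K \<Longrightarrow> s \<noteq> t \<Longrightarrow> m s t = 2 \<or> m s t = 3"
    and w: "w \<in> par K" and v: "v \<in> coord K" "\<And>s. s \<in> K \<Longrightarrow> 2 * bform v (\<alpha> s) \<in> \<int>"
  shows "act w v t - v t \<in> \<int>"
proof -
  define P where "P x \<longleftrightarrow> x \<in> coord K \<and> (\<forall>s\<in>K. 2 * bform x (\<alpha> s) \<in> \<int>)" for x
  have gen: "P (act s x) \<and> (\<forall>t. act s x t - x t \<in> \<int>)" if s: "s \<in> K" and x: "P x" for s x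
  proof -
    have sS: "s \<in> S" using s K by blast
    have i: "2 * bform x (\<alpha> s) \<in> \<int>" using x s by (simp add: P_def)
    have a: "2 * bform (\<alpha> s) (\<alpha> r) \<in> \<int>" if r: "r \<in> K" for r
    proof (cases "s = r")
      case False
      then have "m s r = 2 \<or> m s r = 3" using m s r by blast
      moreover have "r \<in> S" using r K by blast
      ultimately show ?thesis using sS by (auto simp: bform_unit cos_60)
    qed (use sS in auto)
    have "2 * bform (act s x) (\<alpha> r) \<in> \<int>" if r: "r \<in> K" for r
    proof -
      have "2 * bform (act s x) (\<alpha> r) = 2 * bform x (\<alpha> r) - (2 * bform x (\<alpha> s)) * (2 * bform (\<alpha> s) (\<alpha> r))"
        using sS by (simp add: act_gen bform_simps)
      also have "\<dots> \<in> \<int>" using Ints_diff[OF _ Ints_mult[OF i a[OF r]]] x r unfolding P_def by blast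
      finally show ?thesis .
    qed
    moreover have "act s x \<in> coord K" using x act_coord[OF K par_gen[OF s] order_refl] by (simp add: P_def)
    moreover have "act s x t - x t \<in> \<int>" for t
    proof -
      have "act s x t - x t = - ((2 * bform x (\<alpha> s)) * \<alpha> s t)" using sS by (simp add: act_gen vec_apply)
      also have "\<dots> \<in> \<int>" by (intro Ints_minus Ints_mult[OF i]) (simp add: unit_vec_def)
      finally show ?thesis .
    qed
    ultimately show ?thesis by (auto simp: P_def)
  qed
  have "\<forall>x. P x \<longrightarrow> P (act w x) \<and> (\<forall>t. act w x t - x t \<in> \<int>)"
    using w
  proof induction
    case (inv h)
    then show ?case using gen K by (auto simp: subset_iff)
  next
    case (eng h1 h2)
    have c: "h1 \<in> carrier W" "h2 \<in> carrier W" using eng par_in_W[OF K] by auto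
    show ?case
    proof (intro allI impI conjI)
      fix x assume x: "P x"
      have 2: "P (act h2 x)" "\<And>t. act h2 x t - x t \<in> \<int>" using eng x by blast+
      then have 1: "P (act h1 (act h2 x))" "\<And>t. act h1 (act h2 x) t - act h2 x t \<in> \<int>" using eng by blast+
      then show "P (act (h1 \<otimes> h2) x)" using c by simp
      show "act (h1 \<otimes> h2) x t - x t \<in> \<int>" for t
        using Ints_add[OF 1(2)[of t] 2(2)[of t]] c by simp
    qed
  qed (use gen in auto)
  then show ?thesis using v by (auto simp: P_def)
qed

lemma list_bform:
  assumes xs: "distinct xs" "set xs \<subseteq> S" and j: "j < length xs"
    and m: "\<And>i j. i < length xs \<Longrightarrow> j < length xs \<Longrightarrow> i \<noteq> j \<Longrightarrow> m (xs ! i) (xs ! j) = (if E i j then 3 else 2)"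
  shows "2 * bform (\<Sum>i<length xs. c i *\<^sub>R \<alpha> (xs ! i)) (\<alpha> (xs ! j)) = 2 * c j - (\<Sum>i | i < length xs \<and> i \<noteq> j \<and> E i j. c i)"
proof -
  let ?n = "length xs"
  have S: "xs ! i \<in> S" if "i < ?n" for i using xs that by auto
  have b: "2 * (c i * bform (\<alpha> (xs ! i)) (\<alpha> (xs ! j))) = (if E i j then - c i else 0)" if i: "i < ?n" "i \<noteq> j" for i
    using bform_unit[OF S[OF i(1)] S[OF j]] m[OF i(1) j i(2)] by (auto simp: cos_60)
  have "2 * bform (\<Sum>i<?n. c i *\<^sub>R \<alpha> (xs ! i)) (\<alpha> (xs ! j)) = (\<Sum>i<?n. 2 * (c i * bform (\<alpha> (xs ! i)) (\<alpha> (xs ! j))))"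
    by (simp add: bform_sum_left bform_simps sum_distrib_left)
  also have "\<dots> = 2 * c j + (\<Sum>i\<in>{..<?n} - {j}. 2 * (c i * bform (\<alpha> (xs ! i)) (\<alpha> (xs ! j))))"
    using j S[OF j] by (subst sum.remove[of _ j]) auto
  also have "(\<Sum>i\<in>{..<?n} - {j}. 2 * (c i * bform (\<alpha> (xs ! i)) (\<alpha> (xs ! j)))) = (\<Sum>i\<in>{..<?n} - {j}. if E i j then - c i else 0)"
    using b by (intro sum.cong) auto
  also have "\<dots> = (\<Sum>i\<in>{i \<in> {..<?n} - {j}. E i j}. - c i)" by (subst sum.inter_filter) auto
  also have "{i \<in> {..<?n} - {j}. E i j} = {i. i < ?n \<and> i \<noteq> j \<and> E i j}" by auto
  finally show ?thesis by (simp add: sum_negf)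
qed

lemma list_apply:
  fixes c :: "nat \<Rightarrow> real"
  assumes "distinct xs" "j < length xs"
  shows "(\<Sum>i<length xs. c i *\<^sub>R \<alpha> (xs ! i)) (xs ! j) = c j"
proof -
  have "(\<Sum>i<length xs. c i *\<^sub>R \<alpha> (xs ! i)) (xs ! j) = (\<Sum>i<length xs. if i = j then c j else 0)"
    unfolding sum_fun_apply using assms by (intro sum.cong) (auto simp: vec_apply unit_vec_def nth_eq_iff_index_eq)
  then show ?thesis using assms by simp
qed

text \<open>The numbers \<open>c\<close> are the coordinates of a weight \<open>v\<close>. If
  opposition were trivial, \<open>w0\<close> would act as -1 on \<open>v\<close>, and
  \<open>integral_weight\<close> would make all coordinates of \<open>2 v\<close> integers.\<close>

lemma opp_nontrivial:
  fixes c :: "nat \<Rightarrow> real"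
  assumes xs: "distinct xs" "set xs \<subseteq> S"
    and m: "\<And>i j. i < length xs \<Longrightarrow> j < length xs \<Longrightarrow> i \<noteq> j \<Longrightarrow> m (xs ! i) (xs ! j) = (if E i j then 3 else 2)"
    and c: "\<And>j. j < length xs \<Longrightarrow> 2 * c j - (\<Sum>i | i < length xs \<and> i \<noteq> j \<and> E i j. c i) \<in> \<int>"
    and k: "k < length xs" "2 * c k \<notin> \<int>"
  shows "\<exists>s\<in>set xs. opp (set xs) s \<noteq> s"
proof (rule ccontr)
  assume "\<not> ?thesis"
  then have o: "\<And>s. s \<in> set xs \<Longrightarrow> opp (set xs) s = s" by blast
  define v where "v = (\<Sum>i<length xs. c i *\<^sub>R \<alpha> (xs ! i))"
  have "act (w0 (set xs)) v = - v"
    using act_w0[OF xs(2)] o by (simp add: v_def act_simps sum_negf)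
  moreover have "act (w0 (set xs)) v (xs ! k) - v (xs ! k) \<in> \<int>"
  proof (rule integral_weight[OF xs(2) _ w0_par[OF xs(2)]])
    show "m s t = 2 \<or> m s t = 3" if st: "s \<in> set xs" "t \<in> set xs" "s \<noteq> t" for s t
    proof -
      obtain i j where "i < length xs" "s = xs ! i" "j < length xs" "t = xs ! j" using st by (auto simp: in_set_conv_nth)
      moreover have "i \<noteq> j" using st(3) calculation by auto
      ultimately show ?thesis using m[of i j] by auto
    qed
    show "v \<in> coord (set xs)" unfolding v_def by (intro coord_sum coord_scale) auto
    show "2 * bform v (\<alpha> s) \<in> \<int>" if s: "s \<in> set xs" for s
    proof -
      obtain j where j: "j < length xs" "s = xs ! j" using s by (auto simp: in_set_conv_nth)
      then show ?thesis using list_bform[OF xs j(1), of E c] m c[OF j(1)] by (simp add: v_def)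
    qed
  qed
  ultimately have "- v (xs ! k) - v (xs ! k) \<in> \<int>" by (simp add: vec_apply)
  moreover have "v (xs ! k) = c k" unfolding v_def by (rule list_apply[OF xs(1) k(1)])
  ultimately have "- (2 * c k) \<in> \<int>" by simp
  then show False using k(2) by (metis Ints_minus minus_minus)
qed

text \<open>The certificate is the last fundamental weight of type A, whose coordinates grow
  linearly along the path.\<close>

lemma path_A_opp:
  assumes p: "path_A ps" and n: "length ps \<ge> 2"
  shows "\<exists>s\<in>set ps. opp (set ps) s \<noteq> s"
proof (rule opp_nontrivial[where E = "\<lambda>i j. j = Suc i \<or> i = Suc j" and c = "\<lambda>i. real (Suc i) / real (Suc (length ps))" and k = 0])
  let ?n = "length ps" and ?c = "\<lambda>i. real (Suc i) / real (Suc (length ps))"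
  show "distinct ps" "set ps \<subseteq> S" "0 < length ps" using p n by (auto simp: path_A_def)
  show "m (ps ! i) (ps ! j) = (if j = Suc i \<or> i = Suc j then 3 else 2)" if "i < ?n" "j < ?n" "i \<noteq> j" for i j
    using that p by (auto simp: path_A_def)
  show "2 * ?c j - (\<Sum>i | i < ?n \<and> i \<noteq> j \<and> (j = Suc i \<or> i = Suc j). ?c i) \<in> \<int>" if j: "j < ?n" for j
  proof -
    consider "j = 0" | "0 < j" "Suc j < ?n" | "0 < j" "Suc j = ?n" using j by linarith
    then show ?thesis
    proof cases
      case 1
      then have "{i. i < ?n \<and> i \<noteq> j \<and> (j = Suc i \<or> i = Suc j)} = {1}" using n by auto
      then show ?thesis using 1 by (simp add: field_simps)
    next
      case 2
      then have e: "{i. i < ?n \<and> i \<noteq> j \<and> (j = Suc i \<or> i = Suc j)} = {j - 1, Suc j}" by auto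
      have "?c (j - 1) + ?c (Suc j) = (real j + real (Suc (Suc j))) / real (Suc ?n)" using 2 by (simp add: add_divide_distrib)
      also have "\<dots> = 2 * ?c j" by simp
      finally have "2 * ?c j - (?c (j - 1) + ?c (Suc j)) = 0" by simp
      moreover have "j - 1 \<noteq> Suc j" by simp
      ultimately show ?thesis unfolding e by (simp del: of_nat_Suc)
    next
      case 3
      then have e: "{i. i < ?n \<and> i \<noteq> j \<and> (j = Suc i \<or> i = Suc j)} = {j - 1}" by auto
      have "2 * ?c j - ?c (j - 1) = (2 * real (Suc j) - real j) / real (Suc ?n)" using 3 by (simp add: diff_divide_distrib)
      also have "2 * real (Suc j) - real j = real (Suc ?n)" using 3 by simp
      finally have "2 * ?c j - ?c (j - 1) = 1" by simp
      then show ?thesis unfolding e by (simp del: of_nat_Suc)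
    qed
  qed
  show "2 * ?c 0 \<notin> \<int>"
  proof
    assume "2 * ?c 0 \<in> \<int>"
    then obtain z :: int where z: "2 / real (Suc ?n) = of_int z" by (auto elim: Ints_cases)
    have "0 < 2 / real (Suc ?n)" "2 / real (Suc ?n) < 1" using n by (auto simp: field_simps)
    then have "0 < real_of_int z" "real_of_int z < 1" unfolding z by blast+
    then show False by simp
  qed
qed

definition D_edge :: "nat \<Rightarrow> nat \<Rightarrow> bool" where
  "D_edge i j \<longleftrightarrow> (i = 0 \<and> j = 2) \<or> (i \<ge> 1 \<and> j = Suc i)"

text \<open>The vertex \<open>ds ! 0\<close> plays the role of \<open>u\<close>, and \<open>ds ! i\<close> that of \<open>s\<^sub>i\<close>.\<close>

definition path_D :: "'a list \<Rightarrow> bool" where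
  "path_D ds \<longleftrightarrow> length ds \<ge> 4 \<and> set ds \<subseteq> S \<and> distinct ds \<and>
    (\<forall>i<length ds. \<forall>j<length ds. i \<noteq> j \<longrightarrow> m (ds ! i) (ds ! j) = (if D_edge i j \<or> D_edge j i then 3 else 2))"

text \<open>The certificate is a half-spin weight modulo the root lattice. For odd rank its class
  has order 4, whence the coordinate 1/4.\<close>

lemma path_D_opp:
  assumes p: "path_D ds" and n: "odd (length ds)"
  shows "\<exists>s\<in>set ds. opp (set ds) s \<noteq> s"
proof (rule opp_nontrivial[where E = "\<lambda>i j. D_edge i j \<or> D_edge j i" and k = 0 and
      c = "\<lambda>i. if i = 0 then 1 / 4 else if i = 1 then - 1 / 4 else if even i then 1 / 2 else 0 :: real"])
  let ?n = "length ds" and ?c = "\<lambda>i. if i = 0 then 1 / 4 else if i = 1 then - 1 / 4 else if even i then 1 / 2 else 0 :: real"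
  have n4: "?n \<ge> 4" using p by (simp add: path_D_def)
  with n have n5: "?n \<ge> 5" by (cases "?n = 4") auto
  show "distinct ds" "set ds \<subseteq> S" "0 < length ds" using p n4 by (auto simp: path_D_def)
  show "m (ds ! i) (ds ! j) = (if D_edge i j \<or> D_edge j i then 3 else 2)" if "i < ?n" "j < ?n" "i \<noteq> j" for i j
    using that p by (auto simp: path_D_def)
  show "2 * ?c j - (\<Sum>i | i < ?n \<and> i \<noteq> j \<and> (D_edge i j \<or> D_edge j i). ?c i) \<in> \<int>" if j: "j < ?n" for j
  proof -
    consider "j = 0" | "j = 1" | "j = 2" | "3 \<le> j" "Suc j < ?n" | "3 \<le> j" "Suc j = ?n" using j by linarith
    then show ?thesis
    proof cases
      case 1
      then have "{i. i < ?n \<and> i \<noteq> j \<and> (D_edge i j \<or> D_edge j i)} = {2}" using n5 by (auto simp: D_edge_def)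
      then show ?thesis using 1 by simp
    next
      case 2
      then have "{i. i < ?n \<and> i \<noteq> j \<and> (D_edge i j \<or> D_edge j i)} = {2}" using n5 by (auto simp: D_edge_def)
      then show ?thesis using 2 by simp
    next
      case 3
      then have "{i. i < ?n \<and> i \<noteq> j \<and> (D_edge i j \<or> D_edge j i)} = {0, 1, 3}" using n5 by (auto simp: D_edge_def)
      then show ?thesis using 3 by simp
    next
      case 4
      then have e: "{i. i < ?n \<and> i \<noteq> j \<and> (D_edge i j \<or> D_edge j i)} = {j - 1, Suc j}" by (auto simp: D_edge_def)
      have "j - 1 \<noteq> Suc j" by simp
      moreover have "j - 1 \<noteq> 0" "j - 1 \<noteq> 1" using 4 by auto
      moreover have "even (j - 1) \<longleftrightarrow> odd j" using 4 by auto
      ultimately show ?thesis unfolding e using 4 by auto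
    next
      case 5
      then have e: "{i. i < ?n \<and> i \<noteq> j \<and> (D_edge i j \<or> D_edge j i)} = {j - 1}" by (auto simp: D_edge_def)
      have "even j" using n 5 by (metis even_Suc)
      moreover have "j - 1 \<noteq> 0" "j - 1 \<noteq> 1" "odd (j - 1)" using 5 \<open>even j\<close> by presburger+
      ultimately show ?thesis unfolding e using 5 by auto
    qed
  qed
  show "2 * ?c 0 \<notin> \<int>"
  proof
    assume "2 * ?c 0 \<in> \<int>"
    then obtain z :: int where z: "1 / 2 = real_of_int z" by (auto elim: Ints_cases)
    have "0 < real_of_int z" "real_of_int z < 1" unfolding z[symmetric] by auto
    then show False by simp
  qed
qed

lemma spider_m:
  assumes sp: "spider b p q r" and nh: "\<And>s t. \<not> heavy (spider_set b p q r) s t"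
    and st: "s \<in> spider_set b p q r" "t \<in> spider_set b p q r" "s \<noteq> t"
  shows "m s t = (if adj s t then 3 else 2)"
proof -
  have S: "s \<in> S" "t \<in> S" using spider_subset[OF sp] st by blast+
  have "m s t < 4" using nh[of s t] st by (auto simp: heavy_def)
  then show ?thesis using m_ge_2[OF S st(3)] st(3) by (auto simp: adj_def)
qed

text \<open>The certificate is a minuscule weight of E6 modulo the root lattice; the weight lattice
  has index 3 over the root lattice there, whence the thirds.\<close>

lemma spider_opp_E6:
  assumes sp: "spider b [q1, q2] [r1, r2] [p1]" and nh: "\<And>s t. \<not> heavy (spider_set b [q1, q2] [r1, r2] [p1]) s t"
  shows "\<exists>s\<in>spider_set b [q1, q2] [r1, r2] [p1]. opp (spider_set b [q1, q2] [r1, r2] [p1]) s \<noteq> s"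
proof -
  let ?xs = "[q2, q1, b, r1, r2, p1]"
  let ?E = "\<lambda>i j. (i < 5 \<and> j < 5 \<and> (j = Suc i \<or> i = Suc j)) \<or> (i = 2 \<and> j = 5) \<or> (i = 5 \<and> j = (2::nat))"
  let ?c = "\<lambda>i. [1 / 3, 2 / 3, 0, 1 / 3, 2 / 3, 0] ! i :: real"
  have set: "set ?xs = spider_set b [q1, q2] [r1, r2] [p1]" by auto
  have d: "distinct ?xs" using sp by (auto simp: spider_def)
  have p1: "path [q2, q1, b, r1, r2]" and p2: "path [q2, q1, b, p1]" using spider_paths[OF sp] by simp_all
  have p3: "path [r2, r1, b, p1]" using spider_paths(2)[OF spider_swap(1)[OF sp]] by simp
  have less: "(\<forall>i<length ?xs. P i) \<longleftrightarrow> P 0 \<and> P 1 \<and> P 2 \<and> P 3 \<and> P 4 \<and> P 5" for P :: "nat \<Rightarrow> bool"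
    by (simp add: All_less_Suc numeral_eq_Suc conj_ac)
  have a: "adj (?xs ! i) (?xs ! j) \<longleftrightarrow> ?E i j" if "i < length ?xs" "j < length ?xs" "i \<noteq> j" for i j
  proof -
    have "\<forall>i<length ?xs. \<forall>j<length ?xs. i \<noteq> j \<longrightarrow> adj (?xs ! i) (?xs ! j) \<longleftrightarrow> ?E i j"
      using p1 p2 p3 unfolding less path_def by (simp add: All_less_Suc numeral_eq_Suc)
    then show ?thesis using that by blast
  qed
  have "\<exists>s\<in>set ?xs. opp (set ?xs) s \<noteq> s"
  proof (rule opp_nontrivial[where E = ?E and c = ?c and k = 0])
    show "distinct ?xs" "set ?xs \<subseteq> S" "0 < length ?xs" using d spider_subset[OF sp] by auto
    show "m (?xs ! i) (?xs ! j) = (if ?E i j then 3 else 2)" if "i < length ?xs" "j < length ?xs" "i \<noteq> j" for i j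
    proof -
      have "?xs ! i \<in> set ?xs" "?xs ! j \<in> set ?xs" "?xs ! i \<noteq> ?xs ! j" using that d nth_mem nth_eq_iff_index_eq by blast+
      then show ?thesis using spider_m[OF sp nh, of "?xs ! i" "?xs ! j"] a[OF that] unfolding set by simp
    qed
    have "\<forall>j<length ?xs. 2 * ?c j - (\<Sum>i | i < length ?xs \<and> i \<noteq> j \<and> ?E i j. ?c i) \<in> \<int>"
    proof -
      have e: "{i. i < length ?xs \<and> i \<noteq> 0 \<and> ?E i 0} = {1}" "{i. i < length ?xs \<and> i \<noteq> 1 \<and> ?E i 1} = {0, 2}"
        "{i. i < length ?xs \<and> i \<noteq> 2 \<and> ?E i 2} = {1, 3, 5}" "{i. i < length ?xs \<and> i \<noteq> 3 \<and> ?E i 3} = {2, 4}"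
        "{i. i < length ?xs \<and> i \<noteq> 4 \<and> ?E i 4} = {3}" "{i. i < length ?xs \<and> i \<noteq> 5 \<and> ?E i 5} = {2}"
        by auto
      show ?thesis unfolding less e by simp
    qed
    then show "2 * ?c j - (\<Sum>i | i < length ?xs \<and> i \<noteq> j \<and> ?E i j. ?c i) \<in> \<int>" if "j < length ?xs" for j using that by blast
    show "2 * ?c 0 \<notin> \<int>"
    proof
      assume "2 * ?c 0 \<in> \<int>"
      then obtain z :: int where z: "2 / 3 = real_of_int z" by (auto elim: Ints_cases)
      have "0 < real_of_int z" "real_of_int z < 1" unfolding z[symmetric] by auto
      then show False by simp
    qed
  qed
  then show ?thesis unfolding set .
qed

lemma spider_path_D:
  assumes sp: "spider b [a] [c] r" and nh: "\<And>s t. \<not> heavy (spider_set b [a] [c] r) s t"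
  shows "path_D (a # c # b # r)"
proof -
  let ?ds = "a # c # b # r"
  have p1: "path [a, b, c]" and p2: "path (a # b # r)" using spider_paths[OF sp] by simp_all
  have p3: "path (c # b # r)" using spider_paths(2)[OF spider_swap(1)[OF sp]] by simp
  have S: "set ?ds \<subseteq> S" and d: "distinct ?ds" and r: "r \<noteq> []" using spider_subset[OF sp] sp by (auto simp: spider_def)
  have adjs: "adj (?ds ! i) (?ds ! j) \<longleftrightarrow> D_edge i j" if ij: "i < j" "j < length ?ds" for i j
  proof -
    consider "i = 0" "j = 1" | "i = 0" "j \<ge> 2" | "i \<ge> 1" using ij by linarith
    then show ?thesis
    proof cases
      case 1
      show ?thesis using path_adj_iff[OF p1, of 0 2] 1 by (simp add: D_edge_def)
    next
      case 2
      then obtain k where k: "j = Suc (Suc k)" by (metis Suc_le_D numeral_2_eq_2 Suc_le_mono)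
      have "adj ((a # b # r) ! 0) ((a # b # r) ! Suc k) \<longleftrightarrow> Suc k = Suc 0 \<or> 0 = Suc (Suc k)"
        using ij k by (intro path_adj_iff[OF p2]) auto
      then show ?thesis using 2 k by (auto simp: D_edge_def)
    next
      case 3
      then obtain k l where k: "i = Suc k" "j = Suc l" using ij by (metis Suc_le_D One_nat_def less_trans_Suc Suc_lessE)
      have "adj ((c # b # r) ! k) ((c # b # r) ! l) \<longleftrightarrow> l = Suc k \<or> k = Suc l"
        using ij k by (intro path_adj_iff[OF p3]) auto
      then show ?thesis using 3 k ij by (auto simp: D_edge_def)
    qed
  qed
  have "m (?ds ! i) (?ds ! j) = (if D_edge i j \<or> D_edge j i then 3 else 2)"
    if ij: "i < length ?ds" "j < length ?ds" "i \<noteq> j" for i j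
  proof -
    have set: "set ?ds = spider_set b [a] [c] r" by auto
    have mem: "?ds ! i \<in> spider_set b [a] [c] r" "?ds ! j \<in> spider_set b [a] [c] r" "?ds ! i \<noteq> ?ds ! j"
      using ij d nth_mem nth_eq_iff_index_eq unfolding set[symmetric] by blast+
    then have sym: "adj (?ds ! i) (?ds ! j) \<longleftrightarrow> adj (?ds ! j) (?ds ! i)" using adj_sym spider_subset[OF sp] by blast
    have "\<not> D_edge j i" if "i < j" using that by (auto simp: D_edge_def)
    moreover have "\<not> D_edge i j" if "j < i" using that by (auto simp: D_edge_def)
    ultimately have "adj (?ds ! i) (?ds ! j) \<longleftrightarrow> D_edge i j \<or> D_edge j i"
      using adjs[of i j] adjs[of j i] sym ij by (cases "i < j") auto
    then show ?thesis using spider_m[OF sp nh mem] by simp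
  qed
  moreover have "length ?ds \<ge> 4" using r by (cases r) auto
  ultimately show ?thesis using S d by (auto simp: path_D_def)
qed

subsection \<open>Conjugate simple reflections\<close>

text \<open>Count the letters of a word that are joined to \<open>s\<close> through edges of odd
  order. The parity of this number survives every relation: a relator contains each of its two
  letters \<open>m\<close> times, and for odd \<open>m\<close> both or neither are counted. A word
  for \<open>x s\<close>, the inverse of \<open>x\<close>, and \<open>t\<close> has value 1, so
  \<open>t\<close> is counted like \<open>s\<close>.\<close>

lemma conjugate_odd_connected:
  assumes x: "x \<in> carrier W" and s: "s \<in> S" and t: "t \<in> S" and e: "img x s = t"
  shows "(s, t) \<in> {(a, b). a \<in> S \<and> b \<in> S \<and> odd (m a b)}\<^sup>*"
proof -
  define R where "R = {(a, b). a \<in> S \<and> b \<in> S \<and> odd (m a b)}"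
  define A where "A = {r. (s, r) \<in> R\<^sup>*}"
  define cnt where "cnt xs = length (filter (\<lambda>r. r \<in> A) xs)" for xs
  have cl: "b \<in> A" if "a \<in> A" "a \<in> S" "b \<in> S" "odd (m a b)" for a b
    using that by (auto simp: A_def R_def intro: rtrancl_into_rtrancl)
  have app: "cnt (xs @ ys) = cnt xs + cnt ys" for xs ys by (simp add: cnt_def)
  have rep: "cnt (concat (replicate k [a, b])) = k * cnt [a, b]" for k a b
    by (induction k) (auto simp: cnt_def)
  have step: "even (cnt xs) \<longleftrightarrow> even (cnt ys)" if "(xs, ys) \<in> coxeter_step W S" for xs ys
  proof -
    obtain us vs a b where *: "xs = us @ concat (replicate (m a b) [a, b]) @ vs" "ys = us @ vs" "a \<in> S" "b \<in> S"
      using \<open>(xs, ys) \<in> coxeter_step W S\<close> by (auto simp: coxeter_step_def m_def)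
    have "even (m a b * cnt [a, b])"
      using cl[of a b] cl[of b a] m_sym[of a b] * by (cases "a \<in> A"; cases "b \<in> A") (auto simp: cnt_def)
    then show ?thesis using * by (simp add: app rep)
  qed
  have ev: "even (cnt xs)" if "xs \<in> lists S" "word xs = \<one>" for xs
  proof -
    have "even (cnt xs) \<longleftrightarrow> even (cnt ys)" if "(xs, ys) \<in> (coxeter_step W S \<union> (coxeter_step W S)\<inverse>)\<^sup>*" for xs ys
      using that by (induction rule: rtrancl_induct) (auto dest: step)
    from this[OF coxeter_relations[OF that]] show ?thesis by (simp add: cnt_def)
  qed
  obtain xs where xs: "xs \<in> lists S" "word xs = x" using carrier_word[OF x] by blast
  have l: "xs @ [s] \<in> lists S" "rev xs @ [t] \<in> lists S" "rev xs \<in> lists S" using xs s t by (auto simp: in_lists_conv_set)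
  have "word ((xs @ [s]) @ (rev xs @ [t])) = (x \<otimes> s) \<otimes> (inv x \<otimes> t)"
    using l xs s t by (simp add: word_append word_rev del: append_assoc)
  also have "\<dots> = img x s \<otimes> t" using x s t by (simp add: img_def m_assoc)
  also have "\<dots> = \<one>" using e t by simp
  finally have "even (cnt ((xs @ [s]) @ (rev xs @ [t])))" using l by (intro ev) auto
  moreover have "cnt (rev xs) = cnt xs" by (simp add: cnt_def flip: rev_filter)
  moreover have "cnt ((xs @ [s]) @ (rev xs @ [t])) = (cnt xs + cnt [s]) + (cnt (rev xs) + cnt [t])" by (simp only: app)
  ultimately have "even ((cnt xs + cnt [s]) + (cnt xs + cnt [t]))" by metis
  then have "even (cnt [s] + cnt [t])" by presburger
  moreover have "s \<in> A" by (simp add: A_def)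
  ultimately have "t \<in> A" by (auto simp: cnt_def split: if_splits)
  then show ?thesis by (simp add: A_def R_def)
qed

text \<open>A chain of odd edges from \<open>s\<close> to \<open>t\<close> would close up to a cycle
  with the even edge between them.\<close>

lemma even_edge_not_conjugate:
  assumes x: "x \<in> carrier W" and s: "s \<in> S" and t: "t \<in> S" and a: "adj s t" and ev: "even (m s t)" and e: "img x s = t"
  shows False
proof -
  let ?R = "{(a, b). a \<in> S \<and> b \<in> S \<and> s \<noteq> t \<and> odd (m a b)}"
  have st: "s \<noteq> t" using a by auto
  have "(s, t) \<in> ?R\<^sup>*" using conjugate_odd_connected[OF x s t e] st by simp
  from rtrancl_distinct_list[OF this] obtain vs where vs: "vs \<noteq> []" "hd vs = s" "last vs = t" "distinct vs"
    "\<And>i. Suc i < length vs \<Longrightarrow> (vs ! i, vs ! Suc i) \<in> ?R" by blast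
  have n1: "length vs \<noteq> 1" using vs st by (metis One_nat_def Suc_length_conv last_ConsL length_0_conv list.sel(1))
  have n0: "0 < length vs" using vs by simp
  have ends: "vs ! 0 = s" "vs ! (length vs - 1) = t" using vs by (simp_all add: hd_conv_nth last_conv_nth)
  have n2: "length vs \<noteq> 2" using vs(5)[of 0] ends ev by auto
  have n: "length vs \<ge> 3" using n0 n1 n2 by linarith
  have S: "set vs \<subseteq> S"
  proof
    fix v assume "v \<in> set vs"
    then obtain i where i: "i < length vs" "v = vs ! i" by (auto simp: in_set_conv_nth)
    then show "v \<in> S" using vs(5)[of i] vs(5)[of "i - 1"] n by (cases i) auto
  qed
  have w: "adj (vs ! i) (vs ! Suc i)" if "Suc i < length vs" for i
  proof -
    have "vs ! i \<noteq> vs ! Suc i" using vs(4) that by (simp add: nth_eq_iff_index_eq)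
    then show ?thesis using vs(5)[OF that] by (auto simp: adj_def)
  qed
  have "length vs - 1 = Suc 0" using walk_chordless[OF S vs(4) w, of 0 "length vs - 1"] ends a n by simp
  then show False using n by simp
qed

text \<open>The alternating word \<open>z\<close> of odd length \<open>m s t\<close> conjugates
  \<open>s\<close> and \<open>t\<close> into each other. As the product of their roots is negative,
  both signs agree, so \<open>z\<close> is 1 or the longest element, and either contradicts a
  trivial opposition.\<close>

lemma dihedral_opp:
  assumes st: "s \<in> S" "t \<in> S" "adj s t" and od: "odd (m s t)"
  shows "opp {s, t} s = t"
proof (rule ccontr)
  let ?K = "{s, t}"
  have K: "?K \<subseteq> S" and ne: "s \<noteq> t" using st by auto
  assume n: "opp ?K s \<noteq> t"
  then have os: "opp ?K s = s" using opp_in[OF K, of s] by auto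
  have ot: "opp ?K t = t"
    using opp_in[OF K, of t] opp_opp[OF K, of t] os opp_opp[OF K, of s] ne by auto
  obtain j where j: "m s t = Suc (2 * j)" using od by (metis oddE Suc_eq_plus1)
  define z where "z = word (alternating s t (m s t))"
  have L: "alternating s t k \<in> lists S" "alternating t s k \<in> lists S" "alternating s t k \<in> lists ?K" for k
    using st by (simp_all add: alternating_in_lists)
  have zS: "z \<in> carrier W" unfolding z_def using L by (intro word_carrier)
  have zK: "z \<in> par ?K" unfolding z_def using generate_iff_word[OF K] L(3) by blast
  have z2: "z = word (alternating t s (m s t))" unfolding z_def by (rule word_alternating_m[OF st(1,2)])
  define a b where "a = word (alternating s t (2 * j))" and "b = word (alternating t s (2 * j))"
  have ab: "a \<in> carrier W" "b \<in> carrier W" unfolding a_def b_def using L by (simp_all only: word_carrier)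
  have "z = word (t # alternating s t (2 * j))" unfolding z_def j by simp
  then have za: "z = t \<otimes> a" by (simp add: a_def)
  have "z = word (alternating s t (2 * j) @ [s])" unfolding z2 j alternating_snoc ..
  then have za': "z = a \<otimes> s" using L(1)[of "2 * j"] st by (simp add: a_def word_append)
  have "z = word (s # alternating t s (2 * j))" unfolding z2 j by simp
  then have zb: "z = s \<otimes> b" by (simp add: b_def)
  have "z = word (alternating t s (2 * j) @ [t])" unfolding z_def j alternating_snoc ..
  then have zb': "z = b \<otimes> t" using L(2)[of "2 * j"] st by (simp add: b_def word_append)
  have "t \<otimes> z = a" using ab st by (simp add: za)
  moreover have "z \<otimes> s = a" using ab st by (simp add: za' m_assoc)
  ultimately have "t \<otimes> z = z \<otimes> s" by simp
  then have "cj z s = t" using zS st by (metis S_carrier m_assoc inv_closed r_inv r_one)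
  then have zs: "act z (\<alpha> s) = \<alpha> t \<or> act z (\<alpha> s) = - \<alpha> t" using conj_gen_eq_gen_iff zS st by blast
  have "s \<otimes> z = b" using ab st by (simp add: zb)
  moreover have "z \<otimes> t = b" using ab st by (simp add: zb' m_assoc)
  ultimately have "s \<otimes> z = z \<otimes> t" by simp
  then have "cj z t = s" using zS st by (metis S_carrier m_assoc inv_closed r_inv r_one)
  then have zt: "act z (\<alpha> t) = \<alpha> s \<or> act z (\<alpha> t) = - \<alpha> s" using conj_gen_eq_gen_iff zS st by blast
  have B: "bform (act z (\<alpha> s)) (act z (\<alpha> t)) = bform (\<alpha> s) (\<alpha> t)" "bform (\<alpha> s) (\<alpha> t) < 0"
    using bform_act[OF zS] bform_adj[OF st] by auto
  consider "act z (\<alpha> s) = \<alpha> t" "act z (\<alpha> t) = \<alpha> s" | "act z (\<alpha> s) = - \<alpha> t" "act z (\<alpha> t) = - \<alpha> s"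
    using zs zt B bform_sym[of "\<alpha> s" "\<alpha> t"] by (auto simp: bform_simps)
  then show False
  proof cases
    case 1
    then have "z = \<one>" using zK by (intro par_nonneg_imp_one[OF K]) auto
    then show False using 1 ne by simp
  next
    case 2
    then have "z = w0 ?K" using zK by (intro w0_unique[OF K]) auto
    then show False using 2 act_w0[OF K, of s] os ne by simp
  qed
qed

subsection \<open>Automorphisms of components\<close>

lemma path_automorph:
  assumes p: "path ps" and f: "automorph (set ps) f"
  shows "map f ps = ps \<or> map f ps = rev ps"
proof -
  have S: "set ps \<subseteq> S" and ne: "ps \<noteq> []" using p by (auto simp: path_def)
  have "path (map f ps)" using walk_path[OF automorph_walk[OF f path_walk[OF p] order_refl S]] ne by simp
  moreover have "set (map f ps) = set ps" using f by (auto simp: automorph_def)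
  ultimately show ?thesis using path_unique[OF p] by blast
qed

lemma path_A_path: "path_A ps \<Longrightarrow> path ps"
  unfolding path_def
proof (intro conjI allI impI)
  assume p: "path_A ps"
  then show "ps \<noteq> []" "set ps \<subseteq> S" "distinct ps" by (auto simp: path_A_def)
  fix i j assume ij: "i < length ps" "j < length ps"
  show "adj (ps ! i) (ps ! j) \<longleftrightarrow> j = Suc i \<or> i = Suc j"
  proof (cases "i = j")
    case False
    then have "m (ps ! i) (ps ! j) = (if j = Suc i \<or> i = Suc j then 3 else 2)" "ps ! i \<noteq> ps ! j"
      using p ij by (simp_all add: path_A_def nth_eq_iff_index_eq)
    then show ?thesis by (simp add: adj_def)
  qed simp
qed

text \<open>A path has only the identity and the reversal as automorphisms, and opposition is not
  the identity on two or more vertices.\<close>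

lemma typeA_automorph:
  assumes p: "path_A ps" and f: "automorph (set ps) f"
  shows "(\<forall>s\<in>set ps. f s = s) \<or> (\<forall>s\<in>set ps. f s = opp (set ps) s)"
proof (cases "length ps \<ge> 2")
  case True
  have S: "set ps \<subseteq> S" using p by (simp add: path_A_def)
  have "map (opp (set ps)) ps \<noteq> ps" using path_A_opp[OF p True] by (simp add: map_eq_self)
  then have "map (opp (set ps)) ps = rev ps"
    using path_automorph[OF path_A_path[OF p] opp_automorph[OF S]] by blast
  then have "\<forall>s\<in>set ps. f s = opp (set ps) s" if "map f ps = rev ps" using that by (metis map_eq_conv)
  moreover have "\<forall>s\<in>set ps. f s = s" if "map f ps = ps" using that by (simp add: map_eq_self)
  ultimately show ?thesis using path_automorph[OF path_A_path[OF p] f] by blast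
next
  case False
  then obtain s where "ps = [s]" using p unfolding path_A_def by (metis One_nat_def Suc_leI Suc_length_conv length_0_conv length_greater_0_conv not_less_eq_eq numeral_2_eq_2 le_antisym)
  then show ?thesis using f by (auto simp: automorph_def)
qed

text \<open>That \<open>img x\<close> comes from conjugation matters: F4 and dihedral diagrams of
  even order have reversals that no element induces. A reversal by conjugation swaps the ends of the
  heavy edge, so its order is odd and at least 5. Such an edge cannot sit in the middle of a longer
  path, and on two vertices the reversal is opposition.\<close>

lemma heavy_automorph:
  assumes K: "K \<subseteq> S" "conn K" and h: "heavy K s t" and x: "x \<in> carrier W" and f: "automorph K (img x)"
  shows "(\<forall>s\<in>K. img x s = s) \<or> (\<forall>s\<in>K. img x s = opp K s)"
proof -
  obtain ps where p: "path ps" "set ps = K" using exists_path[OF K] branch_heavy[OF K _ h] by blast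
  have d: "distinct ps" using p by (simp add: path_def)
  have st: "s \<in> K" "t \<in> K" "s \<noteq> t" "m s t \<ge> 4" "s \<in> S" "t \<in> S" using h K by (auto simp: heavy_def)
  have ast: "adj s t" using m_ge_4_adj st by blast
  have "heavy K (img x s) (img x t)" using f st by (auto simp: heavy_def automorph_def inj_on_def)
  then have im: "{img x s, img x t} = {s, t}" using heavy_unique[OF K _ h] by blast
  consider "map (img x) ps = ps" | "map (img x) ps = rev ps" using path_automorph[OF p(1)] f p by auto
  then show ?thesis
  proof cases
    case 1
    then have "img x (ps ! i) = ps ! i" if "i < length ps" for i using that by (metis nth_map)
    then show ?thesis using p by (metis in_set_conv_nth)
  next
    case 2
    then have r: "img x (ps ! i) = ps ! (length ps - Suc i)" if "i < length ps" for i using that by (metis nth_map rev_nth)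
    obtain i j where ij: "i < length ps" "s = ps ! i" "j < length ps" "t = ps ! j" using st p by (metis in_set_conv_nth)
    have c: "j = Suc i \<or> i = Suc j" using ast p ij by (auto simp: path_def)
    have "img x s \<noteq> s \<or> img x t \<noteq> t"
    proof (rule ccontr)
      assume "\<not> ?thesis"
      then have "length ps - Suc i = i" "length ps - Suc j = j" using r ij d by (auto simp: nth_eq_iff_index_eq)
      then show False using c ij by auto
    qed
    then have sw: "img x s = t" "img x t = s" using im by (auto simp: doubleton_eq_iff)
    have od: "odd (m s t)" using even_edge_not_conjugate[OF x st(5,6) ast _ sw(1)] by blast
    then have m5: "m s t \<ge> 5" using st(4) by (cases "m s t = 4") auto
    have L: "length ps - Suc i = j" using sw(1) r[OF ij(1)] ij d by (simp add: nth_eq_iff_index_eq)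
    show ?thesis
    proof (cases "length ps = 2")
      case True
      then have "K = {s, t}" using p ij c by (auto simp: numeral_2_eq_2 length_Suc_conv nth_Cons' split: if_splits)
      moreover have "opp {s, t} s = t" using dihedral_opp[OF st(5,6) ast od] .
      moreover have "opp {s, t} t = s" using opp_opp[of "{s, t}" s] calculation st by auto
      ultimately show ?thesis using sw by auto
    next
      case False
      have *: False if ij: "i < length ps" "s = ps ! i" "t = ps ! j" "j = Suc i" "length ps - Suc i = j" and
        mm: "m s t \<ge> 5" for s t i j
      proof -
        have "i \<noteq> 0" "Suc j < length ps" using ij False by auto
        then obtain k where k: "i = Suc k" by (cases i) auto
        have pa: "\<And>a b. a < length ps \<Longrightarrow> b < length ps \<Longrightarrow> adj (ps ! a) (ps ! b) \<longleftrightarrow> b = Suc a \<or> a = Suc b"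
          using p by (simp add: path_def)
        have nd: "ps ! a \<noteq> ps ! b" if "a < length ps" "b < length ps" "a \<noteq> b" for a b
          using d that by (simp add: nth_eq_iff_index_eq)
        have "ps ! a \<in> S" if "a < length ps" for a using that p K by auto
        then show False
          using no_heavy_middle[of "ps ! k" s t "ps ! Suc j"] ij k \<open>Suc j < length ps\<close> pa[of i k] pa[of j "Suc j"] mm
            nd[of k i] nd[of k j] nd[of k "Suc j"] nd[of i j] nd[of i "Suc j"] nd[of j "Suc j"] by auto
      qed
      from c show ?thesis
      proof
        assume "j = Suc i"
        then show ?thesis using *[OF ij(1,2,4) _ L m5] by blast
      next
        assume "i = Suc j"
        moreover have "length ps - Suc j = i" using L ij by linarith
        ultimately show ?thesis using *[OF ij(3,4,2)] m5 m_sym[OF st(5,6)] by auto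
      qed
    qed
  qed
qed

lemma spider_swap_unique:
  assumes sp: "spider b p q r" and K: "K = spider_set b p q r" "conn K" and l: "length p = length q" "length r \<noteq> length p"
    and f: "automorph K f" and n: "\<exists>s\<in>K. f s \<noteq> s"
  shows "f b = b" "map f p = q" "map f q = p" "map f r = r"
proof -
  show fb: "f b = b" using spider_automorph(1)[OF sp K f] .
  have len: "length (map f p) = length p" "length (map f r) = length r" by auto
  have "\<not> (map f p = p \<and> map f q = q \<and> map f r = r)"
    using n fb unfolding K(1) map_eq_self by auto
  then show "map f p = q" "map f q = p" "map f r = r"
    using spider_automorph(2)[OF sp K f] l len by auto
qed

text \<open>A nontrivial automorphism needs two arms of equal length. Length 1 gives the shape of
  type D; length 2 forces the third arm to have length 1 by \<open>no_E6\<close>, which is the shape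
  E6; more is excluded by \<open>no_E7\<close>.\<close>

lemma symmetric_spider:
  assumes K: "K \<subseteq> S" "conn K" and b: "branch K b" and f: "automorph K f" "\<exists>s\<in>K. f s \<noteq> s"
  obtains p q r where "spider b p q r" "spider_set b p q r = K"
    "(\<exists>a c. p = [a] \<and> q = [c]) \<or> (\<exists>p1 p2 q1 q2 r1. p = [p1, p2] \<and> q = [q1, q2] \<and> r = [r1])"
proof -
  obtain p0 q0 r0 where sp0: "spider b p0 q0 r0" "spider_set b p0 q0 r0 = K" using exists_spider[OF K b] by blast
  note fa = spider_automorph[OF sp0(1) sp0(2)[symmetric] K(2) f(1)]
  have "length p0 = length q0 \<or> length p0 = length r0 \<or> length q0 = length r0"
  proof (rule ccontr)
    assume a: "\<not> ?thesis"
    have "map f p0 = p0 \<and> map f q0 = q0 \<and> map f r0 = r0"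
      using fa(2) a by (auto dest: arg_cong[of _ _ length])
    then show False using f(2) fa(1) unfolding sp0(2)[symmetric] map_eq_self by blast
  qed
  then obtain p q r where sp: "spider b p q r" "spider_set b p q r = K" "length p = length q"
  proof (elim disjE)
    assume "length q0 = length r0"
    then show thesis using that[of q0 r0 p0] spider_swap(2)[OF spider_swap(1)[OF sp0(1)]] sp0(2) by (simp add: Un_ac)
  qed (use that[of p0 q0 r0] that[of p0 r0 q0] spider_swap[OF sp0(1)] sp0 in \<open>simp_all add: Un_ac\<close>)
  have ne: "length p \<noteq> 0" "length r \<noteq> 0" using sp(1) by (auto simp: spider_def)
  then consider "length p = 1" | "length p = 2" | "length p \<ge> 3" by linarith
  then show thesis
  proof cases
    case 1
    then show thesis using that[OF sp(1,2)] sp(3) by (metis length_0_conv length_Suc_conv One_nat_def)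
  next
    case 2
    then have "\<not> length r \<ge> 2" using no_E6[OF sp(1)] sp(3) by auto
    then have "length r = 1" using ne(2) by linarith
    then show thesis using that[OF sp(1,2)] 2 sp(3) by (auto simp: length_Suc_conv numeral_2_eq_2)
  next
    case 3
    then show thesis using no_E7[OF spider_swap(1)[OF spider_swap(2)[OF sp(1)]]] sp(3) by simp
  qed
qed

lemma branch_automorph:
  assumes K: "K \<subseteq> S" "conn K" and b: "branch K b" and f: "automorph K f"
  shows "(\<forall>s\<in>K. f s = s) \<or> (\<forall>s\<in>K. f s = opp K s) \<or> (\<exists>ds. path_D ds \<and> set ds = K \<and> even (length ds))"
proof (cases "\<forall>s\<in>K. f s = s")
  case False
  have nh: "\<not> heavy K s t" for s t using branch_heavy[OF K b] by blast
  have nt: "\<exists>s\<in>K. f s \<noteq> s" using False by blast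
  obtain p q r where sp: "spider b p q r" "spider_set b p q r = K"
    "(\<exists>a c. p = [a] \<and> q = [c]) \<or> (\<exists>p1 p2 q1 q2 r1. p = [p1, p2] \<and> q = [q1, q2] \<and> r = [r1])"
    using symmetric_spider[OF K b f nt] by metis
  \<comment> \<open>With two equal arms and a third of another length there is a single nontrivial
    automorphism, so \<open>f\<close> and opposition agree once both are nontrivial.\<close>
  have op: "\<forall>s\<in>K. f s = opp K s" if n: "\<exists>s\<in>K. opp K s \<noteq> s" and l: "length r \<noteq> length p"
  proof -
    have pq: "length p = length q" using sp(3) by auto
    note u = spider_swap_unique[OF sp(1) sp(2)[symmetric] K(2) pq l]
    have "map f p = map (opp K) p" "map f q = map (opp K) q" "map f r = map (opp K) r" "f b = opp K b"
      using u[OF f nt] u[OF opp_automorph[OF K(1)] n] by simp_all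
    then have "\<forall>s\<in>spider_set b p q r. f s = opp K s" by auto
    then show ?thesis using sp(2) by simp
  qed
  from sp(3) show ?thesis
  proof (elim disjE exE conjE)
    fix a c assume pq: "p = [a]" "q = [c]"
    let ?ds = "a # c # b # r"
    have D: "path_D ?ds" using spider_path_D[of b a c r] sp(1,2) pq nh by auto
    have set: "set ?ds = K" using sp(2) pq by auto
    show ?thesis
    proof (cases "even (length ?ds)")
      case False
      then have "length r \<noteq> length p" using pq by auto
      then show ?thesis using path_D_opp[OF D False] op unfolding set by blast
    qed (use D set in blast)
  next
    fix p1 p2 q1 q2 r1 assume pq: "p = [p1, p2]" "q = [q1, q2]" "r = [r1]"
    have "\<exists>s\<in>K. opp K s \<noteq> s" using spider_opp_E6[of b p1 p2 q1 q2 r1] sp(1,2) pq nh by auto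
    then show ?thesis using op pq by simp
  qed
qed blast

text \<open>The third alternative is genuinely separate: there opposition is trivial by
  \<open>path_D_even_opp\<close>, although the diagram has a symmetry.\<close>

theorem automorph_cases:
  assumes K: "K \<subseteq> S" "conn K" and x: "x \<in> carrier W" and f: "automorph K (img x)"
  shows "(\<forall>s\<in>K. img x s = s) \<or> (\<forall>s\<in>K. img x s = opp K s) \<or> (\<exists>ds. path_D ds \<and> set ds = K \<and> even (length ds))"
proof (cases "nonA K")
  case True
  then consider p where "branch K p" | s t where "heavy K s t" by (auto simp: nonA_def special_def)
  then show ?thesis using branch_automorph[OF K _ f] heavy_automorph[OF K _ x f] by metis
next
  case False
  then obtain ps where ps: "path_A ps" "set ps = K" using typeA_or_nonA[OF K] by blast
  then show ?thesis using typeA_automorph[OF ps(1)] f by auto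
qed

end

subsection \<open>Signed permutations\<close>

abbreviation orb :: "('x \<Rightarrow> 'x) \<Rightarrow> 'x \<Rightarrow> 'x set" where "orb \<equiv> Orbits.orbit"

abbreviation (input) ints :: "nat \<Rightarrow> int set" where "ints n \<equiv> {- int n..int n}"

text \<open>Oddness is stated for all integers, since outside the range it is automatic; this form
  composes without side conditions.\<close>

definition signed :: "nat \<Rightarrow> (int \<Rightarrow> int) \<Rightarrow> bool" where
  "signed n w \<longleftrightarrow> w permutes ints n \<and> (\<forall>i. w (- i) = - w i)"

text \<open>The linear character of W(B_n) with kernel W(D_n), a multiplicative form of the parity
  condition in \<open>D_group\<close>.\<close>

definition sign_prod :: "nat \<Rightarrow> (int \<Rightarrow> int) \<Rightarrow> int" where
  "sign_prod n w = (\<Prod>i\<in>{1..int n}. sgn (w i))"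

lemma signed_permutes: "signed n w \<Longrightarrow> w permutes ints n"
  and signed_minus: "signed n w \<Longrightarrow> w (- i) = - w i"
  by (auto simp: signed_def)

lemma signed_zero [simp]: "signed n w \<Longrightarrow> w 0 = 0"
  using signed_minus[of n w 0] by simp

lemma signed_inj: "signed n w \<Longrightarrow> w i = w j \<longleftrightarrow> i = j"
  using permutes_inj[OF signed_permutes] by (auto simp: inj_def)

lemma signed_eq_0: "signed n w \<Longrightarrow> w i = 0 \<longleftrightarrow> i = 0"
  using signed_inj[of n w i 0] by simp

lemma signed_range: "signed n w \<Longrightarrow> w i \<in> ints n \<longleftrightarrow> i \<in> ints n"
  using permutes_in_image[OF signed_permutes] by blast

lemma signed_abs: "signed n w \<Longrightarrow> i \<in> {1..int n} \<Longrightarrow> \<bar>w i\<bar> \<in> {1..int n}"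
  using signed_range[of n w i] signed_eq_0[of n w i] by auto

lemma signedI:
  assumes "\<And>i. i \<in> ints n \<Longrightarrow> w i \<in> ints n" "\<And>i. i \<notin> ints n \<Longrightarrow> w i = i"
    "\<And>i. w (- i) = - w i" "inj_on w (ints n)"
  shows "signed n w"
  unfolding signed_def
proof (intro conjI allI assms(3) bij_imp_permutes)
  show "bij_betw w (ints n) (ints n)"
    unfolding bij_betw_def using assms by (intro conjI endo_inj_surj) auto
qed (use assms in auto)

lemma signed_id [simp]: "signed n id"
  by (auto simp: signed_def permutes_id)

lemma signed_comp: "signed n v \<Longrightarrow> signed n w \<Longrightarrow> signed n (v \<circ> w)"
  unfolding signed_def using permutes_compose by auto

lemma signed_inv: "signed n w \<Longrightarrow> signed n (inv_into UNIV w)"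
proof -
  assume w: "signed n w"
  have "inv_into UNIV w (- i) = - inv_into UNIV w i" for i
  proof -
    have "w (- inv_into UNIV w i) = - i" using signed_minus[OF w] permutes_inverses(1)[OF signed_permutes[OF w]] by simp
    then show ?thesis using permutes_inverses(2)[OF signed_permutes[OF w]] by metis
  qed
  then show ?thesis using permutes_inv[OF signed_permutes[OF w]] by (auto simp: signed_def)
qed

lemma sign_prod_comp:
  assumes v: "signed n v" and w: "signed n w"
  shows "sign_prod n (v \<circ> w) = sign_prod n v * sign_prod n w"
proof -
  have e: "sgn (v (w i)) = sgn (v \<bar>w i\<bar>) * sgn (w i)" for i
  proof (cases "w i" "0 :: int" rule: linorder_cases)
    case less
    then have "v (w i) = - v \<bar>w i\<bar>" using signed_minus[OF v, of "w i"] by simp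
    then show ?thesis using less by (simp add: sgn_minus)
  qed (use v in auto)
  have inj: "inj_on (\<lambda>i. \<bar>w i\<bar>) {1..int n}"
  proof (rule inj_onI)
    fix i j assume ij: "i \<in> {1..int n}" "j \<in> {1..int n}" "\<bar>w i\<bar> = \<bar>w j\<bar>"
    then have "w i = w j \<or> w i = w (- j)" using signed_minus[OF w, of j] by linarith
    then show "i = j" using signed_inj[OF w] ij by auto
  qed
  then have "bij_betw (\<lambda>i. \<bar>w i\<bar>) {1..int n} {1..int n}"
    unfolding bij_betw_def using signed_abs[OF w] by (intro conjI endo_inj_surj) auto
  then have "(\<Prod>i\<in>{1..int n}. sgn (v \<bar>w i\<bar>)) = sign_prod n v"
    unfolding sign_prod_def by (rule prod.reindex_bij_betw[of "\<lambda>i. \<bar>w i\<bar>" _ _ "\<lambda>j. sgn (v j)"])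
  then show ?thesis by (simp add: sign_prod_def e prod.distrib)
qed

lemma sign_prod_id [simp]: "sign_prod n id = 1"
  by (simp add: sign_prod_def)

lemma sign_prod_cases:
  assumes "signed n w" shows "sign_prod n w = (- 1) ^ card {i \<in> {1..int n}. w i < 0}"
proof -
  have "sign_prod n w = (\<Prod>i\<in>{1..int n}. if w i < 0 then - 1 else 1)"
    unfolding sign_prod_def using signed_eq_0[OF assms] by (intro prod.cong) (auto simp: sgn_if)
  also have "\<dots> = (\<Prod>i\<in>{i \<in> {1..int n}. w i < 0}. - 1)"
    by (subst prod.inter_filter) auto
  finally show ?thesis by simp
qed

lemma sign_prod_inv: "signed n w \<Longrightarrow> sign_prod n w = 1 \<Longrightarrow> sign_prod n (inv_into UNIV w) = 1"
  using sign_prod_comp[OF signed_inv, of n w w] permutes_inv_o(2)[OF signed_permutes, of n w] by simp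

lemma D_group_carrier: "w \<in> carrier (D_group n) \<longleftrightarrow> signed n w \<and> sign_prod n w = 1"
proof -
  have *: "(\<forall>i\<in>ints n. w (- i) = - w i) \<longleftrightarrow> (\<forall>i. w (- i) = - w i)" if "w permutes ints n"
  proof
    assume a: "\<forall>i\<in>ints n. w (- i) = - w i"
    show "\<forall>i. w (- i) = - w i"
    proof
      fix i show "w (- i) = - w i"
        using a permutes_not_in[OF that, of i] permutes_not_in[OF that, of "- i"] by (cases "i \<in> ints n") auto
    qed
  qed auto
  have "signed n w \<Longrightarrow> sign_prod n w = 1 \<longleftrightarrow> even (card {i \<in> {1..int n}. w i < 0})"
    by (cases "even (card {i \<in> {1..int n}. w i < 0})") (simp_all add: sign_prod_cases)
  then show ?thesis unfolding D_group_def using * by (auto simp only: signed_def monoid.simps partial_object.simps mem_Collect_eq)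
qed

definition dgen :: "nat \<Rightarrow> int \<Rightarrow> int" where
  "dgen j = (if j = 0 then transpose 1 (- 2) \<circ> transpose (- 1) 2
     else transpose (int j) (int j + 1) \<circ> transpose (- int j) (- (int j + 1)))"

lemma dgen_0: "dgen 0 k = (if k = 1 then -2 else if k = 2 then -1 else if k = -1 then 2 else if k = -2 then 1 else k)"
  by (auto simp: dgen_def transpose_def)

lemma dgen_pos: "j > 0 \<Longrightarrow> dgen j k = (if k = int j then int j + 1 else if k = int j + 1 then int j
    else if k = - int j then - (int j + 1) else if k = - (int j + 1) then - int j else k)"
  by (auto simp: dgen_def transpose_def)

lemma D_generators_dgen: "n \<ge> 1 \<Longrightarrow> D_generators n = dgen ` {..<n}"
proof -
  assume n: "n \<ge> 1"
  have "{transpose i (i + 1) \<circ> transpose (- i) (- (i + 1)) | i. 1 \<le> i \<and> i \<le> int n - 1} = dgen ` {1..<n}"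
  proof (intro equalityI subsetI)
    fix f assume "f \<in> {transpose i (i + 1) \<circ> transpose (- i) (- (i + 1)) | i. 1 \<le> i \<and> i \<le> int n - 1}"
    then obtain i where i: "1 \<le> i" "i \<le> int n - 1" "f = transpose i (i + 1) \<circ> transpose (- i) (- (i + 1))" by blast
    then show "f \<in> dgen ` {1..<n}" by (intro image_eqI[of _ _ "nat i"]) (auto simp: dgen_def)
  qed (force simp: dgen_def)
  moreover have "{..<n} = insert 0 {1..<n}" using n by auto
  moreover have "D_generators n = insert (dgen 0) (dgen ` {1..<n})"
    unfolding D_generators_def using calculation(1) by (simp add: dgen_def[of 0])
  ultimately show ?thesis by simp
qed

lemma dgen_dgen [simp]: "dgen j (dgen j k) = k"
  by (cases "j = 0") (auto simp: dgen_0 dgen_pos)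

lemma dgen_signed: "j < n \<Longrightarrow> n \<ge> 2 \<Longrightarrow> signed n (dgen j)"
proof (rule signedI)
  show "inj_on (dgen j) (ints n)" by (metis dgen_dgen inj_onI)
qed (cases "j = 0"; auto simp: dgen_0 dgen_pos split: if_splits)+

lemma dgen_sign_prod: "j < n \<Longrightarrow> n \<ge> 2 \<Longrightarrow> sign_prod n (dgen j) = 1"
proof (cases "j = 0")
  case True
  assume "j < n" "n \<ge> 2"
  then have "{i \<in> {1..int n}. dgen j i < 0} = {1, 2}" using True by (auto simp: dgen_0)
  with sign_prod_cases[OF dgen_signed[OF \<open>j < n\<close> \<open>n \<ge> 2\<close>]] show ?thesis by (simp only:) simp
next
  case False
  assume "j < n" "n \<ge> 2"
  then have "{i \<in> {1..int n}. dgen j i < 0} = {}" using False by (auto simp: dgen_pos)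
  with sign_prod_cases[OF dgen_signed[OF \<open>j < n\<close> \<open>n \<ge> 2\<close>]] show ?thesis by (simp only:) simp
qed

text \<open>The proof descends along the subgroups \<open>Q k\<close> of elements that fix all
  points beyond \<open>k\<close>. The generators with index at most \<open>k\<close> move
  \<open>k + 1\<close> to every nonzero point of absolute value at most \<open>k + 1\<close>, so
  dividing by such a product lands in \<open>Q k\<close>. In \<open>Q 1\<close> the sign product
  leaves only the identity.\<close>

lemma D_group_induct:
  assumes n: "n \<ge> 2" and g: "signed n g" "sign_prod n g = 1"
    and P: "P id" "\<And>j. j < n \<Longrightarrow> P (dgen j)" "\<And>f g. P f \<Longrightarrow> P g \<Longrightarrow> P (f \<circ> g)"
  shows "P g"
proof -
  define Q where "Q k f \<longleftrightarrow> signed n f \<and> sign_prod n f = 1 \<and> (\<forall>i > int k. f i = i)" for k f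
  have reach: "\<exists>r. P r \<and> Q (Suc k) r \<and> r (int (Suc k)) = j" if k: "1 \<le> k" "Suc k \<le> n" and j: "1 \<le> \<bar>j\<bar>" "\<bar>j\<bar> \<le> int (Suc k)" for k j
  proof -
    define A where "A = {j. \<exists>r. P r \<and> Q (Suc k) r \<and> r (int (Suc k)) = j}"
    have Qd: "Q (Suc k) (dgen i)" if "i \<le> k" for i
      unfolding Q_def using that k n dgen_signed[of i n] dgen_sign_prod[of i n]
      by (cases "i = 0") (auto simp: dgen_0 dgen_pos)
    have step: "dgen i j \<in> A" if j: "j \<in> A" and i: "i \<le> k" for i j
    proof -
      obtain r where r: "P r" "Q (Suc k) r" "r (int (Suc k)) = j" using j by (auto simp: A_def)
      have "Q (Suc k) (dgen i \<circ> r)" using r(2) Qd[OF i] sign_prod_comp[of n "dgen i" r] signed_comp[of n "dgen i" r]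
        by (auto simp: Q_def)
      moreover have "P (dgen i \<circ> r)" using P r i k by simp
      ultimately show ?thesis using r(3) unfolding A_def by (intro CollectI exI[of _ "dgen i \<circ> r"]) auto
    qed
    have top: "int (Suc k) \<in> A" unfolding A_def using P(1) by (intro CollectI exI[of _ id]) (auto simp: Q_def)
    have pos: "int i \<in> A" if "1 \<le> i" "i \<le> Suc k" for i
      using that(2,1)
    proof (induction rule: inc_induct)
      case (step i)
      then have "dgen i (int (Suc i)) \<in> A" using \<open>\<And>i j. j \<in> A \<Longrightarrow> i \<le> k \<Longrightarrow> dgen i j \<in> A\<close>[of "int (Suc i)" i] by simp
      then show ?case using step by (simp add: dgen_pos)
    qed (use top in simp)
    \<comment> \<open>Only \<open>dgen 0\<close> changes signs; it sends 2 to -1, from where the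
      other generators reach all negative points.\<close>
    have "dgen 0 2 \<in> A" using step[OF pos[of 2]] k by simp
    then have m1: "- 1 \<in> A" by (simp add: dgen_0)
    have neg: "- int i \<in> A" if "1 \<le> i" "i \<le> Suc k" for i
      using that
    proof (induction i rule: dec_induct)
      case (step i)
      then have "dgen i (- int i) \<in> A" using \<open>\<And>i j. j \<in> A \<Longrightarrow> i \<le> k \<Longrightarrow> dgen i j \<in> A\<close>[of "- int i" i] by simp
      then show ?case using step by (simp add: dgen_pos diff_diff_eq2 minus_diff_commute)
    qed (use m1 in simp)
    have "j \<in> A" using pos[of "nat j"] neg[of "nat (- j)"] j by (cases "j > 0") auto
    then show ?thesis by (simp add: A_def)
  qed
  have main: "P f" if "1 \<le> k" "k \<le> n" "Q k f" for k f
    using that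
  proof (induction k arbitrary: f rule: dec_induct)
    case base
    have s: "signed n f" "sign_prod n f = 1" "\<And>i. i > 1 \<Longrightarrow> f i = i" using base by (auto simp: Q_def)
    have "sign_prod n f = sgn (f 1) * (\<Prod>i\<in>{2..int n}. sgn (f i))"
      unfolding sign_prod_def using n by (subst prod.remove[of _ 1]) (auto intro!: prod.cong arg_cong2[of _ _ _ _ "(*)"])
    also have "(\<Prod>i\<in>{2..int n}. sgn (f i)) = 1" using s(3) by (intro prod.neutral) auto
    finally have p: "f 1 > 0" using s(2) by (metis mult.right_neutral sgn_1_pos)
    have "f 1 = 1"
    proof (rule ccontr)
      assume "f 1 \<noteq> 1"
      then have "f 1 > 1" using p by simp
      then have "f (f 1) = f 1" using s(3) by blast
      then show False using signed_inj[OF s(1)] \<open>f 1 \<noteq> 1\<close> by metis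
    qed
    have "f i = i" for i
    proof -
      have *: "f i = i" if "i \<ge> 0" for i using s(1) s(3)[of i] \<open>f 1 = 1\<close> that by (cases "i = 0 \<or> i = 1") auto
      show ?thesis using *[of i] *[of "- i"] signed_minus[OF s(1), of i] by linarith
    qed
    then have "f = id" by auto
    then show ?case using P(1) by metis
  next
    case (step k)
    have s: "signed n f" "sign_prod n f = 1" "\<And>i. i > int (Suc k) \<Longrightarrow> f i = i" using step.prems by (auto simp: Q_def)
    define j where "j = f (int (Suc k))"
    have "\<bar>j\<bar> \<le> int (Suc k)"
    proof (rule ccontr)
      assume a: "\<not> ?thesis"
      have "f j = j \<or> f (- j) = - j" using s(3)[of j] s(3)[of "- j"] a by linarith
      then have "f j = j" using signed_minus[OF s(1), of j] by auto
      then have "j = int (Suc k)" using signed_inj[OF s(1)] by (metis j_def)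
      then show False using a by simp
    qed
    moreover have "1 \<le> \<bar>j\<bar>" using signed_eq_0[OF s(1), of "int (Suc k)"] by (auto simp: j_def)
    ultimately obtain r where r: "P r" "Q (Suc k) r" "r (int (Suc k)) = j" using reach step.hyps step.prems by blast
    have rs: "signed n r" "sign_prod n r = 1" "\<And>i. i > int (Suc k) \<Longrightarrow> r i = i" using r by (auto simp: Q_def)
    have ir: "inv_into UNIV r (r i) = i" "r (inv_into UNIV r i) = i" for i using permutes_inverses[OF signed_permutes[OF rs(1)]] by auto
    define h where "h = inv_into UNIV r \<circ> f"
    have "h i = i" if "i > int k" for i
    proof (cases "i = int (Suc k)")
      case True then show ?thesis using ir(1)[of i] r(3) unfolding h_def j_def comp_apply by simp
    next
      case False
      then show ?thesis using s(3)[of i] rs(3)[of i] ir(1)[of i] that by (simp add: h_def)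
    qed
    then have "Q k h"
      using signed_comp[OF signed_inv[OF rs(1)] s(1)] sign_prod_comp[OF signed_inv[OF rs(1)] s(1)] sign_prod_inv[OF rs(1,2)] s(2)
      by (simp add: Q_def h_def)
    then have "P h" using step by simp
    then have "P (r \<circ> h)" using P r by blast
    moreover have "r \<circ> h = f" using ir by (auto simp: h_def)
    ultimately show ?case by simp
  qed
  have "Q n g" using g permutes_not_in[OF signed_permutes[OF g(1)]] by (auto simp: Q_def)
  then show ?thesis by (rule main[rotated 2]) (use n in auto)
qed

subsection \<open>Cycles of signed permutations\<close>

lemma signed_permutation: "signed n w \<Longrightarrow> permutation w"
  using signed_permutes permutes_imp_permutation by blast

lemma self_in_orb: "signed n w \<Longrightarrow> k \<in> orb w k"
  by (rule permutation_self_in_orbit[OF signed_permutation])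

lemma orb_eq: "signed n w \<Longrightarrow> i \<in> orb w k \<Longrightarrow> orb w i = orb w k"
  using orbit_cyclic_eq3[OF cyclic_on_orbit'[OF signed_permutation]] by blast

lemma orb_funpow: "signed n w \<Longrightarrow> orb w k = {(w ^^ j) k | j. True}"
  using orbit_altdef_permutation[OF signed_permutation] by auto

lemma funpow_minus: "signed n w \<Longrightarrow> (w ^^ j) (- k) = - (w ^^ j) k"
  by (induction j) (auto simp: signed_minus)

lemma orb_minus: "signed n w \<Longrightarrow> orb w (- k) = uminus ` orb w k"
  by (auto simp: orb_funpow funpow_minus)

lemma orb_subset: "signed n w \<Longrightarrow> k \<in> ints n \<Longrightarrow> orb w k \<subseteq> ints n"
  using permutes_orbit_subset[OF signed_permutes] by blast

lemma orb_image: "signed n w \<Longrightarrow> w ` orb w k = orb w k"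
proof -
  assume w: "signed n w"
  have "w ` orb w k \<subseteq> orb w k" by (auto intro: orbit.step)
  moreover have "finite (orb w k)" using finite_orbit[OF self_in_orb[OF w]] .
  moreover have "inj_on w (orb w k)" using signed_inj[OF w] by (auto simp: inj_on_def)
  ultimately show ?thesis using endo_inj_surj by blast
qed

lemma orb_neg: "signed n w \<Longrightarrow> - k \<in> orb w k \<Longrightarrow> uminus ` orb w k = orb w k"
  using orb_minus orb_eq by metis

lemma orb_0: "signed n w \<Longrightarrow> 0 \<in> orb w k \<Longrightarrow> k = 0"
proof -
  assume w: "signed n w" "0 \<in> orb w k"
  have "(w ^^ j) 0 = 0" for j by (induction j) (use w in auto)
  then have "orb w 0 = {0}" using orb_funpow[OF w(1)] by auto
  then show ?thesis using orb_eq[OF w] self_in_orb[OF w(1), of k] by auto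
qed

text \<open>With \<open>a j = (w ^^ j) k\<close>, let \<open>h\<close> be the first index with
  \<open>a h = - k\<close>. The absolute values of the first \<open>h\<close> points run exactly
  once through \<open>A\<close>, and the product of signs telescopes to
  \<open>sgn (a h) * sgn (a 0)\<close>.\<close>

lemma neg_cycle:
  assumes w: "signed n w" and k: "k \<in> {1..int n}" and neg: "- k \<in> orb w k"
  defines "A \<equiv> orb w k \<inter> {1..int n}"
  shows neg_cycle_sgn: "(\<Prod>i\<in>A. sgn (w i)) = - 1" and neg_cycle_card: "card (orb w k) = 2 * card A"
proof -
  define a where "a j = (w ^^ j) k" for j
  define h where "h = (LEAST h. a h = - k)"
  obtain h' where "a h' = - k" using neg orb_funpow[OF w, of k] by (auto simp: a_def)
  then have h: "a h = - k" unfolding h_def by (rule LeastI)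
  have least: "a j \<noteq> - k" if "j < h" for j using not_less_Least that unfolding h_def by blast
  have h0: "h \<noteq> 0" using h k by (cases h) (auto simp: a_def)
  have add: "a (i + j) = (w ^^ i) (a j)" for i j by (simp add: a_def funpow_add)
  have ah: "a (j + h) = - a j" for j using add[of j h] h funpow_minus[OF w] by (simp add: a_def)
  have aorb: "a j \<in> orb w k" for j using orb_funpow[OF w] by (auto simp: a_def)
  have a0: "a j \<noteq> 0" for j using orb_0[OF w, of k] aorb[of j] k by (metis atLeastAtMost_iff not_one_le_zero)
  have ar: "a j \<in> ints n" for j using aorb orb_subset[OF w, of k] k by fastforce
  have inj: "(w ^^ i) x = (w ^^ i) y \<longleftrightarrow> x = y" for i x y by (induction i) (auto simp: signed_inj[OF w])
  have per: "a (j mod h) = a j \<or> a (j mod h) = - a j" for j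
  proof (induction j rule: less_induct)
    case (less j)
    show ?case
    proof (cases "j < h")
      case False
      then have "a j = - a (j - h)" using ah[of "j - h"] by simp
      moreover have "j mod h = (j - h) mod h" using False by (simp add: le_mod_geq)
      ultimately show ?thesis using less[of "j - h"] False h0 by auto
    qed simp
  qed
  have noper: "a j \<noteq> k" if j: "0 < j" "j < h" for j
  proof
    assume e: "a j = k"
    have "a (q * j + i) = a i" for q i
    proof (induction q)
      case (Suc q)
      have "a (Suc q * j + i) = (w ^^ (q * j + i)) (a j)" using add[of "q * j + i" j] by (simp add: add_ac)
      then show ?case using Suc e by (simp add: a_def)
    qed simp
    then have "a h = a (h mod j)" using div_mult_mod_eq[of h j] by metis
    moreover have "h mod j < h" using j by (meson less_trans mod_less_divisor)
    ultimately show False using least h by metis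
  qed
  have absinj: "inj_on (\<lambda>j. \<bar>a j\<bar>) {..<h}"
  proof (rule linorder_inj_onI)
    fix i j assume ij: "i < j" "i \<in> {..<h}" "j \<in> {..<h}"
    show "\<bar>a i\<bar> \<noteq> \<bar>a j\<bar>"
    proof
      assume "\<bar>a i\<bar> = \<bar>a j\<bar>"
      then have "a j = a i \<or> a j = - a i" by linarith
      moreover have "a j = (w ^^ i) (a (j - i))" using add[of i "j - i"] ij by simp
      moreover have "a i = (w ^^ i) k" "- a i = (w ^^ i) (- k)" using funpow_minus[OF w] by (auto simp: a_def)
      ultimately have "a (j - i) = k \<or> a (j - i) = - k" using inj by metis
      then show False using noper[of "j - i"] least[of "j - i"] ij by auto
    qed
  qed auto
  have oA: "x \<in> orb w k \<Longrightarrow> - x \<in> orb w k" for x using orb_neg[OF w neg] by blast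
  have img: "(\<lambda>j. \<bar>a j\<bar>) ` {..<h} = A"
  proof (intro equalityI subsetI)
    fix x assume "x \<in> (\<lambda>j. \<bar>a j\<bar>) ` {..<h}"
    then obtain j where j: "x = \<bar>a j\<bar>" by blast
    then have "x = a j \<or> x = - a j" by linarith
    then have "x \<in> orb w k" using aorb oA by auto
    moreover have "x \<in> {1..int n}" using a0[of j] ar[of j] j by auto
    ultimately show "x \<in> A" by (simp add: A_def)
  next
    fix x assume "x \<in> A"
    then obtain j where j: "x = a j" "x \<ge> 1" using orb_funpow[OF w] by (auto simp: A_def a_def)
    then have "x = \<bar>a (j mod h)\<bar>" using per[of j] by auto
    then show "x \<in> (\<lambda>j. \<bar>a j\<bar>) ` {..<h}" using h0 by auto
  qed
  have bij: "bij_betw (\<lambda>j. \<bar>a j\<bar>) {..<h} A" using absinj img by (simp add: bij_betw_def)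
  have cA: "card A = h" using bij_betw_same_card[OF bij] by simp
  have "(\<Prod>i\<in>A. sgn (w i)) = (\<Prod>j<h. sgn (w \<bar>a j\<bar>))"
    using prod.reindex_bij_betw[OF bij, of "\<lambda>i. sgn (w i)"] by simp
  also have "\<dots> = (\<Prod>j<h. sgn (a (Suc j)) * sgn (a j))"
  proof (rule prod.cong[OF refl])
    fix j
    have "a (Suc j) = w (a j)" by (simp add: a_def)
    then show "sgn (w \<bar>a j\<bar>) = sgn (a (Suc j)) * sgn (a j)"
      using a0[of j] signed_minus[OF w, of "a j"] by (cases "a j > 0") (auto simp: sgn_minus)
  qed
  also have "\<dots> = sgn (a h) * sgn (a 0)"
  proof -
    have "(\<Prod>j<i. sgn (a (Suc j)) * sgn (a j)) = sgn (a i) * sgn (a 0)" for i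
    proof (induction i)
      case (Suc i)
      have "sgn (a i) * sgn (a i) = 1" using a0[of i] by (simp add: sgn_if)
      then show ?case using Suc by (simp add: algebra_simps)
    qed (use a0[of 0] in \<open>auto simp: sgn_if\<close>)
    then show ?thesis .
  qed
  also have "\<dots> = - 1" using h k by (simp add: a_def)
  finally show "(\<Prod>i\<in>A. sgn (w i)) = - 1" .
  have "orb w k = A \<union> uminus ` A"
  proof (intro equalityI subsetI)
    fix x assume x: "x \<in> orb w k"
    then have "x \<noteq> 0" "x \<in> ints n" using orb_0[OF w, of k] orb_subset[OF w, of k] k by auto
    then have "x \<in> A \<or> - x \<in> A" using x oA[OF x] by (auto simp: A_def)
    then show "x \<in> A \<union> uminus ` A" using imageI[of "- x" A uminus] by auto
  qed (use oA in \<open>auto simp: A_def\<close>)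
  moreover have "A \<inter> uminus ` A = {}" by (auto simp: A_def)
  moreover have "finite A" by (simp add: A_def)
  ultimately show "card (orb w k) = 2 * card A" using card_image[of uminus A] by (simp add: card_Un_disjoint)
qed

lemma sign_prod_restrict:
  assumes "C \<subseteq> ints n" and g: "\<And>i. i \<notin> C \<Longrightarrow> g i = i"
  shows "sign_prod n g = (\<Prod>i\<in>C \<inter> {1..int n}. sgn (g i))"
  unfolding sign_prod_def
proof (rule prod.mono_neutral_right)
  show "\<forall>i\<in>{1..int n} - C \<inter> {1..int n}. sgn (g i) = 1" using g by auto
qed auto

lemma signed_restrict:
  assumes g: "signed n g" and C: "C \<subseteq> ints n" "g ` C = C" "uminus ` C = C"
  shows "signed n (\<lambda>i. if i \<in> C then g i else i)"
proof (rule signedI)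
  have gC: "i \<in> C \<Longrightarrow> g i \<in> C" and mC: "i \<in> C \<longleftrightarrow> - i \<in> C" for i
    using C imageI[of i C g] imageI[of i C uminus] imageI[of "- i" C uminus] by auto
  show "(if - i \<in> C then g (- i) else - i) = - (if i \<in> C then g i else i)" for i
    using mC[of i] signed_minus[OF g] by auto
  show "inj_on (\<lambda>i. if i \<in> C then g i else i) (ints n)"
    using gC signed_inj[OF g] by (auto simp: inj_on_def split: if_splits)
  show "(if i \<in> C then g i else i) \<in> ints n" if "i \<in> ints n" for i using that gC[of i] subsetD[OF C(1), of "g i"] by auto
  show "(if i \<in> C then g i else i) = i" if "i \<notin> ints n" for i using that C(1) by auto
qed

text \<open>Each negative cycle contributes the factor -1 to the product.\<close>

lemma all_neg_even_cycles:
  assumes w: "signed n w" and neg: "\<And>k. k \<in> {1..int l} \<Longrightarrow> - k \<in> orb w k \<and> orb w k \<inter> {1..int n} \<subseteq> {1..int l}" and l: "l \<le> n"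
    and p: "(\<Prod>i\<in>{1..int l}. sgn (w i)) = 1"
  shows "even (card (orb w ` {1..int l}))"
proof -
  let ?I = "orb w ` {1..int l}"
  have "{1..int l} = (\<Union>C\<in>?I. C \<inter> {1..int n})"
    using self_in_orb[OF w] neg l by fastforce
  then have "(\<Prod>i\<in>{1..int l}. sgn (w i)) = (\<Prod>i\<in>(\<Union>C\<in>?I. C \<inter> {1..int n}). sgn (w i))" by simp
  also have "\<dots> = (\<Prod>C\<in>?I. \<Prod>i\<in>C \<inter> {1..int n}. sgn (w i))"
  proof (rule prod.UNION_disjoint)
    show "\<forall>C\<in>?I. \<forall>D\<in>?I. C \<noteq> D \<longrightarrow> (C \<inter> {1..int n}) \<inter> (D \<inter> {1..int n}) = {}"
      using orb_eq[OF w] by blast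
  qed auto
  also have "\<dots> = (\<Prod>C\<in>?I. - 1)"
    using neg l by (intro prod.cong[OF refl]) (auto intro!: neg_cycle_sgn[OF w])
  also have "\<dots> = (- 1) ^ card ?I" by simp
  finally show ?thesis using p by (auto simp: minus_one_power_iff split: if_splits)
qed

context finite_coxeter
begin

subsection \<open>Type D components as groups of signed permutations\<close>

text \<open>\<open>ev ds i\<close> is the \<open>i\<close>-th vector of an orthogonal basis in which the simple roots are
  \<open>(e\<^sub>1 + e\<^sub>2) / 2\<close> and \<open>(e\<^sub>j\<^sub>+\<^sub>1 - e\<^sub>j) / 2\<close>; \<open>eps\<close> extends it to negative indices.\<close>

definition ev :: "'a list \<Rightarrow> nat \<Rightarrow> 'a \<Rightarrow> real" where
  "ev ds i = \<alpha> (ds ! 0) - \<alpha> (ds ! 1) + 2 *\<^sub>R (\<Sum>j\<in>{1..<i}. \<alpha> (ds ! j))"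

definition eps :: "'a list \<Rightarrow> int \<Rightarrow> 'a \<Rightarrow> real" where
  "eps ds k = (if k = 0 then 0 else if k > 0 then ev ds (nat k) else - ev ds (nat (- k)))"

definition realizes :: "'a list \<Rightarrow> 'a \<Rightarrow> (int \<Rightarrow> int) \<Rightarrow> bool" where
  "realizes ds v g \<longleftrightarrow> (\<forall>k\<in>ints (length ds). act v (eps ds k) = eps ds (g k))"

lemma eps_minus: "eps ds (- k) = - eps ds k"
  by (auto simp: eps_def)

lemma eps_0 [simp]: "eps ds 0 = 0"
  by (simp add: eps_def)

lemma eps_nat: "i \<ge> 1 \<Longrightarrow> eps ds (int i) = ev ds i"
  by (simp add: eps_def)

lemma ev_Suc: "i \<ge> 1 \<Longrightarrow> ev ds (Suc i) = ev ds i + 2 *\<^sub>R \<alpha> (ds ! i)"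
  by (simp add: ev_def scaleR_add_right)

context
  fixes ds :: "'a list"
  assumes D: "path_D ds"
begin

lemma D_length: "length ds \<ge> 4" and D_sub: "set ds \<subseteq> S" and D_distinct: "distinct ds"
  and D_m: "i < length ds \<Longrightarrow> j < length ds \<Longrightarrow> i \<noteq> j \<Longrightarrow> m (ds ! i) (ds ! j) = (if D_edge i j \<or> D_edge j i then 3 else 2)"
  using D by (auto simp: path_D_def)

lemma D_not_Nil: "ds \<noteq> []"
  using D_length by auto

lemma D_nth: "i < length ds \<Longrightarrow> ds ! i \<in> S"
  using D_sub by auto

lemma D_nth_eq: "i < length ds \<Longrightarrow> j < length ds \<Longrightarrow> ds ! i = ds ! j \<longleftrightarrow> i = j"
  using D_distinct by (rule nth_eq_iff_index_eq)

lemma D_bform: "i < length ds \<Longrightarrow> j < length ds \<Longrightarrow>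
    bform (\<alpha> (ds ! i)) (\<alpha> (ds ! j)) = (if i = j then 1 else if D_edge i j \<or> D_edge j i then - 1 / 2 else 0)"
  using D_m[of i j] D_nth by (auto simp: bform_unit cos_60)

lemma D_root: "1 \<le> j \<Longrightarrow> \<alpha> (ds ! j) = (1 / 2) *\<^sub>R (ev ds (Suc j) - ev ds j)"
  by (simp add: ev_Suc)

lemma D_root_0: "\<alpha> (ds ! 0) = (1 / 2) *\<^sub>R (ev ds 1 + ev ds 2)"
proof -
  have "ev ds 2 = ev ds 1 + 2 *\<^sub>R \<alpha> (ds ! 1)" using ev_Suc[of 1 ds] by (simp add: numeral_2_eq_2)
  moreover have "ev ds 1 = \<alpha> (ds ! 0) - \<alpha> (ds ! 1)" by (simp add: ev_def)
  ultimately show ?thesis by (simp add: fun_eq_iff vec_apply)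
qed

lemma bform_ev_root:
  assumes "1 \<le> i" "i \<le> length ds" "j < length ds"
  shows "bform (ev ds i) (\<alpha> (ds ! j)) = (if j = 0 then of_bool (i = 1) + of_bool (i = 2) else of_bool (i = Suc j) - of_bool (i = j))"
  using assms
proof (induction i rule: dec_induct)
  case base
  have "bform (ev ds 1) (\<alpha> (ds ! j)) = bform (\<alpha> (ds ! 0)) (\<alpha> (ds ! j)) - bform (\<alpha> (ds ! 1)) (\<alpha> (ds ! j))"
    by (simp add: ev_def bform_simps)
  then show ?case using D_length D_not_Nil base.prems D_bform[of 0 j] D_bform[of 1 j] by (auto simp: D_edge_def)
next
  case (step i)
  have "bform (ev ds (Suc i)) (\<alpha> (ds ! j)) = bform (ev ds i) (\<alpha> (ds ! j)) + 2 * bform (\<alpha> (ds ! i)) (\<alpha> (ds ! j))"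
    using step.hyps by (simp add: ev_Suc bform_simps)
  then show ?case using step by (auto simp: D_bform D_edge_def of_bool_def)
qed

lemma bform_ev:
  assumes "1 \<le> j" "j \<le> length ds" "1 \<le> i" "i \<le> length ds"
  shows "bform (ev ds i) (ev ds j) = (if i = j then 2 else 0)"
  using assms(1,2)
proof (induction j rule: dec_induct)
  case base
  have "bform (ev ds i) (ev ds 1) = bform (ev ds i) (\<alpha> (ds ! 0)) - bform (ev ds i) (\<alpha> (ds ! 1))"
    by (simp add: ev_def bform_simps)
  then show ?case using D_length D_not_Nil bform_ev_root[OF assms(3,4), of 0] bform_ev_root[OF assms(3,4), of 1] by auto
next
  case (step j)
  have "bform (ev ds i) (ev ds (Suc j)) = bform (ev ds i) (ev ds j) + 2 * bform (ev ds i) (\<alpha> (ds ! j))"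
    using step.hyps by (simp add: ev_Suc bform_simps)
  then show ?case using step by (auto simp: bform_ev_root[OF assms(3,4)])
qed

lemma bform_eps:
  assumes k: "k \<in> ints (length ds)" "k \<noteq> 0" and l: "l \<in> {1..int (length ds)}"
  shows "bform (eps ds k) (eps ds l) = (if k = l then 2 else if k = - l then - 2 else 0)"
proof (cases "k > 0")
  case True
  then show ?thesis using assms bform_ev[of "nat l" "nat k"] by (auto simp: eps_def)
next
  case False
  have "eps ds k = - ev ds (nat (- k))" "eps ds l = ev ds (nat l)" using False assms by (auto simp: eps_def)
  then show ?thesis using False assms bform_ev[of "nat l" "nat (- k)"] by (auto simp: bform_simps)
qed

lemma eps_inj:
  assumes k: "k \<in> ints (length ds)" and l: "l \<in> ints (length ds)" and e: "eps ds k = eps ds l"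
  shows "k = l"
proof -
  have *: "k = l" if k: "k \<in> ints (length ds)" and l: "l \<in> ints (length ds)"
    and e: "eps ds k = eps ds l" and l0: "l \<noteq> 0" for k l
  proof (cases "l > 0")
    case True
    then have "bform (eps ds k) (eps ds l) = 2" using bform_eps[of l l] l unfolding e by simp
    then show ?thesis using bform_eps[of k l] k l True by (cases "k = 0") (auto split: if_splits)
  next
    case False
    have "eps ds (- k) = eps ds (- l)" using e by (simp add: eps_minus)
    moreover have "bform (eps ds (- l)) (eps ds (- l)) = 2" using bform_eps[of "- l" "- l"] l False l0 by simp
    ultimately show ?thesis using bform_eps[of "- k" "- l"] k l False l0 by (cases "k = 0") (auto split: if_splits)
  qed
  then show ?thesis using *[OF k l e] *[OF l k e[symmetric]] by blast
qed

lemma ev_coord: "1 \<le> i \<Longrightarrow> i \<le> length ds \<Longrightarrow> ev ds i \<in> coord (set ds)"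
  unfolding ev_def using D_length D_not_Nil nth_mem[of 0 ds] by (intro coord_add coord_diff coord_scale coord_sum coord_unit nth_mem) auto

lemma eps_coord: "k \<in> ints (length ds) \<Longrightarrow> eps ds k \<in> coord (set ds)"
  unfolding eps_def using ev_coord[of "nat k"] ev_coord[of "nat (- k)"] by (auto intro!: coord_minus coord_zero)

lemma D_root_eps: "j < length ds \<Longrightarrow> \<alpha> (ds ! j) = (1 / 2) *\<^sub>R (if j = 0 then eps ds 1 + eps ds 2 else eps ds (int j + 1) - eps ds (int j))"
  using D_root_0 D_root[of j] eps_nat[of "Suc j" ds] eps_nat[of j ds] eps_nat[of 1 ds] eps_nat[of 2 ds]
  by (auto simp: add_ac)

lemma act_gen_ev:
  assumes j: "j < length ds" and i: "1 \<le> i" "i \<le> length ds"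
  shows "act (ds ! j) (ev ds i) = eps ds (dgen j (int i))"
proof -
  have a: "act (ds ! j) (ev ds i) = ev ds i - (2 * bform (ev ds i) (\<alpha> (ds ! j))) *\<^sub>R \<alpha> (ds ! j)"
    using act_gen D_nth[OF j] by blast
  have e: "ev ds i = eps ds (int i)" using i by (simp add: eps_nat)
  show ?thesis
  proof (cases "j = 0")
    case True
    consider "i = 1" | "i = 2" | "i > 2" using i by linarith
    then show ?thesis
      unfolding a unfolding bform_ev_root[OF i j] unfolding D_root_eps[OF j] e using True eps_minus[of ds 1] eps_minus[of ds 2]
      by cases (auto simp: dgen_0 fun_eq_iff vec_apply)
  next
    case False
    consider "i = j" | "i = Suc j" | "i \<noteq> j" "i \<noteq> Suc j" by blast
    then show ?thesis unfolding a unfolding bform_ev_root[OF i j] unfolding D_root_eps[OF j] e using False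
      by cases (auto simp: dgen_pos fun_eq_iff vec_apply add_ac)
  qed
qed

lemma realizes_gen: "j < length ds \<Longrightarrow> realizes ds (ds ! j) (dgen j)"
  unfolding realizes_def
proof
  fix k assume j: "j < length ds" and k: "k \<in> ints (length ds)"
  have s: "signed (length ds) (dgen j)" using dgen_signed j D_length by simp
  show "act (ds ! j) (eps ds k) = eps ds (dgen j k)"
  proof (cases k "0 :: int" rule: linorder_cases)
    case less
    then show ?thesis using act_gen_ev[OF j, of "nat (- k)"] k signed_minus[OF s, of k] eps_minus[of ds "dgen j k"]
      by (auto simp: eps_def act_simps)
  next
    case equal
    then show ?thesis using s by (auto simp: act_simps)
  next
    case greater
    then show ?thesis using act_gen_ev[OF j, of "nat k"] k by (simp add: eps_def)
  qed
qed

lemma realizes_mult: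
  assumes "realizes ds v g" "realizes ds w h" "signed (length ds) h" "v \<in> carrier W" "w \<in> carrier W"
  shows "realizes ds (v \<otimes> w) (g \<circ> h)"
  using assms signed_range[OF assms(3)] by (auto simp: realizes_def)

lemma realizes_one: "realizes ds \<one> id"
  by (simp add: realizes_def)

lemma realizes_inv:
  assumes r: "realizes ds v g" and g: "signed (length ds) g" and v: "v \<in> carrier W"
  shows "realizes ds (inv v) (inv_into UNIV g)"
  unfolding realizes_def
proof
  fix k assume k: "k \<in> ints (length ds)"
  have gi: "g (inv_into UNIV g k) = k" using permutes_inverses[OF signed_permutes[OF g]] by auto
  then have "eps ds k = act v (eps ds (inv_into UNIV g k))"
    using r signed_range[OF g, of "inv_into UNIV g k"] k by (auto simp: realizes_def)
  then show "act (inv v) (eps ds k) = eps ds (inv_into UNIV g k)" using v by simp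
qed

lemma realizes_unique:
  assumes "realizes ds v g" "realizes ds v h" and g: "signed (length ds) g" and h: "signed (length ds) h"
  shows "g = h"
proof
  fix k show "g k = h k"
  proof (cases "k \<in> ints (length ds)")
    case True
    then have "eps ds (g k) = eps ds (h k)" using assms by (auto simp: realizes_def)
    then show ?thesis using eps_inj signed_range[OF g, of k] signed_range[OF h, of k] True by blast
  next
    case False
    then show ?thesis using permutes_not_in[OF signed_permutes[OF g]] permutes_not_in[OF signed_permutes[OF h]] by simp
  qed
qed

lemma realizes_eqI:
  assumes "realizes ds v g" "realizes ds w g" and x: "x \<in> coord (set ds)"
  shows "act v x = act w x"
proof -
  have e: "act v (eps ds k) = act w (eps ds k)" if "k \<in> ints (length ds)" for k
    using assms that by (simp add: realizes_def)
  have r: "act v (\<alpha> s) = act w (\<alpha> s)" if s: "s \<in> set ds" for s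
  proof -
    obtain j where "j < length ds" "s = ds ! j" using s by (auto simp: in_set_conv_nth)
    then show ?thesis using D_length e[of "int j + 1"] e[of "int j"] e[of 1] e[of 2] by (auto simp: D_root_eps act_simps)
  qed
  have "x = (\<Sum>s\<in>set ds. x s *\<^sub>R \<alpha> s)" using coord_expand x by blast
  then show ?thesis using r by (metis (mono_tags, lifting) act_scale act_sum sum.cong)
qed

lemma realizes_inj:
  assumes "realizes ds v g" "realizes ds w g" "v \<in> par (set ds)" "w \<in> par (set ds)"
  shows "v = w"
  using realizes_eqI[OF assms(1,2)] D_sub assms by (intro par_eqI[of "set ds"]) auto

lemma par_realizes:
  assumes "v \<in> par (set ds)"
  shows "\<exists>g. realizes ds v g \<and> signed (length ds) g \<and> sign_prod (length ds) g = 1"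
proof -
  have n: "length ds \<ge> 2" using D_length by simp
  obtain xs where xs: "xs \<in> lists (set ds)" "word xs = v" using assms generate_iff_word[OF D_sub] by blast
  have "\<exists>g. realizes ds (word xs) g \<and> signed (length ds) g \<and> sign_prod (length ds) g = 1" using xs(1)
  proof (induction xs)
    case Nil
    show ?case using realizes_one by (intro exI[of _ id] conjI) (simp_all del: id_apply)
  next
    case (Cons s xs)
    then obtain g j where g: "realizes ds (word xs) g" "signed (length ds) g" "sign_prod (length ds) g = 1"
      and j: "j < length ds" "s = ds ! j" by (auto simp: in_set_conv_nth)
    have c: "word xs \<in> carrier W" using Cons.hyps D_sub lists_mono[OF D_sub] by (intro word_carrier) auto
    note d = dgen_signed[OF j(1) n]
    have "realizes ds (word (s # xs)) (dgen j \<circ> g)"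
      using realizes_mult[OF realizes_gen[OF j(1)] g(1,2) S_carrier[OF D_nth[OF j(1)]] c] j by simp
    moreover have "sign_prod (length ds) (dgen j \<circ> g) = 1" using sign_prod_comp[OF d g(2)] g(3) dgen_sign_prod[OF j(1) n] by simp
    ultimately show ?case using signed_comp[OF d g(2)] by blast
  qed
  then show ?thesis using xs by simp
qed

lemma exists_realizing:
  assumes "signed (length ds) g" "sign_prod (length ds) g = 1"
  shows "\<exists>v\<in>par (set ds). realizes ds v g"
proof -
  have n: "length ds \<ge> 2" using D_length by simp
  have "signed (length ds) g \<and> (\<exists>v\<in>par (set ds). realizes ds v g)"
  proof (rule D_group_induct[OF n assms])
    show "signed (length ds) id \<and> (\<exists>v\<in>par (set ds). realizes ds v id)" using realizes_one by (auto intro: bexI[of _ \<one>])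
    show "signed (length ds) (dgen j) \<and> (\<exists>v\<in>par (set ds). realizes ds v (dgen j))" if "j < length ds" for j
      using realizes_gen[OF that] dgen_signed[OF that n] par_gen[of "ds ! j" "set ds"] that by (meson nth_mem)
    fix f g assume *: "signed (length ds) f \<and> (\<exists>v\<in>par (set ds). realizes ds v f)" "signed (length ds) g \<and> (\<exists>v\<in>par (set ds). realizes ds v g)"
    then obtain v w where "v \<in> par (set ds)" "realizes ds v f" "w \<in> par (set ds)" "realizes ds w g" by blast
    then show "signed (length ds) (f \<circ> g) \<and> (\<exists>v\<in>par (set ds). realizes ds v (f \<circ> g))"
      using * signed_comp realizes_mult[of v f w g] par_mult[of v "set ds" w] par_in_W[OF D_sub] by blast
  qed
  then show ?thesis by blast
qed

definition sperm :: "'a \<Rightarrow> int \<Rightarrow> int" where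
  "sperm v = (THE g. realizes ds v g \<and> signed (length ds) g)"

lemma sperm: "v \<in> par (set ds) \<Longrightarrow> realizes ds v (sperm v) \<and> signed (length ds) (sperm v)"
proof -
  assume "v \<in> par (set ds)"
  from par_realizes[OF this] obtain g where g: "realizes ds v g" "signed (length ds) g" by (elim exE conjE)
  show ?thesis unfolding sperm_def
  proof (rule theI[of _ g])
    show "f = g" if "realizes ds v f \<and> signed (length ds) f" for f using realizes_unique[OF _ g(1) _ g(2)] that by simp
  qed (simp add: g)
qed

lemma sperm_eqI: "realizes ds v g \<Longrightarrow> signed (length ds) g \<Longrightarrow> v \<in> par (set ds) \<Longrightarrow> sperm v = g"
  using sperm[of v] realizes_unique[of v "sperm v" g] by blast

text \<open>Supplies the isomorphism that \<open>noncompliant_class\<close> asks for.\<close>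

lemma sperm_iso: "sperm \<in> type_D_isos W (set ds) (length ds)"
proof -
  let ?n = "length ds"
  have n: "?n \<ge> 1" "?n \<ge> 2" using D_length by auto
  have carr: "v \<in> carrier W" if "v \<in> par (set ds)" for v using par_in_W[OF D_sub that] .
  have "sperm ` set ds = D_generators ?n"
  proof -
    have "sperm (ds ! j) = dgen j" if "j < ?n" for j
      using realizes_gen[OF that] dgen_signed[OF that n(2)] par_gen[of "ds ! j" "set ds"] that by (intro sperm_eqI) auto
    moreover have "set ds = (!) ds ` {..<?n}" by (auto simp: set_conv_nth)
    ultimately have "sperm ` set ds = dgen ` {..<?n}" by (simp add: image_image)
    then show ?thesis using D_generators_dgen[OF n(1)] by simp
  qed
  moreover have "sperm \<in> iso (W\<lparr>carrier := par (set ds)\<rparr>) (D_group ?n)"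
  proof (rule isoI)
    have D: "sperm v \<in> carrier (D_group ?n)" if v: "v \<in> par (set ds)" for v
      using par_realizes[OF v] sperm_eqI[OF _ _ v] unfolding D_group_carrier by metis
    show "sperm \<in> hom (W\<lparr>carrier := par (set ds)\<rparr>) (D_group ?n)"
    proof (rule homI)
      fix v w assume vw: "v \<in> carrier (W\<lparr>carrier := par (set ds)\<rparr>)" "w \<in> carrier (W\<lparr>carrier := par (set ds)\<rparr>)"
      then have "sperm (v \<otimes> w) = sperm v \<circ> sperm w"
        using sperm[of v] sperm[of w] carr by (intro sperm_eqI realizes_mult signed_comp par_mult) auto
      then show "sperm (v \<otimes>\<^bsub>W\<lparr>carrier := par (set ds)\<rparr>\<^esub> w) = sperm v \<otimes>\<^bsub>D_group ?n\<^esub> sperm w" by (simp add: D_group_def)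
    qed (use D in simp)
    show "bij_betw sperm (carrier (W\<lparr>carrier := par (set ds)\<rparr>)) (carrier (D_group ?n))"
      unfolding bij_betw_def
    proof (intro conjI equalityI subsetI inj_onI)
      fix v w assume "v \<in> carrier (W\<lparr>carrier := par (set ds)\<rparr>)" "w \<in> carrier (W\<lparr>carrier := par (set ds)\<rparr>)" "sperm v = sperm w"
      then show "v = w" using sperm[of v] sperm[of w] realizes_inj[of v "sperm v" w] by simp
    next
      fix g assume "g \<in> carrier (D_group ?n)"
      then have g: "signed ?n g" "sign_prod ?n g = 1" by (simp_all add: D_group_carrier)
      obtain v where "v \<in> par (set ds)" "realizes ds v g" using exists_realizing[OF g] by blast
      then show "g \<in> sperm ` carrier (W\<lparr>carrier := par (set ds)\<rparr>)" using sperm_eqI[of v g] g by auto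
    qed (use D in auto)
  qed
  ultimately show ?thesis by (simp add: type_D_isos_def)
qed

end

end

section \<open>Sign changes and the symmetry of a type D diagram\<close>

lemma orb_closed: "(\<And>i. i \<in> A \<Longrightarrow> g i \<in> A) \<Longrightarrow> k \<in> A \<Longrightarrow> orb g k \<subseteq> A"
proof
  fix x assume A: "\<And>i. i \<in> A \<Longrightarrow> g i \<in> A" "k \<in> A" and x: "x \<in> orb g k"
  from x show "x \<in> A" by (induction rule: orbit.induct) (use A in auto)
qed

definition negate :: "int set \<Rightarrow> int \<Rightarrow> int" where "negate C i = (if i \<in> C then - i else i)"

lemma negate_signed:
  assumes C: "C \<subseteq> ints n" "uminus ` C = C"
  shows "signed n (negate C)"
proof (rule signedI)
  have mC: "i \<in> C \<longleftrightarrow> - i \<in> C" for i using C imageI[of i C uminus] imageI[of "- i" C uminus] by auto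
  then show "negate C (- i) = - negate C i" for i by (simp add: negate_def)
  show "inj_on (negate C) (ints n)" using mC by (auto simp: inj_on_def negate_def split: if_splits)
qed (use C(1) in \<open>auto simp: negate_def\<close>)

lemma negate_sign_prod:
  assumes "C \<subseteq> ints n" shows "sign_prod n (negate C) = (- 1) ^ card (C \<inter> {1..int n})"
proof -
  have "sign_prod n (negate C) = (\<Prod>i\<in>C \<inter> {1..int n}. sgn (negate C i))"
    by (rule sign_prod_restrict[OF assms]) (simp add: negate_def)
  also have "\<dots> = (\<Prod>i\<in>C \<inter> {1..int n}. - 1)" by (rule prod.cong) (auto simp: negate_def)
  finally show ?thesis by simp
qed

lemma negate_commute: "uminus ` C = C \<Longrightarrow> uminus ` D = D \<Longrightarrow> negate C (negate D i) = negate D (negate C i)"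
  using imageI[of i C uminus] imageI[of "- i" C uminus] imageI[of i D uminus] imageI[of "- i" D uminus]
  by (auto simp: negate_def)

lemma negate_negate: "uminus ` C = C \<Longrightarrow> negate C (negate C i) = i"
  using imageI[of i C uminus] by (auto simp: negate_def)

text \<open>Conjugation by it interchanges \<open>u\<close> and \<open>s\<^sub>1\<close>. Its sign
  product is -1, so it lies in W(B_n) but not in W(D_n).\<close>

abbreviation flip1 :: "int \<Rightarrow> int" where "flip1 \<equiv> negate {1, - 1}"

lemma flip1_flip1 [simp]: "flip1 (flip1 i) = i"
  by (simp add: negate_def)

lemma flip1: "n \<ge> 1 \<Longrightarrow> signed n flip1" "n \<ge> 1 \<Longrightarrow> sign_prod n flip1 = - 1"
proof -
  assume n: "n \<ge> 1"
  show "signed n flip1" using n by (intro negate_signed) auto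
  have "{1, - 1} \<inter> {1..int n} = {1}" using n by auto
  then show "sign_prod n flip1 = - 1" using negate_sign_prod[of "{1, - 1}" n] n by simp
qed

lemma signed_extend:
  assumes f: "\<And>i. i \<in> {1..int n} \<Longrightarrow> f i \<noteq> 0 \<and> \<bar>f i\<bar> \<le> int n" and inj: "inj_on (\<lambda>i. \<bar>f i\<bar>) {1..int n}"
  shows "signed n (\<lambda>i. if i \<in> ints n then sgn i * f \<bar>i\<bar> else i)" (is "signed n ?l")
proof (rule signedI)
  show "?l (- i) = - ?l i" for i by (auto simp: sgn_minus)
  have z: "?l i = 0 \<longleftrightarrow> i = 0" if "i \<in> ints n" for i using f[of "\<bar>i\<bar>"] that by (auto simp: sgn_if)
  show "?l i \<in> ints n" if "i \<in> ints n" for i using f[of "\<bar>i\<bar>"] that by (auto simp: sgn_if)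
  show "inj_on ?l (ints n)"
  proof (rule inj_onI)
    fix i j assume i: "i \<in> ints n" and j: "j \<in> ints n" and e: "?l i = ?l j"
    show "i = j"
    proof (cases "i = 0 \<or> j = 0")
      case True then show ?thesis using z[OF i] z[OF j] e by metis
    next
      case False
      have "\<bar>f \<bar>i\<bar>\<bar> = \<bar>f \<bar>j\<bar>\<bar>" using e i j False by (auto simp: sgn_if abs_minus_commute split: if_splits)
      moreover have "\<bar>i\<bar> \<in> {1..int n}" "\<bar>j\<bar> \<in> {1..int n}" using i j False by (auto simp: abs_if)
      ultimately have a: "\<bar>i\<bar> = \<bar>j\<bar>" using inj_onD[OF inj, of "\<bar>i\<bar>" "\<bar>j\<bar>"] by blast
      then show ?thesis using e i j False f[of "\<bar>j\<bar>"] by (auto simp: sgn_if split: if_splits)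
    qed
  qed
qed auto

context finite_coxeter
begin

lemma path_D_spider:
  assumes D: "path_D ds"
  shows "spider (ds ! 2) [ds ! 0] [ds ! 1] (drop 3 ds)" and "set ds = spider_set (ds ! 2) [ds ! 0] [ds ! 1] (drop 3 ds)"
proof -
  obtain a c b r where ds: "ds = a # c # b # r" "r \<noteq> []" using D_length[OF D]
    by (cases ds; cases "tl ds"; cases "tl (tl ds)"; cases "tl (tl (tl ds))") auto
  have adjs: "adj (ds ! i) (ds ! j)" if "i < length ds" "j < length ds" "D_edge i j \<or> D_edge j i" for i j
  proof -
    have "i \<noteq> j" using that by (auto simp: D_edge_def)
    then show ?thesis using D_m[OF D that(1,2)] D_nth_eq[OF D that(1,2)] that(3) by (simp add: adj_def)
  qed
  have "successively adj (drop 2 ds)" unfolding successively_conv_nth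
  proof (intro allI impI)
    fix i assume "Suc i < length (drop 2 ds)"
    then show "adj (drop 2 ds ! i) (drop 2 ds ! Suc i)" using adjs[of "i + 2" "i + 3"] by (simp add: D_edge_def add_ac numeral_3_eq_3)
  qed
  moreover have "adj b a" "adj b c" using adjs[of 2 0] adjs[of 2 1] ds by (auto simp: D_edge_def)
  ultimately show "spider (ds ! 2) [ds ! 0] [ds ! 1] (drop 3 ds)"
    using D_sub[OF D] D_distinct[OF D] ds by (auto simp: spider_def walk_def)
  show "set ds = spider_set (ds ! 2) [ds ! 0] [ds ! 1] (drop 3 ds)" using ds by auto
qed

definition flips :: "'a list \<Rightarrow> ('a \<Rightarrow> 'a) \<Rightarrow> bool" where
  "flips ds f \<longleftrightarrow> f (ds ! 0) = ds ! 1 \<and> f (ds ! 1) = ds ! 0 \<and> (\<forall>j. 2 \<le> j \<and> j < length ds \<longrightarrow> f (ds ! j) = ds ! j)"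

text \<open>Rank 4 is set apart because its diagram has three arms of equal length and hence further
  automorphisms.\<close>

lemma path_D_automorph:
  assumes D: "path_D ds" and c: "conn (set ds)" and n: "length ds \<noteq> 4" and f: "automorph (set ds) f"
  shows "(\<forall>s\<in>set ds. f s = s) \<or> flips ds f"
proof (cases "\<forall>s\<in>set ds. f s = s")
  case False
  note fs = spider_swap_unique[OF path_D_spider[OF D] c _ _ f]
  have *: "length [ds ! 0] = length [ds ! 1]" "length (drop 3 ds) \<noteq> length [ds ! 0]" "\<exists>s\<in>set ds. f s \<noteq> s"
    using n D_length[OF D] False by auto
  have "f (ds ! j) = ds ! j" if j: "2 \<le> j" "j < length ds" for j
  proof (cases "j = 2")
    case False
    then have "ds ! j = drop 3 ds ! (j - 3)" "j - 3 < length (drop 3 ds)" using j by auto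
    then show ?thesis using fs(4)[OF *] unfolding map_eq_self by (metis nth_mem)
  qed (use fs(1)[OF *] in simp)
  then show ?thesis using fs(2,3)[OF *] by (simp add: flips_def)
qed simp

lemma conj_in_par: "J \<subseteq> S \<Longrightarrow> simple_in J x \<Longrightarrow> img x ` J = J \<Longrightarrow> u \<in> par J \<Longrightarrow> cj x u \<in> par J"
  using simple_in_conj_par[of J J x u] by simp

context
  fixes ds :: "'a list"
  assumes D: "path_D ds"
begin

lemma realizesI:
  assumes g: "signed (length ds) g" and e: "\<And>i. 1 \<le> i \<Longrightarrow> i \<le> length ds \<Longrightarrow> act v (ev ds i) = eps ds (g (int i))"
  shows "realizes ds v g"
  unfolding realizes_def
proof
  fix k assume k: "k \<in> ints (length ds)"
  have *: "act v (eps ds (int i)) = eps ds (g (int i))" if "i \<le> length ds" for i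
    using e[of i] that g eps_nat[of i ds] by (cases "i = 0") (auto simp: act_simps)
  show "act v (eps ds k) = eps ds (g k)"
  proof (cases "k \<ge> 0")
    case False
    then show ?thesis using *[of "nat (- k)"] k eps_minus[of ds k] signed_minus[OF g, of k] eps_minus[of ds "g k"]
      by (auto simp: act_simps)
  qed (use *[of "nat k"] k in auto)
qed

text \<open>Interchanging the first two simple roots negates \<open>ev ds 1\<close>, which is their
  difference, and fixes all later \<open>ev ds i\<close>.\<close>

lemma realizes_flip:
  assumes x: "simple_in (set ds) x" and f: "flips ds (img x)"
  shows "realizes ds x flip1"
proof (rule realizesI)
  note n = D_length[OF D] D_not_Nil[OF D]
  show "signed (length ds) flip1" using flip1(1) n by simp
  have a: "act x (\<alpha> (ds ! j)) = \<alpha> (if j = 0 then ds ! 1 else if j = 1 then ds ! 0 else ds ! j)" if "j < length ds" for j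
    using act_img[OF D_sub[OF D] x, of "ds ! j"] f that by (auto simp: flips_def)
  fix i :: nat assume "1 \<le> i" "i \<le> length ds"
  then show "act x (ev ds i) = eps ds (flip1 (int i))"
  proof (induction i rule: dec_induct)
    case base
    show ?case using n a[of 0] a[of 1] by (simp add: negate_def eps_def ev_def act_simps)
  next
    case (step i)
    have 1: "ev ds 1 = \<alpha> (ds ! 0) - \<alpha> (ds ! 1)" "ev ds 2 = ev ds 1 + 2 *\<^sub>R \<alpha> (ds ! 1)"
      using ev_Suc[of 1 ds] by (simp_all add: ev_def numeral_2_eq_2)
    have 2: "flip1 (int (Suc i)) = int (Suc i)" using step.hyps by (simp add: negate_def)
    have 3: "act x (ev ds (Suc i)) = act x (ev ds i) + 2 *\<^sub>R act x (\<alpha> (ds ! i))"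
      using step.hyps by (simp add: ev_Suc act_simps)
    show ?case
    proof (cases "i = 1")
      case True
      have "eps ds (flip1 (int i)) = - ev ds 1" using True by (simp add: negate_def eps_def)
      then show ?thesis unfolding 2 3 using step True a[of i] 1 n eps_nat[of 2 ds]
        by (simp add: fun_eq_iff vec_apply numeral_2_eq_2[symmetric])
    next
      case False
      then have "flip1 (int i) = int i" using step.hyps by (simp add: negate_def)
      then show ?thesis unfolding 2 3 using step False a[of i] by (simp add: eps_nat ev_Suc del: of_nat_Suc)
    qed
  qed
qed

text \<open>Both elements lie in \<open>par (set ds)\<close> and realize the same signed
  permutation. The conjugating \<open>z\<close> may act as an element of W(B_n) outside
  W(D_n).\<close>

lemma realizes_conj_eq:
  assumes y: "y \<in> par (set ds)" and z: "z \<in> carrier W" and h: "realizes ds z h" "signed (length ds) h"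
    and c: "\<And>i. h (sperm ds y i) = sperm ds y (h i)" and p: "cj z y \<in> par (set ds)"
  shows "cj z y = y"
proof (rule realizes_inj[OF D])
  let ?g = "sperm ds y"
  have yc: "y \<in> carrier W" using par_in_W[OF D_sub[OF D] y] .
  have g: "realizes ds y ?g" "signed (length ds) ?g" using sperm[OF D y] by auto
  have "realizes ds (cj z y) ((h \<circ> ?g) \<circ> inv_into UNIV h)"
    using realizes_mult[OF D] realizes_inv[OF D h z] h g z yc signed_inv[OF h(2)] by simp
  moreover have "(h \<circ> ?g) \<circ> inv_into UNIV h = ?g"
    using permutes_inverses(1)[OF signed_permutes[OF h(2)]] c by (auto simp: fun_eq_iff)
  ultimately show "realizes ds (cj z y) ?g" by simp
qed (use sperm[OF D y] p y in auto)

text \<open>The sum of \<open>eps ds i\<close> over the orbit of \<open>k\<close> is fixed by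
  \<open>y\<close>. If \<open>- k\<close> were missing from the orbit, its product with
  \<open>eps ds k\<close> would be 2, and it would be a nonzero fixed vector.\<close>

lemma cuspidal_all_neg:
  assumes y: "cuspidal (set ds) y" and k: "k \<in> {1..int (length ds)}"
  shows "- k \<in> orb (sperm ds y) k"
proof (rule ccontr)
  let ?g = "sperm ds y" and ?n = "length ds"
  assume n: "- k \<notin> orb ?g k"
  have yp: "y \<in> par (set ds)" using y by (simp add: cuspidal_def)
  have g: "realizes ds y ?g" "signed ?n ?g" using sperm[OF D yp] by auto
  have sub: "orb ?g k \<subseteq> ints ?n" using orb_subset[OF g(2)] k by simp
  then have fin: "finite (orb ?g k)" by (rule finite_subset) simp
  define x where "x = (\<Sum>i\<in>orb ?g k. eps ds i)"
  have "act y x = (\<Sum>i\<in>orb ?g k. eps ds (?g i))"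
    unfolding x_def act_sum using g sub by (intro sum.cong) (auto simp: realizes_def)
  also have "\<dots> = (\<Sum>i\<in>?g ` orb ?g k. eps ds i)"
    using signed_inj[OF g(2)] by (subst sum.reindex) (auto simp: inj_on_def)
  also have "\<dots> = x" using orb_image[OF g(2)] by (simp add: x_def)
  finally have "act y x = x" .
  moreover have "x \<in> coord (set ds)" unfolding x_def using eps_coord[OF D] sub by (intro coord_sum) auto
  ultimately have "x = 0" using y by (simp add: cuspidal_def)
  moreover have "bform x (eps ds k) = (\<Sum>i\<in>orb ?g k. if i = k then 2 else 0)"
    unfolding x_def bform_sum_left
  proof (rule sum.cong[OF refl])
    fix i assume i: "i \<in> orb ?g k"
    then have "i \<noteq> 0" "i \<noteq> - k" using orb_0[OF g(2), of k] k n by auto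
    then show "bform (eps ds i) (eps ds k) = (if i = k then 2 else 0)" using bform_eps[OF D, of i k] i sub k by auto
  qed
  ultimately show False using self_in_orb[OF g(2), of k] fin by (simp add: sum.delta)
qed

definition odd_cycle :: "'a \<Rightarrow> bool" where
  "odd_cycle y \<longleftrightarrow> (\<exists>k\<in>{1..int (length ds)}. odd (card (orb (sperm ds y) k \<inter> {1..int (length ds)})))"

text \<open>Neither \<open>h\<close> nor \<open>flip1\<close> is in W(D_n), but their product is,
  hence it is realized by some \<open>v\<close>. Then \<open>v \<otimes> x\<close> acts on the
  component as \<open>h\<close>, which commutes with \<open>y\<close>.\<close>

lemma realizes_flip_lift:
  assumes y: "y \<in> par (set ds)" and h: "signed (length ds) h" "sign_prod (length ds) h = - 1"
    and c: "\<And>i. h (sperm ds y i) = sperm ds y (h i)"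
  obtains v where "v \<in> par (set ds)" "realizes ds v (h \<circ> flip1)"
    "\<And>x. simple_in (set ds) x \<Longrightarrow> img x ` set ds = set ds \<Longrightarrow> flips ds (img x) \<Longrightarrow> cj (v \<otimes> x) y = y"
proof -
  note S = D_sub[OF D]
  have n: "length ds \<ge> 1" using D_length[OF D] by simp
  have hf: "signed (length ds) (h \<circ> flip1)" "sign_prod (length ds) (h \<circ> flip1) = 1"
    using signed_comp[OF h(1) flip1(1)[OF n]] sign_prod_comp[OF h(1) flip1(1)[OF n]] flip1(2)[OF n] h(2) by auto
  obtain v where v: "v \<in> par (set ds)" "realizes ds v (h \<circ> flip1)" using exists_realizing[OF D hf] by blast
  have vc: "v \<in> carrier W" using par_in_W[OF S v(1)] .
  show thesis
  proof (rule that[OF v])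
    fix x assume x: "simple_in (set ds) x" "img x ` set ds = set ds" "flips ds (img x)"
    have xc: "x \<in> carrier W" using simple_in_carrier x(1) by blast
    have "realizes ds (v \<otimes> x) ((h \<circ> flip1) \<circ> flip1)"
      using realizes_mult[OF D v(2) realizes_flip[OF x(1,3)] flip1(1)[OF n] vc xc] .
    moreover have "(h \<circ> flip1) \<circ> flip1 = h" by (auto simp: fun_eq_iff)
    ultimately have r: "realizes ds (v \<otimes> x) h" by simp
    have "cj (v \<otimes> x) y = cj v (cj x y)"
      using vc xc par_in_W[OF S y] by (simp add: inv_mult_group m_assoc)
    also have "\<dots> \<in> par (set ds)"
      using par_mult par_inv[OF S] conj_in_par[OF S x(1,2) y] v(1) by blast
    finally show "cj (v \<otimes> x) y = y" using realizes_conj_eq[OF y _ r h(1) c] vc xc by blast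
  qed
qed

lemma cuspidal_orbit:
  assumes y: "cuspidal (set ds) y" and k: "k \<in> {1..int (length ds)}"
  defines "g \<equiv> sperm ds y"
  defines "C \<equiv> orb g k"
  shows "y \<in> par (set ds)" "signed (length ds) g" "C \<subseteq> ints (length ds)" "g ` C = C" "uminus ` C = C"
    "g i \<in> C \<longleftrightarrow> i \<in> C"
proof -
  show yp: "y \<in> par (set ds)" using y by (simp add: cuspidal_def)
  show g: "signed (length ds) g" using sperm[OF D yp] by (simp add: g_def)
  show "C \<subseteq> ints (length ds)" "g ` C = C" "uminus ` C = C"
    unfolding C_def using orb_subset[OF g, of k] orb_image[OF g] orb_neg[OF g] cuspidal_all_neg[OF y k] k by (auto simp: g_def)
  then show "g i \<in> C \<longleftrightarrow> i \<in> C" using signed_inj[OF g] by (metis imageE imageI)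
qed

lemma flip_conj:
  assumes y: "cuspidal (set ds) y" and x: "simple_in (set ds) x" "img x ` set ds = set ds" "flips ds (img x)"
  shows "\<exists>v\<in>par (set ds). cj (v \<otimes> x) y = y"
proof -
  let ?g = "sperm ds y" and ?n = "length ds"
  have n: "1 \<in> {1..int ?n}" using D_length[OF D] by simp
  define C where "C = orb ?g 1"
  \<comment> \<open>Restricting a permutation to one of its cycles gives something that commutes
    with it; for a negative cycle the sign product is -1 by \<open>neg_cycle_sgn\<close>.\<close>
  define c where "c = (\<lambda>i. if i \<in> C then ?g i else i)"
  note C = cuspidal_orbit[OF y n, folded C_def]
  have c: "signed ?n c" unfolding c_def by (rule signed_restrict[OF C(2-5)])
  have "sign_prod ?n c = (\<Prod>i\<in>C \<inter> {1..int ?n}. sgn (c i))" by (rule sign_prod_restrict[OF C(3)]) (simp add: c_def)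
  also have "\<dots> = (\<Prod>i\<in>C \<inter> {1..int ?n}. sgn (?g i))" by (rule prod.cong) (auto simp: c_def)
  also have "\<dots> = - 1" unfolding C_def using neg_cycle_sgn[OF C(2) n cuspidal_all_neg[OF y n]] .
  finally have cs: "sign_prod ?n c = - 1" .
  have "c (?g i) = ?g (c i)" for i using C(6)[of i] by (simp add: c_def)
  then show ?thesis by (rule realizes_flip_lift[OF C(1) c cs]) (use x in blast)
qed

text \<open>Negating a cycle of odd length has sign product -1. Being a sign change, it also
  commutes with \<open>flip1\<close>; so \<open>v\<close> is an involution commuting with
  \<open>x\<close>, as \<open>component_hom_sign\<close> requires.\<close>

lemma odd_cycle_involution:
  assumes y: "cuspidal (set ds) y" and odd: "odd_cycle y"
  obtains v where "v \<in> par (set ds)" "v \<otimes> v = \<one>"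
    "\<And>x. simple_in (set ds) x \<Longrightarrow> img x ` set ds = set ds \<Longrightarrow> flips ds (img x) \<Longrightarrow>
      x \<otimes> v \<otimes> inv x = v \<and> cj (v \<otimes> x) y = y"
proof -
  let ?g = "sperm ds y" and ?n = "length ds"
  note S = D_sub[OF D]
  have n: "?n \<ge> 1" using D_length[OF D] by simp
  obtain k where k: "k \<in> {1..int ?n}" "odd (card (orb ?g k \<inter> {1..int ?n}))" using odd by (auto simp: odd_cycle_def)
  define C where "C = orb ?g k"
  note C = cuspidal_orbit[OF y k(1), folded C_def]
  let ?t = "negate C"
  have m1: "uminus ` {1, - 1 :: int} = {1, - 1}" by auto
  have t: "signed ?n ?t" by (rule negate_signed[OF C(3,5)])
  have ts: "sign_prod ?n ?t = - 1" using negate_sign_prod[OF C(3)] k(2) by (simp add: C_def)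
  have "?t (?g i) = ?g (?t i)" for i using C(6)[of i] signed_minus[OF C(2)] by (simp add: negate_def)
  then obtain v where v: "v \<in> par (set ds)" "realizes ds v (?t \<circ> flip1)"
    "\<And>x. simple_in (set ds) x \<Longrightarrow> img x ` set ds = set ds \<Longrightarrow> flips ds (img x) \<Longrightarrow> cj (v \<otimes> x) y = y"
    using realizes_flip_lift[OF C(1) t ts] by metis
  have vc: "v \<in> carrier W" using par_in_W[OF S v(1)] .
  note tf = signed_comp[OF t flip1(1)[OF n]]
  have sv: "sperm ds v = ?t \<circ> flip1" using sperm_eqI[OF D v(2) tf v(1)] .
  have "(?t \<circ> flip1) \<circ> (?t \<circ> flip1) = id"
    using negate_commute[OF C(5) m1] negate_negate[OF C(5)] by (auto simp: fun_eq_iff)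
  then have "realizes ds (v \<otimes> v) id" using realizes_mult[OF D v(2) v(2) tf vc vc] by simp
  then have vv: "v \<otimes> v = \<one>" using realizes_inj[OF D _ realizes_one[OF D]] par_mult[OF v(1) v(1)] par_one by blast
  show thesis
  proof (rule that[OF v(1) vv])
    fix x assume x: "simple_in (set ds) x" "img x ` set ds = set ds" "flips ds (img x)"
    have xc: "x \<in> carrier W" using simple_in_carrier x(1) by blast
    have "flip1 (sperm ds v i) = sperm ds v (flip1 i)" for i
      unfolding sv using negate_commute[OF C(5) m1] by simp
    then have "cj x v = v"
      using realizes_conj_eq[OF v(1) xc realizes_flip[OF x(1,3)] flip1(1)[OF n]] conj_in_par[OF S x(1,2) v(1)] by blast
    then show "cj x v = v \<and> cj (v \<otimes> x) y = y" using v(3)[OF x] by simp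
  qed
qed

lemma act_negate:
  assumes v: "realizes ds v g" and g: "\<And>i. i \<in> {1..int (length ds)} \<Longrightarrow> g i = - i" and s: "s \<in> set ds"
  shows "act v (\<alpha> s) = - \<alpha> s"
proof -
  have ve: "act v (eps ds (int i)) = - eps ds (int i)" if "1 \<le> i" "i \<le> length ds" for i
    using v g[of "int i"] that eps_minus[of ds "int i"] by (auto simp: realizes_def)
  obtain j where j: "j < length ds" "s = ds ! j" using s by (auto simp: in_set_conv_nth)
  then show ?thesis using ve[of "Suc j"] ve[of j] ve[of 1] ve[of 2] D_length[OF D]
    unfolding j(2) D_root_eps[OF D j(1)] by (auto simp: act_simps add_ac scaleR_right_diff_distrib scaleR_add_right)
qed

end

end

text \<open>All cycles of \<open>g\<close> are negative and their number is even; with an odd cycle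
  and \<open>g\<close> different from -1, only the lengths 1 and 3 remain. The standard form is a
  Coxeter element with the three leaves of the diagram placed before the centre, which makes it
  invariant under triality.\<close>

lemma D4_conjugate:
  assumes g: "signed 4 g" "sign_prod 4 g = 1" and neg: "\<And>k. k \<in> {1..4} \<Longrightarrow> - k \<in> orb g k"
    and k: "k \<in> {1..4}" "odd (card (orb g k \<inter> {1..4}))" and nid: "i0 \<in> {1..4}" "g i0 \<noteq> - i0"
  obtains l where "signed 4 l" "sign_prod 4 l = 1" "\<And>i. l ((dgen 0 \<circ> dgen 1 \<circ> dgen 3 \<circ> dgen 2) i) = g (l i)"
proof -
  note inj = signed_inj[OF g(1)] and gm = signed_minus[OF g(1)]
  have abs4: "\<bar>g i\<bar> \<in> {1..4}" if "i \<in> {1..4}" for i using signed_abs[OF g(1), of i] that by simp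
  have nfix: "g i \<noteq> i" if "i \<in> {1..4}" for i
    using subsetD[OF orb_closed[of "{i}" g i] neg[OF that]] that by auto
  have "\<exists>p\<in>{1..4}. g p = - p"
  proof -
    define A where "A = orb g k \<inter> {1..4}"
    have sym: "- x \<in> orb g k" if "x \<in> orb g k" for x using orb_neg[OF g(1) neg[OF k(1)]] that by blast
    have A: "i \<in> A \<longleftrightarrow> \<bar>g i\<bar> \<in> A" if i: "i \<in> {1..4}" for i
    proof -
      have "i \<in> orb g k \<longleftrightarrow> g i \<in> orb g k"
        using orb_image[OF g(1), of k] inj by (metis imageE imageI)
      moreover have "g i \<in> orb g k \<longleftrightarrow> \<bar>g i\<bar> \<in> orb g k" using sym[of "g i"] sym[of "- g i"] by (cases "g i \<ge> 0") auto
      ultimately show ?thesis using i abs4[OF i] by (simp add: A_def)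
    qed
    have kA: "k \<in> A" using self_in_orb[OF g(1)] k by (simp add: A_def)
    have fA: "finite A" and A4: "A \<subseteq> {1..4}" by (auto simp: A_def)
    then have "card A \<le> 4" using card_mono[of "{1..4::int}" A] by simp
    then have "card A \<in> {0, 1, 2, 3, 4}" by auto
    \<comment> \<open>Either \<open>A\<close> or its complement is a single point, and that point is
      mapped to itself up to sign.\<close>
    then consider "card A = 1" | "card A = 3" using k(2) unfolding A_def[symmetric] by auto
    then obtain p where p: "p \<in> {1..4}" "\<bar>g p\<bar> = p"
    proof cases
      case 1
      then have "A = {k}" using kA by (metis card_1_singletonE singletonD)
      then show thesis using A[OF k(1)] kA that[OF k(1)] by simp
    next
      case 2
      then have "card ({1..4} - A) = 1" using card_Diff_subset[OF fA A4] by simp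
      then obtain p where p: "{1..4} - A = {p}" by (auto simp: card_1_singleton_iff)
      then have p4: "p \<in> {1..4}" by blast
      have "\<bar>g p\<bar> \<in> {1..4} - A" using A[OF p4] abs4[OF p4] p by blast
      then show thesis using that[OF p4] p by simp
    qed
    then show ?thesis using nfix[OF p(1)] by (intro bexI[of _ p]) auto
  qed
  then obtain p where p: "p \<in> {1..4}" "g p = - p" by blast
  define q r t where "q = i0" and "r = g q" and "t = g r"
  have q: "q \<in> {1..4}" "r \<noteq> - q" "r \<noteq> q" using nid nfix by (auto simp: q_def r_def)
  have pq: "p \<noteq> q" "p \<noteq> - q" using p q by (auto simp: r_def)
  have rp: "r \<noteq> p" "r \<noteq> - p" using inj[of q "- p"] inj[of q p] gm[of p] p pq by (auto simp: r_def)
  have r4: "\<bar>r\<bar> \<in> {1..4}" using abs4[OF q(1)] by (simp add: r_def)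
  have tp: "t \<noteq> p" "t \<noteq> - p" using inj[of r "- p"] inj[of r p] gm[of p] p rp by (auto simp: t_def)
  have tr: "t \<noteq> r" "t \<noteq> - r" using inj[of r q] inj[of r "- q"] gm[of q] q by (auto simp: t_def r_def)
  have t4: "\<bar>t\<bar> \<in> {1..4}" using abs4[OF r4] gm[of r] by (auto simp: t_def abs_if split: if_splits)
  have "t \<noteq> q"
  proof
    assume "t = q"
    then have "orb g q \<subseteq> {q, r}" by (intro orb_closed) (auto simp: t_def r_def)
    then show False using neg[OF q(1)] q by auto
  qed
  \<comment> \<open>If \<open>q\<close> and \<open>r\<close> formed a negative cycle of length 2,
    the fourth point would be negated as well, and three negative cycles have sign product
    -1.\<close>
  moreover have "t \<noteq> - q"
  proof
    assume tq: "t = - q"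
    have d: "p \<noteq> \<bar>r\<bar>" "q \<noteq> \<bar>r\<bar>" using rp q by linarith+
    then have "card {p, q, \<bar>r\<bar>} = 3" using pq by simp
    then have "card ({1..4} - {p, q, \<bar>r\<bar>}) = 1" using card_Diff_subset[of "{p, q, \<bar>r\<bar>}" "{1..4}"] p(1) q(1) r4 by simp
    then obtain s where s: "{1..4} - {p, q, \<bar>r\<bar>} = {s}" by (auto simp: card_1_singleton_iff)
    have "s \<in> {1..4} - {p, q, \<bar>r\<bar>}" unfolding s by (rule singletonI)
    then have s4: "s \<in> {1..4}" "s \<noteq> p" "s \<noteq> q" "s \<noteq> \<bar>r\<bar>" by simp_all
    have "\<bar>g s\<bar> \<noteq> p" using inj[of s p] inj[of s "- p"] gm[of p] p s4 by auto
    moreover have "\<bar>g s\<bar> \<noteq> \<bar>r\<bar>" using inj[of s q] inj[of s "- q"] gm[of q] q(1) s4 by (auto simp: r_def abs_if split: if_splits)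
    moreover have "\<bar>g s\<bar> \<noteq> q" using inj[of s r] inj[of s "- r"] gm[of r] tq s4 by (auto simp: t_def abs_if split: if_splits)
    ultimately have "\<bar>g s\<bar> \<in> {1..4} - {p, q, \<bar>r\<bar>}" using abs4[OF s4(1)] by simp
    then have "\<bar>g s\<bar> = s" unfolding s by (rule singletonD)
    then have gs: "g s = - s" using nfix[OF s4(1)] by linarith
    have "card {p, s, q, \<bar>r\<bar>} = 4" using d s4 pq by simp
    then have "{1..int 4} = {p, s, q, \<bar>r\<bar>}" using s4(1) p(1) q(1) r4 by (intro card_subset_eq[symmetric]) auto
    then have "sign_prod 4 g = sgn (g p) * (sgn (g s) * (sgn (g q) * sgn (g \<bar>r\<bar>)))"
      unfolding sign_prod_def using s4 pq d by simp
    also have "\<dots> = sgn r * sgn (g \<bar>r\<bar>)" using gs p s4 by (simp add: r_def)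
    also have "\<dots> = - 1" using gm[of r] tq q(1) r4 by (cases "r > 0") (auto simp: t_def)
    finally show False using g(2) by simp
  qed
  ultimately have tq: "t \<noteq> q" "t \<noteq> - q" by auto
  have dist: "p \<noteq> \<bar>r\<bar>" "q \<noteq> \<bar>r\<bar>" "p \<noteq> \<bar>t\<bar>" "q \<noteq> \<bar>t\<bar>" "\<bar>r\<bar> \<noteq> \<bar>t\<bar>" "\<bar>p\<bar> = p" "\<bar>q\<bar> = q"
    using rp q tp tq tr p by (auto simp: abs_if)
  have c4: "card {p, q, \<bar>r\<bar>, \<bar>t\<bar>} = 4" using pq dist by simp
  have gt: "g t = - q"
  proof -
    from c4 have all: "{p, q, \<bar>r\<bar>, \<bar>t\<bar>} = {1..4}" using p(1) q(1) r4 t4 by (intro card_subset_eq) auto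
    have "\<bar>g t\<bar> \<in> {1..4}" using abs4[OF t4] gm[of t] by (auto simp: abs_if split: if_splits)
    moreover have "\<bar>g t\<bar> \<noteq> p" using inj[of t p] inj[of t "- p"] gm[of p] p tp by auto
    moreover have "\<bar>g t\<bar> \<noteq> \<bar>r\<bar>" using inj[of t q] inj[of t "- q"] gm[of q] tq by (auto simp: r_def abs_if split: if_splits)
    moreover have "\<bar>g t\<bar> \<noteq> \<bar>t\<bar>" using inj[of t r] inj[of t "- r"] gm[of r] tr by (auto simp: t_def abs_if split: if_splits)
    ultimately have "\<bar>g t\<bar> = q" using all by blast
    moreover have "g t \<noteq> q"
    proof
      assume "g t = q"
      then have "orb g q \<subseteq> {q, r, t}" by (intro orb_closed) (auto simp: t_def r_def)
      then show False using neg[OF q(1)] q tq by auto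
    qed
    ultimately show ?thesis by linarith
  qed
  \<comment> \<open>\<open>l\<close> matches the cycles: the standard form maps 1 to -1, 2 to 4, 4
    to 3 and 3 to -2.\<close>
  define f where "f i = (if i = 1 then p else if i = 2 then q else if i = 4 then r else t)" for i :: int
  define l where "l = (\<lambda>i. if i \<in> ints 4 then sgn i * f \<bar>i\<bar> else i)"
  let ?c = "dgen 0 \<circ> dgen 1 \<circ> dgen 3 \<circ> dgen 2"
  have c: "?c i = (if i = 1 then - 1 else if i = - 1 then 1 else if i = 2 then 4 else if i = 4 then 3 else if i = 3 then - 2
      else if i = - 2 then - 4 else if i = - 4 then - 3 else if i = - 3 then 2 else i)" for i
  proof -
    consider "i = 1" | "i = - 1" | "i = 2" | "i = - 2" | "i = 3" | "i = - 3" | "i = 4" | "i = - 4"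
      | "i \<notin> {1, - 1, 2, - 2, 3, - 3, 4, - 4}" by blast
    then show ?thesis by cases (simp_all add: dgen_0 dgen_pos)
  qed
  have set4: "{1..int 4} = {1, 2, 3, 4}" by auto
  have l: "signed 4 l" unfolding l_def
  proof (rule signed_extend)
    have "(\<lambda>i. \<bar>f i\<bar>) ` {1..int 4} = {\<bar>p\<bar>, \<bar>q\<bar>, \<bar>r\<bar>, \<bar>t\<bar>}"
      unfolding set4 f_def by (simp add: insert_commute)
    then show "inj_on (\<lambda>i. \<bar>f i\<bar>) {1..int 4}" using c4 unfolding dist(6,7) by (intro eq_card_imp_inj_on) simp_all
    show "f i \<noteq> 0 \<and> \<bar>f i\<bar> \<le> int 4" if "i \<in> {1..int 4}" for i using p(1) q(1) r4 t4 by (auto simp: f_def)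
  qed
  have lc: "l (?c i) = g (l i)" for i
  proof (cases "i \<in> {- 4..4}")
    case True
    have vals: "l 1 = p" "l 2 = q" "l 4 = r" "l 3 = t" by (simp_all add: l_def f_def)
    have "i \<in> {- 4, - 3, - 2, - 1, 0, 1, 2, 3, 4}" using True by auto
    then show ?thesis unfolding c
      using vals signed_minus[OF l, of 1] signed_minus[OF l, of 2] signed_minus[OF l, of 3] signed_minus[OF l, of 4]
        gm[of p] gm[of q] gm[of r] gm[of t] p(2) gt l g(1) by (auto simp: r_def[symmetric] t_def[symmetric])
  next
    case False
    then have "?c i = i" unfolding c by auto
    then show ?thesis using False permutes_not_in[OF signed_permutes[OF g(1)], of i] by (auto simp: l_def)
  qed
  have cf: "?c (flip1 i) = flip1 (?c i)" for i unfolding c by (auto simp: negate_def)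
  have "sign_prod 4 l = 1 \<or> sign_prod 4 l = - 1" using sign_prod_cases[OF l] by (simp add: minus_one_power_iff)
  then show thesis
  proof
    \<comment> \<open>\<open>flip1\<close> negates the point that forms the short cycle of the
      standard form, so it commutes with that form and repairs the sign of \<open>l\<close>.\<close>
    assume m: "sign_prod 4 l = - 1"
    show thesis
    proof (rule that)
      show "signed 4 (l \<circ> flip1)" "sign_prod 4 (l \<circ> flip1) = 1"
        using m signed_comp[OF l flip1(1)] sign_prod_comp[OF l flip1(1)] flip1(2)[of 4] by auto
      show "(l \<circ> flip1) (?c i) = g ((l \<circ> flip1) i)" for i using lc[of "flip1 i"] cf[of i] by simp
    qed
  qed (use that l lc in blast)
qed

context finite_coxeter
begin

text \<open>Triality can make the action on this component larger than a sign, so one involution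
  cannot correct all elements. Instead \<open>y\<close> is conjugated to an element fixed by every
  diagram automorphism: either -1 or the product of the three commuting leaves followed by the
  centre.\<close>

lemma D4_special:
  assumes D: "path_D ds" and n: "length ds = 4" and c: "conn (set ds)" and y: "cuspidal (set ds) y" and odd: "odd_cycle ds y"
  obtains u where "u \<in> par (set ds)"
    "\<And>x. simple_in (set ds) x \<Longrightarrow> img x ` set ds = set ds \<Longrightarrow> cj x (inv u \<otimes> y \<otimes> u) = inv u \<otimes> y \<otimes> u"
proof (cases "\<forall>i\<in>{1..4}. sperm ds y i = - i")
  case True
  note S = D_sub[OF D]
  have yp: "y \<in> par (set ds)" using y by (simp add: cuspidal_def)
  have yc: "y \<in> carrier W" using par_in_W[OF S yp] .
  have g: "realizes ds y (sperm ds y)" "signed (length ds) (sperm ds y)" using sperm[OF D yp] by auto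
  have ya: "act y (\<alpha> s) = - \<alpha> s" if "s \<in> set ds" for s
    using act_negate[OF D g(1) _ that] True n by simp
  have yz: "act y z = - z" if "z \<in> coord (set ds)" for z
  proof -
    have z: "z = (\<Sum>s\<in>set ds. z s *\<^sub>R \<alpha> s)" using coord_expand[OF _ that] by simp
    have "act y z = (\<Sum>s\<in>set ds. z s *\<^sub>R (- \<alpha> s))" by (subst z) (simp add: act_simps ya)
    also have "\<dots> = - z" by (subst (2) z) (simp add: sum_negf)
    finally show ?thesis .
  qed
  show thesis
  proof (rule that)
    fix x assume x: "simple_in (set ds) x" "img x ` set ds = set ds"
    have xc: "x \<in> carrier W" using simple_in_carrier x(1) by blast
    have "cj x y = y"
    proof (rule par_eqI[OF S conj_in_par[OF S x yp] yp])
      fix s assume s: "s \<in> set ds"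
      then obtain z where z: "z \<in> coord (set ds)" "\<alpha> s = act x z"
        using coord_img[OF S x(1) order_refl, of "\<alpha> s"] x(2) coord_unit by metis
      then show "act (cj x y) (\<alpha> s) = act y (\<alpha> s)" using act_conj[OF xc yc, of z] yz[OF z(1)] ya[OF s] by (simp add: act_simps)
    qed
    then show "cj x (inv \<one> \<otimes> y \<otimes> \<one>) = inv \<one> \<otimes> y \<otimes> \<one>" using yc by simp
  qed simp
next
  case False
  note S = D_sub[OF D]
  let ?g = "sperm ds y"
  have yp: "y \<in> par (set ds)" using y by (simp add: cuspidal_def)
  have yc: "y \<in> carrier W" using par_in_W[OF S yp] .
  have g: "realizes ds y ?g" "signed 4 ?g" using sperm[OF D yp] n by auto
  have g1: "sign_prod 4 ?g = 1" using par_realizes[OF D yp] sperm_eqI[OF D _ _ yp] n by metis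
  have neg: "- k \<in> orb ?g k" if "k \<in> {1..4}" for k using cuspidal_all_neg[OF D y] that n by simp
  obtain k where k: "k \<in> {1..4}" "odd (card (orb ?g k \<inter> {1..4}))" using odd n unfolding odd_cycle_def[OF D] by auto
  obtain i0 where i0: "i0 \<in> {1..4}" "?g i0 \<noteq> - i0" using False by blast
  let ?h = "dgen 0 \<circ> dgen 1 \<circ> dgen 3 \<circ> dgen 2"
  obtain l where l: "signed 4 l" "sign_prod 4 l = 1" "\<And>i. l (?h i) = ?g (l i)"
    using D4_conjugate[OF g(2) g1 neg k i0] by metis
  obtain u where u: "u \<in> par (set ds)" "realizes ds u l" using exists_realizing[OF D] l n by auto
  have uc: "u \<in> carrier W" using par_in_W[OF S u(1)] .
  obtain a b d e where ds: "ds = [a, b, d, e]" using n by (auto simp: eval_nat_numeral length_Suc_conv)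
  have in_S: "a \<in> S" "b \<in> S" "d \<in> S" "e \<in> S" using S ds by auto
  define z where "z = ((a \<otimes> b) \<otimes> e) \<otimes> d"
  have zc: "z \<in> carrier W" using in_S by (simp add: z_def)
  have zp: "z \<in> par (set ds)" unfolding z_def ds by (intro par_mult par_gen) auto
  have dg: "signed (length ds) (dgen j)" if "j < 4" for j using dgen_signed[of j 4] that n by simp
  have gen: "realizes ds a (dgen 0)" "realizes ds b (dgen 1)" "realizes ds d (dgen 2)" "realizes ds e (dgen 3)"
    using realizes_gen[OF D, of 0] realizes_gen[OF D, of 1] realizes_gen[OF D, of 2] realizes_gen[OF D, of 3] ds
    by (simp_all add: numeral_2_eq_2 numeral_3_eq_3)
  have "realizes ds z (((dgen 0 \<circ> dgen 1) \<circ> dgen 3) \<circ> dgen 2)"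
    unfolding z_def by (intro realizes_mult[OF D] gen dg signed_comp) (use in_S in auto)
  then have z: "realizes ds z ?h" by simp
  have hs: "signed 4 ?h" using dg n by (intro signed_comp) auto
  have "realizes ds (cj u z) ((l \<circ> ?h) \<circ> inv_into UNIV l)"
    using realizes_mult[OF D] realizes_inv[OF D u(2)] u uc zc z l hs n signed_inv[OF l(1)] by simp
  moreover have "(l \<circ> ?h) \<circ> inv_into UNIV l = ?g"
    using permutes_inverses(1)[OF signed_permutes[OF l(1)]] l(3) by (auto simp: fun_eq_iff)
  ultimately have "cj u z = y"
    using realizes_inj[OF D _ g(1) _ yp] par_mult par_inv[OF S] u(1) zp by metis
  then have uy: "inv u \<otimes> y \<otimes> u = z" using uc zc yc by (auto simp: m_assoc)
  show thesis
  proof (rule that[OF u(1)], unfold uy)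
    fix x assume x: "simple_in (set ds) x" "img x ` set ds = set ds"
    have xc: "x \<in> carrier W" using simple_in_carrier x(1) by blast
    have aut: "automorph (set ds) (img x)"
      unfolding automorph_def using x(2) img_inj[OF S xc] img_m[OF S x(1)] by auto
    have xd: "img x d = d" using spider_automorph(1)[OF path_D_spider[OF D] c aut] ds by (simp add: numeral_2_eq_2)
    have dist: "distinct [a, b, d, e]" using D_distinct[OF D] ds by simp
    have inj: "inj_on (img x) (set ds)" using img_inj[OF S xc] .
    have "img x ` (set ds - {d}) = set ds - {d}"
      using inj_on_image_set_diff[OF inj, of "set ds" "{d}"] x(2) xd ds by simp
    moreover have "set ds - {d} = {a, b, e}" using dist ds by auto
    ultimately have im: "img x ` {a, b, e} = {a, b, e}" by simp
    have comm: "s \<otimes> t = t \<otimes> s" if "s \<in> {a, b, e}" "t \<in> {a, b, e}" for s t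
    proof (cases "s = t")
      case False
      have "m a b = 2" "m a e = 2" "m b e = 2" "m b a = 2" "m e a = 2" "m e b = 2"
        using D_m[OF D, of 0 1] D_m[OF D, of 0 3] D_m[OF D, of 1 3] D_m[OF D, of 1 0] D_m[OF D, of 3 0] D_m[OF D, of 3 1] ds
        by (simp_all add: D_edge_def numeral_3_eq_3)
      then have "m s t = 2" using that False by blast
      then show ?thesis using commute_gen that in_S by blast
    qed simp
    let ?i = "img x"
    have i0: "?i s \<in> {a, b, e}" if "s \<in> {a, b, e}" for s using imageI[OF that, of "img x"] unfolding im .
    have i: "?i a \<in> {a, b, e}" "?i b \<in> {a, b, e}" "?i e \<in> {a, b, e}" by (intro i0; simp)+
    have ine: "?i a \<noteq> ?i b" "?i a \<noteq> ?i e" "?i b \<noteq> ?i e"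
      using inj_on_eq_iff[OF inj, of a b] inj_on_eq_iff[OF inj, of a e] inj_on_eq_iff[OF inj, of b e] dist ds by simp_all
    have "cj x z = ((?i a \<otimes> ?i b) \<otimes> ?i e) \<otimes> ?i d"
      unfolding z_def img_def using in_S xc by (simp add: conj_word)
    also have "(?i a \<otimes> ?i b) \<otimes> ?i e = (a \<otimes> b) \<otimes> e"
    proof -
      have 1: "a \<otimes> b = b \<otimes> a" "a \<otimes> e = e \<otimes> a" "b \<otimes> e = e \<otimes> b" using comm by auto
      have 2: "b \<otimes> a \<otimes> e = a \<otimes> b \<otimes> e" "a \<otimes> e \<otimes> b = a \<otimes> b \<otimes> e" "e \<otimes> a \<otimes> b = a \<otimes> b \<otimes> e"
        "b \<otimes> e \<otimes> a = a \<otimes> b \<otimes> e" "e \<otimes> b \<otimes> a = a \<otimes> b \<otimes> e"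
        using 1 in_S m_assoc S_carrier by metis+
      show ?thesis using i ine dist 2 by (elim insertE emptyE) simp_all
    qed
    finally show "cj x z = z" by (simp add: z_def xd)
  qed
qed

end

text \<open>The points above \<open>k\<close> form one positive cycle of odd length
  \<open>n - k\<close>, namely \<open>C0\<close> with its negative. They contribute +1 to the sign
  product, so the number of negative cycles below is even.\<close>

lemma cycle_type_eq:
  assumes g: "signed n g" "sign_prod n g = 1" and k: "1 \<le> k" "k < n"
    and big: "\<And>i. i \<in> {int k + 1..int n} \<Longrightarrow> orb g i = {int k + 1..int n}"
    and small: "\<And>i. i \<in> {1..int k} \<Longrightarrow> - i \<in> orb g i \<and> orb g i \<subseteq> {- int k..int k}"
    and ev: "\<And>i. i \<in> {1..int k} \<Longrightarrow> even (card (orb g i \<inter> {1..int n}))" and odd: "odd n" "even k"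
  shows "double_partition n (cycle_type n g)" "noncompliant_double_partition (cycle_type n g)"
proof -
  define N where "N = orb g ` {1..int k}"
  define C0 where "C0 = {int k + 1..int n}"
  define f where "f C = card C div 2" for C :: "int set"
  have C0: "int n \<in> C0" "uminus ` C0 \<noteq> C0" "finite C0" "card C0 = n - k"
  proof -
    show c: "int n \<in> C0" using k by (simp add: C0_def)
    have "- int n \<notin> C0" by (simp add: C0_def)
    then show "uminus ` C0 \<noteq> C0" using imageI[OF c, of uminus] by metis
  qed (use k in \<open>simp_all add: C0_def\<close>)
  have sym: "uminus ` C = C" if C: "C \<in> N" for C
  proof -
    from C obtain i where "i \<in> {1..int k}" "C = orb g i" unfolding N_def by blast
    then show ?thesis using orb_neg[OF g(1), of i] small[of i] by simp
  qed
  have so: "signed_orbits n g = N \<union> {C0, uminus ` C0}"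
  proof (intro equalityI subsetI)
    fix C assume "C \<in> signed_orbits n g"
    then obtain i where i: "i \<in> ints n - {0}" "C = orb g i" unfolding signed_orbits_def by blast
    consider "i \<in> {1..int k}" | "- i \<in> {1..int k}" | "i \<in> C0" | "- i \<in> C0" using i(1) unfolding C0_def by force
    then show "C \<in> N \<union> {C0, uminus ` C0}"
    proof cases
      case 2
      then have "C = orb g (- i)" using i(2) orb_eq[OF g(1), of i "- i"] small[of "- i"] by simp
      then show ?thesis using 2 by (simp add: N_def)
    next
      case 4
      then show ?thesis using i(2) orb_minus[OF g(1), of "- i"] big[of "- i"] by (simp add: C0_def)
    qed (use i(2) big[of i] in \<open>auto simp: N_def C0_def\<close>)
  next
    fix C assume "C \<in> N \<union> {C0, uminus ` C0}"
    then consider "C \<in> N" | "C = orb g (int n)" | "C = orb g (- int n)"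
      using big[of "int n"] orb_minus[OF g(1), of "int n"] k by (auto simp: C0_def)
    then show "C \<in> signed_orbits n g" unfolding signed_orbits_def using k by cases (auto simp: N_def)
  qed
  have mm: "uminus ` uminus ` C0 = C0" by (simp add: image_image)
  have pos: "positive_cycles n g = {{C0, uminus ` C0}}"
  proof -
    have "positive_cycles n g = {{C, uminus ` C} | C. C \<in> {C0, uminus ` C0}}"
      unfolding positive_cycles_def so using sym C0(2) mm by (intro Collect_cong) (metis Un_iff insertE insertI1 singletonD singletonI insertI2)
    also have "\<dots> = {{C0, uminus ` C0}}" using mm by (auto simp: insert_commute)
    finally show ?thesis .
  qed
  have negc: "negative_cycles n g = N"
    unfolding negative_cycles_def so using sym C0(2) mm by auto
  have disj: "C0 \<inter> uminus ` C0 = {}" by (auto simp: C0_def)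
  have cardC: "card (C0 \<union> uminus ` C0) div 2 = n - k"
  proof -
    have "card (uminus ` C0) = card C0" by (intro card_image) (simp add: inj_on_def)
    then have "card (C0 \<union> uminus ` C0) = 2 * (n - k)"
      using C0(3,4) disj card_Un_disjoint[of C0 "uminus ` C0"] by (simp add: mult_2)
    then show ?thesis by (simp only: div_mult_self1_is_m zero_less_numeral)
  qed
  have fin: "finite N" by (simp add: N_def)
  have half: "f C = card (C \<inter> {1..int n})" "even (f C)" "f C > 0" if C: "C \<in> N" for C
  proof -
    obtain i where i: "i \<in> {1..int k}" "C = orb g i" using C unfolding N_def by blast
    then show 1: "f C = card (C \<inter> {1..int n})" using neg_cycle_card[OF g(1), of i] small[of i] k by (simp add: f_def)
    then show "even (f C)" using ev[OF i(1)] i(2) by simp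
    have "i \<in> C \<inter> {1..int n}" using self_in_orb[OF g(1), of i] i k by auto
    then show "f C > 0" unfolding 1 by (auto simp: card_gt_0_iff)
  qed
  have "even (card N)" unfolding N_def
  proof (rule all_neg_even_cycles[OF g(1)])
    show "- i \<in> orb g i \<and> orb g i \<inter> {1..int n} \<subseteq> {1..int k}" if "i \<in> {1..int k}" for i using small[OF that] by auto
    have "(\<Prod>i\<in>{1..int k}. sgn (g i)) = sign_prod n g"
      unfolding sign_prod_def
    proof (rule prod.mono_neutral_left)
      show "\<forall>i\<in>{1..int n} - {1..int k}. sgn (g i) = 1"
      proof
        fix i assume "i \<in> {1..int n} - {1..int k}"
        then have i: "i \<in> {int k + 1..int n}" by auto
        then have "g i \<in> {int k + 1..int n}" using orb_image[OF g(1), of i] big[OF i] by blast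
        then show "sgn (g i) = 1" by (simp add: sgn_if)
      qed
    qed (use k in auto)
    then show "(\<Prod>i\<in>{1..int k}. sgn (g i)) = 1" using g(2) by simp
  qed (use k in simp)
  moreover have "N \<noteq> {}" using k by (simp add: N_def)
  moreover have snd: "snd (cycle_type n g) = image_mset f (mset_set N)"
    by (simp add: cycle_type_def negc f_def[abs_def])
  moreover have fst: "fst (cycle_type n g) = {#n - k#}" by (simp add: cycle_type_def pos cardC)
  moreover have "odd (n - k)" using odd k by simp
  moreover have "mset_set N \<noteq> {#}" using \<open>N \<noteq> {}\<close> fin by (simp add: mset_set_empty_iff)
  ultimately show "noncompliant_double_partition (cycle_type n g)"
    unfolding noncompliant_double_partition_def snd fst using half(2) fin by auto
  have "(\<Sum>C\<in>N. f C) = (\<Sum>C\<in>N. card (C \<inter> {1..int n}))" using half(1) by simp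
  also have "\<dots> = card (\<Union>C\<in>N. C \<inter> {1..int n})"
  proof (rule card_UN_disjoint[symmetric])
    show "\<forall>C\<in>N. \<forall>D\<in>N. C \<noteq> D \<longrightarrow> (C \<inter> {1..int n}) \<inter> (D \<inter> {1..int n}) = {}"
      unfolding N_def using orb_eq[OF g(1)] by blast
  qed (use fin in auto)
  also have "(\<Union>C\<in>N. C \<inter> {1..int n}) = {1..int k}"
    unfolding N_def using self_in_orb[OF g(1)] small k by fastforce
  finally have "sum_mset (image_mset f (mset_set N)) = k" by (simp add: sum_unfold_sum_mset)
  moreover have "0 \<notin># image_mset f (mset_set N)" using half(3) fin by (metis elem_mset_set imageE less_irrefl set_image_mset)
  ultimately show "double_partition n (cycle_type n g)" unfolding double_partition_def snd fst using k by simp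
qed

section \<open>Recognizing non-compliant classes\<close>

context finite_coxeter
begin

lemma path_D_take:
  assumes D: "path_D ds" and k: "4 \<le> k" "k \<le> length ds"
  shows "path_D (take k ds)"
  using assms set_take_subset[of k ds] by (auto simp: path_D_def)

lemma eps_take:
  assumes "2 \<le> k" "\<bar>i\<bar> \<le> int k" shows "eps (take k ds) i = eps ds i"
proof -
  have "ev (take k ds) j = ev ds j" if "j \<le> k" for j
    using that assms(1) by (auto simp: ev_def)
  then show ?thesis using assms(2) by (auto simp: eps_def)
qed

lemma ev_apply:
  assumes D: "path_D ds" and k: "2 \<le> k" "k < length ds" and i: "1 \<le> i" "i \<le> length ds"
  shows "ev ds i (ds ! k) = (if k < i then 2 else 0)"
  using i
proof (induction i rule: dec_induct)
  case base
  have "ds ! 0 \<noteq> ds ! k" "ds ! 1 \<noteq> ds ! k" using D_nth_eq[OF D, of 0 k] D_nth_eq[OF D, of 1 k] k D_not_Nil[OF D] by auto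
  then show ?case using k by (simp add: ev_def vec_apply unit_vec_def)
next
  case (step i)
  have "\<alpha> (ds ! i) (ds ! k) = (if i = k then 1 else 0)"
    using D_nth_eq[OF D, of i k] k step by (auto simp: unit_vec_def)
  then show ?case using step by (simp add: ev_Suc vec_apply)
qed

text \<open>Removing \<open>ds ! k\<close> from the odd type D diagram leaves type D on the first
  \<open>k\<close> vertices and a possibly empty type A part beyond. On the first part all cycles of
  \<open>w\<close> are negative by cuspidality and of even length by assumption. The indices above
  \<open>k\<close> are permuted without sign changes, and in a single cycle, again by
  cuspidality.\<close>

theorem noncompliantI:
  assumes D: "path_D ds" and n: "odd (length ds)" and k: "even k" "4 \<le> k" "k < length ds"
    and J: "insert (ds ! k) J \<subseteq> S" "ds ! k \<notin> J" and L: "comp (insert (ds ! k) J) (set ds)" and K: "comp J (set (take k ds))"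
    and w: "cuspidal J w" and ev: "\<not> odd_cycle (take k ds) (proj (set (take k ds)) w)"
  shows "noncompliant_class W S (conjugacy_class W w)"
proof -
  let ?n = "length ds" and ?M = "insert (ds ! k) J" and ?L = "set ds" and ?K = "set (take k ds)" and ?ds = "take k ds"
  define a y g g' where "a = proj ?L w" and "y = proj ?K w" and "g = sperm ds a" and "g' = sperm ?ds y"
  have JS: "J \<subseteq> S" using J by blast
  have wJ: "w \<in> par J" using w by (simp add: cuspidal_def)
  have wM: "w \<in> par ?M" using par_mono[OF _ wJ] by blast
  have wc: "w \<in> carrier W" using par_in_W[OF JS wJ] .
  have D': "path_D ?ds" using path_D_take[OF D] k by simp
  have k': "length ?ds = k" using k by simp
  have a: "a \<in> par ?L" "\<And>x. x \<in> coord ?L \<Longrightarrow> act a x = act w x"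
    using proj_par[OF J(1) L wM] act_proj[OF J(1) L wM] by (auto simp: a_def)
  have y: "y \<in> par ?K" "\<And>x. x \<in> coord ?K \<Longrightarrow> act y x = act w x" "cuspidal ?K y"
    using proj_par[OF JS K wJ] act_proj[OF JS K wJ] cuspidal_proj[OF JS K w] by (auto simp: y_def)
  have g: "realizes ds a g" "signed ?n g" using sperm[OF D a(1)] by (auto simp: g_def)
  have g1: "sign_prod ?n g = 1" using par_realizes[OF D a(1)] sperm_eqI[OF D _ _ a(1)] unfolding g_def by metis
  have g': "realizes ?ds y g'" "signed k g'" using sperm[OF D' y(1)] k' by (auto simp: g'_def)
  have gg': "g i = g' i" if i: "i \<in> {- int k..int k}" for i
  proof -
    have i': "i \<in> ints ?n" "\<bar>i\<bar> \<le> int k" using i k by auto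
    have e: "eps ds i = eps ?ds i" using eps_take[of k i ds] i' k by simp
    have c: "eps ds i \<in> coord ?K" using eps_coord[OF D', of i] i k' e by simp
    have "g' i \<in> {- int k..int k}" using signed_range[OF g'(2)] i by blast
    then have r: "\<bar>g' i\<bar> \<le> int k" "g' i \<in> ints ?n" using k by auto
    have "eps ds (g i) = act w (eps ds i)" using g(1) a(2)[OF eps_coord[OF D i'(1)]] i'(1) by (simp add: realizes_def)
    also have "\<dots> = eps ?ds (g' i)" using g'(1) y(2)[OF c] i k' unfolding e by (simp add: realizes_def)
    also have "\<dots> = eps ds (g' i)" using eps_take[OF _ r(1), of ds] k by simp
    finally show ?thesis using eps_inj[OF D _ r(2)] signed_range[OF g(2), of i] i'(1) by blast
  qed
  have coordk: "eps ds i (ds ! k) = (if i > int k then 2 else if - i > int k then - 2 else 0)" if "i \<in> ints ?n" for i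
    using ev_apply[OF D _ k(3), of "nat i"] ev_apply[OF D _ k(3), of "nat (- i)"] that k by (auto simp: eps_def vec_apply)
  \<comment> \<open>\<open>par J\<close> does not change the coordinate at \<open>ds ! k\<close>,
    and this coordinate of \<open>eps ds i\<close> is 2 for indices above \<open>k\<close>, -2 for
    those below \<open>- k\<close> and 0 otherwise.\<close>
  have gbig: "g i \<in> {int k + 1..int ?n}" if i: "i \<in> {int k + 1..int ?n}" for i
  proof -
    have i': "i \<in> ints ?n" using i by simp
    then have gi: "g i \<in> ints ?n" using signed_range[OF g(2)] by blast
    have "eps ds (g i) = act w (eps ds i)" using g(1) a(2)[OF eps_coord[OF D i']] i' by (simp add: realizes_def)
    moreover have "(act w (eps ds i) - eps ds i) (ds ! k) = 0"
      using act_diff_coord[OF JS wJ, of "eps ds i"] J(2) by (simp add: coord_def)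
    ultimately have "eps ds (g i) (ds ! k) = 2" using coordk[OF i'] i by (simp add: vec_apply)
    then show ?thesis using coordk[OF gi] gi by (auto split: if_splits)
  qed
  have trans: "orb g i = {int k + 1..int ?n}" if i: "i \<in> {int k + 1..int ?n}" for i
  proof (rule ccontr)
    let ?I = "{int k + 1..int ?n}"
    define Q where "Q = orb g i"
    assume ne: "orb g i \<noteq> ?I"
    have sub: "Q \<subseteq> ?I" unfolding Q_def using orb_closed[of ?I g i] gbig i by blast
    then have fin: "finite Q" and card: "card Q < card ?I" using ne psubset_card_mono[of ?I Q] finite_subset[OF sub] by (auto simp: Q_def psubset_eq)
    \<comment> \<open>With this constant the coordinate at \<open>ds ! k\<close> cancels, so the
      difference of two fixed sums lies in \<open>coord J\<close>. A proper orbit would make it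
      nonzero, against cuspidality.\<close>
    define c where "c = real (card Q) / real (card ?I)"
    have nI: "real (card ?I) > 0" unfolding of_nat_0_less_iff using card by (rule le_less_trans[OF le0])
    have c1: "c < 1" unfolding c_def divide_less_eq_1_pos[OF nI] of_nat_less_iff by (rule card)
    have range: "j \<in> ints ?n" if "j \<in> ?I" for j using that by simp
    define x where "x = (\<Sum>j\<in>Q. eps ds j) - c *\<^sub>R (\<Sum>j\<in>?I. eps ds j)"
    have inj: "inj_on g A" for A using signed_inj[OF g(2)] by (simp add: inj_on_def)
    have fixed: "act a (\<Sum>j\<in>A. eps ds j) = (\<Sum>j\<in>A. eps ds j)" if A: "A \<subseteq> ?I" "g ` A = A" for A
    proof -
      have "act a (\<Sum>j\<in>A. eps ds j) = (\<Sum>j\<in>A. eps ds (g j))"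
        unfolding act_sum using g(1) A range by (intro sum.cong) (auto simp: realizes_def)
      also have "\<dots> = (\<Sum>j\<in>g ` A. eps ds j)" using inj by (simp add: sum.reindex)
      finally show ?thesis using A by simp
    qed
    have gO: "g ` Q = Q" unfolding Q_def by (rule orb_image[OF g(2)])
    have gI: "g ` ?I = ?I" using gbig inj by (intro endo_inj_surj) auto
    have xL: "x \<in> coord ?L" unfolding x_def using sub range eps_coord[OF D]
      by (intro coord_diff coord_scale coord_sum) (blast)+
    have "act a x = x" unfolding x_def using fixed[OF sub gO] fixed[OF order_refl gI] by (simp add: act_simps)
    then have wx: "act w x = x" using a(2)[OF xL] by simp
    have "x (ds ! k) = (\<Sum>j\<in>Q. 2) - c * (\<Sum>j\<in>?I. 2)"
      unfolding x_def vec_apply sum_fun_apply using sub coordk range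
      by (intro arg_cong2[of _ _ _ _ "(-)"] arg_cong2[of _ _ _ _ "(*)"] sum.cong) auto
    also have "\<dots> = 0" using nI by (simp add: c_def field_simps)
    finally have "x (ds ! k) = 0" .
    then have "x \<in> coord J" using xL comp_sub[OF L] by (auto simp: coord_def)
    then have "x = 0" using w wx by (simp add: cuspidal_def)
    moreover have "bform x (eps ds i) = 2 - c * 2"
    proof -
      have b: "(\<Sum>j\<in>A. bform (eps ds j) (eps ds i)) = 2" if A: "A \<subseteq> ?I" "i \<in> A" for A
      proof -
        have "(\<Sum>j\<in>A. bform (eps ds j) (eps ds i)) = (\<Sum>j\<in>A. if j = i then 2 else 0)"
        proof (rule sum.cong[OF refl])
          fix j assume "j \<in> A"
          then have "j \<in> ?I" using A(1) by blast
          then show "bform (eps ds j) (eps ds i) = (if j = i then 2 else 0)" using bform_eps[OF D, of j i] i by simp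
        qed
        then show ?thesis using A finite_subset[OF A(1)] by (simp add: sum.delta)
      qed
      have "i \<in> Q" unfolding Q_def by (rule self_in_orb[OF g(2)])
      then show ?thesis unfolding x_def using b[OF sub] b[OF order_refl i]
        by (simp add: bform_simps bform_sum_left)
    qed
    ultimately show False using c1 by simp
  qed
  have orbs: "orb g i = orb g' i" if i: "i \<in> {- int k..int k}" for i
  proof -
    have "(g ^^ j) i = (g' ^^ j) i \<and> (g' ^^ j) i \<in> {- int k..int k}" for j
      by (induction j) (use i gg' signed_range[OF g'(2)] in auto)
    then show ?thesis using orb_funpow[OF g(2)] orb_funpow[OF g'(2)] by auto
  qed
  have small: "- i \<in> orb g i \<and> orb g i \<subseteq> {- int k..int k}" if i: "i \<in> {1..int k}" for i
    using cuspidal_all_neg[OF D' y(3), of i] orb_subset[OF g'(2), of i] orbs[of i] i k' by (simp add: g'_def)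
  have even: "even (card (orb g i \<inter> {1..int ?n}))" if i: "i \<in> {1..int k}" for i
  proof -
    have "orb g i \<inter> {1..int ?n} = orb g' i \<inter> {1..int k}" using orbs[of i] small[OF i] i k by auto
    then show ?thesis using ev i k' by (auto simp: odd_cycle_def[OF D'] g'_def y_def)
  qed
  note type = cycle_type_eq[OF g(2) g1 _ k(3) trans small even n k(1)]
  obtain b where b: "b \<in> par (?M - ?L)" "w = a \<otimes> b" using proj_rest[OF J(1) L wM] by (auto simp: a_def)
  show ?thesis unfolding noncompliant_class_def
  proof (intro conjI bexI[of _ w] exI)
    show "odd ?n" "?n > 4" using n k by auto
    show "double_partition ?n (cycle_type ?n g)" "noncompliant_double_partition (cycle_type ?n g)" using type k by auto
    show "?M \<subseteq> S" by fact
    show "irreducible_component W ?M ?L" using comp_iff[OF J(1)] L by blast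
    show "sperm ds \<in> type_D_isos W ?L ?n" by (rule sperm_iso[OF D])
    show "w \<in> conjugacy_class W w" unfolding conjugacy_class_def using wc by (intro CollectI exI[of _ \<one>]) simp
    show "cycle_type ?n (sperm ds a) = cycle_type ?n g" by (simp add: g_def)
  qed (use wc wM a b in auto)
qed

end

section \<open>Type D components of even rank under elementary moves\<close>

context finite_coxeter
begin

text \<open>Let \<open>j\<close> be the first index outside \<open>K\<close>. Later vertices are
  linked to the part before \<open>j\<close> only through \<open>ds ! j\<close>, so by connectedness
  \<open>K\<close> is exactly that part; and \<open>ds ! j\<close> is adjacent to it, hence equals
  \<open>s\<close>.\<close>

lemma D_extend_path:
  assumes D: "path_D ds" and L: "set ds = L" and K: "K \<subseteq> L" "conn K" "K \<noteq> L" and four: "\<And>i. i < 4 \<Longrightarrow> ds ! i \<in> K"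
    and outer: "\<And>r t. r \<in> K \<Longrightarrow> t \<in> L \<Longrightarrow> adj r t \<Longrightarrow> t \<in> K \<or> t = s"
  shows "card K < length ds" "set (take (card K) ds) = K" "ds ! card K = s"
proof -
  define j where "j = (LEAST j. j < length ds \<and> ds ! j \<notin> K)"
  obtain i where "i < length ds \<and> ds ! i \<notin> K" using K L by (metis in_set_conv_nth subsetI subset_antisym)
  then have j: "j < length ds" "ds ! j \<notin> K" unfolding j_def by (metis (mono_tags, lifting) LeastI)+
  have below: "ds ! i \<in> K" if "i < j" for i
  proof (rule ccontr)
    assume "ds ! i \<notin> K"
    then have "j \<le> i" unfolding j_def using that j(1) by (intro Least_le) (auto simp: j_def)
    then show False using that by simp
  qed
  have j4: "j \<ge> 4" using four j(2) by (meson not_less)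
  have adjs: "adj (ds ! i) (ds ! l) \<longleftrightarrow> D_edge i l \<or> D_edge l i" if "i < length ds" "l < length ds" "i \<noteq> l" for i l
    using D_m[OF D that] D_nth_eq[OF D that(1,2)] that(3) by (simp add: adj_def)
  have "K \<subseteq> set (take j ds)"
  proof (rule conn_closed[OF K(2), of "ds ! 0"])
    show "ds ! 0 \<in> K" using four by simp
    show "ds ! 0 \<in> set (take j ds)" using j4 j(1) by (auto simp: in_set_conv_nth intro!: exI[of _ 0])
    fix a b assume a: "a \<in> set (take j ds)" and b: "b \<in> K" and ab: "adj a b"
    obtain i where i: "i < j" "a = ds ! i" using a j(1) by (auto simp: in_set_conv_nth)
    obtain l where l: "l < length ds" "b = ds ! l" using b K(1) L by (metis in_set_conv_nth subsetD)
    have "l \<noteq> j" using b j l by auto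
    moreover have "\<not> j < l" using adjs[of i l] ab i l j j4 by (auto simp: D_edge_def)
    ultimately show "b \<in> set (take j ds)" using l j(1) by (auto simp: in_set_conv_nth intro!: exI[of _ l])
  qed
  moreover have "set (take j ds) \<subseteq> K" using below j(1) by (auto simp: in_set_conv_nth)
  ultimately have KT: "set (take j ds) = K" by blast
  then have c: "card K = j" using distinct_card[of "take j ds"] D_distinct[OF D] j(1) by simp
  have "D_edge (j - 1) j" using j4 by (auto simp: D_edge_def)
  then have "adj (ds ! (j - 1)) (ds ! j)" using adjs[of "j - 1" j] j(1) j4 by simp
  then have "ds ! j = s" using outer[OF below[of "j - 1"], of "ds ! j"] j j4 L nth_mem[OF j(1)] by auto
  then show "card K < length ds" "set (take (card K) ds) = K" "ds ! card K = s" using c j KT by auto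
qed

text \<open>A nontrivial automorphism leaves the shapes D and E6 for \<open>L\<close>. In E6,
  \<open>K\<close> would contain everything but the tip \<open>s\<close> of a long arm, that is 5
  vertices, contrary to its even rank. The numbering \<open>ds\<close> is a fresh one: it agrees
  with \<open>ds0\<close> in the vertex set of its first part only.\<close>

lemma D_extend:
  assumes D0: "path_D ds0" "even (length ds0)" and L: "L \<subseteq> S" "conn L" and K: "K = set ds0" "K \<subseteq> L" "conn K" "s \<notin> K" "s \<in> L"
    and outer: "\<And>r t. r \<in> K \<Longrightarrow> t \<in> L \<Longrightarrow> adj r t \<Longrightarrow> t \<in> K \<or> t = s"
    and f: "automorph L f" "\<exists>r\<in>L. f r \<noteq> r"
  obtains ds where "path_D ds" "set ds = L" "length ds0 < length ds" "set (take (length ds0) ds) = K" "ds ! length ds0 = s"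
proof -
  have cK: "card K = length ds0" using distinct_card[OF D_distinct[OF D0(1)]] K(1) by simp
  have bK: "branch K (ds0 ! 2)" using spider_branch[OF path_D_spider(1)[OF D0(1)]] path_D_spider(2)[OF D0(1)] K(1) by simp
  then have bL: "branch L (ds0 ! 2)" using K(2) unfolding branch_def by blast
  define b where "b = ds0 ! 2"
  have nh: "\<not> heavy L x y" for x y using branch_heavy[OF L bL] by blast
  obtain p q r where sp: "spider b p q r" "spider_set b p q r = L"
    and sh: "(\<exists>a c. p = [a] \<and> q = [c]) \<or> (\<exists>p1 p2 q1 q2 r1. p = [p1, p2] \<and> q = [q1, q2] \<and> r = [r1])"
    using symmetric_spider[OF L bL f] by (auto simp: b_def)
  have ne: "r \<noteq> []" and dist: "distinct (b # p @ q @ r)" using sp(1) by (auto simp: spider_def)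
  have hds: "hd p \<in> K" "hd q \<in> K" "hd r \<in> K" and bin: "b \<in> K"
  proof -
    obtain x y z where x: "x \<in> K" "y \<in> K" "z \<in> K" "x \<noteq> y" "x \<noteq> z" "y \<noteq> z" "adj b x" "adj b y" "adj b z"
      using bK by (auto simp: branch_def b_def)
    have "x \<in> {hd p, hd q, hd r}" "y \<in> {hd p, hd q, hd r}" "z \<in> {hd p, hd q, hd r}"
      using spider_adj_center[OF sp(1)] x K(2) sp(2) by blast+
    then have "{hd p, hd q, hd r} = {x, y, z}" using x(4-6) by (elim insertE emptyE) auto
    then show "hd p \<in> K" "hd q \<in> K" "hd r \<in> K" using x(1-3) by auto
    show "b \<in> K" using bK by (simp add: branch_def b_def)
  qed
  from sh show thesis
  proof (elim disjE exE conjE)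
    fix a c assume pq: "p = [a]" "q = [c]"
    let ?ds = "a # c # b # r"
    have D: "path_D ?ds" using spider_path_D[of b a c r] sp pq nh by auto
    have set: "set ?ds = L" using sp pq by auto
    have "?ds ! i \<in> K" if "i < 4" for i
    proof -
      have "i \<in> {0, 1, 2, 3}" using that by auto
      then show ?thesis using hds bin pq ne by (cases r) (auto simp: numeral_2_eq_2 numeral_3_eq_3)
    qed
    note ext = D_extend_path[OF D set K(2,3) _ this outer]
    have "K \<noteq> L" using K(4,5) by blast
    show thesis using that[OF D set] ext[OF \<open>K \<noteq> L\<close>] cK by simp
  next
    fix p1 p2 q1 q2 r1 assume pqr: "p = [p1, p2]" "q = [q1, q2]" "r = [r1]"
    have "adj p1 p2" using spider_walkD(1)[OF sp(1), of 0] pqr by simp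
    moreover have "adj q1 q2" using spider_walkD(1)[OF spider_swap(1)[OF sp(1)], of 0] pqr by simp
    moreover have in_L: "p2 \<in> L" "q2 \<in> L" "L = {b, p1, p2, q1, q2, r1}" using sp(2) pqr by auto
    ultimately have o: "p2 \<in> K \<or> p2 = s" "q2 \<in> K \<or> q2 = s" using outer[of p1 p2] outer[of q1 q2] hds pqr by auto
    have d: "distinct [b, p1, p2, q1, q2, r1]" using dist pqr by auto
    have sub: "{b, p1, q1, r1} \<subseteq> K" using hds bin pqr by simp
    have s: "s = p2 \<or> s = q2" using K(4,5) sub in_L(3) by auto
    then have "K = {b, p1, q1, r1, q2} \<or> K = {b, p1, q1, r1, p2}"
    proof
      assume sp2: "s = p2"
      then have "q2 \<in> K" using o(2) d by auto
      moreover have "p2 \<notin> K" using K(4) sp2 by simp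
      ultimately have "K = {b, p1, q1, r1, q2}" using sub K(2) unfolding in_L(3) by blast
      then show ?thesis ..
    next
      assume sq2: "s = q2"
      then have "p2 \<in> K" using o(1) d by auto
      moreover have "q2 \<notin> K" using K(4) sq2 by simp
      ultimately have "K = {b, p1, q1, r1, p2}" using sub K(2) unfolding in_L(3) by blast
      then show ?thesis ..
    qed
    then have "card K = 5" using d distinct_card[of "[b, p1, q1, r1, q2]"] distinct_card[of "[b, p1, q1, r1, p2]"]
      by (elim disjE) auto
    then show thesis using D0(2) cK by simp
  qed
qed

text \<open>For even rank the negation of all points has sign product 1, so it belongs to W(D_n) and
  is the longest element.\<close>

lemma path_D_even_opp:
  assumes D: "path_D ds" and n: "even (length ds)" and s: "s \<in> set ds"
  shows "opp (set ds) s = s"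
proof -
  let ?n = "length ds" and ?C = "ints (length ds)"
  note S = D_sub[OF D]
  have sg: "signed ?n (negate ?C)" by (rule negate_signed) auto
  have "?C \<inter> {1..int ?n} = {1..int ?n}" by auto
  then have "sign_prod ?n (negate ?C) = 1" using negate_sign_prod[of ?C ?n] n by simp
  then obtain v where v: "v \<in> par (set ds)" "realizes ds v (negate ?C)" using exists_realizing[OF D sg] by blast
  have va: "act v (\<alpha> s) = - \<alpha> s" if "s \<in> set ds" for s
    by (rule act_negate[OF D v(2) _ that]) (simp add: negate_def)
  have "v = w0 (set ds)" by (rule w0_unique[OF S v(1)]) (simp add: va nonneg_unit)
  then show ?thesis using va[OF s] act_w0[OF S s] by simp
qed

lemma conj_fixed:
  assumes K: "K \<subseteq> S" and v: "v \<in> carrier W" and fx: "\<And>s. s \<in> K \<Longrightarrow> img v s = s" and u: "u \<in> par K"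
  shows "cj v u = u"
proof -
  obtain xs where xs: "xs \<in> lists K" "word xs = u" using u generate_iff_word[OF K] by blast
  from xs(1) have "cj v (word xs) = word xs"
  proof (induction xs)
    case (Cons s xs)
    then have "s \<in> carrier W" "word xs \<in> carrier W" using K by (auto simp: in_lists_conv_set intro!: word_carrier)
    then show ?case using conj_word[OF v, of s "word xs"] Cons fx[of s] by (simp add: img_def)
  qed (use v in simp)
  then show ?thesis using xs by simp
qed

lemma conjugacy_class_conj:
  assumes v: "v \<in> carrier W" and w: "w \<in> carrier W"
  shows "conjugacy_class W (cj v w) = conjugacy_class W w"
  unfolding conjugacy_class_def
proof (intro equalityI subsetI; elim CollectE exE conjE)
  fix x g assume g: "g \<in> carrier W"
  have "cj g (cj v w) = cj (g \<otimes> v) w" using g v w by (simp add: inv_mult_group m_assoc)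
  then show "x = cj g (cj v w) \<Longrightarrow> x \<in> {cj g w | g. g \<in> carrier W}" using g v by blast
  have "cj g w = cj (g \<otimes> inv v) (cj v w)"
    using g v w by (simp add: inv_mult_group m_assoc)
  then show "x = cj g w \<Longrightarrow> x \<in> {cj g (cj v w) | g. g \<in> carrier W}" using g v by blast
qed

text \<open>Opposition in \<open>J\<close> is trivial on \<open>K\<close>, so \<open>v\<close> acts
  on \<open>K\<close> as the opposition of the component \<open>L\<close> of
  \<open>insert s J\<close> containing \<open>K\<close>. If that opposition is nontrivial,
  \<open>D_extend\<close> makes \<open>L\<close> of type D, of odd rank by
  \<open>path_D_even_opp\<close>, and opposition is its flip. Then \<open>noncompliantI\<close>
  applies unless there is an odd cycle.\<close>

lemma D_even_elementary:
  assumes J: "J \<subseteq> S" and s: "s \<in> S" "s \<notin> J" and v: "simple_in J v" "\<And>r. r \<in> J \<Longrightarrow> act v (\<alpha> r) = \<alpha> (opp (insert s J) (opp J r))"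
    and D0: "path_D ds0" "even (length ds0)" and K: "comp J K" "K = set ds0" and w: "cuspidal J w"
  shows "(\<forall>r\<in>K. img v r = r) \<or>
    (img v ` K = K \<and> (\<exists>u\<in>par K. cj (u \<otimes> v) (proj K w) = proj K w) \<and>
     (noncompliant_class W S (conjugacy_class W w) \<or> (\<exists>ds. path_D ds \<and> set ds = K \<and> odd_cycle ds (proj K w))))"
proof -
  let ?M = "insert s J"
  have M: "?M \<subseteq> S" using J s by simp
  have KJ: "K \<subseteq> J" using comp_sub[OF K(1)] .
  have KS: "K \<subseteq> S" using KJ J by blast
  obtain r0 where r0: "r0 \<in> K" using D_not_Nil[OF D0(1)] K(2) by (cases ds0) auto
  obtain L where L: "comp ?M L" "r0 \<in> L" using comp_ex[OF M, of r0] r0 KJ by blast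
  have KL: "K \<subseteq> L" using conn_sub_comp[OF comp_conn[OF K(1)] _ L(1) r0 L(2)] KJ by blast
  have LS: "L \<subseteq> S" using comp_sub[OF L(1)] M by blast
  have im: "img v r = opp L r" if r: "r \<in> K" for r
  proof -
    have "opp J r = r" using opp_comp[OF J K(1) r] path_D_even_opp[OF D0] r K(2) by simp
    then have "\<alpha> (img v r) = \<alpha> (opp ?M r)" using act_img[OF J v(1)] v(2) r KJ by (metis subsetD)
    then show ?thesis using opp_comp[OF M L(1)] r KL by auto
  qed
  show ?thesis
  proof (cases "s \<in> L \<and> (\<exists>r\<in>L. opp L r \<noteq> r)")
    case False
    have "opp L r = r" if r: "r \<in> K" for r
    proof (cases "s \<in> L")
      case True then show ?thesis using False r KL by blast
    next
      case sL: False
      then have "L \<subseteq> J" using comp_sub[OF L(1)] by blast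
      then have "L = K" using conn_sub_comp[OF comp_conn[OF L(1)] _ K(1) L(2) r0] KL by blast
      then show ?thesis using path_D_even_opp[OF D0] r K(2) by simp
    qed
    then show ?thesis using im by simp
  next
    case True
    have outer: "t \<in> K \<or> t = s" if "r \<in> K" "t \<in> L" "adj r t" for r t
      using comp_adj[OF K(1) that(1) _ that(3)] comp_sub[OF L(1)] that(2) by blast
    obtain ds where ds: "path_D ds" "set ds = L" "length ds0 < length ds" "set (take (length ds0) ds) = K" "ds ! length ds0 = s"
    proof (rule D_extend[OF D0 LS comp_conn[OF L(1)] K(2) KL comp_conn[OF K(1)] _ _ _ opp_automorph[OF LS], of s])
      show "s \<notin> K" "s \<in> L" "\<exists>r\<in>L. opp L r \<noteq> r" using True s KJ by auto
    qed (use outer that in blast)+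
    define k where "k = length ds0"
    have k4: "4 \<le> k" using D_length[OF D0(1)] by (simp add: k_def)
    have od: "odd (length ds)" using path_D_even_opp[OF ds(1)] True ds(2) by blast
    let ?t = "take k ds"
    have Dt: "path_D ?t" "set ?t = K" using path_D_take[OF ds(1) k4] ds by (auto simp: k_def)
    have fl: "flips ds (opp L)"
      using path_D_automorph[OF ds(1), of "opp L"] opp_automorph[OF LS] comp_conn[OF L(1)] od ds(2) True by fastforce
    have flt: "flips ?t (img v)"
    proof -
      have "ds ! j \<in> K" if "j < k" for j using nth_mem[of j ?t] that ds(3) Dt(2) by (simp add: k_def)
      then have "img v (ds ! j) = opp L (ds ! j)" if "j < k" for j using im that by blast
      then show ?thesis using fl k4 ds(3) D_not_Nil[OF D0(1)] by (auto simp: flips_def k_def)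
    qed
    have imK: "img v ` K = K"
    proof (rule endo_inj_surj[OF finite_sub_S[OF KS]])
      show "img v ` K \<subseteq> K"
      proof
        fix x assume "x \<in> img v ` K"
        then obtain j where "j < length ?t" "x = img v (?t ! j)" using Dt(2) by (metis imageE in_set_conv_nth)
        then consider "x = ?t ! 1" | "x = ?t ! 0" | "x = ?t ! j" "j < length ?t"
          using flt unfolding flips_def by (metis One_nat_def less_2_cases not_le_imp_less)
        then show "x \<in> K" using nth_mem[of 0 ?t] nth_mem[of 1 ?t] nth_mem[of j ?t] k4 ds(3) Dt(2) D_not_Nil[OF D0(1)] by cases (auto simp: k_def)
      qed
      show "inj_on (img v) K" using img_inj[OF KS simple_in_carrier[OF v(1)]] .
    qed
    have cu: "cuspidal K (proj K w)" using cuspidal_proj[OF J K(1) w] .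
    have "\<exists>u\<in>par K. cj (u \<otimes> v) (proj K w) = proj K w"
      using flip_conj[OF Dt(1), of "proj K w" v] cu simple_in_mono[OF v(1) KJ] imK flt Dt(2) by simp
    moreover have "noncompliant_class W S (conjugacy_class W w) \<or> odd_cycle ?t (proj K w)"
      using noncompliantI[OF ds(1) od, of k J w] D0(2) k4 ds M s(2) L(1) K(1) w by (auto simp: k_def)
    ultimately show ?thesis using imK Dt by blast
  qed
qed

text \<open>Along the elementary moves \<open>J\<close> and \<open>w\<close> change, while
  \<open>K\<close> and the conjugacy class of \<open>w\<close> stay; so the induction generalizes
  over \<open>J\<close> and \<open>w\<close>.\<close>

theorem D_even_moves:
  assumes J: "J \<subseteq> S" and x: "simple_in J x" and D0: "path_D ds0" "even (length ds0)" and K: "comp J K" "K = set ds0"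
    and w: "cuspidal J w"
  shows "img x ` K = K \<and> (\<exists>u\<in>par K. cj (u \<otimes> x) (proj K w) = proj K w) \<and>
    ((\<forall>r\<in>K. img x r = r) \<or> noncompliant_class W S (conjugacy_class W w) \<or>
     (\<exists>ds. path_D ds \<and> set ds = K \<and> odd_cycle ds (proj K w)))"
  using J x K(1) w
proof (induction "len x" arbitrary: x J w rule: less_induct)
  case less
  note J = less.prems(1) and x = less.prems(2) and KJ = less.prems(3) and w = less.prems(4)
  have KS: "K \<subseteq> S" using comp_sub[OF KJ] J by blast
  have wp: "w \<in> par J" using w by (simp add: cuspidal_def)
  have wc: "w \<in> carrier W" using par_in_W[OF J wp] .
  let ?p = "proj K w"
  have pp: "?p \<in> par K" using proj_par[OF J KJ wp] .
  have pc: "?p \<in> carrier W" using par_in_W[OF KS pp] .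
  show ?case
  proof (cases "x = \<one>")
    case True
    then show ?thesis using pc by (auto simp: img_def image_def subsetD[OF KS] intro!: bexI[of _ \<one>])
  next
    case False
    obtain s y v where e: "s \<in> S" "s \<notin> J" "v = w0 (insert s J) \<otimes> w0 J" "y \<in> carrier W" "x = y \<otimes> v" "len y < len x"
      "\<And>r. r \<in> J \<Longrightarrow> act v (\<alpha> r) = \<alpha> (opp (insert s J) (opp J r))"
      "simple_in (img v ` J) y" "simple_in J v"
      using elementary_move[OF J x False] by metis
    have vc: "v \<in> carrier W" using simple_in_carrier e(9) by blast
    note el = D_even_elementary[OF J e(1,2,9,7) D0 KJ K(2) w]
    have imK: "img v ` K = K" using el by force
    let ?J = "img v ` J" and ?w = "cj v w"
    have cJ: "comp ?J K" using img_comp[OF J e(9) KJ] imK by simp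
    have pw: "proj K ?w = cj v ?p" using img_proj[OF J e(9) KJ wp] imK by simp
    note IH = less.hyps[OF e(6) img_subset[OF J e(9)] e(8) cJ cuspidal_img[OF J e(9) w]]
    have imx: "img x r = img y (img v r)" if "r \<in> K" for r
      using that KS vc e(4) unfolding e(5) img_def by (auto simp: inv_mult_group m_assoc)
    have 1: "img x ` K = K" using imx IH imK by (metis (no_types, lifting) image_cong image_image)
    obtain u1 where u1: "u1 \<in> par K" "cj (u1 \<otimes> v) ?p = ?p"
    proof (cases "\<forall>r\<in>K. img v r = r")
      case True
      then show ?thesis using that[of \<one>] conj_fixed[OF KS vc _ pp] vc by simp
    qed (use el that in blast)
    obtain u2 where u2: "u2 \<in> par K" "cj (u2 \<otimes> y) (proj K ?w) = proj K ?w" using IH by blast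
    have uc: "u1 \<in> carrier W" "u2 \<in> carrier W" using par_in_W[OF KS] u1 u2 by auto
    \<comment> \<open>The correction for \<open>y\<close> fixes the moved projection
      \<open>cj v ?p\<close>; the correction for \<open>v\<close> then brings this back to
      \<open>?p\<close>.\<close>
    have "cj ((u1 \<otimes> u2) \<otimes> x) ?p = cj u1 (cj (u2 \<otimes> y) (cj v ?p))"
      unfolding e(5) using uc vc pc e(4) by (simp add: inv_mult_group m_assoc)
    also have "\<dots> = cj (u1 \<otimes> v) ?p" using u2(2) uc vc pc unfolding pw by (simp add: inv_mult_group m_assoc)
    finally have 2: "\<exists>u\<in>par K. cj (u \<otimes> x) ?p = ?p"
      using u1 u2 par_mult by metis
    have cl: "conjugacy_class W ?w = conjugacy_class W w" using conjugacy_class_conj[OF vc wc] .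
    have 3: "(\<forall>r\<in>K. img x r = r) \<or> noncompliant_class W S (conjugacy_class W w) \<or>
      (\<exists>ds. path_D ds \<and> set ds = K \<and> odd_cycle ds ?p)"
    proof (cases "\<forall>r\<in>K. img v r = r")
      \<comment> \<open>A move that is trivial on \<open>K\<close> fixes the projection, so an odd
        cycle found for the moved element is one of the original projection.\<close>
      case True
      then have "proj K ?w = ?p" using conj_fixed[OF KS vc _ pp] pw by simp
      then show ?thesis using IH imx True unfolding cl by auto
    qed (use el in blast)
    show ?thesis using 1 2 3 by blast
  qed
qed

end

context finite_coxeter
begin

subsection \<open>Conjugating the components of a cuspidal element\<close>

lemma img_comp_fun: "x \<in> carrier W \<Longrightarrow> y \<in> carrier W \<Longrightarrow> s \<in> carrier W \<Longrightarrow> img (x \<otimes> y) s = img x (img y s)"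
  by (simp add: img_def inv_mult_group m_assoc)

lemma img_image_mult: "x \<in> carrier W \<Longrightarrow> y \<in> carrier W \<Longrightarrow> K \<subseteq> S \<Longrightarrow> img (x \<otimes> y) ` K = img x ` img y ` K"
  unfolding image_image by (intro image_cong refl img_comp_fun) auto

lemma img_one: "K \<subseteq> S \<Longrightarrow> img \<one> ` K = K"
  by (force simp: img_def)

context
  fixes J :: "'a set" and w :: 'a
  assumes J: "J \<subseteq> S" and w: "cuspidal J w"
begin


lemma N: "x \<in> ncomp J \<Longrightarrow> x \<in> carrier W" "x \<in> ncomp J \<Longrightarrow> simple_in J x" "x \<in> ncomp J \<Longrightarrow> inv x \<in> ncomp J" "x \<in> ncomp J \<Longrightarrow> y \<in> ncomp J \<Longrightarrow> x \<otimes> y \<in> ncomp J" "\<one> \<in> ncomp J"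
  using ncomp_subgroup[OF J] ncomp_simple_in[OF J] by (auto simp: ncomp_carrier subgroup.m_inv_closed subgroup.m_closed subgroup.one_closed)

lemma comp_S: "comp J K \<Longrightarrow> K \<subseteq> S"
  using comp_sub J by blast

lemma N_comp: "x \<in> ncomp J \<Longrightarrow> comp J K \<Longrightarrow> comp J (img x ` K)"
  using img_comp[OF J N(2)] ncomp_img[OF J] by metis

lemma p_par: "comp J K \<Longrightarrow> proj K w \<in> par K" "comp J K \<Longrightarrow> proj K w \<in> carrier W"
  using proj_par[OF J _ cuspidal_par[OF w]] par_in_W[OF comp_S] by auto

lemma N_par: "x \<in> ncomp J \<Longrightarrow> comp J K \<Longrightarrow> u \<in> par K \<Longrightarrow> cj x u \<in> par (img x ` K)"
  using simple_in_conj_par[OF J comp_sub N(2)] by blast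

lemma N_img_inv: "x \<in> ncomp J \<Longrightarrow> comp J K \<Longrightarrow> img x ` img (inv x) ` K = K" "x \<in> ncomp J \<Longrightarrow> comp J K \<Longrightarrow> img (inv x) ` img x ` K = K"
  using img_image_mult[OF N(1) N(1)[OF N(3)] comp_S, of x x K] img_image_mult[OF N(1)[OF N(3)] N(1) comp_S, of x x K] img_one[OF comp_S]
  by (simp_all add: N(1))

text \<open>By \<open>conjugate_odd_connected\<close>, \<open>K\<close> and its image lie in one
  component \<open>C\<close> of the whole diagram, where two subsets outside type A must
  meet.\<close>

lemma nonA_stable:
  assumes K: "comp J K" and n: "nonA K" and x: "x \<in> ncomp J"
  shows "img x ` K = K"
proof -
  have xc: "x \<in> carrier W" and xs: "simple_in J x" using N x by auto
  have KS: "K \<subseteq> S" and KJ: "K \<subseteq> J" using comp_S K comp_sub by auto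
  obtain s where s: "s \<in> K" using comp_conn[OF K] by (auto simp: conn_def)
  obtain C where C: "comp S C" "s \<in> C" using comp_ex[OF order_refl, of s] s KS by blast
  have KC: "K \<subseteq> C" using conn_sub_comp[OF comp_conn[OF K] KS C(1) s C(2)] .
  have "img x t \<in> C" if t: "t \<in> K" for t
  proof -
    have "(t, img x t) \<in> {(a, b). a \<in> S \<and> b \<in> S \<and> odd (m a b)}\<^sup>*"
      using conjugate_odd_connected[OF xc _ img_in_S[OF J xs]] t KS KJ by blast
    then show ?thesis
    proof (induction rule: rtrancl_induct)
      case base then show ?case using t KC by blast
    next
      case (step y z)
      then have "y = z \<or> adj y z" by (auto simp: adj_def)
      then show ?case using comp_adj[OF C(1), of y z] step by auto
    qed
  qed
  then have "img x ` K \<subseteq> C" by blast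
  moreover have "nonA (img x ` K)"
  proof -
    obtain A where "special K A" using n by (auto simp: nonA_def)
    then consider b where "branch K b" | a c where "heavy K a c" by (auto simp: special_def)
    then have "(\<exists>b. branch (img x ` K) b) \<or> (\<exists>a c. heavy (img x ` K) a c)"
    proof cases
      case 1
      then obtain a c d where 2: "b \<in> K" "a \<in> K" "c \<in> K" "d \<in> K" "a \<noteq> c" "a \<noteq> d" "c \<noteq> d" "adj b a" "adj b c" "adj b d"
        by (auto simp: branch_def)
      have "img x a \<noteq> img x c" "img x a \<noteq> img x d" "img x c \<noteq> img x d"
        using 2 inj_on_eq_iff[OF img_inj[OF KS xc]] by auto
      moreover have "adj (img x b) (img x a)" "adj (img x b) (img x c)" "adj (img x b) (img x d)"
        using 2 img_adj[OF J xs] KJ by auto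
      ultimately have "branch (img x ` K) (img x b)" using 2(1-4) unfolding branch_def by blast
      then show ?thesis by blast
    next
      case 2
      then have "a \<in> J" "c \<in> J" using KJ by (auto simp: heavy_def)
      then have "heavy (img x ` K) (img x a) (img x c)"
        using inj_on_eq_iff[OF img_inj[OF KS xc], of a c] img_m[OF J xs, of a c] 2 by (auto simp: heavy_def)
      then show ?thesis by blast
    qed
    then show ?thesis unfolding nonA_def special_def by blast
  qed
  ultimately obtain t where "t \<in> img x ` K" "t \<in> K" using nonA_disjoint[OF comp_sub comp_conn, OF C(1) C(1) _ KC] n by blast
  then show ?thesis using comp_eq[OF N_comp[OF x K] K] by blast
qed

definition stabc :: "'a set \<Rightarrow> 'a set" where "stabc K = {x \<in> ncomp J. img x ` K = K}"

lemma stabc_auto: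
  assumes "comp J K" "x \<in> stabc K" shows "automorph K (img x)"
  using assms img_inj[OF comp_S N(1)] img_m[OF J N(2)] comp_sub unfolding automorph_def stabc_def by blast

lemma stabc_mult:
  assumes K: "comp J K" and x: "x \<in> stabc K" and y: "y \<in> stabc K"
  shows "x \<otimes> y \<in> stabc K" "s \<in> K \<Longrightarrow> img (x \<otimes> y) s = img x (img y s)"
  using img_image_mult[OF N(1) N(1) comp_S[OF K]] N(4) x y img_comp_fun[OF N(1) N(1)] comp_S[OF K] by (auto simp: stabc_def)

text \<open>By the assumption \<open>two\<close>, acting trivially on \<open>K\<close> or not is a
  sign character of \<open>stabc K\<close>. As \<open>v\<close> is an involution that commutes with
  every \<open>x\<close>, inserting it exactly for the nontrivial sign is multiplicative.\<close>

lemma component_hom_sign: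
  assumes K: "comp J K" and v: "v \<in> par K" "v \<otimes> v = \<one>"
    and nt: "\<And>x. x \<in> stabc K \<Longrightarrow> \<exists>s\<in>K. img x s \<noteq> s \<Longrightarrow> cj x v = v \<and> cj (v \<otimes> x) (proj K w) = proj K w"
    and two: "\<And>x y s. x \<in> stabc K \<Longrightarrow> y \<in> stabc K \<Longrightarrow> \<exists>s\<in>K. img x s \<noteq> s \<Longrightarrow> \<exists>s\<in>K. img y s \<noteq> s \<Longrightarrow> s \<in> K \<Longrightarrow> img x (img y s) = s"
  shows "\<exists>H. \<forall>x\<in>stabc K. H x \<in> carrier W \<and> H x \<otimes> inv x \<in> par K \<and> cj (H x) (proj K w) = proj K w \<and> (\<forall>y\<in>stabc K. H (x \<otimes> y) = H x \<otimes> H y)"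
proof -
  define T where "T x \<longleftrightarrow> (\<forall>s\<in>K. img x s = s)" for x
  define H where "H x = (if T x then x else v \<otimes> x)" for x
  have KS: "K \<subseteq> S" using comp_S[OF K] .
  have vc: "v \<in> carrier W" using par_in_W[OF KS v(1)] .
  have c: "x \<in> carrier W" if "x \<in> stabc K" for x using that N(1) by (simp add: stabc_def)
  have Tv: "cj x v = v" if "x \<in> stabc K" for x
    using nt[OF that] conj_fixed[OF KS c[OF that] _ v(1)] by (auto simp: T_def)
  have comm: "x \<otimes> v = v \<otimes> x" if x: "x \<in> stabc K" for x
  proof -
    have "(cj x v) \<otimes> x = v \<otimes> x" using Tv[OF x] by simp
    then show ?thesis using c[OF x] vc by (simp add: m_assoc)
  qed
  have Tm: "T (x \<otimes> y) \<longleftrightarrow> (T x \<longleftrightarrow> T y)" if x: "x \<in> stabc K" and y: "y \<in> stabc K" for x y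
  proof -
    have e: "img (x \<otimes> y) s = img x (img y s)" if "s \<in> K" for s using stabc_mult(2)[OF K x y that] .
    have im: "img y ` K = K" using y by (simp add: stabc_def)
    have "T (x \<otimes> y)" if "\<not> T x" "\<not> T y" using two[OF x y] that e by (auto simp: T_def)
    moreover have "T (x \<otimes> y) \<longleftrightarrow> T y" if "T x" using that e im unfolding T_def by (metis imageI)
    moreover have "T (x \<otimes> y) \<longleftrightarrow> T x" if "T y" using that e unfolding T_def by auto
    ultimately show ?thesis by blast
  qed
  have "H (x \<otimes> y) = H x \<otimes> H y" if x: "x \<in> stabc K" and y: "y \<in> stabc K" for x y
  proof -
    have "x \<otimes> (v \<otimes> y) = v \<otimes> (x \<otimes> y)" using comm[OF x] c[OF x] c[OF y] vc by (metis m_assoc)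
    moreover have "v \<otimes> (x \<otimes> (v \<otimes> y)) = x \<otimes> y" unfolding calculation using v(2) c[OF x] c[OF y] vc by (metis m_assoc m_closed l_one)
    ultimately show ?thesis using c[OF x] c[OF y] vc unfolding H_def Tm[OF x y] by (auto simp: m_assoc)
  qed
  moreover have "H x \<in> carrier W" if "x \<in> stabc K" for x using c[OF that] vc by (simp add: H_def)
  moreover have "H x \<otimes> inv x \<in> par K" if "x \<in> stabc K" for x using c[OF that] vc v(1) by (simp add: H_def m_assoc)
  moreover have "cj (H x) (proj K w) = proj K w" if "x \<in> stabc K" for x
    using nt[OF that] conj_fixed[OF KS c[OF that] _ p_par(1)[OF K]] by (auto simp: H_def T_def)
  ultimately show ?thesis by blast
qed

lemma component_cases:
  assumes K: "comp J K"
  shows "(\<forall>x\<in>stabc K. (\<forall>s\<in>K. img x s = s) \<or> (\<forall>s\<in>K. img x s = opp K s)) \<or> (\<exists>ds. path_D ds \<and> set ds = K \<and> even (length ds))"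
  using automorph_cases[OF comp_S[OF K] comp_conn[OF K] _ stabc_auto[OF K]] N(1) unfolding stabc_def by blast

lemma opp_conj_fixed:
  assumes K: "comp J K" and x: "x \<in> stabc K" and o: "\<forall>s\<in>K. img x s = opp K s" and u: "u \<in> par K"
  shows "cj (w0 K \<otimes> x) u = u"
proof (rule conj_fixed[OF comp_S[OF K] _ _ u])
  have xc: "x \<in> carrier W" using x N(1) by (simp add: stabc_def)
  note KS = comp_S[OF K]
  show "w0 K \<otimes> x \<in> carrier W" using xc w0_carrier[OF KS] by simp
  fix s assume s: "s \<in> K"
  then show "img (w0 K \<otimes> x) s = s"
    using img_comp_fun[OF w0_carrier[OF KS] xc, of s] o opp_img[OF KS opp_in[OF KS s]] opp_opp[OF KS s] KS by auto
qed

text \<open>Where all actions are trivial or opposition, \<open>w0 K\<close> is the correction. What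
  remains is type D of even rank, with an odd cycle by \<open>D_even_moves\<close>; rank 4 is
  treated apart because of triality.\<close>

lemma component_hom:
  assumes K: "comp J K" and nc: "\<not> noncompliant_class W S (conjugacy_class W w)"
  shows "\<exists>H. \<forall>x\<in>stabc K. H x \<in> carrier W \<and> H x \<otimes> inv x \<in> par K \<and> cj (H x) (proj K w) = proj K w \<and> (\<forall>y\<in>stabc K. H (x \<otimes> y) = H x \<otimes> H y)"
proof (cases "\<forall>x\<in>stabc K. (\<forall>s\<in>K. img x s = s) \<or> (\<forall>s\<in>K. img x s = opp K s)")
  case True
  note KS = comp_S[OF K]
  show ?thesis
  proof (rule component_hom_sign[OF K w0_par[OF KS] w0_square[OF KS]])
    fix x assume x: "x \<in> stabc K" "\<exists>s\<in>K. img x s \<noteq> s"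
    then have o: "\<forall>s\<in>K. img x s = opp K s" using True by blast
    have c: "x \<in> carrier W" "w0 K \<in> carrier W" using x(1) N(1) w0_carrier[OF KS] by (auto simp: stabc_def)
    \<comment> \<open>\<open>w0 K \<otimes> x\<close> centralizes \<open>par K\<close>, in
      particular \<open>w0 K\<close> itself.\<close>
    have "w0 K \<otimes> (cj x (w0 K)) \<otimes> w0 K = w0 K"
      using opp_conj_fixed[OF K x(1) o w0_par[OF KS]] c KS by (simp add: inv_mult_group m_assoc)
    then have "w0 K \<otimes> (w0 K \<otimes> (cj x (w0 K)) \<otimes> w0 K) \<otimes> w0 K = w0 K \<otimes> w0 K \<otimes> w0 K" using c KS by simp
    then have "cj x (w0 K) = w0 K" using c KS w0_square[OF KS] by (smt (verit, best) inv_closed l_one m_assoc m_closed r_one)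
    then show "cj x (w0 K) = w0 K \<and> cj (w0 K \<otimes> x) (proj K w) = proj K w"
      using opp_conj_fixed[OF K x(1) o p_par(1)[OF K]] by blast
  next
    fix x y s assume "x \<in> stabc K" "y \<in> stabc K" "\<exists>s\<in>K. img x s \<noteq> s" "\<exists>s\<in>K. img y s \<noteq> s" "s \<in> K"
    then show "img x (img y s) = s" using True opp_opp[OF KS] opp_in[OF KS] by metis
  qed
next
  case False
  then obtain ds0 where ds0: "path_D ds0" "set ds0 = K" "even (length ds0)" using component_cases[OF K] by blast
  obtain x0 where "x0 \<in> stabc K" "\<not> (\<forall>s\<in>K. img x0 s = s)" using False by blast
  then obtain ds where ds: "path_D ds" "set ds = K" "odd_cycle ds (proj K w)"
    using D_even_moves[OF J N(2) ds0(1,3) K _ w, of x0] nc ds0(2) by (auto simp: stabc_def)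
  have cu: "cuspidal (set ds) (proj K w)" using cuspidal_proj[OF J K w] ds(2) by simp
  have cn: "conn (set ds)" using comp_conn[OF K] ds(2) by simp
  have sx: "simple_in (set ds) x" "img x ` set ds = set ds" "x \<in> carrier W" if "x \<in> stabc K" for x
    using that simple_in_mono[OF N(2) comp_sub[OF K]] N(1) ds(2) by (auto simp: stabc_def)
  show ?thesis
  proof (cases "length ds = 4")
    case True
    obtain u where u: "u \<in> par K" "\<And>x. x \<in> stabc K \<Longrightarrow> cj x (inv u \<otimes> proj K w \<otimes> u) = inv u \<otimes> proj K w \<otimes> u"
      using D4_special[OF ds(1) True cn cu ds(3)] sx ds(2) by metis
    have uc: "u \<in> carrier W" using par_in_W[OF comp_S[OF K] u(1)] .
    show ?thesis
    \<comment> \<open>Every \<open>x\<close> centralizes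
      \<open>inv u \<otimes> proj K w \<otimes> u\<close>, so conjugation by \<open>u\<close>, which
      is a homomorphism, carries \<open>x\<close> into the centralizer of
      \<open>proj K w\<close>.\<close>
    proof (intro exI[of _ "\<lambda>x. cj u x"] ballI conjI)
      fix x assume x: "x \<in> stabc K"
      note xc = sx(3)[OF x]
      show "cj u x \<in> carrier W" using uc xc by simp
      have "cj x (inv u) \<in> par K" using N_par[of x K "inv u"] K par_inv[OF comp_S[OF K] u(1)] x by (auto simp: stabc_def)
      then show "cj u x \<otimes> inv x \<in> par K" using par_mult[OF u(1)] uc xc by (simp add: m_assoc)
      have "cj u x \<otimes> proj K w \<otimes> inv (cj u x) = cj u (cj x (inv u \<otimes> proj K w \<otimes> u))"
        using uc xc p_par(2)[OF K] by (simp add: inv_mult_group m_assoc)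
      then show "cj u x \<otimes> proj K w \<otimes> inv (cj u x) = proj K w"
        unfolding u(2)[OF x] using uc p_par(2)[OF K] by (simp add: m_assoc)
      show "cj u (x \<otimes> y) = (cj u x) \<otimes> (cj u y)" if "y \<in> stabc K" for y
        using uc xc sx(3)[OF that] by (simp add: m_assoc)
    qed
  next
    case False
    have fl: "flips ds (img x)" if "x \<in> stabc K" "\<exists>s\<in>K. img x s \<noteq> s" for x
      using path_D_automorph[OF ds(1) cn False] stabc_auto[OF K that(1)] ds(2) that(2) by auto
    obtain v where v: "v \<in> par K" "v \<otimes> v = \<one>" "\<And>x. x \<in> stabc K \<Longrightarrow> \<exists>s\<in>K. img x s \<noteq> s \<Longrightarrow>
        x \<otimes> v \<otimes> inv x = v \<and> cj (v \<otimes> x) (proj K w) = proj K w"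
      using odd_cycle_involution[OF ds(1) cu ds(3)] sx fl ds(2) by metis
    show ?thesis
    proof (rule component_hom_sign[OF K v])
      fix x y s assume a: "x \<in> stabc K" "y \<in> stabc K" "\<exists>s\<in>K. img x s \<noteq> s" "\<exists>s\<in>K. img y s \<noteq> s" "s \<in> K"
      obtain j where j: "j < length ds" "s = ds ! j" using a(5) ds(2) by (metis in_set_conv_nth)
      consider "j = 0" | "j = 1" | "2 \<le> j" by linarith
      then show "img x (img y s) = s" using fl[OF a(1,3)] fl[OF a(2,4)] j unfolding flips_def by cases auto
    qed
  qed
qed

text \<open>A component outside type A is stable, and \<open>component_cases\<close> with
  \<open>D_even_moves\<close> yields a correction within it. In type A both projections are
  conjugate to Coxeter elements read along paths, and \<open>g\<close> carries one path to the
  other.\<close>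

lemma transporter:
  assumes K: "comp J K" and g: "g \<in> ncomp J"
  shows "\<exists>u\<in>par (img g ` K). cj (u \<otimes> g) (proj K w) = proj (img g ` K) w"
proof (cases "nonA K")
  case True
  have e: "img g ` K = K" using nonA_stable[OF K True g] .
  then have gs: "g \<in> stabc K" using g by (simp add: stabc_def)
  note KS = comp_S[OF K]
  consider "\<forall>s\<in>K. img g s = s" | "\<forall>s\<in>K. img g s = opp K s" | ds where "path_D ds" "set ds = K" "even (length ds)"
    using component_cases[OF K] gs by blast
  then have "\<exists>u\<in>par K. cj (u \<otimes> g) (proj K w) = proj K w"
  proof cases
    case 1
    then show ?thesis using conj_fixed[OF KS N(1)[OF g] _ p_par(1)[OF K]] N(1)[OF g] by (intro bexI[of _ \<one>]) auto
  next
    case 2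
    then show ?thesis using opp_conj_fixed[OF K gs _ p_par(1)[OF K]] w0_par[OF KS] by blast
  next
    case 3
    then show ?thesis using D_even_moves[OF J N(2)[OF g] 3(1,3) K _ w] by simp
  qed
  then show ?thesis using e by simp
next
  case False
  note KS = comp_S[OF K] and gc = N(1)[OF g] and gK = N_comp[OF g K]
  obtain ps where ps: "path_A ps" "set ps = K" using typeA_or_nonA[OF KS comp_conn[OF K] False] by blast
  let ?qs = "map (img g) ps"
  have qs: "path_A ?qs" "set ?qs = img g ` K"
  proof -
    have "distinct ?qs" using ps img_inj[OF KS gc] by (simp add: distinct_map path_A_def)
    moreover have "m (?qs ! i) (?qs ! j) = m (ps ! i) (ps ! j)" if "i < length ps" "j < length ps" for i j
      using img_m[OF J N(2)[OF g], of "ps ! i" "ps ! j"] that ps(2) comp_sub[OF K] nth_mem[of i ps] nth_mem[of j ps] by auto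
    ultimately show "path_A ?qs" "set ?qs = img g ` K" using ps comp_S[OF gK] by (auto simp: path_A_def)
  qed
  have "cj g (word xs) = word (map (img g) xs)" if "set xs \<subseteq> S" for xs
    using that
  proof (induction xs)
    case (Cons s xs)
    then have "s \<in> carrier W" "word xs \<in> carrier W" by (auto simp: in_lists_conv_set intro!: word_carrier)
    then show ?case using conj_word[OF gc, of s "word xs"] Cons by (simp add: img_def)
  qed (use gc in simp)
  then have wq: "cj g (word ps) = word ?qs" using ps KS by simp
  obtain a where a: "a \<in> par K" "cj a (proj K w) = word ps"
    using path_A_cuspidal[OF ps(1)] cuspidal_proj[OF J K w] ps(2) by metis
  obtain b where b: "b \<in> par (img g ` K)" "cj b (proj (img g ` K) w) = word ?qs"
    using path_A_cuspidal[OF qs(1)] cuspidal_proj[OF J gK w] qs(2) by metis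
  have c: "a \<in> carrier W" "b \<in> carrier W" using par_in_W[OF KS a(1)] par_in_W[OF comp_S[OF gK] b(1)] by auto
  let ?u = "inv b \<otimes> (cj g a)"
  note pc = p_par(2)[OF K] p_par(2)[OF gK]
  have "cj (?u \<otimes> g) (proj K w) = inv b \<otimes> (cj g (cj a (proj K w))) \<otimes> b"
    using c gc pc by (simp add: inv_mult_group m_assoc)
  also have "\<dots> = inv b \<otimes> (cj b (proj (img g ` K) w)) \<otimes> b" unfolding a(2) wq b(2) ..
  also have "\<dots> = proj (img g ` K) w" using c pc by (simp add: m_assoc)
  finally show ?thesis using par_mult[OF par_inv[OF comp_S[OF gK] b(1)] N_par[OF g K a(1)]] by blast
qed

subsection \<open>Gluing\<close>

lemma proj_conj:
  assumes x: "x \<in> ncomp J" and K: "comp J K" and v: "v \<in> par J"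
  shows "proj K (cj x v) = cj x (proj (img (inv x) ` K) v)"
  using img_proj[OF J N(2)[OF x] N_comp[OF N(3)[OF x] K] v] N_img_inv(1)[OF x K] by simp

lemma N_par_J: "x \<in> ncomp J \<Longrightarrow> u \<in> par J \<Longrightarrow> cj x u \<in> par J"
  using conj_in_par[OF J N(2) ncomp_img[OF J]] by blast

lemma proj_inv: "comp J K \<Longrightarrow> u \<in> par J \<Longrightarrow> proj K (inv u) = inv (proj K u)"
proof -
  assume K: "comp J K" and u: "u \<in> par J"
  have "proj K u \<otimes> proj K (inv u) = proj K \<one>" using proj_mult[OF J K u par_inv[OF J u]] par_in_W[OF J u] by simp
  also have "\<dots> = \<one>" using proj_par_self[OF J K par_one par_one] by simp
  finally show ?thesis using par_in_W[OF comp_S[OF K] proj_par[OF J K]] u par_inv[OF J u] by (metis inv_equality inv_inv inv_closed)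
qed

text \<open>Tested on each component \<open>K\<close>, where conjugation by \<open>x\<close> brings
  in the projection of \<open>w\<close> to the component that \<open>x\<close> maps onto
  \<open>K\<close>.\<close>

lemma glue_commute:
  assumes x: "x \<in> ncomp J" and f: "f \<in> par J"
    and e: "\<And>K. comp J K \<Longrightarrow> cj (proj K f \<otimes> x) (proj (img (inv x) ` K) w) = proj K w"
  shows "cj (f \<otimes> x) w = w"
proof -
  note wJ = cuspidal_par[OF w] and xc = N(1)[OF x]
  have eq: "cj (f \<otimes> x) w = cj f (cj x w)"
    using xc par_in_W[OF J] f wJ by (simp add: inv_mult_group m_assoc)
  have in_par: "f \<otimes> (cj x w) \<in> par J" "inv f \<in> par J" using f par_mult N_par_J[OF x wJ] par_inv[OF J] by auto
  show ?thesis unfolding eq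
  proof (rule par_eq_projI[OF J par_mult[OF in_par] wJ])
    fix K assume K: "comp J K"
    have c: "proj K f \<in> carrier W" "proj (img (inv x) ` K) w \<in> carrier W"
      using par_in_W[OF comp_S[OF K] proj_par[OF J K f]] p_par(2)[OF N_comp[OF N(3)[OF x] K]] .
    have "proj K (cj f (cj x w)) = cj (proj K f) (cj x (proj (img (inv x) ` K) w))"
      using proj_mult[OF J K] in_par f N_par_J[OF x wJ] proj_conj[OF x K wJ] proj_inv[OF K f] by simp
    also have "\<dots> = cj (proj K f \<otimes> x) (proj (img (inv x) ` K) w)"
      using c xc by (simp add: inv_mult_group m_assoc)
    finally show "proj K (cj f (cj x w)) = proj K w" using e[OF K] by simp
  qed
qed

text \<open>One transporter per component, chosen independently of the others and of
  \<open>x\<close>, is enough for (i); multiplicativity in \<open>x\<close> is what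
  \<open>splitting_lift\<close> adds.\<close>

theorem commuting_lift:
  assumes x: "x \<in> ncomp J"
  shows "\<exists>f\<in>par J. cj (f \<otimes> x) w = w"
proof -
  have "\<exists>u\<in>par K. cj (u \<otimes> x) (proj (img (inv x) ` K) w) = proj K w" if K: "comp J K" for K
    using transporter[OF N_comp[OF N(3)[OF x] K] x] N_img_inv(1)[OF x K] by simp
  then obtain u where u: "\<And>K. comp J K \<Longrightarrow> u K \<in> par K \<and> cj (u K \<otimes> x) (proj (img (inv x) ` K) w) = proj K w" by metis
  obtain f where "f \<in> par J" "\<And>K. comp J K \<Longrightarrow> proj K f = u K" using glue[OF J, of u] u by metis
  then show ?thesis using glue_commute[OF x] u by metis
qed

end

end

section \<open>A multiplicative choice of corrections\<close>

context finite_coxeter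
begin

context
  fixes J :: "'a set" and w :: 'a
  assumes J: "J \<subseteq> S" and w: "cuspidal J w"
begin

abbreviation (input) pre where "pre x K \<equiv> img (inv x) ` K"

text \<open>Induction from stabilizers. Each orbit of components gets a representative,
  \<open>u K \<otimes> g K\<close> carries the projection of \<open>w\<close> there to the
  projection to \<open>K\<close>, and \<open>R K x\<close> is the block from \<open>pre x K\<close>
  to \<open>K\<close> of the induced monomial action. The blocks are multiplicative along the orbit,
  and the factors \<open>R K x \<otimes> inv x\<close> are glued to the part of \<open>F x\<close>
  in \<open>par J\<close>.\<close>

theorem splitting_lift:
  assumes nc: "\<not> noncompliant_class W S (conjugacy_class W w)"
  obtains F where "\<And>x. x \<in> ncomp J \<Longrightarrow> F x \<in> carrier W" "\<And>x. x \<in> ncomp J \<Longrightarrow> F x \<otimes> inv x \<in> par J"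
    "\<And>x. x \<in> ncomp J \<Longrightarrow> cj (F x) w = w" "\<And>x y. x \<in> ncomp J \<Longrightarrow> y \<in> ncomp J \<Longrightarrow> F (x \<otimes> y) = F x \<otimes> F y"
proof -
  note N = N[OF J w] and NK = N_comp[OF J w] and KS = comp_S[OF J w]
  \<comment> \<open>\<open>E K\<close> depends only on the orbit of \<open>K\<close>, so the choice
    \<open>rep\<close> is constant on orbits.\<close>
  define E where "E K = {K0. comp J K0 \<and> (\<exists>g\<in>ncomp J. img g ` K0 = K)}" for K
  define rep where "rep K = (SOME K0. K0 \<in> E K)" for K
  have repE: "rep K \<in> E K" if K: "comp J K" for K
    unfolding rep_def by (rule someI[of _ K]) (use K N(5) img_one[OF KS[OF K]] in \<open>auto simp: E_def\<close>)
  have E_sub: "E K \<subseteq> E (img x ` K)" if K: "comp J K" and x: "x \<in> ncomp J" for x K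
  proof
    fix K0 assume "K0 \<in> E K"
    then obtain g where g: "comp J K0" "g \<in> ncomp J" "img g ` K0 = K" by (auto simp: E_def)
    then show "K0 \<in> E (img x ` K)"
      unfolding E_def using img_image_mult[OF N(1)[OF x] N(1)[OF g(2)] KS[OF g(1)]] N(4)[OF x g(2)] by blast
  qed
  have rep_img: "rep (pre x K) = rep K" if K: "comp J K" and x: "x \<in> ncomp J" for x K
  proof -
    have "E (pre x K) \<subseteq> E K" using E_sub[OF NK[OF N(3)[OF x] K] x] N_img_inv(1)[OF J w x K] by simp
    then show ?thesis using E_sub[OF K N(3)[OF x]] by (simp add: rep_def subset_antisym)
  qed
  have "\<exists>g u. g \<in> ncomp J \<and> img g ` rep K = K \<and> u \<in> par K \<and> cj (u \<otimes> g) (proj (rep K) w) = proj K w" if K: "comp J K" for K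
  proof -
    obtain g where g: "comp J (rep K)" "g \<in> ncomp J" "img g ` rep K = K" using repE[OF K] by (auto simp: E_def)
    then show ?thesis using transporter[OF J w g(1,2)] by auto
  qed
  then obtain g u where g: "\<And>K. comp J K \<Longrightarrow> g K \<in> ncomp J" "\<And>K. comp J K \<Longrightarrow> img (g K) ` rep K = K"
    and u: "\<And>K. comp J K \<Longrightarrow> u K \<in> par K" "\<And>K. comp J K \<Longrightarrow> cj (u K \<otimes> g K) (proj (rep K) w) = proj K w"
    by metis
  have rep: "comp J (rep K)" if "comp J K" for K using repE[OF that] by (simp add: E_def)
  have gc: "g K \<in> carrier W" "u K \<in> carrier W" if "comp J K" for K
    using N(1) g(1)[OF that] par_in_W[OF KS u(1)] that by auto
  let ?st = "stabc J"
  have "\<exists>H. \<forall>x\<in>?st K. H x \<in> carrier W \<and> H x \<otimes> inv x \<in> par K \<and> cj (H x) (proj K w) = proj K w \<and>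
     (\<forall>y\<in>?st K. H (x \<otimes> y) = H x \<otimes> H y)" if "comp J K" for K
    using component_hom[OF J w that nc] .
  then obtain H where H: "\<And>K x. comp J K \<Longrightarrow> x \<in> ?st K \<Longrightarrow> H K x \<in> carrier W \<and> H K x \<otimes> inv x \<in> par K \<and> cj (H K x) (proj K w) = proj K w"
    and Hm: "\<And>K x y. comp J K \<Longrightarrow> x \<in> ?st K \<Longrightarrow> y \<in> ?st K \<Longrightarrow> H K (x \<otimes> y) = H K x \<otimes> H K y"
    by metis
  \<comment> \<open>Read through the fixed maps from \<open>rep K\<close>, the element
    \<open>x\<close> from \<open>pre x K\<close> to \<open>K\<close> becomes an element of the
    stabilizer of \<open>rep K\<close>, where \<open>H\<close> is available.\<close>
  define a where "a K x = inv (g K) \<otimes> x \<otimes> g (pre x K)" for K x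
  define R where "R K x = (u K \<otimes> g K) \<otimes> H (rep K) (a K x) \<otimes> inv (u (pre x K) \<otimes> g (pre x K))" for K x
  have pc: "comp J (pre x K)" if "comp J K" "x \<in> ncomp J" for K x using NK N(3) that by blast
  have ast: "a K x \<in> ?st (rep K)" if K: "comp J K" and x: "x \<in> ncomp J" for K x
  proof -
    note K1 = pc[OF K x]
    have aN: "a K x \<in> ncomp J" unfolding a_def using N(3,4) g(1) K K1 x by simp
    have "img (a K x) ` rep K = img (inv (g K)) ` img x ` img (g (pre x K)) ` rep (pre x K)"
      unfolding a_def rep_img[OF K x, symmetric]
      using img_image_mult[of "inv (g K) \<otimes> x" "g (pre x K)" "rep (pre x K)"] img_image_mult[of "inv (g K)" x "pre x K"]
        gc[OF K] gc[OF K1] N(1)[OF x] KS[OF rep[OF K1]] KS[OF K1] g(2)[OF K1] by simp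
    also have "\<dots> = img (inv (g K)) ` img (g K) ` rep K"
      unfolding g(2)[OF K1] N_img_inv(1)[OF J w x K] g(2)[OF K] ..
    also have "\<dots> = rep K" using N_img_inv(2)[OF J w g(1)[OF K] rep[OF K]] .
    finally show ?thesis using aN by (simp add: stabc_def[OF J w])
  qed
  have ac: "a K x \<in> carrier W" if K: "comp J K" and x: "x \<in> ncomp J" for K x
    using gc(1)[OF K] gc(1)[OF pc[OF K x]] N(1)[OF x] by (simp add: a_def)
  have Rc: "R K x \<in> carrier W" if K: "comp J K" and x: "x \<in> ncomp J" for K x
    using gc[OF K] gc[OF pc[OF K x]] H[OF rep[OF K] ast[OF K x]] by (simp add: R_def)
  have Rpar: "R K x \<otimes> inv x \<in> par K" if K: "comp J K" and x: "x \<in> ncomp J" for K x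
  proof -
    note K1 = pc[OF K x]
    have c: "x \<in> carrier W" "H (rep K) (a K x) \<in> carrier W" using N(1)[OF x] H[OF rep[OF K] ast[OF K x]] by auto
    have 1: "cj (g K) (H (rep K) (a K x) \<otimes> inv (a K x)) \<in> par K"
      using N_par[OF J w g(1)[OF K] rep[OF K]] H[OF rep[OF K] ast[OF K x]] g(2)[OF K] by metis
    have 2: "cj x (inv (u (pre x K))) \<in> par K"
      using N_par[OF J w x K1 par_inv[OF KS[OF K1] u(1)[OF K1]]] N_img_inv(1)[OF J w x K] by simp
    \<comment> \<open>Writing out \<open>inv (a K x)\<close> cancels the transports along
      \<open>g\<close>, and three factors from \<open>par K\<close> remain.\<close>
    have "R K x \<otimes> inv x = u K \<otimes> ((cj (g K) (H (rep K) (a K x) \<otimes> inv (a K x))) \<otimes> (cj x (inv (u (pre x K)))))"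
      unfolding R_def a_def using c gc[OF K] gc[OF K1] by (simp add: inv_mult_group m_assoc a_def)
    then show ?thesis using par_mult[OF u(1)[OF K] par_mult[OF 1 2]] by simp
  qed
  have Rp: "cj (R K x) (proj (pre x K) w) = proj K w" if K: "comp J K" and x: "x \<in> ncomp J" for K x
  proof -
    note K1 = pc[OF K x]
    let ?t = "u K \<otimes> g K" and ?t1 = "u (pre x K) \<otimes> g (pre x K)" and ?h = "H (rep K) (a K x)" and ?q = "proj (rep K) w"
    have c: "?t \<in> carrier W" "?t1 \<in> carrier W" "?h \<in> carrier W" "?q \<in> carrier W"
      using gc[OF K] gc[OF K1] H[OF rep[OF K] ast[OF K x]] p_par(2)[OF J w rep[OF K]] by auto
    have "cj (R K x) (proj (pre x K) w) = cj (R K x) (cj ?t1 ?q)"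
      using u(2)[OF K1] rep_img[OF K x] by simp
    also have "\<dots> = cj ?t (cj ?h ?q)"
    proof -
      have "cj (t \<otimes> h \<otimes> inv t1) (cj t1 q) = cj t (cj h q)"
        if "t \<in> carrier W" "t1 \<in> carrier W" "h \<in> carrier W" "q \<in> carrier W" for t t1 h q
        using that by (simp add: inv_mult_group m_assoc)
      then show ?thesis unfolding R_def using c by blast
    qed
    also have "\<dots> = proj K w" using H[OF rep[OF K] ast[OF K x]] u(2)[OF K] by simp
    finally show ?thesis .
  qed
  have Rm: "R K (x \<otimes> y) = R K x \<otimes> R (pre x K) y" if K: "comp J K" and x: "x \<in> ncomp J" and y: "y \<in> ncomp J" for K x y
  proof -
    note K1 = pc[OF K x]
    note K2 = pc[OF K1 y]
    have xy: "x \<in> carrier W" "y \<in> carrier W" using N(1) x y by auto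
    have p2: "pre (x \<otimes> y) K = pre y (pre x K)"
      using img_image_mult[of "inv y" "inv x" K] xy KS[OF K] by (simp add: inv_mult_group)
    have am: "a K (x \<otimes> y) = a K x \<otimes> a (pre x K) y"
      unfolding a_def p2 using xy gc[OF K] gc[OF K1] gc[OF K2] by (simp add: m_assoc)
    have a1: "a (pre x K) y \<in> ?st (rep K)" using ast[OF K1 y] rep_img[OF K x] by simp
    have h: "H (rep K) (a K (x \<otimes> y)) = H (rep K) (a K x) \<otimes> H (rep K) (a (pre x K) y)"
      unfolding am by (rule Hm[OF rep[OF K] ast[OF K x] a1])
    show ?thesis unfolding R_def h p2 rep_img[OF K x]
      using H[OF rep[OF K] ast[OF K x]] H[OF rep[OF K] a1] gc[OF K] gc[OF K1] gc[OF K2] by (simp add: inv_mult_group m_assoc)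
  qed
  have "\<exists>f. f \<in> par J \<and> (\<forall>K. comp J K \<longrightarrow> proj K f = R K x \<otimes> inv x)" if "x \<in> ncomp J" for x
    using glue[OF J, of "\<lambda>K. R K x \<otimes> inv x"] Rpar that by metis
  then obtain f where f: "\<And>x. x \<in> ncomp J \<Longrightarrow> f x \<in> par J" "\<And>x K. x \<in> ncomp J \<Longrightarrow> comp J K \<Longrightarrow> proj K (f x) = R K x \<otimes> inv x" by metis
  have fc: "f x \<in> carrier W" if "x \<in> ncomp J" for x using par_in_W[OF J f(1)[OF that]] .
  show thesis
  proof (rule that[of "\<lambda>x. f x \<otimes> x"])
    fix x assume x: "x \<in> ncomp J"
    note xc = N(1)[OF x]
    show "f x \<otimes> x \<in> carrier W" "f x \<otimes> x \<otimes> inv x \<in> par J" using fc[OF x] xc f(1)[OF x] by (simp_all add: m_assoc)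
    show "cj (f x \<otimes> x) w = w"
    proof (rule glue_commute[OF J w x f(1)[OF x]])
      fix K assume K: "comp J K"
      show "cj (proj K (f x) \<otimes> x) (proj (pre x K) w) = proj K w"
        using f(2)[OF x K] Rp[OF K x] Rc[OF K x] xc by (simp add: m_assoc)
    qed
    fix y assume y: "y \<in> ncomp J"
    note yc = N(1)[OF y] and xy = N(4)[OF x y] and xf = N_par_J[OF J w x f(1)[OF y]]
    \<comment> \<open>The crossed homomorphism law for \<open>f\<close>, which is the same as
      multiplicativity of \<open>f x \<otimes> x\<close>.\<close>
    have "f (x \<otimes> y) = f x \<otimes> (cj x (f y))"
    proof (rule par_eq_projI[OF J f(1)[OF xy] par_mult[OF f(1)[OF x] xf]])
      fix K assume K: "comp J K"
      have "proj K (f x \<otimes> (cj x (f y))) = (R K x \<otimes> inv x) \<otimes> (cj x (R (pre x K) y \<otimes> inv y))"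
        using proj_mult[OF J K f(1)[OF x] xf] proj_conj[OF J w x K f(1)[OF y]] f(2)[OF x K] f(2)[OF y pc[OF K x]] by simp
      also have "\<dots> = R K (x \<otimes> y) \<otimes> inv (x \<otimes> y)"
        unfolding Rm[OF K x y] using Rc[OF K x] Rc[OF pc[OF K x] y] xc yc by (simp add: inv_mult_group m_assoc)
      finally show "proj K (f (x \<otimes> y)) = proj K (f x \<otimes> (cj x (f y)))" using f(2)[OF xy K] by simp
    qed
    then show "f (x \<otimes> y) \<otimes> (x \<otimes> y) = (f x \<otimes> x) \<otimes> (f y \<otimes> y)"
      using fc[OF x] fc[OF y] xc yc by (simp add: m_assoc)
  qed
qed

end

end

section \<open>Complements inside the normalizer of a subgroup\<close>

context group
begin

context
  fixes V C
  assumes V: "subgroup V G" and C: "subgroup C G" and CN: "C \<subseteq> normalizer G V"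
    and VC: "\<And>n. n \<in> normalizer G V \<Longrightarrow> \<exists>v\<in>V. \<exists>c\<in>C. n = v \<otimes> c"
begin

lemma normalizer_facts:
  shows normalizer_subgroup: "subgroup (normalizer G V) G" and normal_in_normalizer: "V \<lhd> G\<lparr>carrier := normalizer G V\<rparr>"
    and subgroup_in: "V \<subseteq> normalizer G V"
  using normalizer_imp_subgroup[OF subgroup.subset[OF V]] subgroup_in_normalizer[OF V]
    normal_imp_subgroup[OF subgroup_in_normalizer[OF V]] subgroup.subset by fastforce+

lemma second_iso: "second_isomorphism_grp V (G\<lparr>carrier := normalizer G V\<rparr>) C"
  using normal_in_normalizer subgroup_incl[OF C normalizer_subgroup CN]
  by (simp add: second_isomorphism_grp_def second_isomorphism_grp_axioms_def)

lemma mult_eq_normalizer: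
  assumes "D \<subseteq> normalizer G V" "\<And>n. n \<in> normalizer G V \<Longrightarrow> \<exists>v\<in>V. \<exists>c\<in>D. n = v \<otimes> c"
  shows "V <#> D = normalizer G V"
  using assms subgroup_in subgroup.m_closed[OF normalizer_subgroup] unfolding set_mult_def by blast

text \<open>As \<open>V\<close> and \<open>C\<close> together make up the normalizer, this is the
  second isomorphism theorem.\<close>

lemma centralizer_quotient:
  shows "C \<inter> V \<lhd> G\<lparr>carrier := C\<rparr>"
    and "G\<lparr>carrier := C\<rparr> Mod (C \<inter> V) \<cong> G\<lparr>carrier := normalizer G V\<rparr> Mod V"
proof -
  have "group (G\<lparr>carrier := normalizer G V\<rparr>)" using subgroup_imp_group[OF normalizer_subgroup] .
  then have "V \<inter> C \<lhd> G\<lparr>carrier := normalizer G V, carrier := C\<rparr>"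
    by (rule group.normal_Int_subgroup[OF _ subgroup_incl[OF C normalizer_subgroup CN] normal_in_normalizer])
  then show "C \<inter> V \<lhd> G\<lparr>carrier := C\<rparr>" by (simp add: Int_commute)
  have "V <#>\<^bsub>G\<lparr>carrier := normalizer G V\<rparr>\<^esub> C = normalizer G V"
    using mult_eq_normalizer[OF CN VC] by (simp add: set_mult_def)
  then show "G\<lparr>carrier := C\<rparr> Mod (C \<inter> V) \<cong> G\<lparr>carrier := normalizer G V\<rparr> Mod V"
    using second_isomorphism_grp.normal_intersection_quotient_isom[OF second_iso] unfolding is_iso_def by (auto simp: Int_commute)
qed

text \<open>\<open>K\<close> complements \<open>V\<close> in the normalizer and lies in
  \<open>C\<close>, so by Dedekind's modular law it complements \<open>C \<inter> V\<close> in
  \<open>C\<close>.\<close>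

lemma complement_splits:
  assumes K: "subgroup K G" "K \<subseteq> C" "K \<inter> V = {\<one>}" and VK: "\<And>n. n \<in> normalizer G V \<Longrightarrow> \<exists>v\<in>V. \<exists>k\<in>K. n = v \<otimes> k"
  shows "splits_over_with_complement (G\<lparr>carrier := C\<rparr>) (C \<inter> V) K"
    and "G\<lparr>carrier := K\<rparr> \<cong> G\<lparr>carrier := normalizer G V\<rparr> Mod V"
proof -
  let ?N = "normalizer G V"
  note Kc = subgroup.mem_carrier[OF K(1)] and Vc = subgroup.mem_carrier[OF V] and Cc = subgroup.mem_carrier[OF C]
  have KN: "K \<subseteq> ?N" using K(2) CN by blast
  have "C \<subseteq> (C \<inter> V) <#> K"
  proof
    fix c assume c: "c \<in> C"
    then obtain v k where vk: "v \<in> V" "k \<in> K" "c = v \<otimes> k" using VK CN by blast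
    then have "v = c \<otimes> inv k" using Kc Vc by (simp add: m_assoc)
    moreover have "c \<otimes> inv k \<in> C" using subgroup.m_closed[OF C c subgroup.m_inv_closed[OF C]] vk(2) K(2) by blast
    ultimately have "v \<in> C" by (rule ssubst)
    then show "c \<in> (C \<inter> V) <#> K" using vk unfolding set_mult_def by blast
  qed
  moreover have "(C \<inter> V) <#> K \<subseteq> C" using subgroup.m_closed[OF C] K(2) unfolding set_mult_def by blast
  ultimately have "C = (C \<inter> V) <#> K" by blast
  moreover have "C \<inter> V \<inter> K = {\<one>}" using K(2,3) by blast
  ultimately show "splits_over_with_complement (G\<lparr>carrier := C\<rparr>) (C \<inter> V) K"
    unfolding splits_over_with_complement_def
    using centralizer_quotient(1) subgroup_incl[OF K(1) C K(2)] by (simp add: set_mult_def)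
  have rc: "V #>\<^bsub>G\<lparr>carrier := ?N\<rparr>\<^esub> k = V #> k" for k by (simp add: r_coset_def)
  have "(\<lambda>k. V #> k) \<in> iso (G\<lparr>carrier := K\<rparr>) (G\<lparr>carrier := ?N\<rparr> Mod V)"
  proof (rule isoI)
    show "(\<lambda>k. V #> k) \<in> hom (G\<lparr>carrier := K\<rparr>) (G\<lparr>carrier := ?N\<rparr> Mod V)"
    proof (rule homI)
      note q = normal.r_coset_hom_Mod[OF normal_in_normalizer, unfolded rc]
      show "V #> k \<in> carrier (G\<lparr>carrier := ?N\<rparr> Mod V)" if "k \<in> carrier (G\<lparr>carrier := K\<rparr>)" for k
        using hom_in_carrier[OF q, of k] KN that by auto
      show "V #> k \<otimes>\<^bsub>G\<lparr>carrier := K\<rparr>\<^esub> l = (V #> k) \<otimes>\<^bsub>G\<lparr>carrier := ?N\<rparr> Mod V\<^esub> (V #> l)"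
        if "k \<in> carrier (G\<lparr>carrier := K\<rparr>)" "l \<in> carrier (G\<lparr>carrier := K\<rparr>)" for k l
        using hom_mult[OF q, of k l] KN that by auto
    qed
    show "bij_betw (\<lambda>k. V #> k) (carrier (G\<lparr>carrier := K\<rparr>)) (carrier (G\<lparr>carrier := ?N\<rparr> Mod V))"
      unfolding bij_betw_def
    proof (intro conjI inj_onI equalityI subsetI)
      fix k l assume kl: "k \<in> carrier (G\<lparr>carrier := K\<rparr>)" "l \<in> carrier (G\<lparr>carrier := K\<rparr>)" "V #> k = V #> l"
      then have c: "k \<in> carrier G" "l \<in> carrier G" using Kc by auto
      then have "l \<in> V #> k" using repr_independenceD[OF V] kl(3) by blast
      then obtain v where v: "v \<in> V" "l = v \<otimes> k" unfolding r_coset_def by blast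
      then have "v = l \<otimes> inv k" using c Vc by (simp add: m_assoc)
      then have "v \<in> K" using kl subgroup.m_closed[OF K(1) _ subgroup.m_inv_closed[OF K(1)]] by simp
      then have "v = \<one>" using v(1) K(3) by blast
      then show "k = l" using v c by simp
    next
      fix A assume "A \<in> (\<lambda>k. V #> k) ` carrier (G\<lparr>carrier := K\<rparr>)"
      then show "A \<in> carrier (G\<lparr>carrier := ?N\<rparr> Mod V)" using KN by (auto simp: FactGroup_def RCOSETS_def rc)
    next
      fix A assume "A \<in> carrier (G\<lparr>carrier := ?N\<rparr> Mod V)"
      then obtain n where n: "n \<in> ?N" "A = V #> n" by (auto simp: FactGroup_def RCOSETS_def rc)
      then obtain v k where vk: "v \<in> V" "k \<in> K" "n = v \<otimes> k" using VK by blast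
      have "V #> (v \<otimes> k) = (V #> v) #> k"
        using coset_mult_assoc[OF subgroup.subset[OF V] Vc[OF vk(1)] Kc[OF vk(2)]] by simp
      then have "A = V #> k" using n vk coset_join2[OF Vc[OF vk(1)] V vk(1)] by simp
      then show "A \<in> (\<lambda>k. V #> k) ` carrier (G\<lparr>carrier := K\<rparr>)" using vk by auto
    qed
  qed
  then show "G\<lparr>carrier := K\<rparr> \<cong> G\<lparr>carrier := ?N\<rparr> Mod V" unfolding is_iso_def by blast
qed

end

lemma centralizer_iff: "w \<in> carrier G \<Longrightarrow> c \<in> centralizer G w \<longleftrightarrow> c \<in> carrier G \<and> cj c w = w"
  unfolding centralizer_def by (auto simp: m_assoc) (metis inv_closed inv_solve_right m_assoc m_closed)

lemma centralizer_subgroup: "w \<in> carrier G \<Longrightarrow> subgroup (centralizer G w) G"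
proof (rule subgroupI)
  assume w: "w \<in> carrier G"
  show "inv c \<in> centralizer G w" if "c \<in> centralizer G w" for c
    using that w unfolding centralizer_def by (auto simp: m_assoc) (metis inv_solve_left inv_solve_right m_closed inv_closed m_assoc)
  show "b \<otimes> c \<in> centralizer G w" if "b \<in> centralizer G w" "c \<in> centralizer G w" for b c
    using that w unfolding centralizer_def by (auto simp: m_assoc) (metis m_assoc)
qed (auto simp: centralizer_def intro!: exI[of _ \<one>])

end

section \<open>Centralizers and parabolic closures\<close>

context finite_coxeter
begin

theorem centralizer_structure:
  fixes w assumes wc: "w \<in> carrier W"
  defines "V \<equiv> parabolic_closure W S w" and "C \<equiv> centralizer W w"
  shows "C \<inter> V \<lhd> W\<lparr>carrier := C\<rparr>"
    and "W\<lparr>carrier := C\<rparr> Mod (C \<inter> V) \<cong> W\<lparr>carrier := normalizer W V\<rparr> Mod V"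
    and "\<not> noncompliant_class W S (conjugacy_class W w) \<Longrightarrow>
      \<exists>K. splits_over_with_complement (W\<lparr>carrier := C\<rparr>) (C \<inter> V) K \<and> W\<lparr>carrier := K\<rparr> \<cong> W\<lparr>carrier := normalizer W V\<rparr> Mod V"
    and "centralizer (W\<lparr>carrier := V\<rparr>) w = C \<inter> V"
proof -
  obtain J g where J: "J \<subseteq> S" and g: "g \<in> carrier W" and Vg: "V = g <# par J #> inv g" and cu: "cuspidal J (inv g \<otimes> w \<otimes> g)"
    using parabolic_closure_standard[OF wc] unfolding V_def by blast
  define w1 where "w1 = inv g \<otimes> w \<otimes> g"
  have w1c: "w1 \<in> carrier W" using wc g by (simp add: w1_def)
  have ww1: "w = cj g w1" using wc g by (simp add: w1_def m_assoc)
  have Jc: "u \<in> carrier W" if "u \<in> par J" for u using par_in_W[OF J that] .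
  have memV: "v \<in> V \<longleftrightarrow> v \<in> carrier W \<and> inv g \<otimes> v \<otimes> g \<in> par J" for v
    unfolding Vg using conj_set_eq[OF g, of "par J"] Jc by auto
  have conjV: "cj g u \<in> V \<longleftrightarrow> u \<in> par J" if "u \<in> carrier W" for u
    using that g by (simp add: memV m_assoc)
  obtain x0 where x0: "x0 \<in> coord S" "V = stab x0" using parabolic_parabolic_closure[OF wc] parabolic_iff_stab unfolding V_def by blast
  have Vsub: "subgroup V W" unfolding x0 by (rule stab_subgroup)
  have VW: "V \<subseteq> carrier W" using subgroup.subset[OF Vsub] .
  have wV: "w \<in> V" using mem_parabolic_closure[OF wc] by (simp add: V_def)
  have Csub: "subgroup C W" unfolding C_def by (rule centralizer_subgroup[OF wc])
  have Ciff: "c \<in> C \<longleftrightarrow> c \<in> carrier W \<and> cj c w = w" for c unfolding C_def by (rule centralizer_iff[OF wc])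
  have normV: "n \<in> normalizer W V \<longleftrightarrow> n \<in> carrier W \<and> n <# V #> inv n = V" for n
    using VW by (auto simp: normalizer_def stabilizer_def)
  \<comment> \<open>Conjugation by \<open>c\<close> fixes \<open>w\<close>, so the conjugate of
    \<open>V\<close> is again a parabolic subgroup containing \<open>w\<close>, and \<open>V\<close>
    is the least of these. The reverse inclusion comes from \<open>inv c\<close>.\<close>
  have V_le: "V \<subseteq> c <# V #> inv c" if c: "c \<in> C" for c
  proof -
    have cc: "c \<in> carrier W" using c Ciff by blast
    have "inv c \<in> C" using subgroup.m_inv_closed[OF Csub c] .
    then have "inv c \<otimes> w \<otimes> c = w" using Ciff[of "inv c"] cc by simp
    then have "w \<in> c <# V #> inv c" using conj_set_eq[OF cc VW] wc wV by simp
    moreover have "parabolic W S (c <# V #> inv c)"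
      unfolding parabolic_iff_stab x0(2) using stab_conj[OF cc, of x0] act_coord_S[OF cc x0(1)] by blast
    ultimately show ?thesis unfolding V_def by (rule parabolic_closure_least[OF wc, rotated])
  qed
  have CN: "C \<subseteq> normalizer W V"
  proof
    fix c assume c: "c \<in> C"
    then have cc: "c \<in> carrier W" using Ciff by blast
    have "c <# V #> inv c \<subseteq> V"
    proof
      fix v assume "v \<in> c <# V #> inv c"
      then have v: "v \<in> carrier W" "inv c \<otimes> v \<otimes> c \<in> V" using conj_set_eq[OF cc VW] by auto
      then have "inv c \<otimes> v \<otimes> c \<in> inv c <# V #> inv (inv c)" using V_le[OF subgroup.m_inv_closed[OF Csub c]] by blast
      then show "v \<in> V" using conj_set_eq[OF inv_closed[OF cc] VW] v cc by (simp add: m_assoc)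
    qed
    then show "c \<in> normalizer W V" using V_le[OF c] cc normV by blast
  qed
  \<comment> \<open>Conjugation by \<open>g\<close> moves \<open>V\<close> to its standard position,
    where \<open>normalizes_imp_ncomp\<close> applies.\<close>
  have decomp: "\<exists>v\<in>V. \<exists>x\<in>ncomp J. n = v \<otimes> (cj g x)" if n: "n \<in> normalizer W V" for n
  proof -
    have nc: "n \<in> carrier W" and nV: "n <# V #> inv n = V" using n normV by auto
    have mem: "inv n \<otimes> v \<otimes> n \<in> V \<longleftrightarrow> v \<in> V" if "v \<in> carrier W" for v
      using conj_set_eq[OF nc VW] nV that by blast
    have mem': "cj n v \<in> V \<longleftrightarrow> v \<in> V" if "v \<in> carrier W" for v
      using mem[of "cj n v"] that nc by (simp add: m_assoc)
    let ?y = "inv g \<otimes> n \<otimes> g"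
    have yc: "?y \<in> carrier W" using nc g by simp
    obtain v x where vx: "v \<in> par J" "x \<in> ncomp J" "?y = v \<otimes> x"
    proof (rule normalizes_imp_ncomp[OF J yc])
      fix u assume u: "u \<in> par J"
      note uc = Jc[OF u]
      have gu: "cj g u \<in> V" using conjV[OF uc] u by simp
      have "cj g (cj ?y u) = cj n (cj g u)"
        using nc g uc by (simp add: inv_mult_group m_assoc)
      then show "cj ?y u \<in> par J" using conjV[of "cj ?y u"] mem'[of "cj g u"] gu yc uc g by simp
      have "cj g (inv ?y \<otimes> u \<otimes> ?y) = inv n \<otimes> (cj g u) \<otimes> n"
        using nc g uc by (simp add: inv_mult_group m_assoc)
      then show "inv ?y \<otimes> u \<otimes> ?y \<in> par J" using conjV[of "inv ?y \<otimes> u \<otimes> ?y"] mem[of "cj g u"] gu yc uc g by simp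
    qed
    have c: "v \<in> carrier W" "x \<in> carrier W" using Jc vx ncomp_carrier by auto
    have "n = cj g ?y" using nc g by (simp add: m_assoc)
    also have "\<dots> = (cj g v) \<otimes> (cj g x)" unfolding vx(3) by (rule conj_word[OF g c])
    finally show ?thesis using vx conjV[OF c(1)] by blast
  qed
  have lift: "cj g z \<in> C" if "z \<in> carrier W" "cj z w1 = w1" for z
  proof -
    have "(cj g z) \<otimes> w \<otimes> inv (cj g z) = cj g (cj z w1)"
      unfolding ww1 using that(1) g w1c by (simp add: inv_mult_group m_assoc)
    then show ?thesis using that g Ciff ww1 by simp
  qed
  \<comment> \<open>\<open>x\<close> and \<open>z\<close> differ by an element of
    \<open>par J\<close> on the left, whose conjugate by \<open>g\<close> is absorbed into
    \<open>V\<close>.\<close>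
  have absorb: "\<exists>v'\<in>V. v \<otimes> (cj g x) = v' \<otimes> (cj g z)"
    if v: "v \<in> V" and x: "x \<in> ncomp J" and z: "z \<in> carrier W" "z \<otimes> inv x \<in> par J" for v x z
  proof -
    have xc: "x \<in> carrier W" using ncomp_carrier x by blast
    have u: "x \<otimes> inv z \<in> par J" using par_inv[OF J z(2)] xc z(1) by (simp add: inv_mult_group)
    have "v \<otimes> (cj g (x \<otimes> inv z)) \<in> V" using subgroup.m_closed[OF Vsub v] conjV[of "x \<otimes> inv z"] u xc z(1) by simp
    moreover have "v \<otimes> (cj g x) = v \<otimes> (cj g (x \<otimes> inv z)) \<otimes> (cj g z)"
      using xc z(1) g VW v by (simp add: m_assoc subsetD)
    ultimately show ?thesis by blast
  qed
  have VC: "\<exists>v\<in>V. \<exists>c\<in>C. n = v \<otimes> c" if n: "n \<in> normalizer W V" for n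
  proof -
    obtain v x where vx: "v \<in> V" "x \<in> ncomp J" "n = v \<otimes> (cj g x)" using decomp[OF n] by blast
    obtain f where f: "f \<in> par J" "cj (f \<otimes> x) w1 = w1"
      using commuting_lift[OF J cu vx(2)] by (auto simp: w1_def)
    have c: "f \<in> carrier W" "x \<in> carrier W" using Jc f ncomp_carrier vx by auto
    then show ?thesis using absorb[OF vx(1,2), of "f \<otimes> x"] lift[OF _ f(2)] f(1) vx(3) by (auto simp: m_assoc)
  qed
  show "C \<inter> V \<lhd> W\<lparr>carrier := C\<rparr>" "W\<lparr>carrier := C\<rparr> Mod (C \<inter> V) \<cong> W\<lparr>carrier := normalizer W V\<rparr> Mod V"
    using centralizer_quotient[OF Vsub Csub CN VC] by blast+
  show "centralizer (W\<lparr>carrier := V\<rparr>) w = C \<inter> V" using VW by (auto simp: centralizer_def C_def)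
  assume "\<not> noncompliant_class W S (conjugacy_class W w)"
  then have nc: "\<not> noncompliant_class W S (conjugacy_class W (inv g \<otimes> w \<otimes> g))"
    using conjugacy_class_conj[OF inv_closed[OF g] wc] g by simp
  obtain F where F: "\<And>x. x \<in> ncomp J \<Longrightarrow> F x \<in> carrier W" "\<And>x. x \<in> ncomp J \<Longrightarrow> F x \<otimes> inv x \<in> par J"
    "\<And>x. x \<in> ncomp J \<Longrightarrow> cj (F x) w1 = w1" "\<And>x y. x \<in> ncomp J \<Longrightarrow> y \<in> ncomp J \<Longrightarrow> F (x \<otimes> y) = F x \<otimes> F y"
    using splitting_lift[OF J cu nc] unfolding w1_def by metis
  define h where "h x = cj g (F x)" for x
  define K where "K = h ` ncomp J"
  note N = ncomp_subgroup[OF J]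
  have hc: "h x \<in> carrier W" if "x \<in> ncomp J" for x using F(1)[OF that] g by (simp add: h_def)
  have hm: "h (x \<otimes> y) = h x \<otimes> h y" if "x \<in> ncomp J" "y \<in> ncomp J" for x y
    unfolding h_def F(4)[OF that] by (rule conj_word[OF g F(1)[OF that(1)] F(1)[OF that(2)]])
  have h1: "h \<one> = \<one>" using hm[of \<one> \<one>] subgroup.one_closed[OF N] hc[of \<one>] by simp
  have Ksub: "subgroup K W"
  proof (rule subgroupI)
    fix a assume "a \<in> K"
    then obtain x where x: "x \<in> ncomp J" "a = h x" by (auto simp: K_def)
    note ix = subgroup.m_inv_closed[OF N x(1)]
    have "h (inv x) \<otimes> h x = \<one>" using hm[OF ix x(1)] ncomp_carrier[OF x(1)] h1 by simp
    then have "inv (h x) = h (inv x)" using hc[OF x(1)] hc[OF ix] by (simp add: inv_equality)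
    then show "inv a \<in> K" using x ix by (simp add: K_def)
    fix b assume "b \<in> K"
    then obtain y where y: "y \<in> ncomp J" "b = h y" by (auto simp: K_def)
    show "a \<otimes> b \<in> K" unfolding x(2) y(2) hm[OF x(1) y(1), symmetric] K_def
      by (rule imageI[OF subgroup.m_closed[OF N x(1) y(1)]])
  qed (use hc subgroup.one_closed[OF N] in \<open>auto simp: K_def\<close>)
  have KC: "K \<subseteq> C" unfolding K_def h_def using lift F(1,3) by blast
  \<comment> \<open>If \<open>F x\<close> lies in \<open>par J\<close>, so does \<open>x\<close>,
    because the two differ by an element of \<open>par J\<close>; and \<open>ncomp J\<close> meets
    \<open>par J\<close> trivially.\<close>
  have "K \<inter> V \<subseteq> {\<one>}"
  proof
    fix a assume "a \<in> K \<inter> V"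
    then obtain x where x: "x \<in> ncomp J" "a = h x" "h x \<in> V" by (auto simp: K_def)
    have xc: "x \<in> carrier W" using ncomp_carrier[OF x(1)] .
    have "F x \<in> par J" using conjV[OF F(1)[OF x(1)]] x(3) by (simp add: h_def)
    then have "inv (F x \<otimes> inv x) \<otimes> F x \<in> par J" using par_mult[OF par_inv[OF J F(2)[OF x(1)]]] by blast
    then have "x \<in> par J" using F(1)[OF x(1)] xc by (simp add: inv_mult_group m_assoc)
    then have "x = \<one>" using ncomp_par_Int[OF J x(1)] by blast
    then show "a \<in> {\<one>}" using x(2) h1 by simp
  qed
  then have KV: "K \<inter> V = {\<one>}" using subgroup.one_closed[OF Ksub] subgroup.one_closed[OF Vsub] by blast
  have VK: "\<exists>v\<in>V. \<exists>k\<in>K. n = v \<otimes> k" if n: "n \<in> normalizer W V" for n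
  proof -
    obtain v x where vx: "v \<in> V" "x \<in> ncomp J" "n = v \<otimes> (cj g x)" using decomp[OF n] by blast
    then show ?thesis using absorb[OF vx(1,2) F(1,2)] by (auto simp: K_def h_def)
  qed
  show "\<exists>K. splits_over_with_complement (W\<lparr>carrier := C\<rparr>) (C \<inter> V) K \<and> W\<lparr>carrier := K\<rparr> \<cong> W\<lparr>carrier := normalizer W V\<rparr> Mod V"
    using complement_splits[OF Vsub Csub CN VC Ksub KC KV VK] by blast
qed

end

theorem theorem1p1:
  fixes W :: "('a, 'b) monoid_scheme" and S V :: "'a set" and w :: 'a
  assumes "coxeter_system W S" and "finite (carrier W)"
    and "w \<in> carrier W"
    and "V = parabolic_closure W S w"
  shows "(centralizer (W\<lparr>carrier := V\<rparr>) w = centralizer W w \<inter> V \<and>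
          centralizer (W\<lparr>carrier := V\<rparr>) w \<lhd> W\<lparr>carrier := centralizer W w\<rparr> \<and>
          (W\<lparr>carrier := centralizer W w\<rparr>) Mod (centralizer (W\<lparr>carrier := V\<rparr>) w)
            \<cong> (W\<lparr>carrier := normalizer W V\<rparr>) Mod V) \<and>
         (\<not> (\<exists>C. noncompliant_class W S C \<and> w \<in> C) \<longrightarrow>
          (\<exists>K. splits_over_with_complement (W\<lparr>carrier := centralizer W w\<rparr>)
                  (centralizer (W\<lparr>carrier := V\<rparr>) w) K \<and>
               W\<lparr>carrier := K\<rparr> \<cong> (W\<lparr>carrier := normalizer W V\<rparr>) Mod V))"
proof -
  interpret group W using assms(1) by (simp add: coxeter_system_def)
  interpret finite_coxeter W S by unfold_locales (use assms in auto)
  have "w \<in> conjugacy_class W w" unfolding conjugacy_class_def using assms(3) by (intro CollectI exI[of _ "\<one>\<^bsub>W\<^esub>"]) simp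
  then show ?thesis using centralizer_structure[OF assms(3)] unfolding assms(4) by auto
qed

end
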